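(* There exists $\lambda_0>0$, depending only on $A,B,C,L$ and $\Omega$ (in particular not on $\epsilon$, $\alpha_z$, $\gamma_z$), such that, for every $\lambda\in(0,\lambda_0)$ and every $\epsilon>0$, the system $$\Delta\mathbf{Q}=\frac{\lambda^2}{L}\left\{A\mathbf{Q}-B\left(\mathbf{Q}\mathbf{Q}-\frac{\mathbf{I}}{3}|\mathbf{Q}|^2\right)+C|\mathbf{Q}|^2\mathbf{Q}\right\}\quad\text{in }V=\Omega\times(0,\epsilon),\qquad \mathbf Q\colon V\to S_0,$$ has a unique solution that satisfies the boundary conditions $$\mathbf{Q}=\mathbf{Q}_{\mathrm b}\ \text{ on }\partial\Omega\times(0,\epsilon),\qquad \partial_\nu\mathbf{Q}+\frac{\lambda}{L}\mathbf{H}(\mathbf{Q})=0\ \text{ on }\Gamma=\Omega\times\{0,\epsilon\}.$$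
   Context: $L,B,C>0$, $A<0$, $\alpha_z,\gamma_z>0$ and $\eta\in(0,1/2)$ are constants, and $s_+=\dfrac{B+\sqrt{B^2+24|A|C}}{4C}$. $S_0$ is the space of symmetric traceless real $3\times3$ matrices, $\mathbf I$ the $3\times 3$ identity, and $|\mathbf Q|^2=\operatorname{tr}(\mathbf Q^2)$ for $\mathbf Q\in S_0$. Domain (a truncated square): $\Omega=\{(x,y)\in\mathbb{R}^2: |x|<1-\eta,\ |y|<1-\eta,\ |x+y|<1,\ |x-y|<1\}$; $\nu$ is the outward unit normal to $V$. The boundary $\partial\Omega$ consists of four long edges $C_1=\{x+y=1,\ \eta\le x\le 1-\eta\}$, $C_2=\{y-x=1,\ \eta\le -x\le 1-\eta\}$, $C_3=\{x+y=-1,\ \eta\le -x\le 1-\eta\}$, $C_4=\{x-y=1,\ \eta\le x\le 1-\eta\}$, and four short edges $S_1=\{(1-\eta,y):|y|\le\eta\}$, $S_2=\{(x,1-\eta):|x|\le\eta\}$, $S_3=\{(-1+\eta,y):|y|\le\eta\}$, $S_4=\{(x,-1+\eta):|x|\le\eta\}$. $g_0\colon[-\eta,\eta]\to[-s_+/2,s_+/2]$ is a continuous, piecewise $C^1$ function with $g_0(\pm\eta)=\pm s_+/2$; for example $g_0(s)=\frac{s_+}{2\eta}s$. The function $q_{1\mathrm b}\colon\partial\Omega\to\mathbb{R}$ is: $q_{1\mathrm b}=s_+/2$ on $C_1\cup C_3$; $-s_+/2$ on $C_2\cup C_4$; $g_0(y)$ on $S_1$; $-g_0(y)$ on $S_3$;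 $g_0(x)$ on $S_2$; $-g_0(x)$ on $S_4$. With $\mathbf n_1=\frac1{\sqrt2}(-1,1,0)$, $\mathbf n_2=\frac1{\sqrt2}(1,1,0)$, $\hat{\mathbf z}=(0,0,1)$, the lateral boundary datum is $$\mathbf Q_{\mathrm b}(x,y,z)=q_{1\mathrm b}(x,y)(\mathbf n_1\otimes\mathbf n_1-\mathbf n_2\otimes\mathbf n_2)-\frac{s_+}{6}(2\hat{\mathbf z}\otimes\hat{\mathbf z}-\mathbf n_1\otimes\mathbf n_1-\mathbf n_2\otimes\mathbf n_2),$$ which equals $s_+(\mathbf n_1\otimes\mathbf n_1-\mathbf I/3)$ on $C_1\cup C_3$ and $s_+(\mathbf n_2\otimes\mathbf n_2-\mathbf I/3)$ on $C_2\cup C_4$. For $\mathbf Q=(Q_{ij})\in S_0$, $$\mathbf H(\mathbf Q)=\begin{pmatrix}-\frac23\alpha_z\left(Q_{33}+\frac{s_+}{3}\right)&0&\gamma_zQ_{13}\\0&-\frac23\alpha_z\left(Q_{33}+\frac{s_+}{3}\right)&\gamma_zQ_{23}\\ \gamma_zQ_{13}&\gamma_zQ_{23}&\frac43\alpha_z\left(Q_{33}+\frac{s_+}{3}\right)\end{pmatrix}.$$ Solutions are understood in $W^{1,2}(V,S_0)$, in the weak sense. *)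

theory Defs
  imports "HOL-Analysis.Analysis"
begin

section \<open>The Sobolev space \<open>W\<^sup>1\<^sup>,\<^sup>2\<close>, weak derivatives and traces\<close>

definition continuously_differentiable ::
    "('a::euclidean_space \<Rightarrow> 'b::euclidean_space) \<Rightarrow> bool" where
  "continuously_differentiable f \<longleftrightarrow>
     (\<exists>f' :: 'a \<Rightarrow> 'a \<Rightarrow>\<^sub>L 'b. (\<forall>x. (f has_derivative blinfun_apply (f' x)) (at x)) \<and>
                          continuous_on UNIV f')"

text \<open>Elements of Lebesgue and Sobolev spaces are represented by functions, to be identified when
  they agree almost everywhere. Borel measurability is no restriction, since every Lebesgue
  measurable function has a Borel representative.\<close>

abbreviation volume_on :: "'a::euclidean_space set \<Rightarrow> 'a measure" where
  "volume_on U \<equiv> restrict_space lborel U"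

definition L2_space :: "'a measure \<Rightarrow> ('a \<Rightarrow> 'b::euclidean_space) set" where
  "L2_space M = {f \<in> borel_measurable M. integrable M (\<lambda>x. (norm (f x))\<^sup>2)}"

definition L2_norm :: "'a measure \<Rightarrow> ('a \<Rightarrow> 'b::euclidean_space) \<Rightarrow> real" where
  "L2_norm M f = sqrt (\<integral>x. (norm (f x))\<^sup>2 \<partial>M)"

text \<open>\<open>v\<close> is the weak derivative of \<open>u\<close> in direction \<open>e\<close>, tested as in Gilbarg--Trudinger against
  the \<open>C\<^sup>1\<close> functions with compact support in \<open>U\<close>.\<close>

definition has_weak_partial ::
    "'a::euclidean_space set \<Rightarrow> 'a \<Rightarrow> ('a \<Rightarrow> 'b::euclidean_space) \<Rightarrow> ('a \<Rightarrow> 'b) \<Rightarrow> bool" where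
  "has_weak_partial U e u v \<longleftrightarrow>
     (\<forall>\<phi> :: 'a \<Rightarrow> real.
        continuously_differentiable \<phi> \<longrightarrow> compact (closure {x. \<phi> x \<noteq> 0}) \<longrightarrow>
        closure {x. \<phi> x \<noteq> 0} \<subseteq> U \<longrightarrow>
          (\<integral>x. frechet_derivative \<phi> (at x) e *\<^sub>R u x \<partial>volume_on U)
            = - (\<integral>x. \<phi> x *\<^sub>R v x \<partial>volume_on U))"

definition W12 :: "'a::euclidean_space set \<Rightarrow> ('a \<Rightarrow> 'b::euclidean_space) set" where
  "W12 U = {u \<in> L2_space (volume_on U).
              \<forall>e\<in>Basis. \<exists>v\<in>L2_space (volume_on U). has_weak_partial U e u v}"

text \<open>Unique up to null sets for \<open>u \<in> W12 U\<close>, \<open>U\<close> open and \<open>e\<close> a basis vector.\<close>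

definition weak_partial ::
    "'a::euclidean_space set \<Rightarrow> 'a \<Rightarrow> ('a \<Rightarrow> 'b::euclidean_space) \<Rightarrow> 'a \<Rightarrow> 'b" where
  "weak_partial U e u = (SOME v. v \<in> L2_space (volume_on U) \<and> has_weak_partial U e u v)"

definition W12_norm :: "'a::euclidean_space set \<Rightarrow> ('a \<Rightarrow> 'b::euclidean_space) \<Rightarrow> real" where
  "W12_norm U u = sqrt ((L2_norm (volume_on U) u)\<^sup>2
                        + (\<Sum>e\<in>Basis. (L2_norm (volume_on U) (weak_partial U e u))\<^sup>2))"

text \<open>\<open>g\<close> is the trace of \<open>u\<close> on a piece of the boundary of \<open>U\<close> carrying the surface measure \<open>M\<close>:
  the trace operator is the continuous extension to \<open>W12 U\<close> of the restriction
  \<open>w \<mapsto> w|\<^sub>\<partial>\<^sub>U\<close>, defined for functions \<open>w\<close> that are \<open>C\<^sup>1\<close> up to the boundary. On a bounded Lipschitz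
  domain every \<open>u \<in> W12 U\<close> has a trace, and it is unique \<open>M\<close>-almost everywhere.\<close>

definition has_trace ::
    "'a::euclidean_space set \<Rightarrow> 'a measure \<Rightarrow> ('a \<Rightarrow> 'b::euclidean_space) \<Rightarrow> ('a \<Rightarrow> 'b) \<Rightarrow> bool" where
  "has_trace U M u g \<longleftrightarrow>
     u \<in> W12 U \<and> g \<in> L2_space M \<and>
     (\<exists>w :: nat \<Rightarrow> 'a \<Rightarrow> 'b.
        (\<forall>k. continuously_differentiable (w k) \<and> w k \<in> W12 U \<and> w k \<in> L2_space M) \<and>
        (\<lambda>k. W12_norm U (\<lambda>x. w k x - u x)) \<longlonglongrightarrow> 0 \<and>
        (\<lambda>k. L2_norm M (\<lambda>x. w k x - g x)) \<longlonglongrightarrow> 0)"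


section \<open>The well and its boundary\<close>

type_synonym point = "(real \<times> real) \<times> real"

definition Omega :: "real \<Rightarrow> (real \<times> real) set" where
  "Omega \<eta> = {(x, y). \<bar>x\<bar> < 1 - \<eta> \<and> \<bar>y\<bar> < 1 - \<eta> \<and> \<bar>x + y\<bar> < 1 \<and> \<bar>x - y\<bar> < 1}"

definition well :: "real \<Rightarrow> real \<Rightarrow> point set" where
  "well \<eta> \<epsilon> = Omega \<eta> \<times> {0<..<\<epsilon>}"

definition C1 :: "real \<Rightarrow> (real \<times> real) set" where
  "C1 \<eta> = {(x, y). x + y = 1 \<and> \<eta> \<le> x \<and> x \<le> 1 - \<eta>}"

definition C2 :: "real \<Rightarrow> (real \<times> real) set" where
  "C2 \<eta> = {(x, y). y - x = 1 \<and> \<eta> \<le> - x \<and> - x \<le> 1 - \<eta>}"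

definition C3 :: "real \<Rightarrow> (real \<times> real) set" where
  "C3 \<eta> = {(x, y). x + y = - 1 \<and> \<eta> \<le> - x \<and> - x \<le> 1 - \<eta>}"

definition C4 :: "real \<Rightarrow> (real \<times> real) set" where
  "C4 \<eta> = {(x, y). x - y = 1 \<and> \<eta> \<le> x \<and> x \<le> 1 - \<eta>}"

definition S1 :: "real \<Rightarrow> (real \<times> real) set" where
  "S1 \<eta> = {(x, y). x = 1 - \<eta> \<and> \<bar>y\<bar> \<le> \<eta>}"

definition S2 :: "real \<Rightarrow> (real \<times> real) set" where
  "S2 \<eta> = {(x, y). y = 1 - \<eta> \<and> \<bar>x\<bar> \<le> \<eta>}"

definition S3 :: "real \<Rightarrow> (real \<times> real) set" where
  "S3 \<eta> = {(x, y). x = - 1 + \<eta> \<and> \<bar>y\<bar> \<le> \<eta>}"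

definition S4 :: "real \<Rightarrow> (real \<times> real) set" where
  "S4 \<eta> = {(x, y). y = - 1 + \<eta> \<and> \<bar>x\<bar> \<le> \<eta>}"

text \<open>The endpoints of the edges \<open>S1, C1, S2, C2, S3, C3, S4, C4\<close>, in this (counterclockwise)
  order.\<close>

definition edges :: "real \<Rightarrow> ((real \<times> real) \<times> (real \<times> real)) set" where
  "edges \<eta> =
    {((1 - \<eta>, - \<eta>), (1 - \<eta>, \<eta>)),
     ((1 - \<eta>, \<eta>), (\<eta>, 1 - \<eta>)),
     ((\<eta>, 1 - \<eta>), (- \<eta>, 1 - \<eta>)),
     ((- \<eta>, 1 - \<eta>), (- 1 + \<eta>, \<eta>)),
     ((- 1 + \<eta>, \<eta>), (- 1 + \<eta>, - \<eta>)),
     ((- 1 + \<eta>, - \<eta>), (- \<eta>, - 1 + \<eta>)),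
     ((- \<eta>, - 1 + \<eta>), (\<eta>, - 1 + \<eta>)),
     ((\<eta>, - 1 + \<eta>), (1 - \<eta>, - \<eta>))}"

text \<open>Arc length on a finite union of segments \<open>[a, b]\<close>, \<open>(a, b) \<in> E\<close>, overlapping at most in
  finitely many points: the sum over \<open>E\<close> of the images of \<open>|b - a| dt\<close> under
  \<open>t \<mapsto> (1 - t) a + t b\<close>.\<close>

definition arc_length :: "((real \<times> real) \<times> (real \<times> real)) set \<Rightarrow> (real \<times> real) measure" where
  "arc_length E =
     distr (density (count_space E \<Otimes>\<^sub>M restrict_space lborel {0..1})
                    (\<lambda>((a, b), t). ennreal (dist a b)))
           borel
           (\<lambda>((a, b), t). (1 - t) *\<^sub>R a + t *\<^sub>R b)"

text \<open>The surface measures of the lateral boundary \<open>\<partial>\<Omega> \<times> (0, \<epsilon>)\<close> and of the top and bottom faces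
  \<open>\<Gamma> = \<Omega> \<times> {0, \<epsilon>}\<close>.\<close>

definition lateral_measure :: "real \<Rightarrow> real \<Rightarrow> point measure" where
  "lateral_measure \<eta> \<epsilon> = arc_length (edges \<eta>) \<Otimes>\<^sub>M restrict_space lborel {0<..<\<epsilon>}"

definition Gamma_measure :: "real \<Rightarrow> real \<Rightarrow> point measure" where
  "Gamma_measure \<eta> \<epsilon> = restrict_space lborel (Omega \<eta>) \<Otimes>\<^sub>M count_space {0, \<epsilon>}"


section \<open>\<open>Q\<close>-tensors and the boundary data\<close>

text \<open>On \<open>real^3^3\<close> the inner product \<open>\<bullet>\<close> is the Frobenius product.\<close>

definition S0 :: "(real^3^3) set" where
  "S0 = {Q. transpose Q = Q \<and> trace Q = 0}"

definition tensor :: "real^3 \<Rightarrow> real^3 \<Rightarrow> real^3^3" (infixr "\<otimes>\<^sub>v" 75) where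
  "u \<otimes>\<^sub>v v = (\<chi> i j. u $ i * v $ j)"

definition n1 :: "real^3" where "n1 = (1 / sqrt 2) *\<^sub>R vector [- 1, 1, 0]"

definition n2 :: "real^3" where "n2 = (1 / sqrt 2) *\<^sub>R vector [1, 1, 0]"

definition zhat :: "real^3" where "zhat = vector [0, 0, 1]"

definition s_plus :: "real \<Rightarrow> real \<Rightarrow> real \<Rightarrow> real" where
  "s_plus A B C = (B + sqrt (B\<^sup>2 + 24 * \<bar>A\<bar> * C)) / (4 * C)"

text \<open>Piecewise \<open>C\<^sup>1\<close> on \<open>[a, b]\<close>: \<open>C\<^sup>1\<close> up to the endpoints on each interval of a finite partition.
  The library's \<open>piecewise_C1_differentiable_on\<close> is weaker: it allows the derivative to be unbounded
  near the break points.\<close>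

definition piecewise_C1 :: "real \<Rightarrow> real \<Rightarrow> (real \<Rightarrow> real) \<Rightarrow> bool" where
  "piecewise_C1 a b g \<longleftrightarrow>
     (\<exists>(n::nat) t. t 0 = a \<and> t n = b \<and> (\<forall>i<n. t i < t (Suc i)) \<and>
        (\<forall>i<n. \<exists>g'. continuous_on {t i..t (Suc i)} g' \<and>
           (\<forall>s\<in>{t i..t (Suc i)}. (g has_real_derivative g' s) (at s within {t i..t (Suc i)}))))"

definition boundary_profile :: "real \<Rightarrow> real \<Rightarrow> (real \<Rightarrow> real) \<Rightarrow> bool" where
  "boundary_profile s \<eta> g0 \<longleftrightarrow>
     continuous_on {- \<eta>..\<eta>} g0 \<and> piecewise_C1 (- \<eta>) \<eta> g0 \<and>
     g0 ` {- \<eta>..\<eta>} \<subseteq> {- s / 2..s / 2} \<and> g0 \<eta> = s / 2 \<and> g0 (- \<eta>) = - s / 2"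

text \<open>The edges share their endpoints, where the prescribed values agree; off \<open>\<partial>\<Omega>\<close> the value is
  immaterial.\<close>

definition q1b :: "real \<Rightarrow> real \<Rightarrow> (real \<Rightarrow> real) \<Rightarrow> real \<times> real \<Rightarrow> real" where
  "q1b s \<eta> g0 p =
     (if p \<in> C1 \<eta> \<union> C3 \<eta> then s / 2
      else if p \<in> C2 \<eta> \<union> C4 \<eta> then - s / 2
      else if p \<in> S1 \<eta> then g0 (snd p)
      else if p \<in> S3 \<eta> then - g0 (snd p)
      else if p \<in> S2 \<eta> then g0 (fst p)
      else if p \<in> S4 \<eta> then - g0 (fst p)
      else 0)"

definition Qb :: "real \<Rightarrow> real \<Rightarrow> (real \<Rightarrow> real) \<Rightarrow> point \<Rightarrow> real^3^3" where
  "Qb s \<eta> g0 = (\<lambda>(p, z).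
     q1b s \<eta> g0 p *\<^sub>R (n1 \<otimes>\<^sub>v n1 - n2 \<otimes>\<^sub>v n2)
     - (s / 6) *\<^sub>R (2 *\<^sub>R (zhat \<otimes>\<^sub>v zhat) - n1 \<otimes>\<^sub>v n1 - n2 \<otimes>\<^sub>v n2))"

definition bulk :: "real \<Rightarrow> real \<Rightarrow> real \<Rightarrow> real^3^3 \<Rightarrow> real^3^3" where
  "bulk A B C Q =
     A *\<^sub>R Q - B *\<^sub>R (Q ** Q - (trace (Q ** Q) / 3) *\<^sub>R mat 1) + (C * trace (Q ** Q)) *\<^sub>R Q"

definition H :: "real \<Rightarrow> real \<Rightarrow> real \<Rightarrow> real^3^3 \<Rightarrow> real^3^3" where
  "H s \<alpha>z \<gamma>z Q = vector
     [vector [- (2 / 3) * \<alpha>z * (Q $ 3 $ 3 + s / 3), 0, \<gamma>z * Q $ 1 $ 3],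
      vector [0, - (2 / 3) * \<alpha>z * (Q $ 3 $ 3 + s / 3), \<gamma>z * Q $ 2 $ 3],
      vector [\<gamma>z * Q $ 1 $ 3, \<gamma>z * Q $ 2 $ 3, (4 / 3) * \<alpha>z * (Q $ 3 $ 3 + s / 3)]]"


section \<open>Weak solutions\<close>

definition W12_S0 :: "point set \<Rightarrow> (point \<Rightarrow> real^3^3) set" where
  "W12_S0 U = {Q \<in> W12 U. AE x in volume_on U. Q x \<in> S0}"

text \<open>\<open>\<Delta>Q = (\<lambda>\<^sup>2/L) bulk Q\<close> in \<open>V\<close>, \<open>Q = Q\<^sub>b\<close> on \<open>\<partial>\<Omega> \<times> (0, \<epsilon>)\<close> in the sense of traces, and
  \<open>\<partial>\<^sub>\<nu>Q + (\<lambda>/L) H(Q) = 0\<close> on \<open>\<Gamma>\<close>: multiply by a test field \<open>\<Phi> \<in> W\<^sup>1\<^sup>,\<^sup>2(V, S0)\<close> with vanishing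
  lateral trace and integrate by parts. Here \<open>G\<close> and \<open>\<Psi>\<close> are the traces of \<open>Q\<close> and \<open>\<Phi>\<close> on \<open>\<Gamma>\<close>.
  Since \<open>W\<^sup>1\<^sup>,\<^sup>2(V)\<close> embeds into \<open>L\<^sup>6(V)\<close>, all the integrals converge.\<close>

definition weak_solution ::
    "real \<Rightarrow> real \<Rightarrow> real \<Rightarrow> real \<Rightarrow> real \<Rightarrow> real \<Rightarrow> real \<Rightarrow> (real \<Rightarrow> real) \<Rightarrow> real \<Rightarrow> real \<Rightarrow>
     (point \<Rightarrow> real^3^3) \<Rightarrow> bool" where
  "weak_solution A B C L \<alpha>z \<gamma>z \<eta> g0 lam \<epsilon> Q \<longleftrightarrow>
     (let V = well \<eta> \<epsilon>; s = s_plus A B C in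
      Q \<in> W12_S0 V \<and>
      has_trace V (lateral_measure \<eta> \<epsilon>) Q (Qb s \<eta> g0) \<and>
      (\<exists>G. has_trace V (Gamma_measure \<eta> \<epsilon>) Q G \<and>
         (\<forall>\<Phi> \<Psi>. \<Phi> \<in> W12_S0 V \<longrightarrow>
            has_trace V (lateral_measure \<eta> \<epsilon>) \<Phi> (\<lambda>_. 0) \<longrightarrow>
            has_trace V (Gamma_measure \<eta> \<epsilon>) \<Phi> \<Psi> \<longrightarrow>
              (\<Sum>e\<in>Basis. \<integral>x. weak_partial V e Q x \<bullet> weak_partial V e \<Phi> x \<partial>volume_on V)
              + (lam / L) * (\<integral>x. H s \<alpha>z \<gamma>z (G x) \<bullet> \<Psi> x \<partial>Gamma_measure \<eta> \<epsilon>)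
              + (lam\<^sup>2 / L) * (\<integral>x. bulk A B C (Q x) \<bullet> \<Phi> x \<partial>volume_on V) = 0)))"

end

theory Submission
  imports Defs
begin

text \<open>
  Write \<open>f\<close> for the bulk energy density, so that \<open>bulk = \<nabla>f\<close>. On \<open>S0\<close> the quartic term of \<open>f\<close>
  dominates the cubic one, so \<open>f\<close> is convex up to \<open>-K|Q|\<^sup>2/2\<close> with \<open>K = |A| + B\<^sup>2/C\<close>; the anchoring term \<open>H\<close>
  is the gradient of a convex quadratic. Every field with a trace is a limit of \<open>C\<^sup>1\<close> fields, for which
  integration along lines parallel to the axes gives three inequalities: a Poincare inequality in the
  direction \<open>x\<close> with a constant independent of \<open>\<epsilon>\<close>, a trace inequality on \<open>\<Gamma>\<close>, and an embedding into
  \<open>L\<^sup>4\<close>. By the first, \<open>\<lambda>\<^sup>2 \<le> L/(32 K)\<close> makes the weak formulation strictly monotone, whence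
  uniqueness, and the energy uniformly convex, so that a minimising sequence of \<open>C\<^sup>1\<close> fields with
  lateral traces tending to \<open>Q\<^sub>b\<close> is Cauchy. Its limit is a solution. No maximum principle is
  needed, since the \<open>L\<^sup>4\<close> bound makes the cubic terms integrable.
\<close>

section \<open>The space \<open>L\<^sup>2\<close>\<close>

text \<open>The obstacle is the lateral datum: its profile is merely Lipschitz, so it need not be
  the restriction of a C^1 field, while traces are by definition limits of restrictions of C^1
  fields. Hence the constraint is relaxed: at level k, all C^1 fields with values in
  \<open>S0\<close> whose lateral L^2 distance to \<open>Qb\<close> is at most 1/(k+1) compete. The
  infima increase to a finite limit, and the parallelogram law bounds the gradient of a difference
  of near-minimisers by the energy gap. Convergence is strong from the start, so neither weak
  compactness nor semicontinuity is involved, and the weak equation follows from perturbations whose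
  lateral restrictions tend to zero.

  Only the bulk term calls for smallness, since \<open>H\<close> is monotone. The factor 16 of the
  Poincare inequality comes from sections of length at most 2; asking that 16 K \<lambda>^2/L be at
  most 1/2 gives 32. The constants of the trace inequality and of the L^4 embedding depend on
  \<epsilon>, but they serve only to pass to limits and leave the threshold for \<lambda>
  untouched.\<close>

lemma L2_spaceD:
  assumes "f \<in> L2_space M"
  shows "f \<in> borel_measurable M" "integrable M (\<lambda>x. (norm (f x))\<^sup>2)"
  using assms by (auto simp: L2_space_def)

lemma L2_norm_nonneg [simp]: "0 \<le> L2_norm M f"
  by (simp add: L2_norm_def)

lemma L2_norm_power2: "(L2_norm M f)\<^sup>2 = (\<integral>x. (norm (f x))\<^sup>2 \<partial>M)"
  by (simp add: L2_norm_def)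

lemma L2_norm_minus_commute: "L2_norm M (\<lambda>x. f x - g x) = L2_norm M (\<lambda>x. g x - f x)"
  by (simp add: L2_norm_def norm_minus_commute)

lemma L2_norm_cong_AE:
  assumes "f \<in> borel_measurable M" "g \<in> borel_measurable M" "AE x in M. f x = g x"
  shows "L2_norm M f = L2_norm M g"
  unfolding L2_norm_def using assms by (intro arg_cong[where f=sqrt] integral_cong_AE) auto

lemma L2_space_bound:
  fixes f :: "'a \<Rightarrow> 'b::euclidean_space" and g :: "'a \<Rightarrow> 'c::euclidean_space"
  assumes "g \<in> L2_space M" "f \<in> borel_measurable M" "AE x in M. norm (f x) \<le> c * norm (g x)"
  shows "f \<in> L2_space M"
proof -
  note [measurable] = assms(2) L2_spaceD(1)[OF assms(1)]
  have "integrable M (\<lambda>x. (norm (f x))\<^sup>2)"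
  proof (rule Bochner_Integration.integrable_bound)
    show "integrable M (\<lambda>x. c\<^sup>2 * (norm (g x))\<^sup>2)"
      using L2_spaceD(2)[OF assms(1)] by simp
    show "AE x in M. norm ((norm (f x))\<^sup>2) \<le> norm (c\<^sup>2 * (norm (g x))\<^sup>2)"
      using assms(3)
    proof eventually_elim
      case (elim x)
      have "(norm (f x))\<^sup>2 \<le> (c * norm (g x))\<^sup>2"
        using elim by (intro power_mono) auto
      then show ?case by (simp add: power_mult_distrib)
    qed
  qed simp
  then show ?thesis using assms(2) by (simp add: L2_space_def)
qed

lemma L2_norm_bound:
  fixes f :: "'a \<Rightarrow> 'b::euclidean_space" and g :: "'a \<Rightarrow> 'c::euclidean_space"
  assumes "g \<in> L2_space M" "f \<in> borel_measurable M" "AE x in M. norm (f x) \<le> c * norm (g x)" "0 \<le> c"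
  shows "L2_norm M f \<le> c * L2_norm M g"
proof -
  have "(\<integral>x. (norm (f x))\<^sup>2 \<partial>M) \<le> (\<integral>x. c\<^sup>2 * (norm (g x))\<^sup>2 \<partial>M)"
  proof (rule integral_mono_AE)
    show "integrable M (\<lambda>x. (norm (f x))\<^sup>2)"
      using L2_space_bound[OF assms(1-3)] L2_spaceD by blast
    show "AE x in M. (norm (f x))\<^sup>2 \<le> c\<^sup>2 * (norm (g x))\<^sup>2"
      using assms(3)
    proof eventually_elim
      case (elim x)
      have "(norm (f x))\<^sup>2 \<le> (c * norm (g x))\<^sup>2"
        using elim by (intro power_mono) auto
      then show ?case by (simp add: power_mult_distrib)
    qed
  qed (use L2_spaceD(2)[OF assms(1)] in simp)
  then have "sqrt (\<integral>x. (norm (f x))\<^sup>2 \<partial>M) \<le> sqrt (c\<^sup>2 * (\<integral>x. (norm (g x))\<^sup>2 \<partial>M))"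
    by simp
  then show ?thesis using assms(4) by (simp add: L2_norm_def real_sqrt_mult)
qed

lemma L2_space_add:
  assumes f: "f \<in> L2_space M" and g: "g \<in> L2_space M"
  shows "(\<lambda>x. f x + g x) \<in> L2_space M"
proof -
  note [measurable] = L2_spaceD(1)[OF f] L2_spaceD(1)[OF g]
  have "integrable M (\<lambda>x. (norm (f x + g x))\<^sup>2)"
  proof (rule Bochner_Integration.integrable_bound)
    show "integrable M (\<lambda>x. 2 * (norm (f x))\<^sup>2 + 2 * (norm (g x))\<^sup>2)"
      using L2_spaceD(2)[OF f] L2_spaceD(2)[OF g] by simp
    show "AE x in M. norm ((norm (f x + g x))\<^sup>2) \<le> norm (2 * (norm (f x))\<^sup>2 + 2 * (norm (g x))\<^sup>2)"
    proof (rule AE_I2)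
      fix x
      have "(norm (f x + g x))\<^sup>2 \<le> (norm (f x) + norm (g x))\<^sup>2"
        by (intro power_mono norm_triangle_ineq) auto
      also have "\<dots> \<le> 2 * (norm (f x))\<^sup>2 + 2 * (norm (g x))\<^sup>2"
        using sum_squares_bound[of "norm (f x)" "norm (g x)"] by (simp add: power2_sum)
      finally show "norm ((norm (f x + g x))\<^sup>2) \<le> norm (2 * (norm (f x))\<^sup>2 + 2 * (norm (g x))\<^sup>2)"
        by simp
    qed
  qed simp
  then show ?thesis by (simp add: L2_space_def)
qed

lemma L2_space_linear:
  fixes f :: "'a \<Rightarrow> 'b::euclidean_space" and T :: "'b \<Rightarrow> 'c::euclidean_space"
  assumes "f \<in> L2_space M" and T: "bounded_linear T"
  shows "(\<lambda>x. T (f x)) \<in> L2_space M"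
proof -
  note [measurable] = L2_spaceD(1)[OF assms(1)]
  have [measurable]: "T \<in> borel_measurable borel"
    using T by (intro borel_measurable_continuous_onI linear_continuous_on)
  show ?thesis
    by (rule L2_space_bound[OF assms(1), where c="onorm T"]) (auto intro: onorm[OF T])
qed

lemma L2_norm_linear:
  fixes f :: "'a \<Rightarrow> 'b::euclidean_space" and T :: "'b \<Rightarrow> 'c::euclidean_space"
  assumes "f \<in> L2_space M" and T: "bounded_linear T"
  shows "L2_norm M (\<lambda>x. T (f x)) \<le> onorm T * L2_norm M f"
proof -
  note [measurable] = L2_spaceD(1)[OF assms(1)]
  have [measurable]: "T \<in> borel_measurable borel"
    using T by (intro borel_measurable_continuous_onI linear_continuous_on)
  show ?thesis
    by (rule L2_norm_bound[OF assms(1)]) (auto intro: onorm[OF T] onorm_pos_le[OF T])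
qed

lemma L2_space_scaleR: "f \<in> L2_space M \<Longrightarrow> (\<lambda>x. c *\<^sub>R f x) \<in> L2_space M"
  using L2_space_linear[OF _ bounded_linear_scaleR_right] .

lemma L2_space_diff:
  assumes "f \<in> L2_space M" "g \<in> L2_space M"
  shows "(\<lambda>x. f x - g x) \<in> L2_space M"
  using L2_space_add[OF assms(1) L2_space_scaleR[OF assms(2), of "-1"]] by simp

lemma L2_space_0 [simp]: "(\<lambda>x. 0) \<in> L2_space M"
  by (simp add: L2_space_def)

lemma L2_norm_0 [simp]: "L2_norm M (\<lambda>x. 0) = 0"
  by (simp add: L2_norm_def)

lemma L2_norm_scaleR: "L2_norm M (\<lambda>x. c *\<^sub>R f x) = \<bar>c\<bar> * L2_norm M f"
  by (simp add: L2_norm_def power_mult_distrib real_sqrt_mult)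

lemma integrable_norm_mult_L2:
  assumes f: "f \<in> L2_space M" and g: "g \<in> L2_space M"
  shows "integrable M (\<lambda>x. norm (f x) * norm (g x))"
proof -
  note [measurable] = L2_spaceD(1)[OF f] L2_spaceD(1)[OF g]
  show ?thesis
  proof (rule Bochner_Integration.integrable_bound)
    show "integrable M (\<lambda>x. (norm (f x))\<^sup>2 + (norm (g x))\<^sup>2)"
      using L2_spaceD(2)[OF f] L2_spaceD(2)[OF g] by simp
    have "a * b \<le> a\<^sup>2 + b\<^sup>2" if "0 \<le> a" "0 \<le> b" for a b :: real
    proof -
      have "0 \<le> a * b" using that by simp
      then show ?thesis using sum_squares_bound[of a b] by linarith
    qed
    then show "AE x in M. norm (norm (f x) * norm (g x)) \<le> norm ((norm (f x))\<^sup>2 + (norm (g x))\<^sup>2)"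
      by simp
  qed simp
qed

lemma integrable_inner_L2:
  assumes f: "f \<in> L2_space M" and g: "g \<in> L2_space M"
  shows "integrable M (\<lambda>x. f x \<bullet> g x)"
proof -
  note [measurable] = L2_spaceD(1)[OF f] L2_spaceD(1)[OF g]
  show ?thesis
    by (rule Bochner_Integration.integrable_bound[OF integrable_norm_mult_L2[OF f g]])
       (auto simp: Cauchy_Schwarz_ineq2)
qed

text \<open>The Cauchy-Schwarz inequality for nonnegative integrals, carried over to real integrals;
  all three of them are finite.\<close>

lemma integral_norm_mult_le:
  assumes f: "f \<in> L2_space M" and g: "g \<in> L2_space M"
  shows "(\<integral>x. norm (f x) * norm (g x) \<partial>M) \<le> L2_norm M f * L2_norm M g"
proof -
  note [measurable] = L2_spaceD(1)[OF f] L2_spaceD(1)[OF g]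
  note i = integrable_norm_mult_L2[OF f g] L2_spaceD(2)[OF f] L2_spaceD(2)[OF g]
  have "(\<integral>\<^sup>+x. ennreal (norm (f x)) * ennreal (norm (g x)) \<partial>M)\<^sup>2
      \<le> (\<integral>\<^sup>+x. (ennreal (norm (f x)))\<^sup>2 \<partial>M) * (\<integral>\<^sup>+x. (ennreal (norm (g x)))\<^sup>2 \<partial>M)"
    by (rule Cauchy_Schwarz_nn_integral) auto
  then have "(ennreal (\<integral>x. norm (f x) * norm (g x) \<partial>M))\<^sup>2
     \<le> ennreal (\<integral>x. (norm (f x))\<^sup>2 \<partial>M) * ennreal (\<integral>x. (norm (g x))\<^sup>2 \<partial>M)"
    by (simp add: nn_integral_eq_integral i ennreal_power flip: ennreal_mult)
  then have "ennreal ((\<integral>x. norm (f x) * norm (g x) \<partial>M)\<^sup>2)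
     \<le> ennreal ((\<integral>x. (norm (f x))\<^sup>2 \<partial>M) * (\<integral>x. (norm (g x))\<^sup>2 \<partial>M))"
    by (simp add: ennreal_power ennreal_mult integral_nonneg_AE)
  then have "(\<integral>x. norm (f x) * norm (g x) \<partial>M)\<^sup>2 \<le> (\<integral>x. (norm (f x))\<^sup>2 \<partial>M) * (\<integral>x. (norm (g x))\<^sup>2 \<partial>M)"
    by (simp add: integral_nonneg_AE)
  then have "\<dots> \<ge> (\<integral>x. norm (f x) * norm (g x) \<partial>M)\<^sup>2" by simp
  then show ?thesis
    unfolding L2_norm_def by (metis real_le_rsqrt real_sqrt_mult)
qed

lemma abs_integral_inner_le:
  assumes f: "f \<in> L2_space M" and g: "g \<in> L2_space M"
  shows "\<bar>\<integral>x. f x \<bullet> g x \<partial>M\<bar> \<le> L2_norm M f * L2_norm M g"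
proof -
  have "\<bar>\<integral>x. f x \<bullet> g x \<partial>M\<bar> \<le> (\<integral>x. \<bar>f x \<bullet> g x\<bar> \<partial>M)"
    using integral_norm_bound[of M "\<lambda>x. f x \<bullet> g x"] by simp
  also have "\<dots> \<le> (\<integral>x. norm (f x) * norm (g x) \<partial>M)"
    using integrable_inner_L2[OF f g] integrable_norm_mult_L2[OF f g]
    by (intro integral_mono) (auto simp: Cauchy_Schwarz_ineq2)
  finally show ?thesis using integral_norm_mult_le[OF f g] by simp
qed

lemma L2_norm_triangle:
  assumes f: "f \<in> L2_space M" and g: "g \<in> L2_space M"
  shows "L2_norm M (\<lambda>x. f x + g x) \<le> L2_norm M f + L2_norm M g"
proof (rule power2_le_imp_le)
  have "(L2_norm M (\<lambda>x. f x + g x))\<^sup>2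
      = (\<integral>x. (norm (f x))\<^sup>2 + 2 * (f x \<bullet> g x) + (norm (g x))\<^sup>2 \<partial>M)"
    unfolding L2_norm_power2
    by (intro Bochner_Integration.integral_cong)
       (simp_all add: power2_norm_eq_inner inner_add_left inner_add_right inner_commute)
  also have "\<dots> = (L2_norm M f)\<^sup>2 + 2 * (\<integral>x. f x \<bullet> g x \<partial>M) + (L2_norm M g)\<^sup>2"
    using L2_spaceD(2)[OF f] L2_spaceD(2)[OF g] integrable_inner_L2[OF f g]
    by (simp add: L2_norm_power2)
  also have "\<dots> \<le> (L2_norm M f + L2_norm M g)\<^sup>2"
    using abs_integral_inner_le[OF f g] by (simp add: power2_sum)
  finally show "(L2_norm M (\<lambda>x. f x + g x))\<^sup>2 \<le> (L2_norm M f + L2_norm M g)\<^sup>2" .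
qed simp

lemma L2_norm_triangle_diff:
  assumes "f \<in> L2_space M" "g \<in> L2_space M" "h \<in> L2_space M"
  shows "L2_norm M (\<lambda>x. f x - h x) \<le> L2_norm M (\<lambda>x. f x - g x) + L2_norm M (\<lambda>x. g x - h x)"
  using L2_norm_triangle[OF L2_space_diff[OF assms(1,2)] L2_space_diff[OF assms(2,3)]] by simp

lemma L2_norm_le_add_diff:
  assumes "f \<in> L2_space M" "g \<in> L2_space M"
  shows "L2_norm M f \<le> L2_norm M (\<lambda>x. f x - g x) + L2_norm M g"
  using L2_norm_triangle[OF L2_space_diff[OF assms] assms(2)] by simp

lemma L2_norm_le_add_diff':
  assumes "f \<in> L2_space M" "g \<in> L2_space M"
  shows "L2_norm M g \<le> L2_norm M (\<lambda>x. f x - g x) + L2_norm M f"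
  using L2_norm_le_add_diff[OF assms(2,1)] L2_norm_minus_commute[of M f g] by simp

lemma tendsto_L2_norm:
  assumes "\<And>k. f k \<in> L2_space M" "g \<in> L2_space M"
    and "(\<lambda>k. L2_norm M (\<lambda>x. f k x - g x)) \<longlonglongrightarrow> 0"
  shows "(\<lambda>k. L2_norm M (f k)) \<longlonglongrightarrow> L2_norm M g"
proof (rule LIM_zero_cancel, rule Lim_null_comparison[OF _ assms(3)], rule always_eventually, rule allI)
  fix k
  show "norm (L2_norm M (f k) - L2_norm M g) \<le> L2_norm M (\<lambda>x. f k x - g x)"
    using L2_norm_le_add_diff[OF assms(1)[of k] assms(2)] L2_norm_le_add_diff'[OF assms(1)[of k] assms(2)]
    by simp
qed

text \<open>One factor is changed at a time, and the norms of \<open>g k\<close> stay bounded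
  because they converge.\<close>

lemma tendsto_integral_inner:
  assumes f: "\<And>k. f k \<in> L2_space M" "f' \<in> L2_space M" "(\<lambda>k. L2_norm M (\<lambda>x. f k x - f' x)) \<longlonglongrightarrow> 0"
    and g: "\<And>k. g k \<in> L2_space M" "g' \<in> L2_space M" "(\<lambda>k. L2_norm M (\<lambda>x. g k x - g' x)) \<longlonglongrightarrow> 0"
  shows "(\<lambda>k. \<integral>x. f k x \<bullet> g k x \<partial>M) \<longlonglongrightarrow> (\<integral>x. f' x \<bullet> g' x \<partial>M)"
proof (rule LIM_zero_cancel, rule Lim_null_comparison)
  let ?b = "\<lambda>k. L2_norm M (\<lambda>x. f k x - f' x) * L2_norm M (g k) + L2_norm M f' * L2_norm M (\<lambda>x. g k x - g' x)"
  show "\<forall>\<^sub>F k in sequentially. norm ((\<integral>x. f k x \<bullet> g k x \<partial>M) - (\<integral>x. f' x \<bullet> g' x \<partial>M)) \<le> ?b k"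
  proof (rule always_eventually, rule allI)
    fix k
    have "(\<integral>x. f k x \<bullet> g k x \<partial>M) - (\<integral>x. f' x \<bullet> g' x \<partial>M)
        = (\<integral>x. (f k x - f' x) \<bullet> g k x \<partial>M) + (\<integral>x. f' x \<bullet> (g k x - g' x) \<partial>M)"
      using integrable_inner_L2[OF f(1) g(1)] integrable_inner_L2[OF f(2) g(1)] integrable_inner_L2[OF f(2) g(2)]
      by (simp add: inner_diff_left inner_diff_right)
    then show "norm ((\<integral>x. f k x \<bullet> g k x \<partial>M) - (\<integral>x. f' x \<bullet> g' x \<partial>M)) \<le> ?b k"
      using abs_integral_inner_le[OF L2_space_diff[OF f(1,2)] g(1), of k k]
        abs_integral_inner_le[OF f(2) L2_space_diff[OF g(1,2)], of k]
      by simp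
  qed
  have "?b \<longlonglongrightarrow> 0 * L2_norm M g' + L2_norm M f' * 0"
    using f(3) g(3) tendsto_L2_norm[OF g] by (intro tendsto_intros)
  then show "?b \<longlonglongrightarrow> 0" by simp
qed

lemma L2_norm_eq_0_D:
  assumes "f \<in> L2_space M" "L2_norm M f = 0"
  shows "AE x in M. f x = 0"
  using integral_nonneg_eq_0_iff_AE[OF L2_spaceD(2)[OF assms(1)]] assms(2) by (simp add: L2_norm_def)

section \<open>Square-integrable functions over a finite measure: subsequences and
  completeness\<close>

lemma (in finite_measure) integrable_L2:
  assumes f: "f \<in> L2_space M"
  shows "integrable M f"
proof -
  note [measurable] = L2_spaceD(1)[OF f]
  have "(\<lambda>x. 1::real) \<in> L2_space M" by (simp add: L2_space_def)
  from integrable_norm_mult_L2[OF f this]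
  show ?thesis by (simp add: integrable_norm_iff)
qed

lemma (in finite_measure) integral_norm_le_L2:
  assumes f: "f \<in> L2_space M"
  shows "(\<integral>x. norm (f x) \<partial>M) \<le> L2_norm M f * sqrt (measure M (space M))"
proof -
  have "(\<lambda>x. 1::real) \<in> L2_space M" by (simp add: L2_space_def)
  from integral_norm_mult_le[OF f this] show ?thesis by (simp add: L2_norm_def)
qed

text \<open>On a finite measure space convergence in L^2 implies convergence in L^1, for which an
  almost everywhere convergent subsequence exists.\<close>

lemma (in finite_measure) L2_AE_subseq:
  assumes f: "\<And>k. f k \<in> L2_space M" "g \<in> L2_space M"
    and "(\<lambda>k. L2_norm M (\<lambda>x. f k x - g x)) \<longlonglongrightarrow> 0"
  obtains r :: "nat \<Rightarrow> nat" where "strict_mono r" "AE x in M. (\<lambda>k. f (r k) x) \<longlonglongrightarrow> g x"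
proof -
  have "(\<lambda>k. \<integral>x. norm (f k x - g x) \<partial>M) \<longlonglongrightarrow> 0"
  proof (rule Lim_null_comparison)
    show "\<forall>\<^sub>F k in sequentially. norm (\<integral>x. norm (f k x - g x) \<partial>M)
        \<le> L2_norm M (\<lambda>x. f k x - g x) * sqrt (measure M (space M))"
      using integral_norm_le_L2[OF L2_space_diff[OF f]] by (intro always_eventually) (simp add: integral_nonneg_AE)
    show "(\<lambda>k. L2_norm M (\<lambda>x. f k x - g x) * sqrt (measure M (space M))) \<longlonglongrightarrow> 0"
      using tendsto_mult_right[OF assms(3)] by simp
  qed
  from tendsto_L1_AE_subseq[OF integrable_L2[OF L2_space_diff[OF f]] this]
  obtain r where "strict_mono r" "AE x in M. (\<lambda>k. f (r k) x - g x) \<longlonglongrightarrow> 0" by blast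
  then show ?thesis using that[of r] by (simp add: LIM_zero_iff)
qed

text \<open>Riesz-Fischer. The limit is found as the pointwise limit of a subsequence of a sequence
  that is Cauchy in L^1; Fatou's lemma then shows that the whole sequence converges to it in
  L^2.\<close>

lemma (in finite_measure) L2_complete:
  fixes f :: "nat \<Rightarrow> 'a \<Rightarrow> 'b::euclidean_space"
  assumes f: "\<And>k. f k \<in> L2_space M"
    and cauchy: "\<And>e. e > 0 \<Longrightarrow> \<exists>N. \<forall>i\<ge>N. \<forall>j\<ge>N. L2_norm M (\<lambda>x. f i x - f j x) < e"
  obtains g where "g \<in> L2_space M" "(\<lambda>k. L2_norm M (\<lambda>x. f k x - g x)) \<longlonglongrightarrow> 0"
proof -
  note [measurable] = L2_spaceD(1)[OF f]
  \<comment> \<open>The summand 1 keeps the constant positive even if the measure is zero.\<close>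
  define c where "c = sqrt (measure M (space M)) + 1"
  have c: "c > 0" by (simp add: c_def add_nonneg_pos)
  have "\<exists>N. \<forall>i\<ge>N. \<forall>j\<ge>N. (\<integral>x. norm (f i x - f j x) \<partial>M) < e" if "e > 0" for e
  proof -
    obtain N where N: "\<And>i j. i \<ge> N \<Longrightarrow> j \<ge> N \<Longrightarrow> L2_norm M (\<lambda>x. f i x - f j x) < e / c"
      using cauchy[of "e / c"] \<open>e > 0\<close> c by auto
    have "(\<integral>x. norm (f i x - f j x) \<partial>M) < e" if "i \<ge> N" "j \<ge> N" for i j
    proof -
      have "(\<integral>x. norm (f i x - f j x) \<partial>M) \<le> L2_norm M (\<lambda>x. f i x - f j x) * c"
        using integral_norm_le_L2[OF L2_space_diff[OF f f], of i j]
        by (rule order_trans) (simp add: c_def mult_left_mono)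
      also have "\<dots> < e" using N[OF that] c by (simp add: pos_less_divide_eq)
      finally show ?thesis .
    qed
    then show ?thesis by blast
  qed
  from cauchy_L1_AE_cauchy_subseq[OF integrable_L2[OF f] this]
  obtain r where r: "strict_mono r" "AE x in M. Cauchy (\<lambda>i. f (r i) x)" by blast
  define g where "g x = lim (\<lambda>i. f (r i) x)" for x
  have gm [measurable]: "g \<in> borel_measurable M"
    unfolding g_def by (rule borel_measurable_lim_metric) simp
  have lim: "AE x in M. (\<lambda>i. f (r i) x) \<longlonglongrightarrow> g x"
    using r(2) by eventually_elim (simp add: g_def Cauchy_convergent_iff convergent_LIMSEQ_iff)
  \<comment> \<open>Fatou along the subsequence: a bound on the distances from \<open>f k\<close> to
    all late members passes to the distance from \<open>f k\<close> to \<open>g\<close>.\<close>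
  have fatou: "(\<integral>\<^sup>+x. ennreal ((norm (f k x - g x))\<^sup>2) \<partial>M) \<le> ennreal (e\<^sup>2)"
    if "\<And>j. j \<ge> N \<Longrightarrow> L2_norm M (\<lambda>x. f k x - f j x) \<le> e" for k e N
  proof -
    have "(\<integral>\<^sup>+x. ennreal ((norm (f k x - g x))\<^sup>2) \<partial>M)
        = (\<integral>\<^sup>+x. liminf (\<lambda>i. ennreal ((norm (f k x - f (r i) x))\<^sup>2)) \<partial>M)"
    proof (rule nn_integral_cong_AE)
      show "AE x in M. ennreal ((norm (f k x - g x))\<^sup>2) = liminf (\<lambda>i. ennreal ((norm (f k x - f (r i) x))\<^sup>2))"
        using lim
      proof eventually_elim
        case (elim x)
        have "(\<lambda>i. ennreal ((norm (f k x - f (r i) x))\<^sup>2)) \<longlonglongrightarrow> ennreal ((norm (f k x - g x))\<^sup>2)"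
          using elim by (intro tendsto_intros)
        then show ?case by (rule lim_imp_Liminf[OF sequentially_bot, symmetric])
      qed
    qed
    also have "\<dots> \<le> liminf (\<lambda>i. \<integral>\<^sup>+x. ennreal ((norm (f k x - f (r i) x))\<^sup>2) \<partial>M)"
      by (rule nn_integral_liminf) simp
    also have "\<dots> \<le> limsup (\<lambda>i. \<integral>\<^sup>+x. ennreal ((norm (f k x - f (r i) x))\<^sup>2) \<partial>M)"
      by (simp add: Liminf_le_Limsup)
    also have "\<dots> \<le> ennreal (e\<^sup>2)"
    proof (rule Limsup_bounded)
      have "\<forall>\<^sub>F i in sequentially. i \<ge> N" by simp
      then show "\<forall>\<^sub>F i in sequentially. (\<integral>\<^sup>+x. ennreal ((norm (f k x - f (r i) x))\<^sup>2) \<partial>M) \<le> ennreal (e\<^sup>2)"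
      proof eventually_elim
        case (elim i)
        then have "r i \<ge> N" using seq_suble[OF r(1), of i] by simp
        then have "(L2_norm M (\<lambda>x. f k x - f (r i) x))\<^sup>2 \<le> e\<^sup>2"
          using that by (intro power_mono) auto
        then show ?case
          using L2_spaceD(2)[OF L2_space_diff[OF f f], of k "r i"]
          by (subst nn_integral_eq_integral) (auto simp: L2_norm_power2 intro: ennreal_leI)
      qed
    qed
    finally show ?thesis .
  qed
  have d: "(\<lambda>x. f k x - g x) \<in> L2_space M \<and> L2_norm M (\<lambda>x. f k x - g x) \<le> e"
    if "\<And>j. j \<ge> N \<Longrightarrow> L2_norm M (\<lambda>x. f k x - f j x) \<le> e" "e \<ge> 0" for k e N
  proof -
    have fa: "(\<integral>\<^sup>+x. ennreal ((norm (f k x - g x))\<^sup>2) \<partial>M) \<le> ennreal (e\<^sup>2)"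
      using fatou that(1) by blast
    then have "integrable M (\<lambda>x. (norm (f k x - g x))\<^sup>2)"
      by (auto simp: integrable_iff_bounded intro: le_less_trans)
    moreover from this have "(\<integral>x. (norm (f k x - g x))\<^sup>2 \<partial>M) \<le> e\<^sup>2"
      using fa by (simp add: nn_integral_eq_integral)
    ultimately show ?thesis
      using that(2) by (auto simp: L2_space_def L2_norm_def real_le_lsqrt)
  qed
  have g: "g \<in> L2_space M"
  proof -
    obtain N where N: "\<And>i j. i \<ge> N \<Longrightarrow> j \<ge> N \<Longrightarrow> L2_norm M (\<lambda>x. f i x - f j x) < 1"
      using cauchy[of 1] by auto
    have "(\<lambda>x. f N x - g x) \<in> L2_space M"
      using d[where k=N and e=1 and N=N] N by (metis less_imp_le order_refl zero_le_one)
    from L2_space_diff[OF f[of N] this] show ?thesis by simp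
  qed
  show ?thesis
  proof (rule that[OF g])
    show "(\<lambda>k. L2_norm M (\<lambda>x. f k x - g x)) \<longlonglongrightarrow> 0"
    proof (rule LIMSEQ_I)
      fix e :: real assume "e > 0"
      then obtain N where N: "\<And>i j. i \<ge> N \<Longrightarrow> j \<ge> N \<Longrightarrow> L2_norm M (\<lambda>x. f i x - f j x) < e / 2"
        using cauchy[of "e / 2"] by auto
      have "norm (L2_norm M (\<lambda>x. f k x - g x) - 0) < e" if "k \<ge> N" for k
      proof -
        have "L2_norm M (\<lambda>x. f k x - g x) \<le> e / 2"
          using d[where k=k and e="e/2" and N=N] N[OF that] \<open>e > 0\<close> by (simp add: less_imp_le)
        then show ?thesis using \<open>e > 0\<close> by simp
      qed
      then show "\<exists>N. \<forall>k\<ge>N. norm (L2_norm M (\<lambda>x. f k x - g x) - 0) < e" by blast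
    qed
  qed
qed

section \<open>Symmetric traceless matrices\<close>
lemma S0_iff: "Q \<in> S0 \<longleftrightarrow> Q$2$1 = Q$1$2 \<and> Q$3$1 = Q$1$3 \<and> Q$3$2 = Q$2$3 \<and> Q$1$1 + Q$2$2 + Q$3$3 = 0"
  by (auto simp: S0_def transpose_def trace_def vec_eq_iff forall_3 sum_3)

lemma inner_matrix_3: "(P::real^3^3) \<bullet> Q = (\<Sum>i\<in>UNIV. \<Sum>j\<in>UNIV. P$i$j * Q$i$j)"
  by (simp add: inner_vec_def)

text \<open>Submultiplicativity of the Frobenius norm: Cauchy-Schwarz for each entry, after which
  the double sum factors.\<close>

lemma norm_matrix_mult_le: "norm ((P::real^'n^'m) ** (Q::real^'k^'n)) \<le> norm P * norm Q"
proof (rule power2_le_imp_le)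
  have N: "(norm A)\<^sup>2 = (\<Sum>i\<in>UNIV. \<Sum>j\<in>UNIV. (A$i$j)\<^sup>2)" for A :: "real^'a^'b"
    by (simp only: power2_norm_eq_inner inner_vec_def) (simp add: power2_eq_square)
  have e: "((P ** Q)$i$j)\<^sup>2 \<le> (\<Sum>k\<in>UNIV. (P$i$k)\<^sup>2) * (\<Sum>k\<in>UNIV. (Q$k$j)\<^sup>2)" for i j
    by (simp add: matrix_matrix_mult_def Cauchy_Schwarz_ineq_sum)
  have "(norm (P ** Q))\<^sup>2 \<le> (\<Sum>i\<in>UNIV. \<Sum>j\<in>UNIV. (\<Sum>k\<in>UNIV. (P$i$k)\<^sup>2) * (\<Sum>k\<in>UNIV. (Q$k$j)\<^sup>2))"
    unfolding N by (intro sum_mono e)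
  also have "\<dots> = (\<Sum>i\<in>UNIV. \<Sum>k\<in>UNIV. (P$i$k)\<^sup>2) * (\<Sum>j\<in>UNIV. \<Sum>k\<in>UNIV. (Q$k$j)\<^sup>2)"
    by (simp add: sum_product)
  also have "(\<Sum>j\<in>UNIV. \<Sum>k\<in>UNIV. (Q$k$j)\<^sup>2) = (norm Q)\<^sup>2"
    unfolding N by (rule sum.swap)
  finally show "(norm (P ** Q))\<^sup>2 \<le> (norm P * norm Q)\<^sup>2"
    by (simp add: N power_mult_distrib)
qed simp

text \<open>For symmetric arguments this is the trace of the product of the three matrices, the
  polarisation of \<open>tr Q^3\<close>. As a symmetric trilinear form on \<open>S0\<close> it
  reduces the algebra of the cubic term to the binomial formula.\<close>

definition cubic :: "real^3^3 \<Rightarrow> real^3^3 \<Rightarrow> real^3^3 \<Rightarrow> real" where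
  "cubic P Q R = P \<bullet> (Q ** R)"

lemma cubic_add: "cubic (P + P') Q R = cubic P Q R + cubic P' Q R"
   "cubic P (Q + Q') R = cubic P Q R + cubic P Q' R"
   "cubic P Q (R + R') = cubic P Q R + cubic P Q R'"
  by (simp_all add: cubic_def inner_add_left inner_add_right matrix_add_ldistrib matrix_matrix_mult_def
    inner_vec_def sum.distrib distrib_left distrib_right)

lemma cubic_scaleR: "cubic (c *\<^sub>R P) Q R = c * cubic P Q R"
   "cubic P (c *\<^sub>R Q) R = c * cubic P Q R"
   "cubic P Q (c *\<^sub>R R) = c * cubic P Q R"
  by (simp_all add: cubic_def inner_vec_def matrix_matrix_mult_def sum_distrib_left mult_ac)

lemma cubic_diff: "cubic (P - P') Q R = cubic P Q R - cubic P' Q R"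
   "cubic P (Q - Q') R = cubic P Q R - cubic P Q' R"
   "cubic P Q (R - R') = cubic P Q R - cubic P Q R'"
  using cubic_add(1)[of P "-1 *\<^sub>R P'"] cubic_add(2)[of P Q "-1 *\<^sub>R Q'"] cubic_add(3)[of P Q R "-1 *\<^sub>R R'"]
  by (simp_all only: cubic_scaleR) simp_all

text \<open>The trace of a product is invariant under cyclic shifts and, for symmetric matrices,
  under reversal; together these generate all permutations. Here the entries are simply
  expanded.\<close>

lemma cubic_sym:
  assumes "P \<in> S0" "Q \<in> S0" "R \<in> S0"
  shows "cubic P Q R = cubic Q P R" "cubic P Q R = cubic P R Q"
  using assms unfolding cubic_def inner_matrix_3 matrix_matrix_mult_def S0_iff
  by (simp_all add: sum_3 algebra_simps)

lemma cubic_sym2: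
  assumes "P \<in> S0" "Q \<in> S0"
  shows "cubic P P Q = cubic Q P P" "cubic P Q P = cubic Q P P"
  using cubic_sym[OF assms(1) assms(1) assms(2)] cubic_sym[OF assms(1) assms(2) assms(1)] by auto

lemma abs_cubic_le: "\<bar>cubic P Q R\<bar> \<le> norm P * norm Q * norm R"
  unfolding cubic_def
  by (smt (verit) Cauchy_Schwarz_ineq2 mult.assoc mult_left_mono norm_ge_zero norm_matrix_mult_le)

text \<open>The term with the identity matrix in \<open>bulk\<close> disappears because it is
  orthogonal to traceless matrices.\<close>

lemma bulk_inner:
  assumes "Q \<in> S0" "X \<in> S0"
  shows "bulk A B C Q \<bullet> X = A * (Q \<bullet> X) - B * cubic X Q Q + C * (Q \<bullet> Q) * (Q \<bullet> X)"
proof -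
  have t: "trace (Q ** Q) = Q \<bullet> Q"
    using assms by (simp add: trace_def matrix_matrix_mult_def inner_matrix_3 S0_iff sum_3)
  have m: "mat 1 \<bullet> X = 0"
    using assms by (simp add: inner_matrix_3 sum_3 mat_def S0_iff)
  show ?thesis
    by (simp add: bulk_def t m cubic_def inner_add_left inner_diff_left inner_commute[of X])
qed

lemma subspace_S0: "subspace S0"
proof -
  have "c * a + c * b + c * d = 0" if "a + b + d = 0" for a b c d :: real
    using arg_cong[OF that, of "(*) c"] by (simp add: distrib_left)
  then show ?thesis by (simp add: subspace_def S0_iff)
qed

lemma zero_S0: "0 \<in> S0"
  by (rule subspace_0[OF subspace_S0])

section \<open>Convexity defect, monotonicity and growth of the bulk energy\<close>

lemma half_sum_diff:
  fixes P Q :: "'a::real_vector"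
  shows "P = (1/2) *\<^sub>R (P + Q) + (1/2) *\<^sub>R (P - Q)" "Q = (1/2) *\<^sub>R (P + Q) - (1/2) *\<^sub>R (P - Q)"
  by (simp_all add: algebra_simps flip: scaleR_add_left)

text \<open>The Landau-de Gennes bulk potential; its gradient within \<open>S0\<close> is
  \<open>bulk\<close>.\<close>

definition bulk_energy :: "real \<Rightarrow> real \<Rightarrow> real \<Rightarrow> real^3^3 \<Rightarrow> real" where
  "bulk_energy A B C Q = A / 2 * (Q \<bullet> Q) - B / 3 * cubic Q Q Q + C / 4 * (Q \<bullet> Q)\<^sup>2"

text \<open>The left side is the second derivative of \<open>bulk_energy\<close> at M in direction D
  without its nonnegative part \<open>2 * C * (M \<bullet> D)^2\<close>. Completing the square in
  the norm of M shows that the cubic contribution costs at most \<open>B^2 / C\<close>, whatever the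
  size of M.\<close>

lemma cubic_lower:
  assumes "0 < C"
  shows "A * (D \<bullet> D) - 2 * B * cubic M D D + C * (M \<bullet> M) * (D \<bullet> D) \<ge> - ((\<bar>A\<bar> + B\<^sup>2 / C) * (D \<bullet> D))"
proof -
  have "B * cubic M D D \<le> \<bar>B\<bar> * \<bar>cubic M D D\<bar>"
    by (simp flip: abs_mult)
  also have "\<dots> \<le> \<bar>B\<bar> * (norm M * norm D * norm D)"
    by (intro mult_left_mono abs_cubic_le) simp
  also have "\<dots> = \<bar>B\<bar> * norm M * (D \<bullet> D)"
    by (simp only: power2_norm_eq_inner[symmetric] power2_eq_square mult.assoc)
  finally have 1: "B * cubic M D D \<le> \<bar>B\<bar> * norm M * (D \<bullet> D)" .
  have "0 \<le> C * (norm M - \<bar>B\<bar> / C)\<^sup>2" using assms by simp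
  also have "\<dots> = C * (norm M)\<^sup>2 - 2 * \<bar>B\<bar> * norm M + \<bar>B\<bar>\<^sup>2 / C"
    using assms by (simp add: power2_diff field_simps) (simp add: power2_eq_square)
  also have "\<dots> = C * (M \<bullet> M) - 2 * \<bar>B\<bar> * norm M + B\<^sup>2 / C"
    by (simp only: power2_norm_eq_inner power2_abs)
  finally have "0 \<le> (C * (M \<bullet> M) - 2 * \<bar>B\<bar> * norm M + B\<^sup>2 / C) * (D \<bullet> D)" by simp
  moreover have "- \<bar>A\<bar> * (D \<bullet> D) \<le> A * (D \<bullet> D)" by (intro mult_right_mono) auto
  ultimately show ?thesis using 1 by (simp add: algebra_simps)
qed

text \<open>In terms of the midpoint M and the half difference D the odd powers of D cancel, and
  what remains is the form bounded in \<open>cubic_lower\<close> plus squares. Since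
  \<open>P - Q\<close> is twice D and the sum of the two energies is halved, the constant K turns
  into K/8.\<close>

lemma bulk_energy_midpoint:
  assumes "P \<in> S0" "Q \<in> S0" "0 < C"
  shows "bulk_energy A B C ((1/2) *\<^sub>R (P + Q)) \<le> (bulk_energy A B C P + bulk_energy A B C Q) / 2
     + (\<bar>A\<bar> + B\<^sup>2 / C) / 8 * ((P - Q) \<bullet> (P - Q))"
proof -
  define K where "K = \<bar>A\<bar> + B\<^sup>2 / C"
  define M D where "M = (1/2) *\<^sub>R (P + Q)" and "D = (1/2) *\<^sub>R (P - Q)"
  have PQ: "P = M + D" "Q = M - D" unfolding M_def D_def by (rule half_sum_diff)+
  have S: "M \<in> S0" "D \<in> S0"
    unfolding M_def D_def using assms subspace_S0 by (simp_all add: subspace_add subspace_diff subspace_scale)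
  have sy: "cubic M M D = cubic D M M" "cubic M D M = cubic D M M" "cubic D M D = cubic M D D"
     "cubic D D M = cubic M D D"
    using cubic_sym2[OF S] cubic_sym2[OF S(2,1)] by auto
  have "bulk_energy A B C P + bulk_energy A B C Q - 2 * bulk_energy A B C M
     = A * (D \<bullet> D) - 2 * B * cubic M D D + C * (M \<bullet> M) * (D \<bullet> D) + C / 2 * (D \<bullet> D)\<^sup>2 + 2 * C * (M \<bullet> D)\<^sup>2"
  proof -
    \<comment> \<open>New coefficients remove the fractions, so that the identity becomes a
      polynomial one.\<close>
    define a b c where "a = A / 2" and "b = B / 3" and "c = C / 4"
    then have abc: "A = 2 * a" "B = 3 * b" "C = 4 * c" by auto
    show ?thesis
      unfolding bulk_energy_def PQ cubic_add cubic_diff sy inner_add_left inner_add_right inner_diff_left inner_diff_right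
          inner_commute[of D M] abc
      by (simp add: power2_eq_square algebra_simps)
  qed
  moreover have "C / 2 * (D \<bullet> D)\<^sup>2 + 2 * C * (M \<bullet> D)\<^sup>2 \<ge> 0" using assms by simp
  moreover have "(P - Q) \<bullet> (P - Q) = 4 * (D \<bullet> D)" by (simp add: D_def)
  then have "K * ((P - Q) \<bullet> (P - Q)) = 4 * (K * (D \<bullet> D))" by simp
  moreover have "w \<le> (u + v) / 2 + k / 8"
    if "u + v - 2 * w = y + z + r" "0 \<le> z + r" "k = 4 * d" "- d \<le> y" for u v w y z r k d :: real
    using that by argo
  ultimately show ?thesis using cubic_lower[OF assms(3), of A B D M]
    unfolding M_def[symmetric] K_def[symmetric] times_divide_eq_left by blast
qed

text \<open>The same reduction to M and D as for the energy: in the pairing with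
  \<open>P - Q = D + D\<close> only even powers of D survive.\<close>

lemma bulk_monotone:
  assumes "P \<in> S0" "Q \<in> S0" "0 < C"
  shows "bulk A B C P \<bullet> (P - Q) - bulk A B C Q \<bullet> (P - Q) \<ge> - ((\<bar>A\<bar> + B\<^sup>2 / C) * ((P - Q) \<bullet> (P - Q)))"
proof -
  define K where "K = \<bar>A\<bar> + B\<^sup>2 / C"
  define M D where "M = (1/2) *\<^sub>R (P + Q)" and "D = (1/2) *\<^sub>R (P - Q)"
  have PQ: "P = M + D" "Q = M - D" unfolding M_def D_def by (rule half_sum_diff)+
  have S: "M \<in> S0" "D \<in> S0"
    unfolding M_def D_def using assms subspace_S0 by (simp_all add: subspace_add subspace_diff subspace_scale)
  have sy: "cubic M M D = cubic D M M" "cubic M D M = cubic D M M" "cubic D M D = cubic M D D"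
     "cubic D D M = cubic M D D"
    using cubic_sym2[OF S] cubic_sym2[OF S(2,1)] by auto
  have PQS: "M + D \<in> S0" "M - D \<in> S0" using assms PQ by simp_all
  have X: "P - Q = D + D" and XS: "D + D \<in> S0"
    using PQ subspace_add[OF subspace_S0 S(2) S(2)] by simp_all
  have "bulk A B C P \<bullet> (P - Q) - bulk A B C Q \<bullet> (P - Q)
     = 4 * (A * (D \<bullet> D) - 2 * B * cubic M D D + C * (M \<bullet> M) * (D \<bullet> D)) + 4 * C * (D \<bullet> D)\<^sup>2 + 8 * C * (M \<bullet> D)\<^sup>2"
    unfolding X unfolding PQ bulk_inner[OF PQS(1) XS] bulk_inner[OF PQS(2) XS]
    unfolding cubic_add cubic_diff sy inner_add_left inner_add_right inner_diff_left inner_diff_right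
          inner_commute[of D M]
    by (simp add: power2_eq_square algebra_simps)
  moreover have "4 * C * (D \<bullet> D)\<^sup>2 + 8 * C * (M \<bullet> D)\<^sup>2 \<ge> 0" using assms by simp
  moreover have "(P - Q) \<bullet> (P - Q) = 4 * (D \<bullet> D)" by (simp add: D_def)
  then have "K * ((P - Q) \<bullet> (P - Q)) = 4 * (K * (D \<bullet> D))" by simp
  moreover have "- k \<le> u" if "u = 4 * y + z + r" "0 \<le> z + r" "k = 4 * d" "- d \<le> y" for u y z r k d :: real
    using that by linarith
  ultimately show ?thesis using cubic_lower[OF assms(3), of A B D M]
    unfolding K_def[symmetric] by blast
qed

text \<open>The weight is quadratic because \<open>bulk\<close> is a cubic polynomial. It is written
  in squares of norms so that the right side is integrable when P, Q and X range over fields in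
  L^4.\<close>

lemma bulk_Lipschitz:
  assumes S: "P \<in> S0" "Q \<in> S0" "X \<in> S0" and "0 < B" "0 < C"
  shows "\<bar>bulk A B C P \<bullet> X - bulk A B C Q \<bullet> X\<bar>
     \<le> (\<bar>A\<bar> + B + 2 * C) * ((1 + (norm P)\<^sup>2 + (norm Q)\<^sup>2) * (norm (P - Q) * norm X))"
proof -
  define p q where "p = norm P" and "q = norm Q"
  have pq: "p \<ge> 0" "q \<ge> 0" by (auto simp: p_def q_def)
  have sq: "p \<le> 1 / 2 + p\<^sup>2 / 2" "q \<le> 1 / 2 + q\<^sup>2 / 2" "2 * (p * q) \<le> p\<^sup>2 + q\<^sup>2"
    using zero_le_power2[of "p - 1"] zero_le_power2[of "q - 1"] zero_le_power2[of "p - q"]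
    by (auto simp: power2_diff)
  define R where "R = norm (P - Q) * norm X"
  define W where "W = 1 + p\<^sup>2 + q\<^sup>2"
  have R0: "R \<ge> 0" by (simp add: R_def)
  have W1: "1 \<le> W" by (simp add: W_def)
  have "\<bar>P \<bullet> X - Q \<bullet> X\<bar> \<le> R"
    by (simp add: R_def Cauchy_Schwarz_ineq2 flip: inner_diff_left)
  also have "\<dots> \<le> W * R" using mult_right_mono[OF W1 R0] by simp
  finally have a: "\<bar>P \<bullet> X - Q \<bullet> X\<bar> \<le> W * R" .
  \<comment> \<open>Telescoping: one argument changes at a time.\<close>
  have "cubic X P P - cubic X Q Q = cubic X (P - Q) P + cubic X Q (P - Q)"
    by (simp add: cubic_diff)
  then have "\<bar>cubic X P P - cubic X Q Q\<bar> \<le> norm X * norm (P - Q) * p + norm X * q * norm (P - Q)"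
    using abs_cubic_le[of X "P - Q" P] abs_cubic_le[of X Q "P - Q"] by (simp add: p_def q_def)
  also have "\<dots> = (p + q) * R" by (simp add: R_def algebra_simps)
  also have "\<dots> \<le> W * R" using sq zero_le_power2[of p] zero_le_power2[of q] unfolding W_def by (intro mult_right_mono R0) argo
  finally have b: "\<bar>cubic X P P - cubic X Q Q\<bar> \<le> W * R" .
  have "(P \<bullet> P) * (P \<bullet> X) - (Q \<bullet> Q) * (Q \<bullet> X)
      = (P \<bullet> P) * ((P - Q) \<bullet> X) + ((P - Q) \<bullet> (P + Q)) * (Q \<bullet> X)"
    by (simp add: inner_diff_left inner_add_right inner_commute algebra_simps)
  moreover have "\<bar>(P \<bullet> P) * ((P - Q) \<bullet> X)\<bar> \<le> p\<^sup>2 * R"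
    unfolding abs_mult R_def p_def
    by (intro mult_mono) (auto simp: Cauchy_Schwarz_ineq2 power2_norm_eq_inner)
  moreover have "\<bar>((P - Q) \<bullet> (P + Q)) * (Q \<bullet> X)\<bar> \<le> (norm (P - Q) * (p + q)) * (q * norm X)"
    unfolding abs_mult p_def q_def
    by (intro mult_mono order_trans[OF Cauchy_Schwarz_ineq2] mult_left_mono norm_triangle_ineq) auto
  moreover have "(norm (P - Q) * (p + q)) * (q * norm X) = (p * q + q\<^sup>2) * R"
    by (simp add: R_def algebra_simps power2_eq_square)
  ultimately have "\<bar>(P \<bullet> P) * (P \<bullet> X) - (Q \<bullet> Q) * (Q \<bullet> X)\<bar> \<le> p\<^sup>2 * R + (p * q + q\<^sup>2) * R"
    by linarith
  also have "\<dots> = (p\<^sup>2 + p * q + q\<^sup>2) * R"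
    by (simp add: algebra_simps)
  also have "\<dots> \<le> (2 * W) * R" 
  proof (intro mult_right_mono R0)
    show "p\<^sup>2 + p * q + q\<^sup>2 \<le> 2 * W" using sq(3) zero_le_power2[of p] zero_le_power2[of q] unfolding W_def by argo
  qed
  finally have c: "\<bar>(P \<bullet> P) * (P \<bullet> X) - (Q \<bullet> Q) * (Q \<bullet> X)\<bar> \<le> 2 * (W * R)" by simp
  have e: "bulk A B C P \<bullet> X - bulk A B C Q \<bullet> X = A * (P \<bullet> X - Q \<bullet> X) - B * (cubic X P P - cubic X Q Q)
     + C * ((P \<bullet> P) * (P \<bullet> X) - (Q \<bullet> Q) * (Q \<bullet> X))"
    by (simp add: bulk_inner S algebra_simps)
  have "\<bar>bulk A B C P \<bullet> X - bulk A B C Q \<bullet> X\<bar> \<le> \<bar>A\<bar> * \<bar>P \<bullet> X - Q \<bullet> X\<bar> + B * \<bar>cubic X P P - cubic X Q Q\<bar>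
     + C * \<bar>(P \<bullet> P) * (P \<bullet> X) - (Q \<bullet> Q) * (Q \<bullet> X)\<bar>"
    unfolding e using assms(4,5) by (auto simp: abs_mult intro!: order_trans[OF abs_triangle_ineq] order_trans[OF abs_triangle_ineq4])
  also have "\<dots> \<le> \<bar>A\<bar> * (W * R) + B * (W * R) + C * (2 * (W * R))"
    using a b c assms(4,5) by (intro add_mono mult_left_mono) auto
  finally show ?thesis by (simp add: W_def R_def p_def q_def algebra_simps)
qed

text \<open>A second-order expansion with explicit remainder. The term with
  \<open>X \<bullet> X\<close> has the sign of A and is dropped, and
  \<open>\<bar>t\<bar> \<le> 1\<close> lets the higher powers of t be absorbed into the
  square.\<close>

lemma bulk_energy_Taylor:
  assumes S: "P \<in> S0" "X \<in> S0" and "A \<le> 0" "0 < B" "0 < C" and t: "\<bar>t\<bar> \<le> 1"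
  shows "bulk_energy A B C (P + t *\<^sub>R X) \<le> bulk_energy A B C P + t * (bulk A B C P \<bullet> X)
     + t\<^sup>2 * (2 * B + 3 * C) * ((1 + (norm P)\<^sup>2 + (norm X)\<^sup>2) * (norm X)\<^sup>2)"
proof -
  define p x where "p = norm P" and "x = norm X"
  have px: "p \<ge> 0" "x \<ge> 0" by (auto simp: p_def x_def)
  have sy: "cubic P P X = cubic X P P" "cubic P X P = cubic X P P" "cubic X P X = cubic P X X"
     "cubic X X P = cubic P X X"
    using cubic_sym2[OF S] cubic_sym2[OF S(2,1)] by auto
  have e: "bulk_energy A B C (P + t *\<^sub>R X) = bulk_energy A B C P + t * (bulk A B C P \<bullet> X)
     + t\<^sup>2 * (A / 2 * (X \<bullet> X) - B * cubic P X X - B / 3 * (t * cubic X X X)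
        + C * (P \<bullet> X)\<^sup>2 + C / 2 * ((P \<bullet> P) * (X \<bullet> X)) + C * (t * ((P \<bullet> X) * (X \<bullet> X))) + C / 4 * (t\<^sup>2 * (X \<bullet> X)\<^sup>2))"
  proof -
    define a b c where "a = A / 2" and "b = B / 3" and "c = C / 4"
    then have "A = 2 * a" "B = 3 * b" "C = 4 * c" by auto
    then show ?thesis
      unfolding bulk_energy_def bulk_inner[OF S]
      by (simp add: cubic_add cubic_scaleR sy inner_add_left inner_add_right inner_commute[of X P])
        (simp add: power2_eq_square algebra_simps)
  qed
  have a: "A / 2 * (X \<bullet> X) \<le> 0" using assms(3) by (simp add: mult_nonpos_nonneg)
  have b: "- B * cubic P X X \<le> B * (p * x\<^sup>2)"
    using abs_cubic_le[of P X X] mult_left_mono[of "- cubic P X X" "p * x\<^sup>2" B] assms(4)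
    by (simp add: p_def x_def power2_eq_square mult.assoc)
  have tle: "\<bar>t * y\<bar> \<le> \<bar>y\<bar>" for y using t by (simp add: abs_mult mult_left_le_one_le)
  have "\<bar>t * cubic X X X\<bar> \<le> x * x\<^sup>2"
    using tle[of "cubic X X X"] abs_cubic_le[of X X X] by (simp add: x_def power2_eq_square mult.assoc)
  then have c: "- (B / 3 * (t * cubic X X X)) \<le> B / 3 * (x * x\<^sup>2)"
    using mult_left_mono[of "- (t * cubic X X X)" "x * x\<^sup>2" "B / 3"] assms(4) by simp
  have cs: "\<bar>P \<bullet> X\<bar> \<le> p * x" by (simp add: p_def x_def Cauchy_Schwarz_ineq2)
  have d: "C * (P \<bullet> X)\<^sup>2 \<le> C * (p * x)\<^sup>2" using power_mono[OF cs, of 2] assms(5) by simp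
  have "\<bar>t * ((P \<bullet> X) * (X \<bullet> X))\<bar> \<le> p * x * x\<^sup>2"
    using tle[of "(P \<bullet> X) * (X \<bullet> X)"] mult_right_mono[OF cs, of "x\<^sup>2"]
    by (simp add: abs_mult x_def power2_norm_eq_inner)
  then have f: "C * (t * ((P \<bullet> X) * (X \<bullet> X))) \<le> C * (p * x * x\<^sup>2)"
    using assms(5) by (intro mult_left_mono) auto
  have "t\<^sup>2 \<le> 1" using t by (simp add: abs_square_le_1)
  then have "t\<^sup>2 * (X \<bullet> X)\<^sup>2 \<le> 1 * (X \<bullet> X)\<^sup>2" by (rule mult_right_mono) simp
  then have g: "C / 4 * (t\<^sup>2 * (X \<bullet> X)\<^sup>2) \<le> C / 4 * (x\<^sup>2)\<^sup>2"
    using assms(5) by (intro mult_left_mono) (auto simp: x_def power2_norm_eq_inner)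
  have sq: "p \<le> 1 / 2 + p\<^sup>2 / 2" "x \<le> 1 / 2 + x\<^sup>2 / 2" "2 * (p * x) \<le> p\<^sup>2 + x\<^sup>2"
    using zero_le_power2[of "p - 1"] zero_le_power2[of "x - 1"] zero_le_power2[of "p - x"]
    by (auto simp: power2_diff)
  have "B * (p * x\<^sup>2) + B / 3 * (x * x\<^sup>2) + C * (p * x)\<^sup>2 + C / 2 * (p\<^sup>2 * x\<^sup>2) + C * (p * x * x\<^sup>2) + C / 4 * (x\<^sup>2)\<^sup>2
     = (B * (p + x / 3) + C * (p\<^sup>2 * 3 / 2 + p * x + x\<^sup>2 / 4)) * x\<^sup>2"
    by (simp add: power2_eq_square algebra_simps)
  also have "\<dots> \<le> (B * (2 * (1 + p\<^sup>2 + x\<^sup>2)) + C * (3 * (1 + p\<^sup>2 + x\<^sup>2))) * x\<^sup>2"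
  proof (intro mult_right_mono add_mono mult_left_mono)
    show "p + x / 3 \<le> 2 * (1 + p\<^sup>2 + x\<^sup>2)" using sq(1,2) zero_le_power2[of p] zero_le_power2[of x] by argo
    show "p\<^sup>2 * 3 / 2 + p * x + x\<^sup>2 / 4 \<le> 3 * (1 + p\<^sup>2 + x\<^sup>2)"
      using sq(3) zero_le_power2[of p] zero_le_power2[of x] by argo
  qed (use assms in auto)
  finally have s: "B * (p * x\<^sup>2) + B / 3 * (x * x\<^sup>2) + C * (p * x)\<^sup>2 + C / 2 * (p\<^sup>2 * x\<^sup>2) + C * (p * x * x\<^sup>2) + C / 4 * (x\<^sup>2)\<^sup>2
      \<le> (2 * B + 3 * C) * ((1 + p\<^sup>2 + x\<^sup>2) * x\<^sup>2)" by (simp add: algebra_simps)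
  have n: "P \<bullet> P = p\<^sup>2" "X \<bullet> X = x\<^sup>2" by (auto simp: p_def x_def power2_norm_eq_inner)
  have "A / 2 * (X \<bullet> X) - B * cubic P X X - B / 3 * (t * cubic X X X)
        + C * (P \<bullet> X)\<^sup>2 + C / 2 * ((P \<bullet> P) * (X \<bullet> X)) + C * (t * ((P \<bullet> X) * (X \<bullet> X))) + C / 4 * (t\<^sup>2 * (X \<bullet> X)\<^sup>2)
      \<le> (2 * B + 3 * C) * ((1 + p\<^sup>2 + x\<^sup>2) * x\<^sup>2)"
    using a b c d f g s unfolding n by linarith
  then have "t\<^sup>2 * (A / 2 * (X \<bullet> X) - B * cubic P X X - B / 3 * (t * cubic X X X)
        + C * (P \<bullet> X)\<^sup>2 + C / 2 * ((P \<bullet> P) * (X \<bullet> X)) + C * (t * ((P \<bullet> X) * (X \<bullet> X))) + C / 4 * (t\<^sup>2 * (X \<bullet> X)\<^sup>2))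
      \<le> t\<^sup>2 * ((2 * B + 3 * C) * ((1 + p\<^sup>2 + x\<^sup>2) * x\<^sup>2))" by (rule mult_left_mono) simp
  then show ?thesis unfolding e by (simp add: p_def x_def mult.assoc)
qed

text \<open>The quartic term is split into halves: one absorbs the cubic term by completing the
  square, the other absorbs the quadratic terms.\<close>

lemma bulk_energy_bounded_below:
  assumes "0 < B" "0 < C"
  obtains c where "0 \<le> c" "\<And>Q. - c \<le> bulk_energy A B C Q"
proof -
  \<comment> \<open>The quadratic coefficient to be absorbed: half of \<open>\<bar>A\<bar>\<close>
    from the energy itself, the rest from the square that swallows the cubic term.\<close>
  define k where "k = \<bar>A\<bar> / 2 + 2 * B\<^sup>2 / (9 * C)"
  show ?thesis
  proof
    show "0 \<le> 2 * k\<^sup>2 / C" using assms by simp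
    fix Q :: "real^3^3"
    define q where "q = norm Q"
    have "cubic Q Q Q \<le> q ^ 3"
      using abs_cubic_le[of Q Q Q] by (simp add: q_def power3_eq_cube)
    then have 1: "B / 3 * cubic Q Q Q \<le> B / 3 * q ^ 3" using assms by (intro mult_left_mono) auto
    have 2: "- \<bar>A\<bar> / 2 * q\<^sup>2 \<le> A / 2 * q\<^sup>2" by (intro mult_right_mono) auto
    have "0 \<le> q\<^sup>2 * (C / 8 * (q - 4 * B / (3 * C))\<^sup>2) + C / 8 * (q\<^sup>2 - 4 * k / C)\<^sup>2"
      using assms by simp
    also have "q\<^sup>2 * (C / 8 * (q - 4 * B / (3 * C))\<^sup>2) = C / 8 * q ^ 4 - B / 3 * q ^ 3 + 2 * B\<^sup>2 / (9 * C) * q\<^sup>2"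
      using assms by (simp add: field_simps power2_eq_square power3_eq_cube power4_eq_xxxx)
    also have "C / 8 * (q\<^sup>2 - 4 * k / C)\<^sup>2 = C / 8 * q ^ 4 - k * q\<^sup>2 + 2 * k\<^sup>2 / C"
      using assms by (simp add: field_simps power2_eq_square power4_eq_xxxx)
    finally have 3: "0 \<le> C / 4 * q ^ 4 - B / 3 * q ^ 3 + 2 * B\<^sup>2 / (9 * C) * q\<^sup>2 - k * q\<^sup>2 + 2 * k\<^sup>2 / C" by simp
    have "k * q\<^sup>2 = \<bar>A\<bar> / 2 * q\<^sup>2 + 2 * B\<^sup>2 / (9 * C) * q\<^sup>2" by (simp add: k_def algebra_simps)
    then show "- (2 * k\<^sup>2 / C) \<le> bulk_energy A B C Q"
      using 1 2 3 unfolding bulk_energy_def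
      by (simp add: q_def power2_norm_eq_inner power4_eq_xxxx flip: power_mult) (simp add: power2_eq_square power2_norm_eq_inner[symmetric] mult_ac)
  qed
qed

text \<open>The orthogonal projection onto \<open>S0\<close>. Being linear it commutes with
  differentiation, so it makes approximating sequences \<open>S0\<close>-valued without leaving the
  C^1 functions.\<close>

definition S0_proj :: "real^3^3 \<Rightarrow> real^3^3" where
  "S0_proj Q = (1/2) *\<^sub>R (Q + transpose Q) - (trace Q / 3) *\<^sub>R mat 1"

lemma S0_proj_in: "S0_proj Q \<in> S0"
  by (simp add: S0_iff S0_proj_def transpose_def trace_def sum_3 mat_def field_simps)

lemma S0_proj_id: "Q \<in> S0 \<Longrightarrow> S0_proj Q = Q"
  by (auto simp: S0_proj_def S0_def scaleR_2[symmetric])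

lemma bounded_linear_S0_proj: "bounded_linear S0_proj"
proof (rule linear_conv_bounded_linear[THEN iffD1, OF linearI])
qed (auto simp: S0_proj_def transpose_def trace_def sum_3 mat_def vec_eq_iff algebra_simps add_divide_distrib)

section \<open>The anchoring energy and its gradient\<close>

definition anchoring_energy :: "real \<Rightarrow> real \<Rightarrow> real \<Rightarrow> real^3^3 \<Rightarrow> real" where
  "anchoring_energy s \<alpha>z \<gamma>z Q = \<alpha>z * (Q$3$3 + s/3)\<^sup>2 + \<gamma>z * ((Q$1$3)\<^sup>2 + (Q$2$3)\<^sup>2)"

text \<open>Against a traceless X the diagonal coefficients -2/3, -2/3, 4/3 of \<open>H\<close>
  collapse to the factor 2 on the 33 entry. Thus \<open>H\<close> is the gradient of
  \<open>anchoring_energy\<close> within \<open>S0\<close>.\<close>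

lemma H_inner:
  assumes "X \<in> S0"
  shows "H s \<alpha>z \<gamma>z Q \<bullet> X = 2 * \<alpha>z * (Q$3$3 + s/3) * X$3$3 + 2 * \<gamma>z * (Q$1$3 * X$1$3 + Q$2$3 * X$2$3)"
proof -
  have "X$1$1 = - X$2$2 - X$3$3" using assms by (simp add: S0_iff)
  then show ?thesis
    using assms by (simp add: inner_matrix_3 sum_3 H_def S0_iff) (simp add: field_simps)
qed

lemma H_diff: "H s \<alpha>z \<gamma>z P - H s \<alpha>z \<gamma>z Q = H 0 \<alpha>z \<gamma>z (P - Q)"
  by (simp add: H_def vec_eq_iff forall_3 algebra_simps)

lemma bounded_linear_H: "bounded_linear (H 0 \<alpha>z \<gamma>z)"
  by (rule linear_conv_bounded_linear[THEN iffD1, OF linearI]) (auto simp: H_def vec_eq_iff forall_3 algebra_simps)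

text \<open>There is no remainder because the energy is a quadratic polynomial.\<close>

lemma anchoring_energy_add:
  assumes "X \<in> S0"
  shows "anchoring_energy s \<alpha>z \<gamma>z (P + t *\<^sub>R X) = anchoring_energy s \<alpha>z \<gamma>z P + t * (H s \<alpha>z \<gamma>z P \<bullet> X)
     + t\<^sup>2 * anchoring_energy 0 \<alpha>z \<gamma>z X"
  unfolding H_inner[OF assms] anchoring_energy_def by (simp add: power2_eq_square algebra_simps)

lemma anchoring_energy_midpoint:
  assumes "0 \<le> \<alpha>z" "0 \<le> \<gamma>z"
  shows "anchoring_energy s \<alpha>z \<gamma>z ((1/2) *\<^sub>R (P + Q))
     \<le> (anchoring_energy s \<alpha>z \<gamma>z P + anchoring_energy s \<alpha>z \<gamma>z Q) / 2"
proof -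
  have "(anchoring_energy s \<alpha>z \<gamma>z P + anchoring_energy s \<alpha>z \<gamma>z Q) / 2 - anchoring_energy s \<alpha>z \<gamma>z ((1/2) *\<^sub>R (P + Q))
     = \<alpha>z * ((P$3$3 - Q$3$3) / 2)\<^sup>2 + \<gamma>z * (((P$1$3 - Q$1$3) / 2)\<^sup>2 + ((P$2$3 - Q$2$3) / 2)\<^sup>2)"
  proof -
    \<comment> \<open>The midpoint deficit of a square is again a square; the shift c is
      \<open>s/3\<close> for the 33 entry and 0 for the others.\<close>
    have e: "((u - v) / 2)\<^sup>2 = ((u + c)\<^sup>2 + (v + c)\<^sup>2) / 2 - ((1/2) * (u + v) + c)\<^sup>2" for u v c :: real
      by (simp add: power2_eq_square field_simps)
    show ?thesis
      unfolding anchoring_energy_def e[of "P$3$3" "Q$3$3" "s/3"] e[of "P$1$3" "Q$1$3" 0] e[of "P$2$3" "Q$2$3" 0]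
        vector_add_component vector_scaleR_component add_0_right real_scaleR_def
      by (simp add: right_diff_distrib distrib_left add_divide_distrib)
  qed
  also have "\<dots> \<ge> 0" using assms by simp
  finally show ?thesis by simp
qed

lemma anchoring_energy_nonneg: "0 \<le> \<alpha>z \<Longrightarrow> 0 \<le> \<gamma>z \<Longrightarrow> 0 \<le> anchoring_energy s \<alpha>z \<gamma>z Q"
  by (simp add: anchoring_energy_def)

lemma anchoring_energy_le:
  assumes "0 \<le> \<alpha>z" "0 \<le> \<gamma>z"
  shows "anchoring_energy 0 \<alpha>z \<gamma>z Q \<le> (\<alpha>z + 2 * \<gamma>z) * (norm Q)\<^sup>2"
proof -
  have c: "(Q$i$j)\<^sup>2 \<le> (norm Q)\<^sup>2" for i j :: 3
    using component_le_norm_cart[of "Q$i" j] Finite_Cartesian_Product.norm_nth_le[of Q i] by (intro abs_le_square_iff[THEN iffD1]) simp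
  show ?thesis
    using mult_left_mono[OF c[of 3 3] assms(1)] mult_left_mono[OF c[of 1 3] assms(2)] mult_left_mono[OF c[of 2 3] assms(2)]
    by (simp add: anchoring_energy_def algebra_simps)
qed

section \<open>Functions of class \<open>C\<^sup>1\<close> and weak derivatives\<close>

abbreviation partial :: "'a::euclidean_space \<Rightarrow> ('a \<Rightarrow> 'b::euclidean_space) \<Rightarrow> 'a \<Rightarrow> 'b" where
  "partial e f x \<equiv> frechet_derivative f (at x) e"

lemma C1_has_derivative:
  "continuously_differentiable f \<Longrightarrow> (f has_derivative frechet_derivative f (at x)) (at x)"
  unfolding continuously_differentiable_def by (metis differentiableI frechet_derivative_works)

lemma C1_continuous_on: "continuously_differentiable f \<Longrightarrow> continuous_on S f"
  by (rule has_derivative_continuous_on, rule has_derivative_at_withinI, rule C1_has_derivative)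

lemma C1_continuous_on_partial:
  assumes "continuously_differentiable f"
  shows "continuous_on S (partial e f)"
proof -
  obtain f' where f': "\<And>x. (f has_derivative blinfun_apply (f' x)) (at x)" "continuous_on UNIV f'"
    using assms by (auto simp: continuously_differentiable_def)
  have "partial e f = (\<lambda>x. blinfun_apply (f' x) e)"
    by (intro ext) (metis f'(1) frechet_derivative_at)
  moreover have "continuous_on UNIV (\<lambda>x. blinfun_apply (f' x) e)"
    using f'(2) by (intro continuous_intros)
  ultimately show ?thesis by (metis continuous_on_subset subset_UNIV)
qed

text \<open>In finite dimension, continuity of the derivative as a bounded linear map may be tested
  on each direction separately.\<close>

lemma C1_I:
  fixes f :: "'a::euclidean_space \<Rightarrow> 'b::euclidean_space"
  assumes d: "\<And>x. (f has_derivative f' x) (at x)" and c: "\<And>e. continuous_on UNIV (\<lambda>x. f' x e)"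
  shows "continuously_differentiable f"
  unfolding continuously_differentiable_def
proof (intro exI conjI allI)
  have b: "blinfun_apply (Blinfun (f' x)) = f' x" for x
    using d[of x] by (intro bounded_linear_Blinfun_apply has_derivative_bounded_linear)
  show "(f has_derivative blinfun_apply (Blinfun (f' x))) (at x)" for x
    using d[of x] by (simp add: b)
  show "continuous_on UNIV (\<lambda>x. Blinfun (f' x))"
    by (rule continuous_on_blinfun_componentwise) (simp add: b c)
qed

lemma partial_eqI: "(f has_derivative f') (at x) \<Longrightarrow> partial e f x = f' e"
  by (metis frechet_derivative_at)

lemma C1_const: "continuously_differentiable (\<lambda>x. c)"
  by (rule C1_I[where f'="\<lambda>x h. 0"]) auto

lemma C1_linear:
  assumes T: "bounded_linear T" and f: "continuously_differentiable f"
  shows "continuously_differentiable (\<lambda>x. T (f x))" "partial e (\<lambda>x. T (f x)) x = T (partial e f x)"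
proof -
  have d: "((\<lambda>x. T (f x)) has_derivative (\<lambda>e. T (partial e f x))) (at x)" for x
    by (rule bounded_linear.has_derivative[OF T C1_has_derivative[OF f]])
  show "continuously_differentiable (\<lambda>x. T (f x))"
    by (rule C1_I[OF d]) (rule bounded_linear.continuous_on[OF T C1_continuous_on_partial[OF f]])
  show "partial e (\<lambda>x. T (f x)) x = T (partial e f x)"
    by (rule partial_eqI[OF d])
qed

lemma C1_add:
  assumes f: "continuously_differentiable f" and g: "continuously_differentiable g"
  shows "continuously_differentiable (\<lambda>x. f x + g x)"
    "partial e (\<lambda>x. f x + g x) x = partial e f x + partial e g x"
proof -
  have d: "((\<lambda>x. f x + g x) has_derivative (\<lambda>e. partial e f x + partial e g x)) (at x)" for x
    by (intro has_derivative_add C1_has_derivative f g)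
  show "continuously_differentiable (\<lambda>x. f x + g x)"
    by (rule C1_I[OF d]) (intro continuous_on_add C1_continuous_on_partial f g)
  show "partial e (\<lambda>x. f x + g x) x = partial e f x + partial e g x"
    by (rule partial_eqI[OF d])
qed

lemma C1_diff:
  assumes f: "continuously_differentiable f" and g: "continuously_differentiable g"
  shows "continuously_differentiable (\<lambda>x. f x - g x)"
    "partial e (\<lambda>x. f x - g x) x = partial e f x - partial e g x"
proof -
  have d: "((\<lambda>x. f x - g x) has_derivative (\<lambda>e. partial e f x - partial e g x)) (at x)" for x
    by (intro has_derivative_diff C1_has_derivative f g)
  show "continuously_differentiable (\<lambda>x. f x - g x)"
    by (rule C1_I[OF d]) (intro continuous_on_diff C1_continuous_on_partial f g)
  show "partial e (\<lambda>x. f x - g x) x = partial e f x - partial e g x"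
    by (rule partial_eqI[OF d])
qed

lemmas C1_scaleR = C1_linear[OF bounded_linear_scaleR_right]

lemma C1_scaleR_fun:
  assumes f: "continuously_differentiable f" and g: "continuously_differentiable g"
  shows "continuously_differentiable (\<lambda>x. f x *\<^sub>R g x)"
    "partial e (\<lambda>x. f x *\<^sub>R g x) x = f x *\<^sub>R partial e g x + partial e f x *\<^sub>R g x"
proof -
  have d: "((\<lambda>x. f x *\<^sub>R g x) has_derivative (\<lambda>e. f x *\<^sub>R partial e g x + partial e f x *\<^sub>R g x)) (at x)" for x
    by (intro has_derivative_scaleR C1_has_derivative f g)
  show "continuously_differentiable (\<lambda>x. f x *\<^sub>R g x)"
    by (rule C1_I[OF d]) (intro continuous_intros C1_continuous_on C1_continuous_on_partial f g)
  show "partial e (\<lambda>x. f x *\<^sub>R g x) x = f x *\<^sub>R partial e g x + partial e f x *\<^sub>R g x"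
    by (rule partial_eqI[OF d])
qed

lemma C1_sum:
  fixes f :: "'i \<Rightarrow> 'a::euclidean_space \<Rightarrow> 'b::euclidean_space"
  assumes "finite I" "\<And>i. i \<in> I \<Longrightarrow> continuously_differentiable (f i)"
  shows "continuously_differentiable (\<lambda>x. \<Sum>i\<in>I. f i x)"
  using assms
proof (induction I rule: finite_induct)
  case empty
  then show ?case by (simp add: C1_const)
next
  case (insert i I)
  have "continuously_differentiable (\<lambda>x. f i x + (\<Sum>i\<in>I. f i x))"
    using insert by (intro C1_add(1)) blast+
  then show ?case using insert.hyps by simp
qed

lemma C1_real_compose:
  fixes f :: "'a::euclidean_space \<Rightarrow> real"
  assumes f: "continuously_differentiable f"
    and g: "\<And>x. (g has_real_derivative g' (f x)) (at (f x))" "continuous_on UNIV (\<lambda>x. g' (f x))"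
  shows "continuously_differentiable (\<lambda>x. g (f x))"
proof (rule C1_I)
  show "((\<lambda>x. g (f x)) has_derivative (\<lambda>e. partial e f x * g' (f x))) (at x)" for x
    by (rule DERIV_compose_FDERIV[OF g(1) C1_has_derivative[OF f]])
  show "continuous_on UNIV (\<lambda>x. partial e f x * g' (f x))" for e
    by (intro continuous_on_mult C1_continuous_on_partial f g)
qed

section \<open>Compactly supported functions and integration by parts\<close>

lemma compact_support_bounded:
  fixes f :: "'a::euclidean_space \<Rightarrow> 'b::euclidean_space"
  assumes "continuous_on UNIV f" "compact K" "\<And>x. x \<notin> K \<Longrightarrow> f x = 0"
  obtains c where "0 \<le> c" "\<And>x. norm (f x) \<le> c"
proof -
  have "compact (f ` K)" using assms by (meson compact_continuous_image continuous_on_subset subset_UNIV)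
  then obtain b where b: "\<And>x. x \<in> K \<Longrightarrow> norm (f x) \<le> b"
    by (meson bounded_iff compact_imp_bounded image_eqI)
  show ?thesis
  proof
    show "norm (f x) \<le> max 0 b" for x
      using b[of x] assms(3)[of x] by (cases "x \<in> K") auto
  qed simp
qed

lemma compact_support_integrable:
  fixes f :: "'a::euclidean_space \<Rightarrow> 'b::euclidean_space"
  assumes "continuous_on UNIV f" "compact K" "\<And>x. x \<notin> K \<Longrightarrow> f x = 0"
  shows "integrable lborel f"
proof -
  have "integrable lborel (\<lambda>x. indicator K x *\<^sub>R f x)"
    using assms by (intro borel_integrable_compact continuous_on_subset[OF assms(1)]) auto
  moreover have "(\<lambda>x. indicator K x *\<^sub>R f x) = f" using assms(3) by (auto simp: indicator_def)
  ultimately show ?thesis by simp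
qed

text \<open>The complement of K is open, so f vanishes in a neighbourhood of x.\<close>

lemma partial_compact_support:
  assumes "compact K" "\<And>x. x \<notin> K \<Longrightarrow> f x = 0" "x \<notin> K"
  shows "partial e f x = 0"
proof -
  have "(f has_derivative (\<lambda>h. 0)) (at x)"
  proof (rule has_derivative_transform_within_open)
    show "((\<lambda>_. 0) has_derivative (\<lambda>h. 0)) (at x)" by simp
    show "open (- K)" using assms(1) by (simp add: compact_imp_closed open_Compl)
    show "x \<in> - K" using assms(3) by simp
    show "0 = f y" if "y \<in> - K" for y using assms(2) that by simp
  qed
  then show ?thesis by (rule partial_eqI)
qed

text \<open>The difference quotients of \<open>f\<close> have integral zero by translation invariance.\<close>

lemma integral_partial_eq_0:
  fixes f :: "'a::euclidean_space \<Rightarrow> 'b::euclidean_space"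
  assumes f: "continuously_differentiable f" and K: "compact K" "\<And>x. x \<notin> K \<Longrightarrow> f x = 0"
  shows "(\<integral>x. partial e f x \<partial>lborel) = 0"
proof -
  define h where "h n = inverse (real (Suc n))" for n
  have h: "h n > 0" "h n \<le> 1" for n by (auto simp: h_def inverse_le_1_iff)
  have h0: "h \<longlonglongrightarrow> 0" unfolding h_def by (rule LIMSEQ_inverse_real_of_nat)
  define q where "q n x = (1 / h n) *\<^sub>R (f (x + h n *\<^sub>R e) - f x)" for n x
  have fc: "continuous_on UNIV f" by (rule C1_continuous_on[OF f])
  have fi: "integrable lborel f" by (rule compact_support_integrable[OF fc K])
  have q0: "(\<integral>x. q n x \<partial>lborel) = 0" for n
  proof -
    have fm: "f \<in> borel_measurable borel" using fc by (rule borel_measurable_continuous_onI)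
    have "integrable lborel (\<lambda>x. f (h n *\<^sub>R e + x)) \<longleftrightarrow> integrable (distr lborel borel ((+) (h n *\<^sub>R e))) f"
      using fm by (intro integrable_distr_eq[symmetric]) auto
    moreover have "(\<integral>x. f (h n *\<^sub>R e + x) \<partial>lborel) = (\<integral>x. f x \<partial>distr lborel borel ((+) (h n *\<^sub>R e)))"
      using fm by (intro integral_distr[symmetric]) auto
    ultimately have "integrable lborel (\<lambda>x. f (h n *\<^sub>R e + x))" "(\<integral>x. f (h n *\<^sub>R e + x) \<partial>lborel) = (\<integral>x. f x \<partial>lborel)"
      using fi by (simp_all add: lborel_distr_plus)
    then show ?thesis
      using fi by (simp add: q_def add.commute)
  qed
  have pc: "continuous_on UNIV (partial e f)" by (rule C1_continuous_on_partial[OF f])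
  obtain c where c: "0 \<le> c" "\<And>x. norm (partial e f x) \<le> c"
    using compact_support_bounded[OF pc K(1) partial_compact_support[OF K]] by blast
  obtain r where r: "\<And>x. x \<in> K \<Longrightarrow> norm x \<le> r" using compact_imp_bounded[OF K(1)] by (auto simp: bounded_iff)
  \<comment> \<open>The difference quotients look at most \<open>norm e\<close> ahead because
    \<open>h n \<le> 1\<close>, so all of them vanish outside the ball of this radius.\<close>
  define R where "R = r + norm e"
  have bound: "norm (q n x) \<le> c * indicator (cball 0 R) x" for n x
  proof (cases "x \<in> cball 0 R")
    case True
    \<comment> \<open>The mean value inequality bounds the quotients by the bound c of the
      derivative, which supplies the dominating function.\<close>
    have "norm (f (x + h n *\<^sub>R e) - f (x + 0 *\<^sub>R e)) \<le> c * norm (h n - 0)"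
    proof (rule differentiable_bound[where S="UNIV" and f'="\<lambda>t s. s *\<^sub>R partial e f (x + t *\<^sub>R e)"])
      fix t
      have "((\<lambda>t. f (x + t *\<^sub>R e)) has_derivative (\<lambda>s. partial (0 + s *\<^sub>R e) f (x + t *\<^sub>R e))) (at t)"
        by (rule has_derivative_compose[OF _ C1_has_derivative[OF f]]) (auto intro!: derivative_eq_intros)
      moreover have "partial (0 + s *\<^sub>R e) f (x + t *\<^sub>R e) = s *\<^sub>R partial e f (x + t *\<^sub>R e)" for s
        using linear_cmul[OF has_derivative_linear[OF C1_has_derivative[OF f]]] by simp
      ultimately show "((\<lambda>t. f (x + t *\<^sub>R e)) has_derivative (\<lambda>s. s *\<^sub>R partial e f (x + t *\<^sub>R e))) (at t within UNIV)"
        by simp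
      show "onorm (\<lambda>s. s *\<^sub>R partial e f (x + t *\<^sub>R e)) \<le> c"
        by (intro onorm_bound c(1)) (simp add: mult.commute[of c] mult_left_mono c(2))
    qed auto
    then show ?thesis using True h[of n] by (simp add: q_def divide_le_eq)
  next
    case False
    then have "norm x > r + norm e" by (simp add: R_def)
    moreover have "norm (h n *\<^sub>R e) \<le> norm e" using h[of n] by (simp add: mult_left_le_one_le)
    moreover have "norm x \<le> norm (x + h n *\<^sub>R e) + norm (h n *\<^sub>R e)"
      using norm_triangle_ineq4[of "x + h n *\<^sub>R e" "h n *\<^sub>R e"] by simp
    ultimately have "norm (x + h n *\<^sub>R e) > r" "norm x > r" using norm_ge_zero[of e] by linarith+
    then have "x + h n *\<^sub>R e \<notin> K" "x \<notin> K" using r by force+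
    then show ?thesis using K(2) False by (simp add: q_def)
  qed
  have "(\<lambda>n. \<integral>x. q n x \<partial>lborel) \<longlonglongrightarrow> (\<integral>x. partial e f x \<partial>lborel)"
  proof (rule integral_dominated_convergence)
    show "partial e f \<in> borel_measurable lborel" using pc by (simp add: borel_measurable_continuous_onI)
    have "continuous_on UNIV (q n)" for n
      unfolding q_def by (intro continuous_intros continuous_on_compose2[OF fc]) auto
    then show "q n \<in> borel_measurable lborel" for n by (simp add: borel_measurable_continuous_onI)
    show "integrable lborel (\<lambda>x::'a. c * indicator (cball 0 R) x)"
      using emeasure_bounded_finite[of "cball (0::'a) R"]
      by (intro integrable_mult_right integrable_real_indicator) auto
    show "AE x in lborel. (\<lambda>n. q n x) \<longlonglongrightarrow> partial e f x"
    proof (rule AE_I2)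
      fix x
      have "((\<lambda>t. f (x + t *\<^sub>R e)) has_derivative (\<lambda>s. partial (0 + s *\<^sub>R e) f (x + 0 *\<^sub>R e))) (at 0)"
        by (rule has_derivative_compose[OF _ C1_has_derivative[OF f]]) (auto intro!: derivative_eq_intros)
      moreover have "partial (0 + s *\<^sub>R e) f (x + 0 *\<^sub>R e) = s *\<^sub>R partial e f x" for s
        using linear_cmul[OF has_derivative_linear[OF C1_has_derivative[OF f]]] by simp
      ultimately have "((\<lambda>t. norm (f (x + t *\<^sub>R e) - f x - t *\<^sub>R partial e f x) / norm t) \<longlongrightarrow> 0) (at 0)"
        by (simp add: has_derivative_at)
      moreover have "filterlim h (at 0) sequentially"
        using h0 h(1) by (intro filterlim_atI always_eventually) (auto simp: less_imp_neq[symmetric])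
      ultimately have "(\<lambda>n. norm (f (x + h n *\<^sub>R e) - f x - h n *\<^sub>R partial e f x) / norm (h n)) \<longlonglongrightarrow> 0"
        by (rule filterlim_compose)
      moreover have "norm (f (x + h n *\<^sub>R e) - f x - h n *\<^sub>R partial e f x) / norm (h n) = norm (q n x - partial e f x)" for n
      proof -
        have "q n x - partial e f x = (1 / h n) *\<^sub>R (f (x + h n *\<^sub>R e) - f x - h n *\<^sub>R partial e f x)"
          using h(1)[of n] by (simp add: q_def scaleR_diff_right)
        then show ?thesis using h(1)[of n] by (simp add: divide_inverse_commute)
      qed
      ultimately show "(\<lambda>n. q n x) \<longlonglongrightarrow> partial e f x"
        by (simp add: tendsto_norm_zero_iff LIM_zero_iff)
    qed
    show "AE x in lborel. norm (q n x) \<le> c * indicator (cball 0 R) x" for n using bound by simp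
  qed
  then show ?thesis using q0 LIMSEQ_unique[OF _ tendsto_const] by simp
qed

lemma volume_on_integral:
  fixes f :: "'a::euclidean_space \<Rightarrow> 'b::euclidean_space"
  assumes "open U" "\<And>x. x \<notin> U \<Longrightarrow> f x = 0"
  shows "(\<integral>x. f x \<partial>volume_on U) = (\<integral>x. f x \<partial>lborel)"
proof -
  have "(\<integral>x. f x \<partial>volume_on U) = (\<integral>x. indicator U x *\<^sub>R f x \<partial>lborel)"
    using assms(1) by (intro integral_restrict_space) simp
  also have "(\<lambda>x. indicator U x *\<^sub>R f x) = f" using assms(2) by (auto simp: indicator_def)
  finally show ?thesis .
qed

text \<open>The product of w with a test function has compact support in U. Hence both integrals
  over U are integrals over the whole space, where the derivative of the product has integral
  zero.\<close>

lemma C1_has_weak_partial: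
  assumes U: "open U" and w: "continuously_differentiable w"
  shows "has_weak_partial U e w (partial e w)"
  unfolding has_weak_partial_def
proof (intro allI impI)
  fix \<phi> :: "'a \<Rightarrow> real"
  assume \<phi>: "continuously_differentiable \<phi>"
    and K: "compact (closure {x. \<phi> x \<noteq> 0})" and KU: "closure {x. \<phi> x \<noteq> 0} \<subseteq> U"
  let ?K = "closure {x. \<phi> x \<noteq> 0}"
  have z: "\<phi> x = 0" if "x \<notin> ?K" for x using that closure_subset[of "{x. \<phi> x \<noteq> 0}"] by auto
  have z': "partial e \<phi> x = 0" if "x \<notin> ?K" for x by (rule partial_compact_support[OF K z that])
  have 1: "(\<integral>x. partial e \<phi> x *\<^sub>R w x \<partial>volume_on U) = (\<integral>x. partial e \<phi> x *\<^sub>R w x \<partial>lborel)"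
    by (rule volume_on_integral[OF U]) (metis z' KU scaleR_zero_left subsetD)
  have 2: "(\<integral>x. \<phi> x *\<^sub>R partial e w x \<partial>volume_on U) = (\<integral>x. \<phi> x *\<^sub>R partial e w x \<partial>lborel)"
    by (rule volume_on_integral[OF U]) (metis z KU scaleR_zero_left subsetD)
  have i1: "integrable lborel (\<lambda>x. partial e \<phi> x *\<^sub>R w x)"
    by (rule compact_support_integrable[OF continuous_on_scaleR[OF C1_continuous_on_partial[OF \<phi>] C1_continuous_on[OF w]] K])
       (metis z' scaleR_zero_left)
  have z2: "\<phi> x *\<^sub>R partial e w x = 0" if "x \<notin> ?K" for x using z[OF that] by simp
  have z3: "\<phi> x *\<^sub>R w x = 0" if "x \<notin> ?K" for x using z[OF that] by simp
  have i2: "integrable lborel (\<lambda>x. \<phi> x *\<^sub>R partial e w x)"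
    by (rule compact_support_integrable[OF continuous_on_scaleR[OF C1_continuous_on[OF \<phi>] C1_continuous_on_partial[OF w]] K z2])
  have "(\<integral>x. partial e (\<lambda>x. \<phi> x *\<^sub>R w x) x \<partial>lborel) = 0"
    by (rule integral_partial_eq_0[OF C1_scaleR_fun(1)[OF \<phi> w] K z3])
  then show "(\<integral>x. partial e \<phi> x *\<^sub>R w x \<partial>volume_on U) = - (\<integral>x. \<phi> x *\<^sub>R partial e w x \<partial>volume_on U)"
    unfolding 1 2 C1_scaleR_fun(2)[OF \<phi> w] using i1 i2 by (simp add: add_eq_0_iff2)
qed

section \<open>Cut-off functions and the fundamental lemma of the calculus of variations\<close>

lemma has_real_derivative_pos_part_square:
  "((\<lambda>s::real. (max 0 s)\<^sup>2) has_real_derivative 2 * max 0 s) (at s)"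
proof (cases s "0::real" rule: linorder_cases)
  case less
  have "((\<lambda>s::real. 0) has_real_derivative 0) (at s)" by simp
  then have "((\<lambda>s::real. (max 0 s)\<^sup>2) has_real_derivative 0) (at s)"
    by (rule has_field_derivative_transform_within_open[where S="{..<0}"]) (use less in auto)
  then show ?thesis using less by simp
next
  case equal
  have "((\<lambda>h::real. (max 0 h)\<^sup>2 / h) \<longlongrightarrow> 0) (at 0)"
  proof (rule Lim_null_comparison)
    show "\<forall>\<^sub>F h::real in at 0. norm ((max 0 h)\<^sup>2 / h) \<le> \<bar>h\<bar>"
      by (intro always_eventually allI) (auto simp: max_def power2_eq_square)
    show "((\<lambda>h::real. \<bar>h\<bar>) \<longlongrightarrow> 0) (at 0)" by (simp add: tendsto_rabs_zero)
  qed
  then show ?thesis using equal by (simp add: DERIV_def)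
next
  case greater
  have "((\<lambda>s::real. s\<^sup>2) has_real_derivative 2 * s) (at s)" by (auto intro!: derivative_eq_intros)
  then have "((\<lambda>s::real. (max 0 s)\<^sup>2) has_real_derivative 2 * s) (at s)"
    by (rule has_field_derivative_transform_within_open[where S="{0<..}"]) (use greater in auto)
  then show ?thesis using greater by simp
qed

text \<open>The bump is the squared positive part of a quadratic polynomial. Test functions are only
  asked to be C^1, so this simple cut-off can be used.\<close>

lemma C1_bump:
  fixes c :: "'a::euclidean_space"
  obtains \<psi> :: "'a \<Rightarrow> real" where "continuously_differentiable \<psi>" "\<And>x. 0 \<le> \<psi> x"
    "\<And>x. \<psi> x \<noteq> 0 \<longleftrightarrow> x \<in> ball c r"
proof (cases "0 < r")
  case True
  let ?q = "\<lambda>x. r\<^sup>2 - (x - c) \<bullet> (x - c)"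
  have q: "continuously_differentiable ?q"
  proof (rule C1_I)
    show "(?q has_derivative (\<lambda>h. - (2 * ((x - c) \<bullet> h)))) (at x)" for x
      by (auto intro!: derivative_eq_intros simp: inner_commute)
    show "continuous_on UNIV (\<lambda>x. - (2 * ((x - c) \<bullet> e)))" for e
      by (intro continuous_intros)
  qed
  show ?thesis
  proof (rule that)
    show "continuously_differentiable (\<lambda>x. (max 0 (?q x))\<^sup>2)"
      by (rule C1_real_compose[OF q has_real_derivative_pos_part_square]) (intro continuous_intros)
    show "((max 0 (?q x))\<^sup>2 \<noteq> 0) \<longleftrightarrow> x \<in> ball c r" for x
    proof -
      have "x \<in> ball c r \<longleftrightarrow> norm (x - c) < r"
        by (simp add: dist_norm norm_minus_commute)
      also have "\<dots> \<longleftrightarrow> (norm (x - c))\<^sup>2 < r\<^sup>2"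
        using True power2_less_imp_less[of "norm (x - c)" r] power_strict_mono[of "norm (x - c)" r 2] by auto
      finally have "x \<in> ball c r \<longleftrightarrow> (norm (x - c))\<^sup>2 < r\<^sup>2" .
      then show ?thesis by (auto simp: power2_norm_eq_inner)
    qed
  qed simp
next
  case False
  then have e: "ball c r = {}" by simp
  show ?thesis by (rule that[of "\<lambda>x. 0"]) (simp_all only: C1_const e, simp_all)
qed

text \<open>For positive k the map that sends t to \<open>k * t / (1 + k * t)\<close> turns a
  nonnegative function into a cut-off with the same zeros and values below 1; as k grows, the values
  at all other points tend to 1.\<close>

lemma C1_saturate:
  fixes f :: "'a::euclidean_space \<Rightarrow> real"
  assumes f: "continuously_differentiable f" "\<And>x. 0 \<le> f x" and k: "0 \<le> k"
  shows "continuously_differentiable (\<lambda>x. k * f x / (1 + k * f x))"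
proof (rule C1_real_compose[OF f(1), where g="\<lambda>t. k * t / (1 + k * t)" and g'="\<lambda>t. k / (1 + k * t)\<^sup>2"])
  have p: "1 + k * f x > 0" for x using mult_nonneg_nonneg[OF k f(2)[of x]] by linarith
  show "((\<lambda>t. k * t / (1 + k * t)) has_real_derivative k / (1 + k * f x)\<^sup>2) (at (f x))" for x
    using p[of x] by (auto intro!: derivative_eq_intros simp: power2_eq_square) (simp add: field_simps)
  show "continuous_on UNIV (\<lambda>x. k / (1 + k * f x)\<^sup>2)"
    using p by (intro continuous_intros C1_continuous_on f) (simp add: less_imp_neq[symmetric])
qed

text \<open>By Lindelof, A is the union of countably many balls whose closed versions lie in A.
  Finite sums of their bumps have compact support in A, and saturating the k-th sum with the factor
  k produces the indicator in the limit.\<close>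

lemma open_approx_C1:
  fixes A :: "'a::euclidean_space set"
  assumes "open A"
  obtains \<phi> :: "nat \<Rightarrow> 'a \<Rightarrow> real" where
    "\<And>k. continuously_differentiable (\<phi> k)" "\<And>k. compact (closure {x. \<phi> k x \<noteq> 0})"
    "\<And>k. closure {x. \<phi> k x \<noteq> 0} \<subseteq> A" "\<And>k x. 0 \<le> \<phi> k x \<and> \<phi> k x \<le> 1"
    "\<And>x. (\<lambda>k. \<phi> k x) \<longlonglongrightarrow> indicator A x"
proof (cases "A = {}")
  case True
  show ?thesis
    by (rule that[of "\<lambda>k x. 0"]) (auto simp: True C1_const)
next
  case False
  define F where "F = {ball x r | x r. cball x r \<subseteq> A}"
  have "\<Union>F = A"
  proof
    show "\<Union>F \<subseteq> A" using ball_subset_cball by (fastforce simp: F_def)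
    show "A \<subseteq> \<Union>F"
    proof
      fix x assume "x \<in> A"
      then obtain r where "r > 0" "cball x r \<subseteq> A" using assms open_contains_cball by blast
      then show "x \<in> \<Union>F" by (auto simp: F_def intro!: exI[of _ "ball x r"])
    qed
  qed
  moreover obtain F' where F': "F' \<subseteq> F" "countable F'" "\<Union>F' = \<Union>F"
    using Lindelof[of F] by (auto simp: F_def)
  ultimately have "F' \<noteq> {}" and UF: "\<Union>F' = A" using False by auto
  define b where "b = from_nat_into F'"
  have b: "range b = F'" unfolding b_def using range_from_nat_into[OF \<open>F' \<noteq> {}\<close> F'(2)] .
  have "\<exists>\<psi>. \<exists>x r. continuously_differentiable \<psi> \<and> (\<forall>y. 0 \<le> \<psi> y) \<and> (\<forall>y. (\<psi> y \<noteq> (0::real)) = (y \<in> b i)) \<and>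
      b i = ball x r \<and> cball x r \<subseteq> A" for i
  proof -
    have "b i \<in> F" using b F'(1) by auto
    then obtain x r where xr: "b i = ball x r" "cball x r \<subseteq> A" by (auto simp: F_def)
    obtain \<psi> :: "'a \<Rightarrow> real" where "continuously_differentiable \<psi>" "\<And>x. 0 \<le> \<psi> x" "\<And>y. \<psi> y \<noteq> 0 \<longleftrightarrow> y \<in> ball x r"
      by (rule C1_bump[of x r]) blast
    then show ?thesis using xr by blast
  qed
  then obtain \<psi> :: "nat \<Rightarrow> 'a \<Rightarrow> real" and c r where \<psi>: "\<And>i. continuously_differentiable (\<psi> i)" "\<And>i y. 0 \<le> \<psi> i y"
      "\<And>i y. \<psi> i y \<noteq> 0 \<longleftrightarrow> y \<in> b i" and c: "\<And>i. b i = ball (c i) (r i)" "\<And>i. cball (c i) (r i) \<subseteq> A"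
    by metis
  define S where "S k x = (\<Sum>i<k. \<psi> i x)" for k x
  define \<phi> where "\<phi> k x = real k * S k x / (1 + real k * S k x)" for k x
  have S0: "0 \<le> S k x" for k x unfolding S_def by (intro sum_nonneg \<psi>)
  have SC: "continuously_differentiable (S k)" for k
    unfolding S_def using C1_sum[of "{..<k}" \<psi>] \<psi>(1) by simp
  have p: "1 + real k * S k x > 0" for k x using mult_nonneg_nonneg[OF _ S0, of "real k" k x] by simp
  have Sn: "S k x \<noteq> 0 \<Longrightarrow> x \<in> (\<Union>i<k. cball (c i) (r i))" for k x
  proof -
    assume "S k x \<noteq> 0"
    then obtain i where "i < k" "\<psi> i x \<noteq> 0" unfolding S_def by (metis lessThan_iff sum.neutral)
    then show ?thesis using \<psi>(3) c(1) ball_subset_cball by (metis UN_iff lessThan_iff subsetD)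
  qed
  have cl: "closure {x. \<phi> k x \<noteq> 0} \<subseteq> (\<Union>i<k. cball (c i) (r i))" for k
  proof (rule closure_minimal)
    show "{x. \<phi> k x \<noteq> 0} \<subseteq> (\<Union>i<k. cball (c i) (r i))"
      using Sn by (auto simp: \<phi>_def)
    show "closed (\<Union>i<k. cball (c i) (r i))" by (intro closed_UN) auto
  qed
  show ?thesis
  proof (rule that)
    show "continuously_differentiable (\<phi> k)" for k
      unfolding \<phi>_def by (rule C1_saturate[OF SC S0]) simp
    show "compact (closure {x. \<phi> k x \<noteq> 0})" for k
      unfolding compact_eq_bounded_closed
      using bounded_subset[OF _ cl] by (auto intro: bounded_subset[OF _ cl])
    show "closure {x. \<phi> k x \<noteq> 0} \<subseteq> A" for k using cl[of k] c(2) by blast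
    show "0 \<le> \<phi> k x \<and> \<phi> k x \<le> 1" for k x
      using p[of k x] S0[of k x] by (auto simp: \<phi>_def divide_le_eq)
    show "(\<lambda>k. \<phi> k x) \<longlonglongrightarrow> indicator A x" for x
    proof (cases "x \<in> A")
      case False
      then have "S k x = 0" for k using Sn[of k x] c(2) by blast
      then show ?thesis using False by (simp add: \<phi>_def)
    next
      case True
      then obtain N where N: "x \<in> b N" using UF b by blast
      define d where "d = \<psi> N x"
      have d: "d > 0" using \<psi>(2)[of N x] \<psi>(3)[of N x] N by (simp add: d_def)
      \<comment> \<open>Once the bump with index N is included, the sums stay above its value d, so
        \<open>real k * S k x\<close> tends to infinity.\<close>
      have Sd: "S k x \<ge> d" if "k > N" for k
        unfolding S_def d_def using that \<psi>(2) by (intro member_le_sum) auto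
      have "(\<lambda>k. 1 - 1 / (1 + real k * S k x)) \<longlonglongrightarrow> 1 - 0"
      proof (intro tendsto_diff tendsto_const)
        have "filterlim (\<lambda>k. 1 + real k * d) at_top sequentially"
          using d by (intro filterlim_tendsto_add_at_top[OF tendsto_const] filterlim_at_top_mult_tendsto_pos[OF tendsto_const])
             (auto simp: filterlim_real_sequentially)
        then have "filterlim (\<lambda>k. 1 + real k * S k x) at_top sequentially"
        proof (rule filterlim_at_top_mono)
          have "\<forall>\<^sub>F k in sequentially. k > N" by (rule eventually_gt_at_top)
          then show "\<forall>\<^sub>F k in sequentially. 1 + real k * d \<le> 1 + real k * S k x"
            by eventually_elim (simp add: Sd mult_left_mono)
        qed
        then show "(\<lambda>k. 1 / (1 + real k * S k x)) \<longlonglongrightarrow> 0"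
          by (intro real_tendsto_divide_at_top[OF tendsto_const])
      qed
      moreover have "\<phi> k x = 1 - 1 / (1 + real k * S k x)" for k
        using p[of k x] by (simp add: \<phi>_def field_simps)
      ultimately show ?thesis using True by simp
    qed
  qed
qed

text \<open>The open sets form an intersection-stable generator, so it suffices that \<open>v\<close> has integral zero
  over every open subset.\<close>

lemma weak_zero_AE:
  fixes v :: "'a::euclidean_space \<Rightarrow> 'b::euclidean_space"
  assumes U: "open U" and v: "integrable (volume_on U) v"
    and z: "\<And>\<phi> :: 'a \<Rightarrow> real. continuously_differentiable \<phi> \<Longrightarrow> compact (closure {x. \<phi> x \<noteq> 0}) \<Longrightarrow>
        closure {x. \<phi> x \<noteq> 0} \<subseteq> U \<Longrightarrow> (\<integral>x. \<phi> x *\<^sub>R v x \<partial>volume_on U) = 0"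
  shows "AE x in volume_on U. v x = 0"
proof -
  let ?M = "volume_on U"
  have vm [measurable]: "v \<in> borel_measurable ?M" using v by (rule borel_measurable_integrable)
  have sp: "space ?M = U" by (simp add: space_restrict_space)
  \<comment> \<open>The cut-offs converge boundedly to the indicator, so vanishing against test
    functions becomes vanishing over open sets.\<close>
  have op: "set_lebesgue_integral ?M (A \<inter> U) v = 0" if "open A" for A
  proof -
    have "open (A \<inter> U)" using that U by auto
    from open_approx_C1[OF this] obtain \<phi> :: "nat \<Rightarrow> 'a \<Rightarrow> real" where
      \<phi>: "\<And>k. continuously_differentiable (\<phi> k)" "\<And>k. compact (closure {x. \<phi> k x \<noteq> 0})"
      "\<And>k. closure {x. \<phi> k x \<noteq> 0} \<subseteq> A \<inter> U" "\<And>k x. 0 \<le> \<phi> k x \<and> \<phi> k x \<le> 1"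
      "\<And>x. (\<lambda>k. \<phi> k x) \<longlonglongrightarrow> indicator (A \<inter> U) x" by blast
    have [measurable]: "\<phi> k \<in> borel_measurable ?M" for k
      by (rule measurable_restrict_space1) (simp add: borel_measurable_continuous_onI C1_continuous_on[OF \<phi>(1)])
    have [measurable]: "A \<inter> U \<in> sets ?M"
      using \<open>open (A \<inter> U)\<close> U by (simp add: sets_restrict_space_iff)
    have "(\<lambda>k. \<integral>x. \<phi> k x *\<^sub>R v x \<partial>?M) \<longlonglongrightarrow> (\<integral>x. indicator (A \<inter> U) x *\<^sub>R v x \<partial>?M)"
    proof (rule integral_dominated_convergence[where w="\<lambda>x. norm (v x)"])
      show "AE x in ?M. (\<lambda>k. \<phi> k x *\<^sub>R v x) \<longlonglongrightarrow> indicator (A \<inter> U) x *\<^sub>R v x"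
        using \<phi>(5) by (intro AE_I2 tendsto_scaleR tendsto_const)
      show "AE x in ?M. norm (\<phi> k x *\<^sub>R v x) \<le> norm (v x)" for k
        using \<phi>(4) by (intro AE_I2) (simp add: mult_left_le_one_le)
    qed (use v in auto)
    moreover have "(\<integral>x. \<phi> k x *\<^sub>R v x \<partial>?M) = 0" for k
      using z[OF \<phi>(1,2), of k] \<phi>(3) by blast
    ultimately show ?thesis
      unfolding set_lebesgue_integral_def using LIMSEQ_unique[OF _ tendsto_const] by simp
  qed
  have "(\<integral>x. v x \<partial>?M) = set_lebesgue_integral ?M (UNIV \<inter> U) v"
    unfolding set_lebesgue_integral_def by (rule Bochner_Integration.integral_cong) (auto simp: sp)
  then have tot: "(\<integral>x. v x \<partial>?M) = 0" using op[of UNIV] by simp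
  have si: "set_integrable ?M B v" if "B \<in> sets ?M" for B
    unfolding set_integrable_def using that v by (rule integrable_mult_indicator)
  have hel: "A \<inter> U \<in> sets ?M" if "A \<in> sigma_sets UNIV {S. open S}" for A
  proof -
    have "A \<in> sets borel" using that by (simp add: borel_def)
    then show ?thesis using U by (simp add: sets_restrict_space_iff)
  qed
  have all: "set_lebesgue_integral ?M (A \<inter> U) v = 0" if "A \<in> sets borel" for A
  proof -
    \<comment> \<open>The sets with vanishing integral are stable under complements, because the
      total integral is zero, and under countable disjoint unions.\<close>
    have "Int_stable {S :: 'a set. open S}" by (auto simp: Int_stable_def)
    moreover have "{S :: 'a set. open S} \<subseteq> Pow UNIV" by simp
    moreover have "A \<in> sigma_sets UNIV {S. open S}" using that by (simp add: borel_def)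
    ultimately show ?thesis
    proof (induction rule: sigma_sets_induct_disjoint)
      case (compl A)
      then have A: "A \<inter> U \<in> sets ?M" by (intro hel)
      have "set_lebesgue_integral ?M ((UNIV - A) \<inter> U) v = (\<integral>x. v x - indicator (A \<inter> U) x *\<^sub>R v x \<partial>?M)"
        unfolding set_lebesgue_integral_def
        by (rule Bochner_Integration.integral_cong) (auto simp: indicator_def sp)
      also have "\<dots> = 0"
        using compl(2) v si[OF A] tot by (simp add: set_lebesgue_integral_def set_integrable_def)
      finally show ?case .
    next
      case (union A)
      have A: "A i \<inter> U \<in> sets ?M" for i
        using union(2) by (intro hel) blast
      have e: "(\<Union>i. A i) \<inter> U = (\<Union>i. A i \<inter> U)" by blast
      have "set_lebesgue_integral ?M (\<Union>i. A i \<inter> U) v = (\<Sum>i. set_lebesgue_integral ?M (A i \<inter> U) v)"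
      proof (rule lebesgue_integral_countable_add[OF A])
        show "(A i \<inter> U) \<inter> (A j \<inter> U) = {}" if "i \<noteq> j" for i j
          using disjoint_family_onD[OF union(1) _ _ that] by blast
        show "set_integrable ?M (\<Union>i. A i \<inter> U) v"
          by (rule si, rule sets.countable_UN) (use A in blast)
      qed
      then show ?case by (simp only: e union(3) suminf_zero)
    next
      case (basic A)
      then show ?case by (simp add: op)
    next
      case empty
      show ?case by (simp add: set_lebesgue_integral_def)
    qed
  qed
  have "set_lebesgue_integral ?M B v = set_lebesgue_integral ?M B (\<lambda>x. 0)" if "B \<in> sets ?M" for B
  proof -
    have "B \<in> sets borel" "B \<subseteq> U" using that U by (auto simp: sets_restrict_space_iff sets_restrict_space)
    then show ?thesis using all[of B] by (simp add: Int_absorb2 set_lebesgue_integral_def)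
  qed
  moreover have "sigma_finite_measure ?M"
    using U by (intro sigma_finite_measure_restrict_space sigma_finite_lborel) simp
  \<comment> \<open>An integrable function is determined almost everywhere by its integrals over
    measurable sets.\<close>
  ultimately have "AE x in ?M. v x = 0"
    using sigma_finite_measure.density_unique_banach[OF _ v, of "\<lambda>x. 0"] by simp
  then show ?thesis by simp
qed

section \<open>Calculus of weak derivatives\<close>

lemma test_integrable:
  fixes u :: "'a::euclidean_space \<Rightarrow> 'b::euclidean_space" and g :: "'a \<Rightarrow> real"
  assumes u: "integrable (volume_on U) u" and g: "continuous_on UNIV g" "compact K" "\<And>x. x \<notin> K \<Longrightarrow> g x = 0"
  shows "integrable (volume_on U) (\<lambda>x. g x *\<^sub>R u x)"
proof -
  obtain c where c: "0 \<le> c" "\<And>x. norm (g x) \<le> c" using compact_support_bounded[OF g] by blast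
  have [measurable]: "g \<in> borel_measurable (volume_on U)"
    by (rule measurable_restrict_space1) (simp add: borel_measurable_continuous_onI g(1))
  have [measurable]: "u \<in> borel_measurable (volume_on U)" using u by (rule borel_measurable_integrable)
  show ?thesis
  proof (rule Bochner_Integration.integrable_bound)
    show "integrable (volume_on U) (\<lambda>x. c * norm (u x))" using u by simp
    show "AE x in volume_on U. norm (g x *\<^sub>R u x) \<le> norm (c * norm (u x))"
      using c by (intro AE_I2) (simp add: abs_mult mult_right_mono)
  qed simp
qed

lemma closure_support: "x \<notin> closure {x. \<phi> x \<noteq> 0} \<Longrightarrow> \<phi> x = 0"
  using closure_subset[of "{x. \<phi> x \<noteq> 0}"] by auto

lemma has_weak_partial_diff:
  fixes u u' :: "'a::euclidean_space \<Rightarrow> 'b::euclidean_space"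
  assumes "has_weak_partial U e u v" "has_weak_partial U e u' v'"
    and i: "integrable (volume_on U) u" "integrable (volume_on U) u'"
      "integrable (volume_on U) v" "integrable (volume_on U) v'"
  shows "has_weak_partial U e (\<lambda>x. u x - u' x) (\<lambda>x. v x - v' x)"
  unfolding has_weak_partial_def
proof (intro allI impI)
  fix \<phi> :: "'a \<Rightarrow> real"
  assume \<phi>: "continuously_differentiable \<phi>" "compact (closure {x. \<phi> x \<noteq> 0})" "closure {x. \<phi> x \<noteq> 0} \<subseteq> U"
  have p: "partial e \<phi> x = 0" if "x \<notin> closure {x. \<phi> x \<noteq> 0}" for x
    by (rule partial_compact_support[OF \<phi>(2) closure_support that])
  have a: "integrable (volume_on U) (\<lambda>x. partial e \<phi> x *\<^sub>R h x)" if "integrable (volume_on U) h" for h :: "'a \<Rightarrow> 'b"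
    by (rule test_integrable[OF that C1_continuous_on_partial[OF \<phi>(1)] \<phi>(2) p])
  have b: "integrable (volume_on U) (\<lambda>x. \<phi> x *\<^sub>R h x)" if "integrable (volume_on U) h" for h :: "'a \<Rightarrow> 'b"
    by (rule test_integrable[OF that C1_continuous_on[OF \<phi>(1)] \<phi>(2) closure_support[where \<phi>=\<phi>]])
  have e: "(\<integral>x. partial e \<phi> x *\<^sub>R u x \<partial>volume_on U) = - (\<integral>x. \<phi> x *\<^sub>R v x \<partial>volume_on U)"
    "(\<integral>x. partial e \<phi> x *\<^sub>R u' x \<partial>volume_on U) = - (\<integral>x. \<phi> x *\<^sub>R v' x \<partial>volume_on U)"
    using assms(1,2) \<phi> unfolding has_weak_partial_def by blast+
  show "(\<integral>x. partial e \<phi> x *\<^sub>R (u x - u' x) \<partial>volume_on U) = - (\<integral>x. \<phi> x *\<^sub>R (v x - v' x) \<partial>volume_on U)"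
    unfolding scaleR_diff_right Bochner_Integration.integral_diff[OF a[OF i(1)] a[OF i(2)]]
      Bochner_Integration.integral_diff[OF b[OF i(3)] b[OF i(4)]] e by simp
qed

text \<open>Bounded linear maps commute with the Bochner integral.\<close>

lemma has_weak_partial_linear:
  fixes u :: "'a::euclidean_space \<Rightarrow> 'b::euclidean_space" and T :: "'b \<Rightarrow> 'c::euclidean_space"
  assumes h: "has_weak_partial U e u v" and T: "bounded_linear T"
    and i: "integrable (volume_on U) u" "integrable (volume_on U) v"
  shows "has_weak_partial U e (\<lambda>x. T (u x)) (\<lambda>x. T (v x))"
  unfolding has_weak_partial_def
proof (intro allI impI)
  fix \<phi> :: "'a \<Rightarrow> real"
  assume \<phi>: "continuously_differentiable \<phi>" "compact (closure {x. \<phi> x \<noteq> 0})" "closure {x. \<phi> x \<noteq> 0} \<subseteq> U"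
  have p: "partial e \<phi> x = 0" if "x \<notin> closure {x. \<phi> x \<noteq> 0}" for x
    by (rule partial_compact_support[OF \<phi>(2) closure_support that])
  have a: "integrable (volume_on U) (\<lambda>x. partial e \<phi> x *\<^sub>R h x)" if "integrable (volume_on U) h" for h :: "'a \<Rightarrow> 'b"
    by (rule test_integrable[OF that C1_continuous_on_partial[OF \<phi>(1)] \<phi>(2) p])
  have b: "integrable (volume_on U) (\<lambda>x. \<phi> x *\<^sub>R h x)" if "integrable (volume_on U) h" for h :: "'a \<Rightarrow> 'b"
    by (rule test_integrable[OF that C1_continuous_on[OF \<phi>(1)] \<phi>(2) closure_support[where \<phi>=\<phi>]])
  have e: "(\<integral>x. partial e \<phi> x *\<^sub>R u x \<partial>volume_on U) = - (\<integral>x. \<phi> x *\<^sub>R v x \<partial>volume_on U)"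
    using h \<phi> unfolding has_weak_partial_def by blast
  have s: "r *\<^sub>R T y = T (r *\<^sub>R y)" for r y using T by (simp add: linear_simps)
  have m: "T (- y) = - T y" for y using T by (simp add: linear_simps)
  show "(\<integral>x. partial e \<phi> x *\<^sub>R T (u x) \<partial>volume_on U) = - (\<integral>x. \<phi> x *\<^sub>R T (v x) \<partial>volume_on U)"
    unfolding s integral_bounded_linear[OF T a[OF i(1)]] integral_bounded_linear[OF T b[OF i(2)]] e m ..
qed

text \<open>The difference of the two candidates is annihilated by all test functions.\<close>

lemma has_weak_partial_unique:
  fixes u :: "'a::euclidean_space \<Rightarrow> 'b::euclidean_space"
  assumes U: "open U" and h: "has_weak_partial U e u v" "has_weak_partial U e u v'"
    and i: "integrable (volume_on U) v" "integrable (volume_on U) v'"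
  shows "AE x in volume_on U. v x = v' x"
proof -
  have "AE x in volume_on U. v x - v' x = 0"
  proof (rule weak_zero_AE[OF U])
    fix \<phi> :: "'a \<Rightarrow> real"
    assume \<phi>: "continuously_differentiable \<phi>" "compact (closure {x. \<phi> x \<noteq> 0})" "closure {x. \<phi> x \<noteq> 0} \<subseteq> U"
    have b: "integrable (volume_on U) (\<lambda>x. \<phi> x *\<^sub>R h x)" if "integrable (volume_on U) h" for h :: "'a \<Rightarrow> 'b"
    by (rule test_integrable[OF that C1_continuous_on[OF \<phi>(1)] \<phi>(2) closure_support[where \<phi>=\<phi>]])
    have "(\<integral>x. partial e \<phi> x *\<^sub>R u x \<partial>volume_on U) = - (\<integral>x. \<phi> x *\<^sub>R v x \<partial>volume_on U)"
      "(\<integral>x. partial e \<phi> x *\<^sub>R u x \<partial>volume_on U) = - (\<integral>x. \<phi> x *\<^sub>R v' x \<partial>volume_on U)"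
      using h \<phi> unfolding has_weak_partial_def by blast+
    then show "(\<integral>x. \<phi> x *\<^sub>R (v x - v' x) \<partial>volume_on U) = 0"
      unfolding scaleR_diff_right Bochner_Integration.integral_diff[OF b[OF i(1)] b[OF i(2)]] by simp
  qed (use i in simp)
  then show ?thesis by simp
qed

text \<open>A test function and its derivative are bounded, so both sides of the defining identity
  are continuous in L^1, hence in L^2 because the measure is finite.\<close>

lemma has_weak_partial_limit:
  fixes u :: "'a::euclidean_space \<Rightarrow> 'b::euclidean_space"
  assumes fin: "finite_measure (volume_on U)"
    and h: "\<And>k. has_weak_partial U e (f k) (g k)"
    and f: "\<And>k. f k \<in> L2_space (volume_on U)" "u \<in> L2_space (volume_on U)"
      "(\<lambda>k. L2_norm (volume_on U) (\<lambda>x. f k x - u x)) \<longlonglongrightarrow> 0"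
    and g: "\<And>k. g k \<in> L2_space (volume_on U)" "v \<in> L2_space (volume_on U)"
      "(\<lambda>k. L2_norm (volume_on U) (\<lambda>x. g k x - v x)) \<longlonglongrightarrow> 0"
  shows "has_weak_partial U e u v"
  unfolding has_weak_partial_def
proof (intro allI impI)
  fix \<phi> :: "'a \<Rightarrow> real"
  assume \<phi>: "continuously_differentiable \<phi>" "compact (closure {x. \<phi> x \<noteq> 0})" "closure {x. \<phi> x \<noteq> 0} \<subseteq> U"
  interpret finite_measure "volume_on U" by (rule fin)
  have p: "partial e \<phi> x = 0" if "x \<notin> closure {x. \<phi> x \<noteq> 0}" for x
    by (rule partial_compact_support[OF \<phi>(2) closure_support that])
  \<comment> \<open>Stated for a general multiplier q, since it is applied both to the test function
    and to its derivative.\<close>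
  have lim: "(\<lambda>k. \<integral>x. q x *\<^sub>R f k x \<partial>volume_on U) \<longlonglongrightarrow> (\<integral>x. q x *\<^sub>R u x \<partial>volume_on U)"
    if q: "continuous_on UNIV q" "\<And>x. x \<notin> closure {x. \<phi> x \<noteq> 0} \<Longrightarrow> q x = 0"
      and f: "\<And>k. f k \<in> L2_space (volume_on U)" "u \<in> L2_space (volume_on U)"
      "(\<lambda>k. L2_norm (volume_on U) (\<lambda>x. f k x - u x)) \<longlonglongrightarrow> 0"
    for q :: "'a \<Rightarrow> real" and f and u :: "'a \<Rightarrow> 'b"
  proof -
    obtain c where c: "0 \<le> c" "\<And>x. norm (q x) \<le> c" using compact_support_bounded[OF q(1) \<phi>(2) q(2)] by blast
    have a: "integrable (volume_on U) (\<lambda>x. q x *\<^sub>R h x)" if "integrable (volume_on U) h" for h :: "'a \<Rightarrow> 'b"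
      by (rule test_integrable[OF that q(1) \<phi>(2) q(2)])
    have d: "norm ((\<integral>x. q x *\<^sub>R f k x \<partial>volume_on U) - (\<integral>x. q x *\<^sub>R u x \<partial>volume_on U))
        \<le> c * (L2_norm (volume_on U) (\<lambda>x. f k x - u x) * sqrt (measure (volume_on U) (space (volume_on U))))" for k
    proof -
      have i: "integrable (volume_on U) (\<lambda>x. f k x - u x)" by (intro integrable_L2 L2_space_diff f)
      have "(\<integral>x. q x *\<^sub>R f k x \<partial>volume_on U) - (\<integral>x. q x *\<^sub>R u x \<partial>volume_on U)
         = (\<integral>x. q x *\<^sub>R (f k x - u x) \<partial>volume_on U)"
        unfolding scaleR_diff_right
        by (rule Bochner_Integration.integral_diff[OF a[OF integrable_L2[OF f(1)]] a[OF integrable_L2[OF f(2)]], symmetric])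
      also have "norm \<dots> \<le> (\<integral>x. norm (q x *\<^sub>R (f k x - u x)) \<partial>volume_on U)" by (rule integral_norm_bound)
      also have "\<dots> \<le> (\<integral>x. c * norm (f k x - u x) \<partial>volume_on U)"
      proof (rule integral_mono)
        show "integrable (volume_on U) (\<lambda>x. norm (q x *\<^sub>R (f k x - u x)))" by (intro integrable_norm a i)
        show "integrable (volume_on U) (\<lambda>x. c * norm (f k x - u x))" using i by simp
        show "norm (q x *\<^sub>R (f k x - u x)) \<le> c * norm (f k x - u x)" for x
          using c(2)[of x] by (simp add: mult_right_mono)
      qed
      also have "\<dots> = c * (\<integral>x. norm (f k x - u x) \<partial>volume_on U)" by simp
      also have "\<dots> \<le> c * (L2_norm (volume_on U) (\<lambda>x. f k x - u x) * sqrt (measure (volume_on U) (space (volume_on U))))"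
        by (intro mult_left_mono integral_norm_le_L2 L2_space_diff f c(1))
      finally show ?thesis .
    qed
    have "(\<lambda>k. c * (L2_norm (volume_on U) (\<lambda>x. f k x - u x) * sqrt (measure (volume_on U) (space (volume_on U))))) \<longlonglongrightarrow> c * (0 * sqrt (measure (volume_on U) (space (volume_on U))))"
      by (intro tendsto_intros f)
    then have l0: "(\<lambda>k. c * (L2_norm (volume_on U) (\<lambda>x. f k x - u x) * sqrt (measure (volume_on U) (space (volume_on U))))) \<longlonglongrightarrow> 0"
      by (simp only: mult_zero_left mult_zero_right)
    show ?thesis
      by (rule LIM_zero_cancel, rule Lim_null_comparison[OF always_eventually l0], rule allI, rule d)
  qed
  have 1: "(\<lambda>k. \<integral>x. partial e \<phi> x *\<^sub>R f k x \<partial>volume_on U) \<longlonglongrightarrow> (\<integral>x. partial e \<phi> x *\<^sub>R u x \<partial>volume_on U)"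
    by (rule lim[OF C1_continuous_on_partial[OF \<phi>(1)] p f])
  have 2: "(\<lambda>k. \<integral>x. \<phi> x *\<^sub>R g k x \<partial>volume_on U) \<longlonglongrightarrow> (\<integral>x. \<phi> x *\<^sub>R v x \<partial>volume_on U)"
    by (rule lim[OF C1_continuous_on[OF \<phi>(1)] closure_support[where \<phi>=\<phi>] g])
  have e: "(\<integral>x. partial e \<phi> x *\<^sub>R f k x \<partial>volume_on U) = - (\<integral>x. \<phi> x *\<^sub>R g k x \<partial>volume_on U)" for k
    using h \<phi> unfolding has_weak_partial_def by blast
  show "(\<integral>x. partial e \<phi> x *\<^sub>R u x \<partial>volume_on U) = - (\<integral>x. \<phi> x *\<^sub>R v x \<partial>volume_on U)"
    using LIMSEQ_unique[OF 1] tendsto_minus[OF 2] unfolding e by blast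
qed

text \<open>What the volume and the two surface measures have in common; it makes every continuous
  function on the whole space square integrable. Measurability of the identity is asked for because
  the measurable sets of these measures need not be the Borel sets of the space, and K carries the
  measure only almost everywhere because the lateral measure is built from an image measure on the
  full plane.\<close>

definition bounded_finite_measure :: "'a::euclidean_space measure \<Rightarrow> bool" where
  "bounded_finite_measure M \<longleftrightarrow> finite_measure M \<and> (\<lambda>x. x) \<in> measurable M borel \<and>
     (\<exists>K. compact K \<and> (AE x in M. x \<in> K))"

lemma continuous_measurable:
  assumes "bounded_finite_measure M" "continuous_on UNIV f"
  shows "f \<in> borel_measurable M"
  using assms measurable_compose[of "\<lambda>x. x" M borel f borel]
  by (auto simp: bounded_finite_measure_def borel_measurable_continuous_onI)

lemma continuous_integrable:
  fixes f :: "'a::euclidean_space \<Rightarrow> 'b::euclidean_space"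
  assumes M: "bounded_finite_measure M" and f: "continuous_on UNIV f"
  shows "integrable M f"
proof -
  obtain K where K: "compact K" "AE x in M. x \<in> K" and fin: "finite_measure M"
    using M by (auto simp: bounded_finite_measure_def)
  have "compact (f ` K)" using f K(1) by (meson compact_continuous_image continuous_on_subset subset_UNIV)
  then obtain b where b: "\<And>x. x \<in> K \<Longrightarrow> norm (f x) \<le> b"
    by (meson bounded_iff compact_imp_bounded image_eqI)
  have "AE x in M. norm (f x) \<le> b" using K(2) by eventually_elim (rule b)
  then show ?thesis
    using finite_measure.integrable_const_bound[OF fin _ continuous_measurable[OF M f]] by blast
qed

lemma continuous_L2:
  fixes f :: "'a::euclidean_space \<Rightarrow> 'b::euclidean_space"
  assumes M: "bounded_finite_measure M" and f: "continuous_on UNIV f"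
  shows "f \<in> L2_space M"
proof -
  have "continuous_on UNIV (\<lambda>x. (norm (f x))\<^sup>2)" using f by (intro continuous_intros)
  then show ?thesis
    unfolding L2_space_def using continuous_measurable[OF assms] continuous_integrable[OF M] by blast
qed

section \<open>Sobolev functions on a bounded open set\<close>

lemma W12D:
  assumes "u \<in> W12 U" "e \<in> Basis"
  shows "u \<in> L2_space (volume_on U)" "weak_partial U e u \<in> L2_space (volume_on U)"
    "has_weak_partial U e u (weak_partial U e u)"
proof -
  have "\<exists>v. v \<in> L2_space (volume_on U) \<and> has_weak_partial U e u v" using assms by (auto simp: W12_def)
  from someI_ex[OF this] show "weak_partial U e u \<in> L2_space (volume_on U)"
    "has_weak_partial U e u (weak_partial U e u)" by (auto simp: weak_partial_def)
qed (use assms in \<open>simp add: W12_def\<close>)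

lemma W12_L2: "u \<in> W12 U \<Longrightarrow> u \<in> L2_space (volume_on U)"
  by (simp add: W12_def)

locale bounded_open =
  fixes U :: "'a::euclidean_space set"
  assumes open_U: "open U" and bounded_U: "bounded U"
begin

lemma bfm: "bounded_finite_measure (volume_on U)"
  unfolding bounded_finite_measure_def
proof (intro conjI exI)
  show "finite_measure (volume_on U)"
    using emeasure_bounded_finite[OF bounded_U] open_U
    by (intro finite_measureI) (simp add: space_restrict_space emeasure_restrict_space less_top[symmetric])
  show "(\<lambda>x. x) \<in> measurable (volume_on U) borel" by (intro measurable_restrict_space1) simp
  show "compact (closure U)" using bounded_U by simp
  show "AE x in volume_on U. x \<in> closure U"
    by (intro AE_I2) (use closure_subset[of U] in \<open>auto simp: space_restrict_space\<close>)
qed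

sublocale finite_measure "volume_on U"
  using bfm by (simp add: bounded_finite_measure_def)

text \<open>\<open>weak_partial\<close> is an arbitrary choice; uniqueness shows that it agrees with
  a weak derivative found by any other means.\<close>

lemma weak_partial_AE:
  assumes "has_weak_partial U e u v" "v \<in> L2_space (volume_on U)"
  shows "AE x in volume_on U. weak_partial U e u x = v x" "weak_partial U e u \<in> L2_space (volume_on U)"
proof -
  have "\<exists>v. v \<in> L2_space (volume_on U) \<and> has_weak_partial U e u v" using assms by auto
  from someI_ex[OF this] have *: "weak_partial U e u \<in> L2_space (volume_on U)"
    "has_weak_partial U e u (weak_partial U e u)" by (auto simp: weak_partial_def)
  show "AE x in volume_on U. weak_partial U e u x = v x"
    by (rule has_weak_partial_unique[OF open_U *(2) assms(1)]) (intro integrable_L2 * assms)+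
  show "weak_partial U e u \<in> L2_space (volume_on U)" by (rule *)
qed

lemma W12_I:
  assumes "u \<in> L2_space (volume_on U)" "\<And>e. e \<in> Basis \<Longrightarrow> v e \<in> L2_space (volume_on U)"
    "\<And>e. e \<in> Basis \<Longrightarrow> has_weak_partial U e u (v e)"
  shows "u \<in> W12 U"
  using assms by (auto simp: W12_def)

lemma C1_L2:
  assumes "continuously_differentiable w"
  shows "w \<in> L2_space (volume_on U)" "partial e w \<in> L2_space (volume_on U)"
  using assms by (auto intro!: continuous_L2[OF bfm] C1_continuous_on C1_continuous_on_partial)

lemma C1_W12: "continuously_differentiable w \<Longrightarrow> w \<in> W12 U"
  by (rule W12_I[of _ "\<lambda>e. partial e w"]) (auto intro: C1_L2 C1_has_weak_partial[OF open_U])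

text \<open>\<open>W12_norm\<close> involves the weak derivative chosen for the difference, which
  agrees only almost everywhere with the difference of the derivatives.\<close>

lemma L2_norm_weak_partial:
  assumes w: "continuously_differentiable w"
    and u: "u \<in> L2_space (volume_on U)" and v: "v \<in> L2_space (volume_on U)" "has_weak_partial U e u v"
  shows "L2_norm (volume_on U) (weak_partial U e (\<lambda>x. w x - u x))
      = L2_norm (volume_on U) (\<lambda>x. partial e w x - v x)"
proof -
  have h: "has_weak_partial U e (\<lambda>x. w x - u x) (\<lambda>x. partial e w x - v x)"
    by (intro has_weak_partial_diff C1_has_weak_partial open_U w v integrable_L2 u C1_L2)
  have L: "(\<lambda>x. partial e w x - v x) \<in> L2_space (volume_on U)"
    by (intro L2_space_diff v C1_L2 w)
  show ?thesis
    using weak_partial_AE[OF h L] L by (intro L2_norm_cong_AE L2_spaceD(1)) auto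
qed

text \<open>Splits convergence in \<open>W12_norm\<close> into L^2 convergence of the functions and
  of their classical derivatives, the form in which traces are handled from here on.\<close>

lemma W12_norm_tendsto_0_iff:
  assumes w: "\<And>k. continuously_differentiable (w k)"
    and u: "u \<in> L2_space (volume_on U)"
    and v: "\<And>e. e \<in> Basis \<Longrightarrow> v e \<in> L2_space (volume_on U)" "\<And>e. e \<in> Basis \<Longrightarrow> has_weak_partial U e u (v e)"
  shows "(\<lambda>k. W12_norm U (\<lambda>x. w k x - u x)) \<longlonglongrightarrow> 0 \<longleftrightarrow>
     (\<lambda>k. L2_norm (volume_on U) (\<lambda>x. w k x - u x)) \<longlonglongrightarrow> 0 \<and>
     (\<forall>e\<in>Basis. (\<lambda>k. L2_norm (volume_on U) (\<lambda>x. partial e (w k) x - v e x)) \<longlonglongrightarrow> 0)"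
    (is "?l \<longleftrightarrow> ?r1 \<and> ?r2")
proof -
  let ?a = "\<lambda>k. L2_norm (volume_on U) (\<lambda>x. w k x - u x)"
  let ?b = "\<lambda>e k. L2_norm (volume_on U) (\<lambda>x. partial e (w k) x - v e x)"
  have N: "W12_norm U (\<lambda>x. w k x - u x) = sqrt ((?a k)\<^sup>2 + (\<Sum>e\<in>Basis. (?b e k)\<^sup>2))" for k
    unfolding W12_norm_def using L2_norm_weak_partial[OF w u v]
    by (intro arg_cong[where f=sqrt] arg_cong2[where f="(+)"] sum.cong refl) simp
  show ?thesis
  proof
    assume l: ?l
    have 1: "?a k \<le> W12_norm U (\<lambda>x. w k x - u x)" for k
      unfolding N by (intro real_le_rsqrt) (simp add: sum_nonneg)
    have ?r1 by (rule tendsto_sandwich[OF _ _ tendsto_const l]) (simp_all add: 1)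
    moreover have 2: "?b e k \<le> W12_norm U (\<lambda>x. w k x - u x)" if "e \<in> Basis" for e k
    proof -
      have "(?b e k)\<^sup>2 \<le> (\<Sum>e\<in>Basis. (?b e k)\<^sup>2)"
        using that by (intro member_le_sum) auto
      then show ?thesis unfolding N by (intro real_le_rsqrt) (simp add: add_increasing)
    qed
    then have ?r2 by (intro ballI tendsto_sandwich[OF _ _ tendsto_const l]) (simp_all add: 2)
    ultimately show "?r1 \<and> ?r2" ..
  next
    assume r: "?r1 \<and> ?r2"
    have "(\<lambda>k. sqrt ((?a k)\<^sup>2 + (\<Sum>e\<in>Basis. (?b e k)\<^sup>2))) \<longlonglongrightarrow> sqrt (0\<^sup>2 + (\<Sum>e\<in>(Basis::'a set). 0\<^sup>2))"
      using r by (intro tendsto_intros) auto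
    then show ?l unfolding N by simp
  qed
qed

end

section \<open>Integration over the well and its boundary\<close>

lemma nn_integral_lborel_pair:
  fixes f :: "'a::euclidean_space \<times> 'b::euclidean_space \<Rightarrow> ennreal"
  assumes f: "f \<in> borel_measurable borel"
  shows "(\<integral>\<^sup>+x. f x \<partial>lborel) = (\<integral>\<^sup>+y. \<integral>\<^sup>+x. f (x, y) \<partial>lborel \<partial>lborel)"
    "(\<integral>\<^sup>+x. f x \<partial>lborel) = (\<integral>\<^sup>+x. \<integral>\<^sup>+y. f (x, y) \<partial>lborel \<partial>lborel)"
proof -
  have f': "f \<in> borel_measurable (lborel \<Otimes>\<^sub>M lborel)" using f by (simp add: lborel_prod)
  show "(\<integral>\<^sup>+x. f x \<partial>lborel) = (\<integral>\<^sup>+y. \<integral>\<^sup>+x. f (x, y) \<partial>lborel \<partial>lborel)"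
    using lborel_pair.nn_integral_snd[OF f'] by (simp add: lborel_prod)
  show "(\<integral>\<^sup>+x. f x \<partial>lborel) = (\<integral>\<^sup>+x. \<integral>\<^sup>+y. f (x, y) \<partial>lborel \<partial>lborel)"
    using lborel.nn_integral_fst[OF f'] by (simp add: lborel_prod)
qed

text \<open>The fundamental theorem of calculus for the squared norm, whose derivative is twice
  \<open>g t \<bullet> g' t\<close>. With extended nonnegative values the inequality can be
  integrated over further variables without integrability conditions.\<close>

lemma square_norm_le_interval:
  fixes g :: "real \<Rightarrow> 'b::euclidean_space"
  assumes g: "\<And>t. (g has_vector_derivative g' t) (at t)" and g': "continuous_on UNIV g'"
    and xy: "x \<in> {a..b}" "y \<in> {a..b}"
  shows "ennreal ((norm (g x))\<^sup>2) \<le> ennreal ((norm (g y))\<^sup>2)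
     + (\<integral>\<^sup>+t\<in>{a<..<b}. ennreal (2 * (norm (g t) * norm (g' t))) \<partial>lborel)"
proof -
  have gc: "continuous_on UNIV g"
    by (rule continuous_on_vector_derivative) (rule has_vector_derivative_at_within[OF g])
  define h' where "h' t = 2 * (g t \<bullet> g' t)" for t
  have h: "((\<lambda>t. g t \<bullet> g t) has_vector_derivative h' t) (at t within S)" for t S
  proof -
    have "((\<lambda>t. g t \<bullet> g t) has_derivative (\<lambda>s. g t \<bullet> (s *\<^sub>R g' t) + (s *\<^sub>R g' t) \<bullet> g t)) (at t within S)"
      using has_vector_derivative_at_within[OF g] unfolding has_vector_derivative_def by (intro has_derivative_inner)
    then show ?thesis by (simp add: has_vector_derivative_def h'_def inner_commute algebra_simps)
  qed
  have h'c: "continuous_on S h'" for S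
    unfolding h'_def by (intro continuous_intros continuous_on_subset[OF gc] continuous_on_subset[OF g']) auto
  \<comment> \<open>Ordering the two points treats both directions of integration at once.\<close>
  define lo hi where "lo = min x y" and "hi = max x y"
  have lh: "lo \<le> hi" "a \<le> lo" "hi \<le> b" using xy by (auto simp: lo_def hi_def)
  have "(\<integral>t. indicator {lo..hi} t *\<^sub>R h' t \<partial>lborel) = g hi \<bullet> g hi - g lo \<bullet> g lo"
    by (rule integral_FTC_atLeastAtMost[OF lh(1) h h'c])
  moreover have "\<bar>g hi \<bullet> g hi - g lo \<bullet> g lo\<bar> = \<bar>g x \<bullet> g x - g y \<bullet> g y\<bar>"
    by (auto simp: lo_def hi_def min_def max_def)
  ultimately have "g x \<bullet> g x - g y \<bullet> g y \<le> norm (\<integral>t. indicator {lo..hi} t *\<^sub>R h' t \<partial>lborel)" by simp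
  then have "ennreal (g x \<bullet> g x - g y \<bullet> g y) \<le> ennreal (norm (\<integral>t. indicator {lo..hi} t *\<^sub>R h' t \<partial>lborel))"
    by (rule ennreal_leI)
  also have "\<dots> \<le> (\<integral>\<^sup>+t. ennreal (norm (indicator {lo..hi} t *\<^sub>R h' t)) \<partial>lborel)"
    by (rule integral_norm_bound_ennreal)
       (use borel_integrable_atLeastAtMost'[OF h'c] in \<open>simp add: set_integrable_def\<close>)
  also have "\<dots> \<le> (\<integral>\<^sup>+t\<in>{a<..<b}. ennreal (2 * (norm (g t) * norm (g' t))) \<partial>lborel)"
  proof (rule nn_integral_mono_AE)
    \<comment> \<open>The closed interval between the points may contain a or b, which are missing
      from the open one; they are null sets.\<close>
    have "AE t in lborel. t \<noteq> a" "AE t in lborel. t \<noteq> b" by (rule AE_lborel_singleton)+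
    then show "AE t in lborel. ennreal (norm (indicator {lo..hi} t *\<^sub>R h' t))
        \<le> ennreal (2 * (norm (g t) * norm (g' t))) * indicator {a<..<b} t"
    proof eventually_elim
      case (elim t)
      have "\<bar>h' t\<bar> \<le> 2 * (norm (g t) * norm (g' t))"
        unfolding h'_def by (simp add: abs_mult Cauchy_Schwarz_ineq2)
      then show ?case using elim lh by (auto simp: indicator_def intro: ennreal_leI)
    qed
  qed
  finally have "ennreal (g x \<bullet> g x - g y \<bullet> g y) \<le> (\<integral>\<^sup>+t\<in>{a<..<b}. ennreal (2 * (norm (g t) * norm (g' t))) \<partial>lborel)" .
  then have "ennreal (g y \<bullet> g y) + ennreal (g x \<bullet> g x - g y \<bullet> g y)
     \<le> ennreal (g y \<bullet> g y) + (\<integral>\<^sup>+t\<in>{a<..<b}. ennreal (2 * (norm (g t) * norm (g' t))) \<partial>lborel)"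
    by (rule add_left_mono)
  moreover have "ennreal (g x \<bullet> g x) \<le> ennreal (g y \<bullet> g y) + ennreal (g x \<bullet> g x - g y \<bullet> g y)"
    by (cases "g y \<bullet> g y \<le> g x \<bullet> g x") (auto simp: ennreal_leI ennreal_neg simp flip: ennreal_plus)
  ultimately show ?thesis by (auto simp: power2_norm_eq_inner intro: order_trans)
qed

text \<open>The preceding inequality averaged over y. The lower bound l for the length makes the
  constant uniform over a family of intervals.\<close>

lemma square_norm_le_mean:
  fixes g :: "real \<Rightarrow> 'b::euclidean_space"
  assumes g: "\<And>t. (g has_vector_derivative g' t) (at t)" and g': "continuous_on UNIV g'"
    and x: "x \<in> {a..b}" and l: "0 < l" "l \<le> b - a"
  shows "ennreal ((norm (g x))\<^sup>2) \<le> (\<integral>\<^sup>+t\<in>{a<..<b}. ennreal (1 / l * (norm (g t))\<^sup>2 + 2 * (norm (g t) * norm (g' t))) \<partial>lborel)"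
proof -
  let ?J = "\<integral>\<^sup>+t\<in>{a<..<b}. ennreal (2 * (norm (g t) * norm (g' t))) \<partial>lborel"
  let ?I = "\<integral>\<^sup>+t\<in>{a<..<b}. ennreal ((norm (g t))\<^sup>2) \<partial>lborel"
  have gc: "continuous_on UNIV g"
    by (rule continuous_on_vector_derivative) (rule has_vector_derivative_at_within[OF g])
  have [measurable]: "g \<in> borel_measurable borel" "g' \<in> borel_measurable borel"
    using gc g' by (auto intro: borel_measurable_continuous_onI)
  have em: "emeasure lborel {a<..<b} = ennreal (b - a)" using l by simp
  have "ennreal ((norm (g x))\<^sup>2) * ennreal (b - a) = (\<integral>\<^sup>+y\<in>{a<..<b}. ennreal ((norm (g x))\<^sup>2) \<partial>lborel)"
    using em by (simp add: nn_integral_cmult_indicator)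
  also have "\<dots> \<le> (\<integral>\<^sup>+y\<in>{a<..<b}. (ennreal ((norm (g y))\<^sup>2) + ?J) \<partial>lborel)"
  proof (rule nn_integral_mono)
    fix y
    show "ennreal ((norm (g x))\<^sup>2) * indicator {a<..<b} y \<le> (ennreal ((norm (g y))\<^sup>2) + ?J) * indicator {a<..<b} y"
    proof (cases "y \<in> {a<..<b}")
      case True
      then have "y \<in> {a..b}" by simp
      from square_norm_le_interval[OF g g' x this] show ?thesis using True by simp
    qed simp
  qed
  also have "\<dots> = (\<integral>\<^sup>+y. ennreal ((norm (g y))\<^sup>2) * indicator {a<..<b} y + ?J * indicator {a<..<b} y \<partial>lborel)"
    by (intro nn_integral_cong) (auto simp: indicator_def)
  also have "\<dots> = ?I + ?J * ennreal (b - a)"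
    using em by (subst nn_integral_add) (auto simp: nn_integral_cmult_indicator)
  finally have 1: "ennreal ((norm (g x))\<^sup>2) * ennreal (b - a) \<le> ?I + ?J * ennreal (b - a)" .
  have ba: "b - a > 0" using l by simp
  have "ennreal ((norm (g x))\<^sup>2) = ennreal (1 / (b - a)) * (ennreal ((norm (g x))\<^sup>2) * ennreal (b - a))"
    using ba by (simp flip: ennreal_mult)
  also have "\<dots> \<le> ennreal (1 / (b - a)) * (?I + ?J * ennreal (b - a))"
    by (rule mult_left_mono[OF 1]) simp
  also have "\<dots> = ennreal (1 / (b - a)) * ?I + ?J * (ennreal (1 / (b - a)) * ennreal (b - a))"
    by (simp add: distrib_left mult_ac)
  also have "ennreal (1 / (b - a)) * ennreal (b - a) = 1"
    using ba by (simp flip: ennreal_mult)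
  also have "ennreal (1 / (b - a)) * ?I + ?J * 1 \<le> ennreal (1 / l) * ?I + ?J"
    using l by (intro add_mono mult_right_mono ennreal_leI) (auto simp: frac_le)
  also have "\<dots> = (\<integral>\<^sup>+t. ennreal (1 / l) * (ennreal ((norm (g t))\<^sup>2) * indicator {a<..<b} t)
       + ennreal (2 * (norm (g t) * norm (g' t))) * indicator {a<..<b} t \<partial>lborel)"
    by (subst nn_integral_add) (auto simp: nn_integral_cmult)
  also have "\<dots> = (\<integral>\<^sup>+t\<in>{a<..<b}. ennreal (1 / l * (norm (g t))\<^sup>2 + 2 * (norm (g t) * norm (g' t))) \<partial>lborel)"
    using l by (intro nn_integral_cong) (auto simp: indicator_def ennreal_mult'[symmetric] simp flip: ennreal_plus)
  finally show ?thesis .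
qed

lemma C1_has_vector_derivative_line:
  fixes f :: "'a::euclidean_space \<Rightarrow> 'b::euclidean_space"
  assumes f: "continuously_differentiable f"
    and p: "\<And>t. (p has_vector_derivative e) (at t)"
  shows "((\<lambda>t. f (p t)) has_vector_derivative partial e f (p t)) (at t)"
proof -
  have "((\<lambda>t. f (p t)) has_derivative (\<lambda>s. partial (s *\<^sub>R e) f (p t))) (at t)"
    by (rule has_derivative_compose[OF _ C1_has_derivative[OF f]]) (use p in \<open>simp add: has_vector_derivative_def\<close>)
  moreover have "partial (s *\<^sub>R e) f (p t) = s *\<^sub>R partial e f (p t)" for s
    using linear_cmul[OF has_derivative_linear[OF C1_has_derivative[OF f]]] by simp
  ultimately show ?thesis by (simp add: has_vector_derivative_def)
qed

section \<open>Coordinates and sections of the well\<close>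

abbreviation ex :: point where "ex \<equiv> ((1, 0), 0)"
abbreviation ey :: point where "ey \<equiv> ((0, 1), 0)"
abbreviation ez :: point where "ez \<equiv> ((0, 0), 1)"

lemma Basis_point: "(Basis :: point set) = {ex, ey, ez}"
  by (auto simp: Basis_prod_def zero_prod_def)

lemma sum_Basis_point: "(\<Sum>e\<in>(Basis :: point set). f e) = f ex + f ey + f ez"
  by (simp add: Basis_point add.assoc)

lemma C1_lines:
  fixes w :: "point \<Rightarrow> 'b::euclidean_space"
  assumes w: "continuously_differentiable w"
  shows "((\<lambda>t. w ((t, y), z)) has_vector_derivative partial ex w ((t, y), z)) (at t)"
    "((\<lambda>t. w ((x, t), z)) has_vector_derivative partial ey w ((x, t), z)) (at t)"
    "((\<lambda>t. w (p, t)) has_vector_derivative partial ez w (p, t)) (at t)"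
proof -
  show "((\<lambda>t. w ((t, y), z)) has_vector_derivative partial ex w ((t, y), z)) (at t)"
    by (rule C1_has_vector_derivative_line[OF w])
       (auto simp: has_vector_derivative_def zero_prod_def intro!: derivative_eq_intros)
  show "((\<lambda>t. w ((x, t), z)) has_vector_derivative partial ey w ((x, t), z)) (at t)"
    by (rule C1_has_vector_derivative_line[OF w])
       (auto simp: has_vector_derivative_def zero_prod_def intro!: derivative_eq_intros)
  show "((\<lambda>t. w (p, t)) has_vector_derivative partial ez w (p, t)) (at t)"
    by (rule C1_has_vector_derivative_line[OF w])
       (auto simp: has_vector_derivative_def zero_prod_def intro!: derivative_eq_intros)
qed

text \<open>Half the length of the section of the well at height \<open>y\<close>; by symmetry also of the section
  over \<open>x\<close>.\<close>

definition half_width :: "real \<Rightarrow> real \<Rightarrow> real" where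
  "half_width \<eta> y = min (1 - \<eta>) (1 - \<bar>y\<bar>)"

locale truncated_square =
  fixes \<eta> :: real
  assumes eta: "0 < \<eta>" "\<eta> < 1 / 2"
begin

lemma Omega_iff_x: "(x, y) \<in> Omega \<eta> \<longleftrightarrow> \<bar>y\<bar> < 1 - \<eta> \<and> x \<in> {- half_width \<eta> y<..<half_width \<eta> y}"
  using eta by (auto simp: Omega_def half_width_def)

lemma Omega_iff_y: "(x, y) \<in> Omega \<eta> \<longleftrightarrow> \<bar>x\<bar> < 1 - \<eta> \<and> y \<in> {- half_width \<eta> x<..<half_width \<eta> x}"
  using eta by (auto simp: Omega_def half_width_def)

text \<open>The effect of the truncation: sections of \<open>Omega\<close> are never shorter than 2
  \<eta>, whereas those of the full square shrink to a point at its corners.\<close>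

lemma half_width_ge: "\<bar>y\<bar> < 1 - \<eta> \<Longrightarrow> \<eta> \<le> half_width \<eta> y"
  using eta by (auto simp: half_width_def)

lemma half_width_le: "half_width \<eta> y \<le> 1"
  using eta by (auto simp: half_width_def)

lemma open_Omega: "open (Omega \<eta>)"
proof -
  have "Omega \<eta> = {p. \<bar>fst p\<bar> < 1 - \<eta>} \<inter> {p. \<bar>snd p\<bar> < 1 - \<eta>} \<inter> {p. \<bar>fst p + snd p\<bar> < 1} \<inter> {p. \<bar>fst p - snd p\<bar> < 1}"
    by (auto simp: Omega_def)
  then show ?thesis by (simp only:) (intro open_Int open_Collect_less continuous_intros)
qed

lemma Omega_borel [measurable]: "Omega \<eta> \<in> sets borel"
  using open_Omega by simp

lemma Omega_subset: "Omega \<eta> \<subseteq> cbox (-1, -1) (1, 1)"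
  using eta by (auto simp: Omega_def mem_box Basis_prod_def)

lemma bounded_Omega: "bounded (Omega \<eta>)"
  using Omega_subset bounded_subset bounded_cbox by blast

end

locale square_well = truncated_square +
  fixes \<epsilon> :: real
  assumes eps: "0 < \<epsilon>"
begin

abbreviation V :: "point set" where "V \<equiv> well \<eta> \<epsilon>"

lemma open_V: "open V"
  unfolding well_def by (intro open_Times open_Omega) simp

lemma bounded_V: "bounded V"
  unfolding well_def by (intro bounded_Times bounded_Omega) simp

sublocale V: bounded_open V
  by standard (rule open_V bounded_V)+

lemma V_nn_integral:
  assumes f [measurable]: "f \<in> borel_measurable borel"
  shows "(\<integral>\<^sup>+x. f x \<partial>volume_on V) = (\<integral>\<^sup>+z\<in>{0<..<\<epsilon>}. (\<integral>\<^sup>+p\<in>Omega \<eta>. f (p, z) \<partial>lborel) \<partial>lborel)"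
    "(\<integral>\<^sup>+x. f x \<partial>volume_on V) = (\<integral>\<^sup>+p\<in>Omega \<eta>. (\<integral>\<^sup>+z\<in>{0<..<\<epsilon>}. f (p, z) \<partial>lborel) \<partial>lborel)"
proof -
  have Vb [measurable]: "V \<in> sets borel" using open_V by simp
  have i: "indicator V (p, z) = (indicator (Omega \<eta>) p * indicator {0<..<\<epsilon>} z :: ennreal)" for p z
    by (auto simp: indicator_def well_def)
  have r: "(\<integral>\<^sup>+x. f x \<partial>volume_on V) = (\<integral>\<^sup>+x. f x * indicator V x \<partial>lborel)"
    by (rule nn_integral_restrict_space) simp
  have m: "(\<lambda>x. f x * indicator V x) \<in> borel_measurable borel" by simp
  have mp [measurable]: "f \<in> borel_measurable (borel \<Otimes>\<^sub>M borel)" using f by (simp add: borel_prod)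
  show "(\<integral>\<^sup>+x. f x \<partial>volume_on V) = (\<integral>\<^sup>+z\<in>{0<..<\<epsilon>}. (\<integral>\<^sup>+p\<in>Omega \<eta>. f (p, z) \<partial>lborel) \<partial>lborel)"
    unfolding r nn_integral_lborel_pair(1)[OF m] i
    by (subst nn_integral_multc[symmetric]) (auto simp: mult_ac intro!: nn_integral_cong)
  show "(\<integral>\<^sup>+x. f x \<partial>volume_on V) = (\<integral>\<^sup>+p\<in>Omega \<eta>. (\<integral>\<^sup>+z\<in>{0<..<\<epsilon>}. f (p, z) \<partial>lborel) \<partial>lborel)"
    unfolding r nn_integral_lborel_pair(2)[OF m] i
    by (subst nn_integral_multc[symmetric]) (auto simp: mult_ac intro!: nn_integral_cong)
qed

text \<open>The value at one height is estimated by a mean over the whole thickness, which brings in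
  the factor \<open>1 / \<epsilon> + 1\<close>.\<close>

lemma square_norm_section_le:
  fixes w :: "point \<Rightarrow> 'b::euclidean_space"
  assumes w: "continuously_differentiable w" and \<tau>: "\<tau> \<in> {0..\<epsilon>}"
  shows "ennreal ((norm (w (p, \<tau>)))\<^sup>2)
     \<le> ennreal (1 / \<epsilon> + 1) * (\<integral>\<^sup>+z\<in>{0<..<\<epsilon>}. ennreal ((norm (w (p, z)))\<^sup>2 + (norm (partial ez w (p, z)))\<^sup>2) \<partial>lborel)"
proof -
  have c: "continuous_on UNIV (\<lambda>t. partial ez w (p, t))" "continuous_on UNIV (\<lambda>t. w (p, t))"
    by (rule continuous_on_compose2[OF C1_continuous_on_partial[OF w, of UNIV] continuous_on_Pair[OF continuous_on_const continuous_on_id]], simp)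
       (rule continuous_on_compose2[OF C1_continuous_on[OF w, of UNIV] continuous_on_Pair[OF continuous_on_const continuous_on_id]], simp)
  have [measurable]: "(\<lambda>t. partial ez w (p, t)) \<in> borel_measurable borel" "(\<lambda>t. w (p, t)) \<in> borel_measurable borel"
    using c by (auto intro: borel_measurable_continuous_onI)
  have "ennreal ((norm (w (p, \<tau>)))\<^sup>2) \<le> (\<integral>\<^sup>+z\<in>{0<..<\<epsilon>}. ennreal (1 / \<epsilon> * (norm (w (p, z)))\<^sup>2
      + 2 * (norm (w (p, z)) * norm (partial ez w (p, z)))) \<partial>lborel)"
    by (rule square_norm_le_mean[OF C1_lines(3)[OF w] c(1) \<tau> eps]) simp
  also have "\<dots> \<le> (\<integral>\<^sup>+z. ennreal (1 / \<epsilon> + 1) * (ennreal ((norm (w (p, z)))\<^sup>2 + (norm (partial ez w (p, z)))\<^sup>2)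
      * indicator {0<..<\<epsilon>} z) \<partial>lborel)"
  proof (rule nn_integral_mono)
    fix z
    have "1 / \<epsilon> * a\<^sup>2 + 2 * (a * b) \<le> (1 / \<epsilon> + 1) * (a\<^sup>2 + b\<^sup>2)" for a b :: real
    proof -
      have "0 \<le> 1 / \<epsilon> * b\<^sup>2" using eps by simp
      then show ?thesis using sum_squares_bound[of a b] by (simp add: distrib_left distrib_right mult.assoc)
    qed
    then have "ennreal (1 / \<epsilon> * (norm (w (p, z)))\<^sup>2 + 2 * (norm (w (p, z)) * norm (partial ez w (p, z))))
       \<le> ennreal (1 / \<epsilon> + 1) * ennreal ((norm (w (p, z)))\<^sup>2 + (norm (partial ez w (p, z)))\<^sup>2)"
      using eps by (subst ennreal_mult[symmetric], simp, simp, intro ennreal_leI)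
    then show "ennreal (1 / \<epsilon> * (norm (w (p, z)))\<^sup>2 + 2 * (norm (w (p, z)) * norm (partial ez w (p, z)))) * indicator {0<..<\<epsilon>} z
       \<le> ennreal (1 / \<epsilon> + 1) * (ennreal ((norm (w (p, z)))\<^sup>2 + (norm (partial ez w (p, z)))\<^sup>2) * indicator {0<..<\<epsilon>} z)"
      by (auto simp: indicator_def)
  qed
  also have "\<dots> = ennreal (1 / \<epsilon> + 1) * (\<integral>\<^sup>+z\<in>{0<..<\<epsilon>}. ennreal ((norm (w (p, z)))\<^sup>2 + (norm (partial ez w (p, z)))\<^sup>2) \<partial>lborel)"
    by (rule nn_integral_cmult) simp
  finally show ?thesis .
qed

lemma C1_borel:
  fixes w :: "point \<Rightarrow> 'b::euclidean_space"
  assumes "continuously_differentiable w"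
  shows "w \<in> borel_measurable (borel \<Otimes>\<^sub>M borel)" "partial e w \<in> borel_measurable (borel \<Otimes>\<^sub>M borel)"
    "w \<in> borel_measurable ((borel \<Otimes>\<^sub>M borel) \<Otimes>\<^sub>M borel)"
    "partial e w \<in> borel_measurable ((borel \<Otimes>\<^sub>M borel) \<Otimes>\<^sub>M borel)"
    "w \<in> borel_measurable borel" "partial e w \<in> borel_measurable borel"
proof -
  show "w \<in> borel_measurable borel" "partial e w \<in> borel_measurable borel"
    by (rule borel_measurable_continuous_onI, rule C1_continuous_on[OF assms] C1_continuous_on_partial[OF assms])+
  then show "w \<in> borel_measurable (borel \<Otimes>\<^sub>M borel)" "partial e w \<in> borel_measurable (borel \<Otimes>\<^sub>M borel)"
     "w \<in> borel_measurable ((borel \<Otimes>\<^sub>M borel) \<Otimes>\<^sub>M borel)"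
    "partial e w \<in> borel_measurable ((borel \<Otimes>\<^sub>M borel) \<Otimes>\<^sub>M borel)"
    by (simp_all add: borel_prod)
qed

text \<open>At the heights 0 and \<epsilon> this is the trace inequality on \<Gamma>; at
  intermediate heights it controls the slices in the L^4 embedding.\<close>

lemma slab_le:
  fixes w :: "point \<Rightarrow> 'b::euclidean_space"
  assumes w: "continuously_differentiable w" and \<tau>: "\<tau> \<in> {0..\<epsilon>}"
  shows "(\<integral>\<^sup>+p\<in>Omega \<eta>. ennreal ((norm (w (p, \<tau>)))\<^sup>2) \<partial>lborel)
     \<le> ennreal (1 / \<epsilon> + 1) * (\<integral>\<^sup>+x. ennreal ((norm (w x))\<^sup>2 + (norm (partial ez w x))\<^sup>2) \<partial>volume_on V)"
proof -
  note [measurable] = C1_borel[OF w]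
  have "(\<integral>\<^sup>+p\<in>Omega \<eta>. ennreal ((norm (w (p, \<tau>)))\<^sup>2) \<partial>lborel)
     \<le> (\<integral>\<^sup>+p. ennreal (1 / \<epsilon> + 1) * ((\<integral>\<^sup>+z\<in>{0<..<\<epsilon>}. ennreal ((norm (w (p, z)))\<^sup>2 + (norm (partial ez w (p, z)))\<^sup>2) \<partial>lborel)
         * indicator (Omega \<eta>) p) \<partial>lborel)"
    using square_norm_section_le[OF w \<tau>] by (intro nn_integral_mono) (auto simp: indicator_def)
  also have "\<dots> = ennreal (1 / \<epsilon> + 1) * (\<integral>\<^sup>+p\<in>Omega \<eta>. (\<integral>\<^sup>+z\<in>{0<..<\<epsilon>}. ennreal ((norm (w (p, z)))\<^sup>2 + (norm (partial ez w (p, z)))\<^sup>2) \<partial>lborel) \<partial>lborel)"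
    by (rule nn_integral_cmult) measurable
  also have "(\<integral>\<^sup>+p\<in>Omega \<eta>. (\<integral>\<^sup>+z\<in>{0<..<\<epsilon>}. ennreal ((norm (w (p, z)))\<^sup>2 + (norm (partial ez w (p, z)))\<^sup>2) \<partial>lborel) \<partial>lborel)
      = (\<integral>\<^sup>+x. ennreal ((norm (w x))\<^sup>2 + (norm (partial ez w x))\<^sup>2) \<partial>volume_on V)"
    by (rule V_nn_integral(2)[symmetric]) simp
  finally show ?thesis .
qed

section \<open>Integration against the surface measures\<close>

lemma id_measurable_pair:
  assumes "(\<lambda>x. x) \<in> measurable M borel" "(\<lambda>x. x) \<in> measurable N borel"
  shows "(\<lambda>x. x) \<in> measurable (M \<Otimes>\<^sub>M N) (borel :: ('a::euclidean_space \<times> 'b::euclidean_space) measure)"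
  using measurable_Pair[OF measurable_compose[OF measurable_fst assms(1)] measurable_compose[OF measurable_snd assms(2)]]
  by (simp add: borel_prod)

lemma Gamma_id: "(\<lambda>x. x) \<in> measurable (Gamma_measure \<eta> \<epsilon>) borel"
  unfolding Gamma_measure_def by (intro id_measurable_pair measurable_restrict_space1) simp_all

lemma Gamma_nn_integral:
  assumes f: "f \<in> borel_measurable borel"
  shows "(\<integral>\<^sup>+x. f x \<partial>Gamma_measure \<eta> \<epsilon>)
     = (\<integral>\<^sup>+p\<in>Omega \<eta>. f (p, 0) \<partial>lborel) + (\<integral>\<^sup>+p\<in>Omega \<eta>. f (p, \<epsilon>) \<partial>lborel)"
proof -
  have [measurable]: "f \<in> borel_measurable (borel \<Otimes>\<^sub>M borel)" using f by (simp add: borel_prod)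
  interpret c: sigma_finite_measure "count_space {0, \<epsilon>}"
    by (rule sigma_finite_measure_count_space_finite) simp
  have m: "f \<in> borel_measurable (restrict_space lborel (Omega \<eta>) \<Otimes>\<^sub>M count_space {0, \<epsilon>})"
    using measurable_compose[OF Gamma_id f] by (simp add: Gamma_measure_def)
  have "(\<integral>\<^sup>+x. f x \<partial>Gamma_measure \<eta> \<epsilon>) = (\<integral>\<^sup>+p. (\<integral>\<^sup>+z. f (p, z) \<partial>count_space {0, \<epsilon>}) \<partial>restrict_space lborel (Omega \<eta>))"
    unfolding Gamma_measure_def by (rule c.nn_integral_fst[OF m, symmetric])
  also have "\<dots> = (\<integral>\<^sup>+p. f (p, 0) + f (p, \<epsilon>) \<partial>restrict_space lborel (Omega \<eta>))"
    using eps by (simp add: nn_integral_count_space_finite)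
  also have "\<dots> = (\<integral>\<^sup>+p. f (p, 0) * indicator (Omega \<eta>) p + f (p, \<epsilon>) * indicator (Omega \<eta>) p \<partial>lborel)"
    by (subst nn_integral_restrict_space) (auto simp: distrib_right)
  also have "\<dots> = (\<integral>\<^sup>+p\<in>Omega \<eta>. f (p, 0) \<partial>lborel) + (\<integral>\<^sup>+p\<in>Omega \<eta>. f (p, \<epsilon>) \<partial>lborel)"
    by (rule nn_integral_add) measurable
  finally show ?thesis .
qed

text \<open>Unwinds image measure, density and product, so that afterwards only integrals over
  parametrised edges occur.\<close>

lemma nn_integral_arc_length:
  assumes E: "finite E" and g [measurable]: "g \<in> borel_measurable borel"
  shows "(\<integral>\<^sup>+p. g p \<partial>arc_length E)
     = (\<Sum>(a, b)\<in>E. ennreal (dist a b) * (\<integral>\<^sup>+t\<in>{0..1}. g ((1 - t) *\<^sub>R a + t *\<^sub>R b) \<partial>lborel))"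
proof -
  let ?I = "restrict_space lborel {0..1::real}"
  let ?\<gamma> = "\<lambda>((a, b), t). (1 - t) *\<^sub>R a + t *\<^sub>R b :: real \<times> real"
  let ?d = "\<lambda>((a, b), t). ennreal (dist a (b :: real \<times> real)) "
  interpret I: sigma_finite_measure ?I
    by (intro sigma_finite_measure_restrict_space sigma_finite_lborel) simp
  have 1 [measurable]: "?\<gamma> \<in> measurable (count_space E \<Otimes>\<^sub>M ?I) borel"
    by (rule measurable_pair_measure_countable1[OF countable_finite[OF E]])
       (auto intro!: measurable_restrict_space1 split: prod.split)
  have 2 [measurable]: "?d \<in> borel_measurable (count_space E \<Otimes>\<^sub>M ?I)"
    by (rule measurable_pair_measure_countable1[OF countable_finite[OF E]])
       (auto intro!: measurable_restrict_space1 split: prod.split)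
  have "(\<integral>\<^sup>+p. g p \<partial>arc_length E) = (\<integral>\<^sup>+x. g (?\<gamma> x) \<partial>density (count_space E \<Otimes>\<^sub>M ?I) ?d)"
    unfolding arc_length_def by (rule nn_integral_distr) simp_all
  also have "\<dots> = (\<integral>\<^sup>+x. ?d x * g (?\<gamma> x) \<partial>(count_space E \<Otimes>\<^sub>M ?I))"
    by (rule nn_integral_density) measurable
  also have "\<dots> = (\<integral>\<^sup>+e. (\<integral>\<^sup>+t. ?d (e, t) * g (?\<gamma> (e, t)) \<partial>?I) \<partial>count_space E)"
    by (rule I.nn_integral_fst[symmetric]) measurable
  also have "\<dots> = (\<Sum>e\<in>E. (\<integral>\<^sup>+t. ?d (e, t) * g (?\<gamma> (e, t)) \<partial>?I))"
    by (rule nn_integral_count_space_finite[OF E])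
  also have "\<dots> = (\<Sum>(a, b)\<in>E. ennreal (dist a b) * (\<integral>\<^sup>+t\<in>{0..1}. g ((1 - t) *\<^sub>R a + t *\<^sub>R b) \<partial>lborel))"
  proof (rule sum.cong[OF refl])
    fix e assume "e \<in> E"
    obtain a b where e: "e = (a, b)" by (cases e)
    have [measurable]: "(\<lambda>t. g ((1 - t) *\<^sub>R a + t *\<^sub>R b)) \<in> borel_measurable borel" by measurable
    show "(\<integral>\<^sup>+t. ?d (e, t) * g (?\<gamma> (e, t)) \<partial>?I)
        = (case e of (a, b) \<Rightarrow> ennreal (dist a b) * (\<integral>\<^sup>+t\<in>{0..1}. g ((1 - t) *\<^sub>R a + t *\<^sub>R b) \<partial>lborel))"
      unfolding e by (simp add: nn_integral_restrict_space nn_integral_cmult mult.assoc)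
  qed
  finally show ?thesis .
qed

lemma finite_edges: "finite (edges \<eta>)"
  by (simp add: edges_def)

lemma lateral_id: "(\<lambda>x. x) \<in> measurable (lateral_measure \<eta> \<epsilon>) borel"
  unfolding lateral_measure_def
  by (intro id_measurable_pair measurable_restrict_space1) (simp_all add: arc_length_def)

lemma lateral_nn_integral:
  assumes f: "f \<in> borel_measurable borel"
  shows "(\<integral>\<^sup>+x. f x \<partial>lateral_measure \<eta> \<epsilon>) = (\<Sum>(a, b)\<in>edges \<eta>. ennreal (dist a b) *
     (\<integral>\<^sup>+t\<in>{0..1}. (\<integral>\<^sup>+z\<in>{0<..<\<epsilon>}. f ((1 - t) *\<^sub>R a + t *\<^sub>R b, z) \<partial>lborel) \<partial>lborel))"
proof -
  let ?J = "restrict_space lborel {0<..<\<epsilon>}"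
  have [measurable]: "f \<in> borel_measurable (borel \<Otimes>\<^sub>M borel)" using f by (simp add: borel_prod)
  interpret J: sigma_finite_measure ?J
    by (intro sigma_finite_measure_restrict_space sigma_finite_lborel) simp
  have "f \<in> borel_measurable (arc_length (edges \<eta>) \<Otimes>\<^sub>M ?J)"
    using measurable_compose[OF lateral_id f] by (simp add: lateral_measure_def)
  then have "(\<integral>\<^sup>+x. f x \<partial>lateral_measure \<eta> \<epsilon>) = (\<integral>\<^sup>+p. (\<integral>\<^sup>+z. f (p, z) \<partial>?J) \<partial>arc_length (edges \<eta>))"
    unfolding lateral_measure_def by (rule J.nn_integral_fst[symmetric])
  also have "\<dots> = (\<integral>\<^sup>+p. (\<integral>\<^sup>+z\<in>{0<..<\<epsilon>}. f (p, z) \<partial>lborel) \<partial>arc_length (edges \<eta>))"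
    by (simp add: nn_integral_restrict_space)
  also have "\<dots> = (\<Sum>(a, b)\<in>edges \<eta>. ennreal (dist a b) *
     (\<integral>\<^sup>+t\<in>{0..1}. (\<integral>\<^sup>+z\<in>{0<..<\<epsilon>}. f ((1 - t) *\<^sub>R a + t *\<^sub>R b, z) \<partial>lborel) \<partial>lborel))"
    by (rule nn_integral_arc_length[OF finite_edges]) measurable
  finally show ?thesis .
qed

text \<open>The arc length is an image of the parameter space, so a Borel property has to be checked
  only at parametrised points of the edges.\<close>

lemma AE_lateral:
  assumes P: "{x. P x} \<in> sets borel"
    and e: "\<And>a b t z. (a, b) \<in> edges \<eta> \<Longrightarrow> t \<in> {0..1} \<Longrightarrow> z \<in> {0<..<\<epsilon>} \<Longrightarrow> P ((1 - t) *\<^sub>R a + t *\<^sub>R b, z)"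
  shows "AE x in lateral_measure \<eta> \<epsilon>. P x"
proof -
  have B: "- {x. P x} \<in> sets borel" using P by simp
  have "{x \<in> space (lateral_measure \<eta> \<epsilon>). P x} \<in> sets (lateral_measure \<eta> \<epsilon>)"
    using measurable_sets[OF lateral_id P] by (simp add: vimage_def Int_def conj_commute)
  moreover have "(\<integral>\<^sup>+x. indicator {x. \<not> P x} x \<partial>lateral_measure \<eta> \<epsilon>) = 0"
  proof -
    have "(\<integral>\<^sup>+t\<in>{0..1}. (\<integral>\<^sup>+z\<in>{0<..<\<epsilon>}. indicator {x. \<not> P x} ((1 - t) *\<^sub>R a + t *\<^sub>R b, z) \<partial>lborel) \<partial>lborel) = 0"
      if "(a, b) \<in> edges \<eta>" for a b
    proof -
      have "(\<integral>\<^sup>+z\<in>{0<..<\<epsilon>}. indicator {x. \<not> P x} ((1 - t) *\<^sub>R a + t *\<^sub>R b, z) \<partial>lborel) * indicator {0..1} t = 0" for t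
      proof (cases "t \<in> {0..1}")
        case True
        have "(\<integral>\<^sup>+z\<in>{0<..<\<epsilon>}. indicator {x. \<not> P x} ((1 - t) *\<^sub>R a + t *\<^sub>R b, z) \<partial>lborel) = (\<integral>\<^sup>+(z::real). 0 \<partial>lborel)"
          using e[OF that True] by (intro nn_integral_cong) (auto simp: indicator_def)
        then show ?thesis by simp
      qed simp
      then show ?thesis by (simp only:) simp
    qed
    then show ?thesis
      using B by (subst lateral_nn_integral) (auto simp: Compl_eq intro!: sum.neutral)
  qed
  ultimately show ?thesis by (subst AE_iff_nn_integral) auto
qed

lemma edge_point_bounds:
  assumes "(a, b) \<in> edges \<eta>" "t \<in> {0..1}"
  shows "(1 - t) *\<^sub>R a + t *\<^sub>R b \<in> cbox (-1, -1) (1, 1)"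
proof (rule convexD_alt[of "cbox (-1, -1) (1, 1)" a b t, simplified])
  show "a \<in> cbox (-1, -1) (1, 1)" "b \<in> cbox (-1, -1) (1, 1)"
    using assms(1) eta by (auto simp: edges_def mem_box Basis_prod_def)
qed (use assms in \<open>auto simp: convex_box\<close>)

lemma bfm_lateral: "bounded_finite_measure (lateral_measure \<eta> \<epsilon>)"
  unfolding bounded_finite_measure_def
proof (intro conjI exI)
  show "finite_measure (lateral_measure \<eta> \<epsilon>)"
  proof (rule finite_measureI)
    have "emeasure (lateral_measure \<eta> \<epsilon>) (space (lateral_measure \<eta> \<epsilon>)) = (\<integral>\<^sup>+x. 1 \<partial>lateral_measure \<eta> \<epsilon>)" by simp
    also have "\<dots> = (\<Sum>(a, b)\<in>edges \<eta>. ennreal (dist a b) * ennreal \<epsilon>)"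
      using eps by (subst lateral_nn_integral) (simp_all add: nn_integral_cmult_indicator)
    also have "\<dots> < \<infinity>"
      by (simp add: split_beta finite_edges ennreal_mult_less_top)
    finally show "emeasure (lateral_measure \<eta> \<epsilon>) (space (lateral_measure \<eta> \<epsilon>)) \<noteq> \<infinity>" by simp
  qed
  show "compact (cbox (-1, -1) (1, 1) \<times> {0..\<epsilon>})"
    by (intro compact_Times compact_cbox compact_Icc)
  show "AE x in lateral_measure \<eta> \<epsilon>. x \<in> cbox (-1, -1) (1, 1) \<times> {0..\<epsilon>}"
  proof (rule AE_lateral)
    show "{x. x \<in> cbox (-1, -1) (1, 1) \<times> {0..\<epsilon>}} \<in> sets borel"
      by (auto intro!: borel_closed closed_Times)
  qed (use edge_point_bounds in auto)
qed (rule lateral_id)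

lemma bfm_Gamma: "bounded_finite_measure (Gamma_measure \<eta> \<epsilon>)"
  unfolding bounded_finite_measure_def
proof (intro conjI exI)
  show "finite_measure (Gamma_measure \<eta> \<epsilon>)"
  proof (rule finite_measureI)
    have "emeasure (Gamma_measure \<eta> \<epsilon>) (space (Gamma_measure \<eta> \<epsilon>)) = (\<integral>\<^sup>+x. 1 \<partial>Gamma_measure \<eta> \<epsilon>)" by simp
    also have "\<dots> = emeasure lborel (Omega \<eta>) + emeasure lborel (Omega \<eta>)"
      by (subst Gamma_nn_integral) simp_all
    also have "\<dots> < \<infinity>" using emeasure_bounded_finite[OF bounded_Omega] by simp
    finally show "emeasure (Gamma_measure \<eta> \<epsilon>) (space (Gamma_measure \<eta> \<epsilon>)) \<noteq> \<infinity>" by simp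
  qed
  show "compact (cbox (-1, -1) (1, 1) \<times> {0..\<epsilon>})"
    by (intro compact_Times compact_cbox compact_Icc)
  show "AE x in Gamma_measure \<eta> \<epsilon>. x \<in> cbox (-1, -1) (1, 1) \<times> {0..\<epsilon>}"
    using Omega_subset eps
    by (intro AE_I2) (auto simp: Gamma_measure_def space_pair_measure space_restrict_space)
qed (rule Gamma_id)

section \<open>The Poincare inequality in the direction x\<close>

lemma Omega_nn_integral:
  assumes f: "f \<in> borel_measurable borel"
  shows "(\<integral>\<^sup>+p\<in>Omega \<eta>. f p \<partial>lborel) = (\<integral>\<^sup>+y. (\<integral>\<^sup>+x. f (x, y) * indicator (Omega \<eta>) (x, y) \<partial>lborel) \<partial>lborel)"
    "(\<integral>\<^sup>+p\<in>Omega \<eta>. f p \<partial>lborel) = (\<integral>\<^sup>+x. (\<integral>\<^sup>+y. f (x, y) * indicator (Omega \<eta>) (x, y) \<partial>lborel) \<partial>lborel)"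
proof -
  have m: "(\<lambda>p. f p * indicator (Omega \<eta>) p) \<in> borel_measurable borel"
    using f by simp
  show "(\<integral>\<^sup>+p\<in>Omega \<eta>. f p \<partial>lborel) = (\<integral>\<^sup>+y. (\<integral>\<^sup>+x. f (x, y) * indicator (Omega \<eta>) (x, y) \<partial>lborel) \<partial>lborel)"
    by (rule nn_integral_lborel_pair(1)[OF m])
  show "(\<integral>\<^sup>+p\<in>Omega \<eta>. f p \<partial>lborel) = (\<integral>\<^sup>+x. (\<integral>\<^sup>+y. f (x, y) * indicator (Omega \<eta>) (x, y) \<partial>lborel) \<partial>lborel)"
    by (rule nn_integral_lborel_pair(2)[OF m])
qed

text \<open>For an edge formed by left ends of sections, the height is an affine function of the
  parameter. Projection to the y axis does not lengthen a segment, hence the inequality.\<close>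

lemma edge_nn_integral_le:
  assumes F [measurable]: "F \<in> borel_measurable borel" and y: "snd b < snd a"
    and x: "\<And>t. t \<in> {0..1} \<Longrightarrow> - half_width \<eta> ((1 - t) * snd a + t * snd b) = (1 - t) * fst a + t * fst b"
  shows "(\<integral>\<^sup>+y\<in>{snd b..snd a}. F (- half_width \<eta> y, y) \<partial>lborel)
     \<le> ennreal (dist a b) * (\<integral>\<^sup>+t\<in>{0..1}. F ((1 - t) *\<^sub>R a + t *\<^sub>R b) \<partial>lborel)"
proof -
  have [measurable]: "half_width \<eta> \<in> borel_measurable borel"
    by (auto simp: half_width_def[abs_def])
  have F' [measurable]: "F \<in> borel_measurable (borel \<Otimes>\<^sub>M borel)" using F by (simp add: borel_prod)
  have "(\<integral>\<^sup>+y\<in>{snd b..snd a}. F (- half_width \<eta> y, y) \<partial>lborel)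
      = ennreal \<bar>snd b - snd a\<bar> * (\<integral>\<^sup>+t. F (- half_width \<eta> (snd a + (snd b - snd a) * t), snd a + (snd b - snd a) * t)
          * indicator {snd b..snd a} (snd a + (snd b - snd a) * t) \<partial>lborel)"
    using y by (intro nn_integral_real_affine) auto
  also have "\<dots> = ennreal \<bar>snd b - snd a\<bar> * (\<integral>\<^sup>+t\<in>{0..1}. F ((1 - t) *\<^sub>R a + t *\<^sub>R b) \<partial>lborel)"
  proof (rule arg_cong2[where f="(*)", OF refl], rule nn_integral_cong)
    fix t
    have "snd a + (snd b - snd a) * t \<in> {snd b..snd a} \<longleftrightarrow> t \<in> {0..1}"
    proof -
      have "snd a + (snd b - snd a) * t \<le> snd a \<longleftrightarrow> 0 \<le> (snd a - snd b) * t"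
        by (simp add: algebra_simps)
      moreover have "snd b \<le> snd a + (snd b - snd a) * t \<longleftrightarrow> 0 \<le> (snd a - snd b) * (1 - t)"
        by (simp add: algebra_simps)
      ultimately show ?thesis using y by (auto simp: zero_le_mult_iff)
    qed
    moreover have "(- half_width \<eta> (snd a + (snd b - snd a) * t), snd a + (snd b - snd a) * t) = (1 - t) *\<^sub>R a + t *\<^sub>R b"
      if "t \<in> {0..1}"
    proof -
      have "snd a + (snd b - snd a) * t = (1 - t) * snd a + t * snd b" by (simp add: algebra_simps)
      then show ?thesis using x[OF that] by (simp add: prod_eq_iff)
    qed
    ultimately show "F (- half_width \<eta> (snd a + (snd b - snd a) * t), snd a + (snd b - snd a) * t)
          * indicator {snd b..snd a} (snd a + (snd b - snd a) * t)
        = F ((1 - t) *\<^sub>R a + t *\<^sub>R b) * indicator {0..1} t"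
      by (auto simp: indicator_def)
  qed
  also have "\<dots> \<le> ennreal (dist a b) * (\<integral>\<^sup>+t\<in>{0..1}. F ((1 - t) *\<^sub>R a + t *\<^sub>R b) \<partial>lborel)"
    using dist_snd_le[of a b] by (intro mult_right_mono ennreal_leI) (auto simp: dist_real_def abs_minus_commute)
  finally show ?thesis .
qed

text \<open>The left ends of the horizontal sections run downwards through the edges
  \<open>C2\<close>, \<open>S3\<close> and \<open>C3\<close>; the other five edges only add
  nonnegative terms.\<close>

lemma left_boundary_le:
  assumes F [measurable]: "F \<in> borel_measurable borel"
  shows "(\<integral>\<^sup>+y\<in>{- (1 - \<eta>)<..<1 - \<eta>}. F (- half_width \<eta> y, y) \<partial>lborel)
     \<le> (\<Sum>(a, b)\<in>edges \<eta>. ennreal (dist a b) * (\<integral>\<^sup>+t\<in>{0..1}. F ((1 - t) *\<^sub>R a + t *\<^sub>R b) \<partial>lborel))"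
proof -
  let ?G = "\<lambda>a b. ennreal (dist a b) * (\<integral>\<^sup>+t\<in>{0..1}. F ((1 - t) *\<^sub>R a + t *\<^sub>R b) \<partial>lborel)"
  let ?I = "\<lambda>a b. (\<integral>\<^sup>+y\<in>{a..b}. F (- half_width \<eta> y, y) \<partial>lborel)"
  let ?e1 = "((- \<eta>, 1 - \<eta>), (- 1 + \<eta>, \<eta>))"
  let ?e2 = "((- 1 + \<eta>, \<eta>), (- 1 + \<eta>, - \<eta>))"
  let ?e3 = "((- 1 + \<eta>, - \<eta>), (- \<eta>, - 1 + \<eta>))"
  have [measurable]: "half_width \<eta> \<in> borel_measurable borel"
    by (auto simp: half_width_def[abs_def])
  have F' [measurable]: "F \<in> borel_measurable (borel \<Otimes>\<^sub>M borel)" using F by (simp add: borel_prod)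
  have h1: "half_width \<eta> y = 1 - y" if "\<eta> \<le> y" for y using that eta by (auto simp: half_width_def)
  have h2: "half_width \<eta> y = 1 - \<eta>" if "- \<eta> \<le> y \<and> y \<le> \<eta>" for y using that eta by (auto simp: half_width_def)
  have h3: "half_width \<eta> y = 1 + y" if "y \<le> - \<eta>" for y using that eta by (auto simp: half_width_def)
  have 1: "?I (\<eta>) (1 - \<eta>) \<le> ?G (fst ?e1) (snd ?e1)"
  proof -
    have "- half_width \<eta> ((1 - t) * (1 - \<eta>) + t * (\<eta>)) = (1 - t) * (- \<eta>) + t * (- 1 + \<eta>)" if t: "t \<in> {0..1}" for t
    proof -
      \<comment> \<open>These inequalities place the height in the range where
        \<open>half_width\<close> has the form given by \<open>h1\<close>.\<close>
      have "0 \<le> t * \<eta>" "t * \<eta> \<le> \<eta>" "0 \<le> (1 - t) * (1 - 2 * \<eta>)" "0 \<le> t * (1 - 2 * \<eta>)"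
        using t eta by (auto simp: mult_left_le_one_le)
      then show ?thesis by (subst h1) (simp_all add: algebra_simps)
    qed
    then show ?thesis
      using edge_nn_integral_le[OF F, where a="(- \<eta>, 1 - \<eta>)" and b="(- 1 + \<eta>, \<eta>)"] eta by simp
  qed
  have 2: "?I (- \<eta>) (\<eta>) \<le> ?G (fst ?e2) (snd ?e2)"
  proof -
    have "- half_width \<eta> ((1 - t) * (\<eta>) + t * (- \<eta>)) = (1 - t) * (- 1 + \<eta>) + t * (- 1 + \<eta>)" if t: "t \<in> {0..1}" for t
    proof -
      have "0 \<le> t * \<eta>" "t * \<eta> \<le> \<eta>" "0 \<le> (1 - t) * (1 - 2 * \<eta>)" "0 \<le> t * (1 - 2 * \<eta>)"
        using t eta by (auto simp: mult_left_le_one_le)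
      then show ?thesis by (subst h2) (simp_all add: algebra_simps)
    qed
    then show ?thesis
      using edge_nn_integral_le[OF F, where a="(- 1 + \<eta>, \<eta>)" and b="(- 1 + \<eta>, - \<eta>)"] eta by simp
  qed
  have 3: "?I (- 1 + \<eta>) (- \<eta>) \<le> ?G (fst ?e3) (snd ?e3)"
  proof -
    have "- half_width \<eta> ((1 - t) * (- \<eta>) + t * (- 1 + \<eta>)) = (1 - t) * (- 1 + \<eta>) + t * (- \<eta>)" if t: "t \<in> {0..1}" for t
    proof -
      have "0 \<le> t * \<eta>" "t * \<eta> \<le> \<eta>" "0 \<le> (1 - t) * (1 - 2 * \<eta>)" "0 \<le> t * (1 - 2 * \<eta>)"
        using t eta by (auto simp: mult_left_le_one_le)
      then show ?thesis by (subst h3) (simp_all add: algebra_simps)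
    qed
    then show ?thesis
      using edge_nn_integral_le[OF F, where a="(- 1 + \<eta>, - \<eta>)" and b="(- \<eta>, - 1 + \<eta>)"] eta by simp
  qed
  have "(\<integral>\<^sup>+y\<in>{- (1 - \<eta>)<..<1 - \<eta>}. F (- half_width \<eta> y, y) \<partial>lborel)
     \<le> (\<integral>\<^sup>+y. F (- half_width \<eta> y, y) * indicator {\<eta>..1 - \<eta>} y
         + (F (- half_width \<eta> y, y) * indicator {- \<eta>..\<eta>} y + F (- half_width \<eta> y, y) * indicator {- 1 + \<eta>..- \<eta>} y) \<partial>lborel)"
    by (intro nn_integral_mono) (auto simp: indicator_def)
  also have "\<dots> = ?I \<eta> (1 - \<eta>) + (?I (- \<eta>) \<eta> + ?I (- 1 + \<eta>) (- \<eta>))"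
    by (subst nn_integral_add; (subst nn_integral_add)?) measurable
  also have "\<dots> \<le> ?G (fst ?e1) (snd ?e1) + (?G (fst ?e2) (snd ?e2) + ?G (fst ?e3) (snd ?e3))"
    by (intro add_mono 1 2 3)
  also have "\<dots> = (\<Sum>(a, b)\<in>{?e1, ?e2, ?e3}. ?G a b)"
    using eta by simp
  also have "\<dots> \<le> (\<Sum>(a, b)\<in>edges \<eta>. ?G a b)"
    by (rule sum_mono2[OF finite_edges]) (auto simp: edges_def)
  finally show ?thesis .
qed

text \<open>Each horizontal line is followed from its left end, which lies on the lateral boundary.
  Half of the squared norm of w is left on the right, because it can be subtracted only where the
  integrals are known to be finite. No constant depends on \<epsilon>.\<close>

lemma Poincare_nn:
  fixes w :: "point \<Rightarrow> 'b::euclidean_space"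
  assumes w: "continuously_differentiable w"
  shows "(\<integral>\<^sup>+x. ennreal ((norm (w x))\<^sup>2) \<partial>volume_on V)
     \<le> 2 * (\<integral>\<^sup>+x. ennreal ((norm (w x))\<^sup>2) \<partial>lateral_measure \<eta> \<epsilon>)
       + (\<integral>\<^sup>+x. ennreal (1/2 * (norm (w x))\<^sup>2 + 8 * (norm (partial ex w x))\<^sup>2) \<partial>volume_on V)"
proof -
  note [measurable] = C1_borel[OF w]
  have [measurable]: "half_width \<eta> \<in> borel_measurable borel"
    by (auto simp: half_width_def[abs_def])
  let ?R = "\<lambda>x. ennreal (1/2 * (norm (w x))\<^sup>2 + 8 * (norm (partial ex w x))\<^sup>2)"
  let ?c = "\<lambda>y z. ennreal ((norm (w ((- half_width \<eta> y, y), z)))\<^sup>2)"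
  have [measurable]: "Omega \<eta> \<in> sets (borel \<Otimes>\<^sub>M borel)" using Omega_borel by (simp only: borel_prod)
  have line: "(\<integral>\<^sup>+x. ennreal ((norm (w ((x, y), z)))\<^sup>2) * indicator (Omega \<eta>) (x, y) \<partial>lborel)
     \<le> 2 * ?c y z * indicator {- (1 - \<eta>)<..<1 - \<eta>} y + (\<integral>\<^sup>+x. ?R ((x, y), z) * indicator (Omega \<eta>) (x, y) \<partial>lborel)" for y z
  proof (cases "\<bar>y\<bar> < 1 - \<eta>")
    case False
    then show ?thesis by (simp add: Omega_iff_x)
  next
    case True
    define b where "b = half_width \<eta> y"
    have b: "0 < b" "b \<le> 1" using half_width_ge[OF True] half_width_le[of y] eta by (auto simp: b_def)
    have i: "indicator (Omega \<eta>) (x, y) = (indicator {- b<..<b} x :: ennreal)" for x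
      using True by (auto simp: indicator_def Omega_iff_x b_def)
    have iy: "indicator {- (1 - \<eta>)<..<1 - \<eta>} y = (1 :: ennreal)" using True by (auto simp: indicator_def)
    have c: "continuous_on UNIV (\<lambda>t. partial ex w ((t, y), z))"
      by (rule continuous_on_compose2[OF C1_continuous_on_partial[OF w, of UNIV]]) (auto intro!: continuous_intros)
    have c': "continuous_on UNIV (\<lambda>t. w ((t, y), z))"
      by (rule continuous_on_compose2[OF C1_continuous_on[OF w, of UNIV]]) (auto intro!: continuous_intros)
    have [measurable]: "(\<lambda>t. partial ex w ((t, y), z)) \<in> borel_measurable borel" "(\<lambda>t. w ((t, y), z)) \<in> borel_measurable borel"
      using c c' by (auto intro: borel_measurable_continuous_onI)
    let ?J = "\<integral>\<^sup>+t\<in>{- b<..<b}. ennreal (2 * (norm (w ((t, y), z)) * norm (partial ex w ((t, y), z)))) \<partial>lborel"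
    have "2 * ?J = (\<integral>\<^sup>+t. 2 * (ennreal (2 * (norm (w ((t, y), z)) * norm (partial ex w ((t, y), z)))) * indicator {- b<..<b} t) \<partial>lborel)"
      by (rule nn_integral_cmult[symmetric]) simp
    also have "\<dots> \<le> (\<integral>\<^sup>+x. ?R ((x, y), z) * indicator {- b<..<b} x \<partial>lborel)"
    proof (rule nn_integral_mono)
      fix t
      \<comment> \<open>Young's inequality, weighted so as to produce the coefficient 1/2.\<close>
      have "2 * (2 * (m * n)) \<le> 1/2 * m\<^sup>2 + 8 * n\<^sup>2" for m n :: real
        using zero_le_power2[of "m - 4 * n"] by (simp add: power2_eq_square algebra_simps)
      then have "2 * ennreal (2 * (norm (w ((t, y), z)) * norm (partial ex w ((t, y), z)))) \<le> ?R ((t, y), z)"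
        by (subst ennreal_numeral[symmetric], subst ennreal_mult[symmetric], simp, simp, intro ennreal_leI)
      then show "2 * (ennreal (2 * (norm (w ((t, y), z)) * norm (partial ex w ((t, y), z)))) * indicator {- b<..<b} t)
         \<le> ?R ((t, y), z) * indicator {- b<..<b} t"
        by (auto simp: indicator_def)
    qed
    finally have J: "2 * ?J \<le> (\<integral>\<^sup>+x. ?R ((x, y), z) * indicator {- b<..<b} x \<partial>lborel)" .
    have "(\<integral>\<^sup>+x\<in>{- b<..<b}. ennreal ((norm (w ((x, y), z)))\<^sup>2) \<partial>lborel) \<le> (\<integral>\<^sup>+x\<in>{- b<..<b}. (?c y z + ?J) \<partial>lborel)"
    proof (rule nn_integral_mono)
      fix x
      show "ennreal ((norm (w ((x, y), z)))\<^sup>2) * indicator {- b<..<b} x \<le> (?c y z + ?J) * indicator {- b<..<b} x"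
        using square_norm_le_interval[OF C1_lines(1)[OF w] c, of x "- b" b "- b"] b
        by (auto simp: indicator_def b_def)
    qed
    also have "\<dots> = (?c y z + ?J) * ennreal (2 * b)"
      using b by (simp add: nn_integral_cmult_indicator)
    \<comment> \<open>Sections have length at most 2.\<close>
    also have "\<dots> \<le> (?c y z + ?J) * ennreal 2"
      using b by (intro mult_left_mono ennreal_leI) auto
    also have "\<dots> = 2 * ?c y z + 2 * ?J"
      by (simp add: distrib_right mult.commute)
    also have "\<dots> \<le> 2 * ?c y z + (\<integral>\<^sup>+x. ?R ((x, y), z) * indicator {- b<..<b} x \<partial>lborel)"
      by (intro add_left_mono J)
    finally show ?thesis unfolding i iy mult_1_right .
  qed
  have "(\<integral>\<^sup>+x. ennreal ((norm (w x))\<^sup>2) \<partial>volume_on V)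
      = (\<integral>\<^sup>+z\<in>{0<..<\<epsilon>}. (\<integral>\<^sup>+y. (\<integral>\<^sup>+x. ennreal ((norm (w ((x, y), z)))\<^sup>2) * indicator (Omega \<eta>) (x, y) \<partial>lborel) \<partial>lborel) \<partial>lborel)"
    by (subst V_nn_integral(1), simp, subst Omega_nn_integral(1), simp, rule refl)
  also have "\<dots> \<le> (\<integral>\<^sup>+z\<in>{0<..<\<epsilon>}. (\<integral>\<^sup>+y. 2 * ?c y z * indicator {- (1 - \<eta>)<..<1 - \<eta>} y
        + (\<integral>\<^sup>+x. ?R ((x, y), z) * indicator (Omega \<eta>) (x, y) \<partial>lborel) \<partial>lborel) \<partial>lborel)"
    by (intro nn_integral_mono mult_right_mono line) auto
  also have "\<dots> = (\<integral>\<^sup>+z. 2 * ((\<integral>\<^sup>+y\<in>{- (1 - \<eta>)<..<1 - \<eta>}. ?c y z \<partial>lborel) * indicator {0<..<\<epsilon>} z)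
        + (\<integral>\<^sup>+p\<in>Omega \<eta>. ?R (p, z) \<partial>lborel) * indicator {0<..<\<epsilon>} z \<partial>lborel)"
  proof (rule nn_integral_cong)
    fix z
    have 1: "(\<integral>\<^sup>+y. 2 * ?c y z * indicator {- (1 - \<eta>)<..<1 - \<eta>} y \<partial>lborel) = 2 * (\<integral>\<^sup>+y\<in>{- (1 - \<eta>)<..<1 - \<eta>}. ?c y z \<partial>lborel)"
      unfolding mult.assoc by (rule nn_integral_cmult) measurable
    have 2: "(\<integral>\<^sup>+y. (\<integral>\<^sup>+x. ?R ((x, y), z) * indicator (Omega \<eta>) (x, y) \<partial>lborel) \<partial>lborel) = (\<integral>\<^sup>+p\<in>Omega \<eta>. ?R (p, z) \<partial>lborel)"
      by (rule Omega_nn_integral(1)[symmetric]) simp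
    have "(\<integral>\<^sup>+y. 2 * ?c y z * indicator {- (1 - \<eta>)<..<1 - \<eta>} y
        + (\<integral>\<^sup>+x. ?R ((x, y), z) * indicator (Omega \<eta>) (x, y) \<partial>lborel) \<partial>lborel)
      = 2 * (\<integral>\<^sup>+y\<in>{- (1 - \<eta>)<..<1 - \<eta>}. ?c y z \<partial>lborel) + (\<integral>\<^sup>+p\<in>Omega \<eta>. ?R (p, z) \<partial>lborel)"
      unfolding 1[symmetric] 2[symmetric] by (rule nn_integral_add) measurable
    then show "(\<integral>\<^sup>+y. 2 * ?c y z * indicator {- (1 - \<eta>)<..<1 - \<eta>} y
        + (\<integral>\<^sup>+x. ?R ((x, y), z) * indicator (Omega \<eta>) (x, y) \<partial>lborel) \<partial>lborel) * indicator {0<..<\<epsilon>} z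
      = 2 * ((\<integral>\<^sup>+y\<in>{- (1 - \<eta>)<..<1 - \<eta>}. ?c y z \<partial>lborel) * indicator {0<..<\<epsilon>} z)
        + (\<integral>\<^sup>+p\<in>Omega \<eta>. ?R (p, z) \<partial>lborel) * indicator {0<..<\<epsilon>} z"
      by (simp only: distrib_right mult.assoc)
  qed
  also have "\<dots> = 2 * (\<integral>\<^sup>+z\<in>{0<..<\<epsilon>}. (\<integral>\<^sup>+y\<in>{- (1 - \<eta>)<..<1 - \<eta>}. ?c y z \<partial>lborel) \<partial>lborel) + (\<integral>\<^sup>+x. ?R x \<partial>volume_on V)"
  proof -
    have 1: "(\<integral>\<^sup>+z. 2 * ((\<integral>\<^sup>+y\<in>{- (1 - \<eta>)<..<1 - \<eta>}. ?c y z \<partial>lborel) * indicator {0<..<\<epsilon>} z) \<partial>lborel)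
       = 2 * (\<integral>\<^sup>+z\<in>{0<..<\<epsilon>}. (\<integral>\<^sup>+y\<in>{- (1 - \<eta>)<..<1 - \<eta>}. ?c y z \<partial>lborel) \<partial>lborel)"
      by (rule nn_integral_cmult) measurable
    have 2: "(\<integral>\<^sup>+x. ?R x \<partial>volume_on V) = (\<integral>\<^sup>+z\<in>{0<..<\<epsilon>}. (\<integral>\<^sup>+p\<in>Omega \<eta>. ?R (p, z) \<partial>lborel) \<partial>lborel)"
      by (rule V_nn_integral(1)) simp
    show ?thesis
      unfolding 1[symmetric] 2 by (rule nn_integral_add) measurable
  qed
  \<comment> \<open>In the lateral integral z is the inner variable, in the volume integral the
    outer one.\<close>
  also have swap: "(\<integral>\<^sup>+z\<in>{0<..<\<epsilon>}. (\<integral>\<^sup>+y\<in>{- (1 - \<eta>)<..<1 - \<eta>}. ?c y z \<partial>lborel) \<partial>lborel)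
     = (\<integral>\<^sup>+y\<in>{- (1 - \<eta>)<..<1 - \<eta>}. (\<integral>\<^sup>+z\<in>{0<..<\<epsilon>}. ?c y z \<partial>lborel) \<partial>lborel)"
  proof -
    let ?h = "\<lambda>y z. ?c y z * indicator {- (1 - \<eta>)<..<1 - \<eta>} y * indicator {0<..<\<epsilon>} z"
    have "(\<integral>\<^sup>+z. (\<integral>\<^sup>+y. ?h y z \<partial>lborel) \<partial>lborel) = (\<integral>\<^sup>+y. (\<integral>\<^sup>+z. ?h y z \<partial>lborel) \<partial>lborel)"
      by (rule lborel_pair.Fubini') measurable
    also have "(\<integral>\<^sup>+y. (\<integral>\<^sup>+z. ?h y z \<partial>lborel) \<partial>lborel)
        = (\<integral>\<^sup>+y\<in>{- (1 - \<eta>)<..<1 - \<eta>}. (\<integral>\<^sup>+z\<in>{0<..<\<epsilon>}. ?c y z \<partial>lborel) \<partial>lborel)"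
      by (intro nn_integral_cong, subst nn_integral_multc[symmetric]) (auto simp: mult_ac)
    also have "(\<integral>\<^sup>+z. (\<integral>\<^sup>+y. ?h y z \<partial>lborel) \<partial>lborel)
        = (\<integral>\<^sup>+z\<in>{0<..<\<epsilon>}. (\<integral>\<^sup>+y\<in>{- (1 - \<eta>)<..<1 - \<eta>}. ?c y z \<partial>lborel) \<partial>lborel)"
      by (intro nn_integral_cong, rule nn_integral_multc) measurable
    finally show ?thesis .
  qed
  also have "\<dots> \<le> (\<integral>\<^sup>+x. ennreal ((norm (w x))\<^sup>2) \<partial>lateral_measure \<eta> \<epsilon>)"
    by (subst lateral_nn_integral, simp)
       (rule left_boundary_le[where F="\<lambda>p. \<integral>\<^sup>+z\<in>{0<..<\<epsilon>}. ennreal ((norm (w (p, z)))\<^sup>2) \<partial>lborel"], measurable)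
  finally show ?thesis by (simp add: mult_left_mono add_right_mono)
qed

section \<open>The embedding into L^4\<close>

lemma ennreal_add_square_le: "(a + b)\<^sup>2 \<le> 4 * (a\<^sup>2 + b\<^sup>2)" for a b :: ennreal
proof -
  have "a + b \<le> 2 * max a b" by (simp add: mult_2 add_mono)
  then have "(a + b)\<^sup>2 \<le> (2 * max a b)\<^sup>2" by (rule power_mono) simp
  also have "\<dots> = 4 * (max a b)\<^sup>2" by (simp add: power_mult_distrib)
  also have "\<dots> \<le> 4 * (a\<^sup>2 + b\<^sup>2)"
    by (intro mult_left_mono) (auto simp: max_def add_increasing add_increasing2)
  finally show ?thesis .
qed

text \<open>The larger of a and b decides; the usual argument through the square of
  \<open>a - b\<close> would subtract possibly infinite values.\<close>

lemma ennreal_mult_le_square_bound: "a * b \<le> c" if "a\<^sup>2 \<le> c" "b\<^sup>2 \<le> c" for a b c :: ennreal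
proof (cases "a \<le> b")
  case True
  then have "a * b \<le> b\<^sup>2" by (simp add: power2_eq_square mult_right_mono)
  then show ?thesis using that by simp
next
  case False
  then have "a * b \<le> a\<^sup>2" by (simp add: power2_eq_square mult_left_mono)
  then show ?thesis using that by simp
qed

text \<open>The squared norm of u at (x, y) is bounded by a function of y alone and also by a
  function of x alone, so the integral of the fourth power is at most the product of their
  integrals. Each of these is then estimated by Cauchy-Schwarz.\<close>

lemma Ladyzhenskaya_nn:
  fixes u :: "real \<times> real \<Rightarrow> 'b::euclidean_space"
  assumes u: "continuous_on UNIV u"
    and ux: "continuous_on UNIV ux" "\<And>x y. ((\<lambda>t. u (t, y)) has_vector_derivative ux (x, y)) (at x)"
    and uy: "continuous_on UNIV uy" "\<And>x y. ((\<lambda>t. u (x, t)) has_vector_derivative uy (x, y)) (at y)"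
  defines "m \<equiv> \<integral>\<^sup>+p\<in>Omega \<eta>. ennreal ((norm (u p))\<^sup>2) \<partial>lborel"
    and "d \<equiv> \<integral>\<^sup>+p\<in>Omega \<eta>. ennreal ((norm (ux p))\<^sup>2 + (norm (uy p))\<^sup>2) \<partial>lborel"
  shows "(\<integral>\<^sup>+p\<in>Omega \<eta>. ennreal ((norm (u p)) ^ 4) \<partial>lborel) \<le> ennreal (4 * (1 / (2 * \<eta>))\<^sup>2 + 16) * (m * (m + d))"
proof -
  have b [measurable]: "u \<in> borel_measurable borel" "ux \<in> borel_measurable borel" "uy \<in> borel_measurable borel"
    using u ux(1) uy(1) by (auto intro: borel_measurable_continuous_onI)
  have b2 [measurable]: "u \<in> borel_measurable (borel \<Otimes>\<^sub>M borel)" "ux \<in> borel_measurable (borel \<Otimes>\<^sub>M borel)"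
      "uy \<in> borel_measurable (borel \<Otimes>\<^sub>M borel)" "Omega \<eta> \<in> sets (borel \<Otimes>\<^sub>M borel)"
    using b Omega_borel by (simp_all only: borel_prod)
  \<comment> \<open>The reciprocal of a lower bound for the length of all sections.\<close>
  define c where "c = 1 / (2 * \<eta>)"
  have c0: "c \<ge> 0" using eta by (simp add: c_def)
  let ?f = "\<lambda>v p. ennreal (c * (norm (u p))\<^sup>2 + 2 * (norm (u p) * norm (v p :: 'b)))"
  define a1 where "a1 y = (\<integral>\<^sup>+x. ?f ux (x, y) * indicator (Omega \<eta>) (x, y) \<partial>lborel)" for y
  define a2 where "a2 x = (\<integral>\<^sup>+y. ?f uy (x, y) * indicator (Omega \<eta>) (x, y) \<partial>lborel)" for x
  have a12 [measurable]: "a1 \<in> borel_measurable borel" "a2 \<in> borel_measurable borel"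
    unfolding a1_def[abs_def] a2_def[abs_def] by measurable
  have 1: "ennreal ((norm (u (x, y)))\<^sup>2) \<le> a1 y" if "(x, y) \<in> Omega \<eta>" for x y
  proof -
    have y: "\<bar>y\<bar> < 1 - \<eta>" and x: "x \<in> {- half_width \<eta> y<..<half_width \<eta> y}" using that by (auto simp: Omega_iff_x)
    have cx: "continuous_on UNIV (\<lambda>t. ux (t, y))"
      by (rule continuous_on_compose2[OF ux(1)]) (auto intro!: continuous_intros)
    have "ennreal ((norm (u (x, y)))\<^sup>2) \<le> (\<integral>\<^sup>+t\<in>{- half_width \<eta> y<..<half_width \<eta> y}. ennreal (1 / (2 * \<eta>) * (norm (u (t, y)))\<^sup>2
        + 2 * (norm (u (t, y)) * norm (ux (t, y)))) \<partial>lborel)"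
      by (rule square_norm_le_mean[OF ux(2) cx]) (use x half_width_ge[OF y] eta in auto)
    also have "\<dots> = a1 y"
      unfolding a1_def using y by (intro nn_integral_cong) (auto simp: indicator_def Omega_iff_x c_def)
    finally show ?thesis .
  qed
  have 2: "ennreal ((norm (u (x, y)))\<^sup>2) \<le> a2 x" if "(x, y) \<in> Omega \<eta>" for x y
  proof -
    have x: "\<bar>x\<bar> < 1 - \<eta>" and y: "y \<in> {- half_width \<eta> x<..<half_width \<eta> x}" using that by (auto simp: Omega_iff_y)
    have cy: "continuous_on UNIV (\<lambda>t. uy (x, t))"
      by (rule continuous_on_compose2[OF uy(1)]) (auto intro!: continuous_intros)
    have "ennreal ((norm (u (x, y)))\<^sup>2) \<le> (\<integral>\<^sup>+t\<in>{- half_width \<eta> x<..<half_width \<eta> x}. ennreal (1 / (2 * \<eta>) * (norm (u (x, t)))\<^sup>2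
        + 2 * (norm (u (x, t)) * norm (uy (x, t)))) \<partial>lborel)"
      by (rule square_norm_le_mean[OF uy(2) cy]) (use y half_width_ge[OF x] eta in auto)
    also have "\<dots> = a2 x"
      unfolding a2_def using x by (intro nn_integral_cong) (auto simp: indicator_def Omega_iff_y c_def)
    finally show ?thesis .
  qed
  have "(\<integral>\<^sup>+p\<in>Omega \<eta>. ennreal ((norm (u p)) ^ 4) \<partial>lborel)
      = (\<integral>\<^sup>+y. (\<integral>\<^sup>+x. ennreal ((norm (u (x, y))) ^ 4) * indicator (Omega \<eta>) (x, y) \<partial>lborel) \<partial>lborel)"
    by (rule Omega_nn_integral(1)) simp
  also have "\<dots> \<le> (\<integral>\<^sup>+y. (\<integral>\<^sup>+x. a1 y * a2 x \<partial>lborel) \<partial>lborel)"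
  proof (intro nn_integral_mono)
    fix y x
    show "ennreal ((norm (u (x, y))) ^ 4) * indicator (Omega \<eta>) (x, y) \<le> a1 y * a2 x"
    proof (cases "(x, y) \<in> Omega \<eta>")
      case True
      have "ennreal ((norm (u (x, y))) ^ 4) = ennreal ((norm (u (x, y)))\<^sup>2) * ennreal ((norm (u (x, y)))\<^sup>2)"
        by (simp flip: ennreal_mult power_add)
      then show ?thesis using True mult_mono[OF 1[OF True] 2[OF True]] by simp
    qed simp
  qed
  also have "\<dots> = (\<integral>\<^sup>+y. a1 y \<partial>lborel) * (\<integral>\<^sup>+x. a2 x \<partial>lborel)"
    by (simp add: nn_integral_cmult nn_integral_multc)
  also have "(\<integral>\<^sup>+y. a1 y \<partial>lborel) = (\<integral>\<^sup>+p\<in>Omega \<eta>. ?f ux p \<partial>lborel)"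
    unfolding a1_def by (rule Omega_nn_integral(1)[symmetric]) simp
  also have "(\<integral>\<^sup>+x. a2 x \<partial>lborel) = (\<integral>\<^sup>+p\<in>Omega \<eta>. ?f uy p \<partial>lborel)"
    unfolding a2_def by (rule Omega_nn_integral(2)[symmetric]) simp
  also have "(\<integral>\<^sup>+p\<in>Omega \<eta>. ?f ux p \<partial>lborel) * (\<integral>\<^sup>+p\<in>Omega \<eta>. ?f uy p \<partial>lborel)
      \<le> ennreal (4 * c\<^sup>2 + 16) * (m * (m + d))"
  proof (rule ennreal_mult_le_square_bound)
    \<comment> \<open>One bound serves both factors, as the derivatives enter only through being
      dominated by the integrand of d.\<close>
    have *: "(\<integral>\<^sup>+p\<in>Omega \<eta>. ?f v p \<partial>lborel)\<^sup>2 \<le> ennreal (4 * c\<^sup>2 + 16) * (m * (m + d))"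
      if v [measurable]: "v \<in> borel_measurable borel" and vd: "\<And>p. (norm (v p))\<^sup>2 \<le> (norm (ux p))\<^sup>2 + (norm (uy p))\<^sup>2" for v
    proof -
      define I where "I = (\<integral>\<^sup>+p. (ennreal (norm (u p)) * indicator (Omega \<eta>) p) * (ennreal (norm (v p)) * indicator (Omega \<eta>) p) \<partial>lborel)"
      have "I\<^sup>2 \<le> (\<integral>\<^sup>+p. (ennreal (norm (u p)) * indicator (Omega \<eta>) p)\<^sup>2 \<partial>lborel) * (\<integral>\<^sup>+p. (ennreal (norm (v p)) * indicator (Omega \<eta>) p)\<^sup>2 \<partial>lborel)"
        unfolding I_def by (rule Cauchy_Schwarz_nn_integral) simp_all
      also have "(\<integral>\<^sup>+p. (ennreal (norm (u p)) * indicator (Omega \<eta>) p)\<^sup>2 \<partial>lborel) = m"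
        unfolding m_def by (intro nn_integral_cong) (auto simp: indicator_def ennreal_power)
      also have "(\<integral>\<^sup>+p. (ennreal (norm (v p)) * indicator (Omega \<eta>) p)\<^sup>2 \<partial>lborel) \<le> d"
        unfolding d_def by (intro nn_integral_mono) (auto simp: indicator_def ennreal_power vd simp del: ennreal_plus intro!: ennreal_leI)
      finally have I: "I\<^sup>2 \<le> m * d" by (simp add: mult_left_mono)
      have "(\<integral>\<^sup>+p\<in>Omega \<eta>. ?f v p \<partial>lborel) = (\<integral>\<^sup>+p. ennreal c * (ennreal ((norm (u p))\<^sup>2) * indicator (Omega \<eta>) p)
          + 2 * ((ennreal (norm (u p)) * indicator (Omega \<eta>) p) * (ennreal (norm (v p)) * indicator (Omega \<eta>) p)) \<partial>lborel)"
        using c0 by (intro nn_integral_cong) (auto simp: indicator_def ennreal_mult)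
      also have "\<dots> = ennreal c * m + 2 * I"
        unfolding m_def I_def by (subst nn_integral_add) (auto simp: nn_integral_cmult)
      finally have e: "(\<integral>\<^sup>+p\<in>Omega \<eta>. ?f v p \<partial>lborel) = ennreal c * m + 2 * I" .
      have "(\<integral>\<^sup>+p\<in>Omega \<eta>. ?f v p \<partial>lborel)\<^sup>2 \<le> 4 * ((ennreal c * m)\<^sup>2 + (2 * I)\<^sup>2)"
        unfolding e by (rule ennreal_add_square_le)
      also have "\<dots> \<le> 4 * (ennreal (c\<^sup>2) * (m * m) + 4 * (m * d))"
        using I c0 by (intro mult_left_mono add_mono) (auto simp: power_mult_distrib ennreal_power power2_eq_square[of m] intro: mult_left_mono)
      also have "\<dots> \<le> 4 * (ennreal (c\<^sup>2) * (m * (m + d)) + 4 * (m * (m + d)))"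
        by (intro mult_left_mono add_mono) (auto simp: add_increasing add_increasing2)
      also have "\<dots> = (4 * ennreal (c\<^sup>2) + 16) * (m * (m + d))"
        by (simp add: distrib_left distrib_right mult.assoc)
      also have "4 * ennreal (c\<^sup>2) + 16 = ennreal (4 * c\<^sup>2 + 16)"
        by (simp add: ennreal_mult)
      finally show ?thesis .
    qed
    show "(\<integral>\<^sup>+p\<in>Omega \<eta>. ?f ux p \<partial>lborel)\<^sup>2 \<le> ennreal (4 * c\<^sup>2 + 16) * (m * (m + d))"
      by (rule *) simp_all
    show "(\<integral>\<^sup>+p\<in>Omega \<eta>. ?f uy p \<partial>lborel)\<^sup>2 \<le> ennreal (4 * c\<^sup>2 + 16) * (m * (m + d))"
      by (rule *) simp_all
  qed
  finally show ?thesis by (simp only: c_def)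
qed

text \<open>The planar inequality on every horizontal slice. The first factor is bounded uniformly
  in z by \<open>slab_le\<close>, so only the second is integrated in z; each yields one full
  norm.\<close>

lemma Sobolev_nn:
  fixes w :: "point \<Rightarrow> 'b::euclidean_space"
  assumes w: "continuously_differentiable w"
  defines "N \<equiv> \<integral>\<^sup>+x. ennreal ((norm (w x))\<^sup>2 + ((norm (partial ex w x))\<^sup>2 + (norm (partial ey w x))\<^sup>2 + (norm (partial ez w x))\<^sup>2)) \<partial>volume_on V"
  shows "(\<integral>\<^sup>+x. ennreal ((norm (w x)) ^ 4) \<partial>volume_on V) \<le> ennreal ((4 * (1 / (2 * \<eta>))\<^sup>2 + 16) * (1 / \<epsilon> + 1)) * N\<^sup>2"
proof -
  note [measurable] = C1_borel[OF w]
  let ?K = "ennreal (4 * (1 / (2 * \<eta>))\<^sup>2 + 16)" and ?c = "ennreal (1 / \<epsilon> + 1)"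
  define m where "m z = (\<integral>\<^sup>+p\<in>Omega \<eta>. ennreal ((norm (w (p, z)))\<^sup>2) \<partial>lborel)" for z
  define d where "d z = (\<integral>\<^sup>+p\<in>Omega \<eta>. ennreal ((norm (partial ex w (p, z)))\<^sup>2 + (norm (partial ey w (p, z)))\<^sup>2) \<partial>lborel)" for z
  have m: "m z \<le> ?c * N" if "z \<in> {0<..<\<epsilon>}" for z
  proof -
    have "m z \<le> ?c * (\<integral>\<^sup>+x. ennreal ((norm (w x))\<^sup>2 + (norm (partial ez w x))\<^sup>2) \<partial>volume_on V)"
      unfolding m_def using that by (intro slab_le w) auto
    also have "\<dots> \<le> ?c * N"
      unfolding N_def by (intro mult_left_mono nn_integral_mono ennreal_leI) auto
    finally show ?thesis .
  qed
  have L: "(\<integral>\<^sup>+p\<in>Omega \<eta>. ennreal ((norm (w (p, z))) ^ 4) \<partial>lborel) \<le> ?K * (m z * (m z + d z))" for z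
    unfolding m_def d_def
  proof (rule Ladyzhenskaya_nn)
    show "continuous_on UNIV (\<lambda>p. w (p, z))"
      by (rule continuous_on_compose2[OF C1_continuous_on[OF w, of UNIV]]) (auto intro!: continuous_intros)
    show "continuous_on UNIV (\<lambda>p. partial ex w (p, z))" "continuous_on UNIV (\<lambda>p. partial ey w (p, z))"
      by (rule continuous_on_compose2[OF C1_continuous_on_partial[OF w, of UNIV]]; auto intro!: continuous_intros)+
  qed (rule C1_lines[OF w])+
  have "(\<integral>\<^sup>+x. ennreal ((norm (w x)) ^ 4) \<partial>volume_on V)
     = (\<integral>\<^sup>+z\<in>{0<..<\<epsilon>}. (\<integral>\<^sup>+p\<in>Omega \<eta>. ennreal ((norm (w (p, z))) ^ 4) \<partial>lborel) \<partial>lborel)"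
    by (rule V_nn_integral(1)) simp
  also have "\<dots> \<le> (\<integral>\<^sup>+z. (?K * (?c * N)) * ((m z + d z) * indicator {0<..<\<epsilon>} z) \<partial>lborel)"
  proof (rule nn_integral_mono)
    fix z
    have "?K * (m z * (m z + d z)) \<le> ?K * ((?c * N) * (m z + d z))" if "z \<in> {0<..<\<epsilon>}"
      by (intro mult_left_mono mult_right_mono m that) auto
    then show "(\<integral>\<^sup>+p\<in>Omega \<eta>. ennreal ((norm (w (p, z))) ^ 4) \<partial>lborel) * indicator {0<..<\<epsilon>} z
        \<le> (?K * (?c * N)) * ((m z + d z) * indicator {0<..<\<epsilon>} z)"
      using L[of z] by (auto simp: indicator_def mult.assoc intro: order_trans)
  qed
  also have "\<dots> = (?K * (?c * N)) * (\<integral>\<^sup>+z\<in>{0<..<\<epsilon>}. (m z + d z) \<partial>lborel)"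
    unfolding m_def d_def by (rule nn_integral_cmult) measurable
  also have "(\<integral>\<^sup>+z\<in>{0<..<\<epsilon>}. (m z + d z) \<partial>lborel)
     = (\<integral>\<^sup>+x. ennreal ((norm (w x))\<^sup>2 + ((norm (partial ex w x))\<^sup>2 + (norm (partial ey w x))\<^sup>2)) \<partial>volume_on V)"
    unfolding m_def d_def
    by (subst V_nn_integral(1), simp, intro nn_integral_cong arg_cong2[where f="(*)"] refl, subst nn_integral_add[symmetric])
       (auto simp: indicator_def intro!: nn_integral_cong)
  also have "(?K * (?c * N)) * \<dots> \<le> (?K * (?c * N)) * N"
    unfolding N_def by (intro mult_left_mono nn_integral_mono ennreal_leI) auto
  also have "\<dots> = ennreal ((4 * (1 / (2 * \<eta>))\<^sup>2 + 16) * (1 / \<epsilon> + 1)) * N\<^sup>2"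
    using eps by (subst ennreal_mult) (simp_all add: power2_eq_square mult.assoc)
  finally show ?thesis .
qed

end

section \<open>Traces\<close>

lemma tendsto_0_dominated:
  fixes f g :: "nat \<Rightarrow> real"
  assumes "\<And>k. 0 \<le> f k" "\<And>k. f k \<le> g k" "g \<longlonglongrightarrow> 0"
  shows "f \<longlonglongrightarrow> 0"
  by (rule tendsto_sandwich[OF _ _ tendsto_const assms(3)]) (simp_all add: assms)

context square_well
begin

abbreviation nV :: "(point \<Rightarrow> 'b::euclidean_space) \<Rightarrow> real" where "nV \<equiv> L2_norm (volume_on V)"
abbreviation nL :: "(point \<Rightarrow> 'b::euclidean_space) \<Rightarrow> real" where "nL \<equiv> L2_norm (lateral_measure \<eta> \<epsilon>)"
abbreviation nG :: "(point \<Rightarrow> 'b::euclidean_space) \<Rightarrow> real" where "nG \<equiv> L2_norm (Gamma_measure \<eta> \<epsilon>)"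

section \<open>The inequalities for C^1 fields in terms of norms\<close>

lemma nn_integral_square_norm:
  fixes f :: "point \<Rightarrow> 'b::euclidean_space"
  assumes "f \<in> L2_space M"
  shows "(\<integral>\<^sup>+x. ennreal ((norm (f x))\<^sup>2) \<partial>M) = ennreal ((L2_norm M f)\<^sup>2)"
  using nn_integral_eq_integral[OF L2_spaceD(2)[OF assms]] by (simp add: L2_norm_power2)

lemma C1_L2_space:
  assumes "continuously_differentiable w"
  shows "w \<in> L2_space (volume_on V)" "partial e w \<in> L2_space (volume_on V)"
    "w \<in> L2_space (lateral_measure \<eta> \<epsilon>)" "w \<in> L2_space (Gamma_measure \<eta> \<epsilon>)"
  using V.C1_L2[OF assms] continuous_L2[OF bfm_lateral] continuous_L2[OF bfm_Gamma] C1_continuous_on[OF assms]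
  by blast+

text \<open>All norms of a C^1 field are finite, so half of the left side can now be absorbed, which
  doubles the constants.\<close>

lemma Poincare:
  fixes w :: "point \<Rightarrow> 'b::euclidean_space"
  assumes w: "continuously_differentiable w"
  shows "(nV w)\<^sup>2 \<le> 4 * (nL w)\<^sup>2 + 16 * (nV (partial ex w))\<^sup>2"
proof -
  note L = C1_L2_space[OF w]
  have i: "integrable (volume_on V) (\<lambda>x. 1/2 * (norm (w x))\<^sup>2 + 8 * (norm (partial ex w x))\<^sup>2)"
    using L2_spaceD(2)[OF L(1)] L2_spaceD(2)[OF L(2)[of ex]] by simp
  have e: "(\<integral>x. 1/2 * (norm (w x))\<^sup>2 + 8 * (norm (partial ex w x))\<^sup>2 \<partial>volume_on V) = 1/2 * (nV w)\<^sup>2 + 8 * (nV (partial ex w))\<^sup>2"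
    using L2_spaceD(2)[OF L(1)] L2_spaceD(2)[OF L(2)[of ex]] by (simp add: L2_norm_power2)
  have "(\<integral>\<^sup>+x. ennreal (1/2 * (norm (w x))\<^sup>2 + 8 * (norm (partial ex w x))\<^sup>2) \<partial>volume_on V)
     = ennreal (1/2 * (nV w)\<^sup>2 + 8 * (nV (partial ex w))\<^sup>2)"
    unfolding e[symmetric] by (rule nn_integral_eq_integral[OF i]) simp
  with Poincare_nn[OF w] have "ennreal ((nV w)\<^sup>2) \<le> 2 * ennreal ((nL w)\<^sup>2) + ennreal (1/2 * (nV w)\<^sup>2 + 8 * (nV (partial ex w))\<^sup>2)"
    using nn_integral_square_norm[OF L(1)] nn_integral_square_norm[OF L(3)] by simp
  also have "\<dots> = ennreal (2 * (nL w)\<^sup>2 + (1/2 * (nV w)\<^sup>2 + 8 * (nV (partial ex w))\<^sup>2))"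
    by (simp add: ennreal_mult)
  finally have "(nV w)\<^sup>2 \<le> 2 * (nL w)\<^sup>2 + (1/2 * (nV w)\<^sup>2 + 8 * (nV (partial ex w))\<^sup>2)"
    by (subst (asm) ennreal_le_iff) auto
  then show ?thesis by simp
qed

text \<open>Each of the two faces contributes the constant of \<open>slab_le\<close>.\<close>

lemma trace_Gamma_le:
  fixes w :: "point \<Rightarrow> 'b::euclidean_space"
  assumes w: "continuously_differentiable w"
  shows "(nG w)\<^sup>2 \<le> 2 * (1 / \<epsilon> + 1) * ((nV w)\<^sup>2 + (nV (partial ez w))\<^sup>2)"
proof -
  note L = C1_L2_space[OF w]
  have m: "(\<lambda>x. ennreal ((norm (w x))\<^sup>2)) \<in> borel_measurable borel" using C1_borel[OF w] by simp
  have i: "integrable (volume_on V) (\<lambda>x. (norm (w x))\<^sup>2 + (norm (partial ez w x))\<^sup>2)"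
    using L2_spaceD(2)[OF L(1)] L2_spaceD(2)[OF L(2)[of ez]] by simp
  have e: "(\<integral>x. (norm (w x))\<^sup>2 + (norm (partial ez w x))\<^sup>2 \<partial>volume_on V) = (nV w)\<^sup>2 + (nV (partial ez w))\<^sup>2"
    using L2_spaceD(2)[OF L(1)] L2_spaceD(2)[OF L(2)[of ez]] by (simp add: L2_norm_power2)
  have N: "(\<integral>\<^sup>+x. ennreal ((norm (w x))\<^sup>2 + (norm (partial ez w x))\<^sup>2) \<partial>volume_on V) = ennreal ((nV w)\<^sup>2 + (nV (partial ez w))\<^sup>2)"
    unfolding e[symmetric] by (rule nn_integral_eq_integral[OF i]) simp
  have "ennreal ((nG w)\<^sup>2) = (\<integral>\<^sup>+x. ennreal ((norm (w x))\<^sup>2) \<partial>Gamma_measure \<eta> \<epsilon>)"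
    using nn_integral_square_norm[OF L(4)] by simp
  also have "\<dots> \<le> ennreal (1 / \<epsilon> + 1) * ennreal ((nV w)\<^sup>2 + (nV (partial ez w))\<^sup>2)
       + ennreal (1 / \<epsilon> + 1) * ennreal ((nV w)\<^sup>2 + (nV (partial ez w))\<^sup>2)"
    unfolding Gamma_nn_integral[OF m] N[symmetric]
    by (intro add_mono slab_le w) (use eps in auto)
  also have "\<dots> = ennreal (2 * (1 / \<epsilon> + 1) * ((nV w)\<^sup>2 + (nV (partial ez w))\<^sup>2))"
  proof -
    have n: "0 \<le> 1 / \<epsilon> + 1" "0 \<le> (1 / \<epsilon> + 1) * ((nV w)\<^sup>2 + (nV (partial ez w))\<^sup>2)" using eps by auto
    then have "ennreal (1 / \<epsilon> + 1) * ennreal ((nV w)\<^sup>2 + (nV (partial ez w))\<^sup>2) = ennreal ((1 / \<epsilon> + 1) * ((nV w)\<^sup>2 + (nV (partial ez w))\<^sup>2))"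
      by (intro ennreal_mult[symmetric]) auto
    then show ?thesis
      by (simp only: ennreal_plus[OF n(2) n(2), symmetric] mult.assoc mult_2) (simp only: distrib_right)
  qed
  finally show ?thesis using eps by (subst (asm) ennreal_le_iff) auto
qed

abbreviation gradsq :: "(point \<Rightarrow> point \<Rightarrow> 'b::euclidean_space) \<Rightarrow> real" where
  "gradsq v \<equiv> (\<Sum>e\<in>Basis. (nV (v e))\<^sup>2)"

definition Sob :: real where "Sob = (4 * (1 / (2 * \<eta>))\<^sup>2 + 16) * (1 / \<epsilon> + 1)"

lemma Sob_nonneg: "0 \<le> Sob" using eps by (simp add: Sob_def)

lemma Sobolev:
  fixes w :: "point \<Rightarrow> 'b::euclidean_space"
  assumes w: "continuously_differentiable w"
  shows "(\<integral>\<^sup>+x. ennreal ((norm (w x)) ^ 4) \<partial>volume_on V) \<le> ennreal (Sob * ((nV w)\<^sup>2 + gradsq (\<lambda>e. partial e w))\<^sup>2)"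
proof -
  note L = C1_L2_space[OF w]
  let ?f = "\<lambda>x. (norm (w x))\<^sup>2 + ((norm (partial ex w x))\<^sup>2 + (norm (partial ey w x))\<^sup>2 + (norm (partial ez w x))\<^sup>2)"
  have i: "integrable (volume_on V) ?f"
    using L2_spaceD(2)[OF L(1)] L2_spaceD(2)[OF L(2)[of ex]] L2_spaceD(2)[OF L(2)[of ey]] L2_spaceD(2)[OF L(2)[of ez]]
    by simp
  have "(\<integral>x. ?f x \<partial>volume_on V) = (nV w)\<^sup>2 + gradsq (\<lambda>e. partial e w)"
    using L2_spaceD(2)[OF L(1)] L2_spaceD(2)[OF L(2)[of ex]] L2_spaceD(2)[OF L(2)[of ey]] L2_spaceD(2)[OF L(2)[of ez]]
    by (simp add: L2_norm_power2 sum_Basis_point)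
  moreover have "(\<integral>\<^sup>+x. ennreal (?f x) \<partial>volume_on V) = ennreal (\<integral>x. ?f x \<partial>volume_on V)"
    by (rule nn_integral_eq_integral[OF i]) simp
  ultimately have "(\<integral>\<^sup>+x. ennreal (?f x) \<partial>volume_on V) = ennreal ((nV w)\<^sup>2 + gradsq (\<lambda>e. partial e w))"
    by simp
  then show ?thesis
    using Sobolev_nn[OF w] Sob_nonneg unfolding Sob_def[symmetric]
    by (simp add: ennreal_power sum_nonneg ennreal_mult del: ennreal_plus)
qed

text \<open>A single C^1 sequence with values in \<open>S0\<close> at every point witnesses the
  field u, its gradient v and both traces g and G at once. What holds for C^1 fields then passes to
  the limit in one go, and gradient and traces are carried as data instead of being chosen.\<close>

definition traced :: "(nat \<Rightarrow> point \<Rightarrow> real^3^3) \<Rightarrow> (point \<Rightarrow> real^3^3) \<Rightarrow> (point \<Rightarrow> point \<Rightarrow> real^3^3)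
     \<Rightarrow> (point \<Rightarrow> real^3^3) \<Rightarrow> (point \<Rightarrow> real^3^3) \<Rightarrow> bool" where
  "traced w u v g G \<longleftrightarrow> (\<forall>k. continuously_differentiable (w k)) \<and> (\<forall>k x. w k x \<in> S0) \<and>
     u \<in> L2_space (volume_on V) \<and> (\<forall>e\<in>Basis. v e \<in> L2_space (volume_on V)) \<and>
     g \<in> L2_space (lateral_measure \<eta> \<epsilon>) \<and> G \<in> L2_space (Gamma_measure \<eta> \<epsilon>) \<and>
     (\<lambda>k. nV (\<lambda>x. w k x - u x)) \<longlonglongrightarrow> 0 \<and>
     (\<forall>e\<in>Basis. (\<lambda>k. nV (\<lambda>x. partial e (w k) x - v e x)) \<longlonglongrightarrow> 0) \<and>
     (\<lambda>k. nL (\<lambda>x. w k x - g x)) \<longlonglongrightarrow> 0 \<and> (\<lambda>k. nG (\<lambda>x. w k x - G x)) \<longlonglongrightarrow> 0"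

lemma tracedD:
  assumes "traced w u v g G"
  shows "\<And>k. continuously_differentiable (w k)" "\<And>k x. w k x \<in> S0"
    "u \<in> L2_space (volume_on V)" "\<And>e. e \<in> Basis \<Longrightarrow> v e \<in> L2_space (volume_on V)"
    "g \<in> L2_space (lateral_measure \<eta> \<epsilon>)" "G \<in> L2_space (Gamma_measure \<eta> \<epsilon>)"
    "(\<lambda>k. nV (\<lambda>x. w k x - u x)) \<longlonglongrightarrow> 0"
    "\<And>e. e \<in> Basis \<Longrightarrow> (\<lambda>k. nV (\<lambda>x. partial e (w k) x - v e x)) \<longlonglongrightarrow> 0"
    "(\<lambda>k. nL (\<lambda>x. w k x - g x)) \<longlonglongrightarrow> 0" "(\<lambda>k. nG (\<lambda>x. w k x - G x)) \<longlonglongrightarrow> 0"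
  using assms by (auto simp: traced_def)

text \<open>The projection fixes every \<open>w k\<close>, so the difference between u and its
  projection is controlled by the distance from u to \<open>w k\<close>, which tends to
  zero.\<close>

lemma AE_S0_of_L2_limit:
  assumes w: "\<And>k. w k \<in> L2_space M" "\<And>k x. w k x \<in> S0" and u: "u \<in> L2_space M"
    and lim: "(\<lambda>k. L2_norm M (\<lambda>x. w k x - u x)) \<longlonglongrightarrow> 0"
  shows "AE x in M. u x \<in> S0"
proof -
  note bl = bounded_linear_S0_proj
  have pu: "(\<lambda>x. S0_proj (u x)) \<in> L2_space M" by (rule L2_space_linear[OF u bl])
  have "L2_norm M (\<lambda>x. S0_proj (u x) - u x) \<le> (onorm S0_proj + 1) * L2_norm M (\<lambda>x. w k x - u x)" for k
  proof -
    have "L2_norm M (\<lambda>x. S0_proj (u x) - u x)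
       \<le> L2_norm M (\<lambda>x. S0_proj (u x) - w k x) + L2_norm M (\<lambda>x. w k x - u x)"
      by (rule L2_norm_triangle_diff[OF pu w(1) u])
    also have "(\<lambda>x. S0_proj (u x) - w k x) = (\<lambda>x. S0_proj (u x - w k x))"
      using w(2) by (simp add: linear_simps(2)[OF bl] S0_proj_id)
    also have "L2_norm M (\<lambda>x. S0_proj (u x - w k x)) \<le> onorm S0_proj * L2_norm M (\<lambda>x. u x - w k x)"
      by (rule L2_norm_linear[OF L2_space_diff[OF u w(1)] bl])
    finally show ?thesis by (simp add: L2_norm_minus_commute[of M u] distrib_right)
  qed
  moreover have "(\<lambda>k. (onorm S0_proj + 1) * L2_norm M (\<lambda>x. w k x - u x)) \<longlonglongrightarrow> (onorm S0_proj + 1) * 0"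
    by (intro tendsto_intros lim)
  ultimately have "L2_norm M (\<lambda>x. S0_proj (u x) - u x) \<le> 0"
    by (intro LIMSEQ_le_const[where X="\<lambda>k. (onorm S0_proj + 1) * L2_norm M (\<lambda>x. w k x - u x)"]) auto
  then have "AE x in M. S0_proj (u x) - u x = 0"
    by (intro L2_norm_eq_0_D L2_space_diff pu u) (simp add: antisym)
  then show ?thesis
    by eventually_elim (metis S0_proj_in eq_iff_diff_eq_0)
qed

lemma traced_AE_S0:
  assumes t: "traced w u v g G"
  shows "AE x in volume_on V. u x \<in> S0" "AE x in lateral_measure \<eta> \<epsilon>. g x \<in> S0" "AE x in Gamma_measure \<eta> \<epsilon>. G x \<in> S0"
  using AE_S0_of_L2_limit[OF C1_L2_space(1)[OF tracedD(1)[OF t]] tracedD(2,3,7)[OF t]]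
    AE_S0_of_L2_limit[OF C1_L2_space(3)[OF tracedD(1)[OF t]] tracedD(2,5,9)[OF t]]
    AE_S0_of_L2_limit[OF C1_L2_space(4)[OF tracedD(1)[OF t]] tracedD(2,6,10)[OF t]] by auto

lemma traced_weak_partial:
  assumes t: "traced w u v g G" and e: "e \<in> Basis"
  shows "has_weak_partial V e u (v e)" "AE x in volume_on V. weak_partial V e u x = v e x"
proof -
  show h: "has_weak_partial V e u (v e)"
    by (rule has_weak_partial_limit[OF V.finite_measure_axioms
        C1_has_weak_partial[OF open_V tracedD(1)[OF t]]
        C1_L2_space(1)[OF tracedD(1)[OF t]] tracedD(3,7)[OF t]
        C1_L2_space(2)[OF tracedD(1)[OF t]] tracedD(4)[OF t e] tracedD(8)[OF t e]])
  show "AE x in volume_on V. weak_partial V e u x = v e x"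
    by (rule V.weak_partial_AE[OF h tracedD(4)[OF t e]])
qed

lemma traced_has_trace:
  assumes t: "traced w u v g G"
  shows "u \<in> W12_S0 V" "has_trace V (lateral_measure \<eta> \<epsilon>) u g" "has_trace V (Gamma_measure \<eta> \<epsilon>) u G"
proof -
  have W: "u \<in> W12 V"
    by (rule V.W12_I[where v=v]) (use tracedD[OF t] traced_weak_partial[OF t] in auto)
  show "u \<in> W12_S0 V" using W traced_AE_S0[OF t] by (simp add: W12_S0_def)
  have c: "(\<lambda>k. W12_norm V (\<lambda>x. w k x - u x)) \<longlonglongrightarrow> 0"
    by (rule V.W12_norm_tendsto_0_iff[where w=w, THEN iffD2, OF tracedD(1,3,4)[OF t] traced_weak_partial(1)[OF t]])
       (use tracedD(7,8)[OF t] in blast)+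
  show "has_trace V (lateral_measure \<eta> \<epsilon>) u g"
    unfolding has_trace_def
    by (intro conjI exI[of _ w] allI W c tracedD(1,5,9)[OF t] C1_L2_space(3)[OF tracedD(1)[OF t]]
        V.C1_W12[OF tracedD(1)[OF t]])
  show "has_trace V (Gamma_measure \<eta> \<epsilon>) u G"
    unfolding has_trace_def
    by (intro conjI exI[of _ w] allI W c tracedD(1,6,10)[OF t] C1_L2_space(4)[OF tracedD(1)[OF t]]
        V.C1_W12[OF tracedD(1)[OF t]])
qed

lemma has_trace_C1_seq:
  assumes "has_trace V M u g"
  obtains w where "\<And>k. continuously_differentiable (w k)" "\<And>k. w k \<in> L2_space M" "g \<in> L2_space M"
    "(\<lambda>k. nV (\<lambda>x. w k x - u x)) \<longlonglongrightarrow> 0"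
    "\<And>e. e \<in> Basis \<Longrightarrow> (\<lambda>k. nV (\<lambda>x. partial e (w k) x - weak_partial V e u x)) \<longlonglongrightarrow> 0"
    "(\<lambda>k. L2_norm M (\<lambda>x. w k x - g x)) \<longlonglongrightarrow> 0"
proof -
  obtain w where u: "u \<in> W12 V" and g: "g \<in> L2_space M"
    and w: "\<And>k. continuously_differentiable (w k)" "\<And>k. w k \<in> L2_space M"
      "(\<lambda>k. W12_norm V (\<lambda>x. w k x - u x)) \<longlonglongrightarrow> 0" "(\<lambda>k. L2_norm M (\<lambda>x. w k x - g x)) \<longlonglongrightarrow> 0"
    using assms unfolding has_trace_def by blast
  have "(\<lambda>k. nV (\<lambda>x. w k x - u x)) \<longlonglongrightarrow> 0 \<and>
     (\<forall>e\<in>Basis. (\<lambda>k. nV (\<lambda>x. partial e (w k) x - weak_partial V e u x)) \<longlonglongrightarrow> 0)"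
    by (rule V.W12_norm_tendsto_0_iff[where w=w, THEN iffD1, OF w(1) W12_L2[OF u] W12D(2,3)[OF u] w(3)])
  then show ?thesis using that[OF w(1,2) g _ _ w(4)] by blast
qed

text \<open>The sequences witnessing the two traces differ; by the trace inequality on \<open>\<Gamma>\<close> the one for
  the lateral trace serves for both.\<close>

lemma has_trace_traced:
  assumes u: "u \<in> W12_S0 V" and l: "has_trace V (lateral_measure \<eta> \<epsilon>) u g"
    and G: "has_trace V (Gamma_measure \<eta> \<epsilon>) u G" and gS: "AE x in lateral_measure \<eta> \<epsilon>. g x \<in> S0"
  obtains w where "traced w u (\<lambda>e. weak_partial V e u) g G"
proof -
  let ?v = "\<lambda>e. weak_partial V e u"
  note bl = bounded_linear_S0_proj
  have uW: "u \<in> W12 V" and uS: "AE x in volume_on V. u x \<in> S0" using u by (auto simp: W12_S0_def)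
  have uL: "u \<in> L2_space (volume_on V)" by (rule W12_L2[OF uW])
  obtain a where a: "\<And>k. continuously_differentiable (a k)" "\<And>k. a k \<in> L2_space (lateral_measure \<eta> \<epsilon>)"
    and gL: "g \<in> L2_space (lateral_measure \<eta> \<epsilon>)"
    and a0: "(\<lambda>k. nV (\<lambda>x. a k x - u x)) \<longlonglongrightarrow> 0"
    and a1: "\<And>e. e \<in> Basis \<Longrightarrow> (\<lambda>k. nV (\<lambda>x. partial e (a k) x - ?v e x)) \<longlonglongrightarrow> 0"
    and aL: "(\<lambda>k. nL (\<lambda>x. a k x - g x)) \<longlonglongrightarrow> 0"
    using has_trace_C1_seq[OF l] by blast
  obtain b where b: "\<And>k. continuously_differentiable (b k)" "\<And>k. b k \<in> L2_space (Gamma_measure \<eta> \<epsilon>)"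
    and GL: "G \<in> L2_space (Gamma_measure \<eta> \<epsilon>)"
    and b0: "(\<lambda>k. nV (\<lambda>x. b k x - u x)) \<longlonglongrightarrow> 0"
    and b1: "\<And>e. e \<in> Basis \<Longrightarrow> (\<lambda>k. nV (\<lambda>x. partial e (b k) x - ?v e x)) \<longlonglongrightarrow> 0"
    and bG: "(\<lambda>k. nG (\<lambda>x. b k x - G x)) \<longlonglongrightarrow> 0"
    using has_trace_C1_seq[OF G] by blast
  \<comment> \<open>Projection keeps the sequence C^1 and makes it \<open>S0\<close>-valued; its
    errors grow at most by the factor J.\<close>
  define w where "w k x = S0_proj (a k x)" for k x
  define J where "J = onorm S0_proj"
  have wC: "continuously_differentiable (w k)" for k
    unfolding w_def by (intro C1_linear(1)[OF bl] a)
  have wp: "partial e (w k) x = S0_proj (partial e (a k) x)" for e k x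
    unfolding w_def by (rule C1_linear(2)[OF bl a(1)])
  \<comment> \<open>The weak gradient of an \<open>S0\<close>-valued field is
    \<open>S0\<close>-valued: the projection minus the identity kills the field, hence also its weak
    derivatives.\<close>
  have vS: "AE x in volume_on V. S0_proj (?v e x) = ?v e x" if "e \<in> Basis" for e
  proof -
    have iu: "integrable (volume_on V) u" by (rule V.integrable_L2[OF uL])
    have iv: "integrable (volume_on V) (?v e)" by (rule V.integrable_L2[OF W12D(2)[OF uW that]])
    have p: "has_weak_partial V e (\<lambda>x. S0_proj (u x)) (\<lambda>x. S0_proj (?v e x))"
      by (rule has_weak_partial_linear[OF W12D(3)[OF uW that] bl iu iv])
    have d: "has_weak_partial V e (\<lambda>x. S0_proj (u x) - u x) (\<lambda>x. S0_proj (?v e x) - ?v e x)"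
      by (rule has_weak_partial_diff[OF p W12D(3)[OF uW that] integrable_bounded_linear[OF bl iu] iu
        integrable_bounded_linear[OF bl iv] iv])
    have z: "AE x in volume_on V. S0_proj (u x) - u x = 0"
      using uS by eventually_elim (simp add: S0_proj_id)
    have "AE x in volume_on V. S0_proj (?v e x) - ?v e x = 0"
    proof (rule weak_zero_AE[OF open_V])
      show "integrable (volume_on V) (\<lambda>x. S0_proj (?v e x) - ?v e x)"
        by (intro Bochner_Integration.integrable_diff integrable_bounded_linear[OF bl] iv)
      fix \<phi> :: "point \<Rightarrow> real"
      assume \<phi>: "continuously_differentiable \<phi>" "compact (closure {x. \<phi> x \<noteq> 0})" "closure {x. \<phi> x \<noteq> 0} \<subseteq> V"
      have i0: "(\<integral>x. partial e \<phi> x *\<^sub>R (S0_proj (u x) - u x) \<partial>volume_on V) = 0"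
        by (rule integral_eq_zero_AE) (use z in eventually_elim, simp)
      have e: "(\<integral>x. partial e \<phi> x *\<^sub>R (S0_proj (u x) - u x) \<partial>volume_on V)
          = - (\<integral>x. \<phi> x *\<^sub>R (S0_proj (?v e x) - ?v e x) \<partial>volume_on V)"
        using d \<phi> unfolding has_weak_partial_def by blast
      have "(\<integral>x. \<phi> x *\<^sub>R (S0_proj (?v e x) - ?v e x) \<partial>volume_on V)
          = - (\<integral>x. partial e \<phi> x *\<^sub>R (S0_proj (u x) - u x) \<partial>volume_on V)"
        unfolding e by (rule minus_minus[symmetric])
      then show "(\<integral>x. \<phi> x *\<^sub>R (S0_proj (?v e x) - ?v e x) \<partial>volume_on V) = 0"
        by (simp only: i0 minus_zero)
    qed
    then show ?thesis by simp
  qed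
  have proj: "L2_norm M (\<lambda>x. S0_proj (f x) - h x) \<le> J * L2_norm M (\<lambda>x. f x - h x)"
    if f: "f \<in> L2_space M" and h: "h \<in> L2_space M" and S: "AE x in M. S0_proj (h x) = h x" for M :: "point measure" and f h
  proof -
    note [measurable] = L2_spaceD(1)[OF L2_space_linear[OF f bl]] L2_spaceD(1)[OF L2_space_linear[OF h bl]] L2_spaceD(1)[OF h]
    have "L2_norm M (\<lambda>x. S0_proj (f x) - h x) = L2_norm M (\<lambda>x. S0_proj (f x) - S0_proj (h x))"
      by (rule L2_norm_cong_AE, measurable) (use S in eventually_elim, simp)
    also have "\<dots> = L2_norm M (\<lambda>x. S0_proj (f x - h x))" by (simp add: linear_simps(2)[OF bl])
    also have "\<dots> \<le> J * L2_norm M (\<lambda>x. f x - h x)"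
      unfolding J_def by (rule L2_norm_linear[OF L2_space_diff[OF f h] bl])
    finally show ?thesis .
  qed
  have lim0: "(\<lambda>k. L2_norm M (F k)) \<longlonglongrightarrow> 0"
    if "\<And>k. L2_norm M (F k) \<le> J * r k" "r \<longlonglongrightarrow> 0" for M :: "point measure" and F :: "nat \<Rightarrow> point \<Rightarrow> real^3^3" and r
  proof (rule tendsto_0_dominated[OF L2_norm_nonneg that(1)])
    show "(\<lambda>k. J * r k) \<longlonglongrightarrow> 0" using tendsto_mult_left[OF that(2), of J] by simp
  qed
  have uS': "AE x in volume_on V. S0_proj (u x) = u x" using uS by eventually_elim (simp add: S0_proj_id)
  have gS': "AE x in lateral_measure \<eta> \<epsilon>. S0_proj (g x) = g x" using gS by eventually_elim (simp add: S0_proj_id)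
  have w0: "(\<lambda>k. nV (\<lambda>x. w k x - u x)) \<longlonglongrightarrow> 0"
    unfolding w_def by (rule lim0[OF proj[OF C1_L2_space(1)[OF a(1)] uL uS'] a0])
  have w1: "(\<lambda>k. nV (\<lambda>x. partial e (w k) x - ?v e x)) \<longlonglongrightarrow> 0" if "e \<in> Basis" for e
    unfolding wp by (rule lim0[OF proj[OF C1_L2_space(2)[OF a(1)] W12D(2)[OF uW that] vS[OF that]] a1[OF that]])
  have wL: "(\<lambda>k. nL (\<lambda>x. w k x - g x)) \<longlonglongrightarrow> 0"
    unfolding w_def by (rule lim0[OF proj[OF a(2) gL gS'] aL])
  \<comment> \<open>Two C^1 sequences with the same limit in the interior have restrictions to
    \<Gamma> that approach each other, by the trace inequality applied to their difference.\<close>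
  have key: "(\<lambda>k. nG (\<lambda>x. f k x - h k x)) \<longlonglongrightarrow> 0"
    if f: "\<And>k. continuously_differentiable (f k)" and h: "\<And>k. continuously_differentiable (h k)"
      and f0: "(\<lambda>k. nV (\<lambda>x. f k x - u x)) \<longlonglongrightarrow> 0" and h0: "(\<lambda>k. nV (\<lambda>x. h k x - u x)) \<longlonglongrightarrow> 0"
      and f1: "(\<lambda>k. nV (\<lambda>x. partial ez (f k) x - ?v ez x)) \<longlonglongrightarrow> 0" 
      and h1: "(\<lambda>k. nV (\<lambda>x. partial ez (h k) x - ?v ez x)) \<longlonglongrightarrow> 0" for f h :: "nat \<Rightarrow> point \<Rightarrow> real^3^3"
  proof -
    have ez: "ez \<in> Basis" by (simp add: Basis_point)
    define r where "r k = (nV (\<lambda>x. f k x - u x) + nV (\<lambda>x. h k x - u x))\<^sup>2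
      + (nV (\<lambda>x. partial ez (f k) x - ?v ez x) + nV (\<lambda>x. partial ez (h k) x - ?v ez x))\<^sup>2" for k
    have le: "nG (\<lambda>x. f k x - h k x) \<le> sqrt (2 * (1 / \<epsilon> + 1) * r k)" for k
    proof (rule real_le_rsqrt)
      have "nV (\<lambda>x. f k x - h k x) \<le> nV (\<lambda>x. f k x - u x) + nV (\<lambda>x. h k x - u x)"
        using L2_norm_triangle_diff[OF C1_L2_space(1)[OF f] uL C1_L2_space(1)[OF h], of k k]
          L2_norm_minus_commute[of "volume_on V" "h k" u] by simp
      moreover have "nV (partial ez (\<lambda>x. f k x - h k x))
          \<le> nV (\<lambda>x. partial ez (f k) x - ?v ez x) + nV (\<lambda>x. partial ez (h k) x - ?v ez x)"
      proof -
        have "partial ez (\<lambda>x. f k x - h k x) = (\<lambda>x. partial ez (f k) x - partial ez (h k) x)"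
          by (intro ext C1_diff(2) f h)
        then show ?thesis
          using L2_norm_triangle_diff[OF C1_L2_space(2)[where e=ez, OF f] W12D(2)[OF uW ez] C1_L2_space(2)[where e=ez, OF h], of k k]
            L2_norm_minus_commute[of "volume_on V" "partial ez (h k)" "?v ez"] by simp
      qed
      ultimately have "(nV (\<lambda>x. f k x - h k x))\<^sup>2 + (nV (partial ez (\<lambda>x. f k x - h k x)))\<^sup>2 \<le> r k"
        unfolding r_def by (intro add_mono power_mono) auto
      then have "2 * (1 / \<epsilon> + 1) * ((nV (\<lambda>x. f k x - h k x))\<^sup>2 + (nV (partial ez (\<lambda>x. f k x - h k x)))\<^sup>2)
          \<le> 2 * (1 / \<epsilon> + 1) * r k"
        using eps by (intro mult_left_mono) auto
      then show "(nG (\<lambda>x. f k x - h k x))\<^sup>2 \<le> 2 * (1 / \<epsilon> + 1) * r k"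
        using trace_Gamma_le[OF C1_diff(1)[OF f h], of k k] by linarith
    qed
    have "(\<lambda>k. sqrt (2 * (1 / \<epsilon> + 1) * r k)) \<longlonglongrightarrow> sqrt (2 * (1 / \<epsilon> + 1) * ((0 + 0)\<^sup>2 + (0 + 0)\<^sup>2))"
      unfolding r_def by (intro tendsto_intros f0 h0 f1 h1)
    then have "(\<lambda>k. sqrt (2 * (1 / \<epsilon> + 1) * r k)) \<longlonglongrightarrow> 0" by simp
    then show ?thesis by (rule tendsto_0_dominated[OF L2_norm_nonneg le])
  qed
  have ez: "ez \<in> Basis" by (simp add: Basis_point)
  have wb: "(\<lambda>k. nG (\<lambda>x. w k x - b k x)) \<longlonglongrightarrow> 0"
    by (rule key[OF wC b(1) w0 b0 w1[OF ez] b1[OF ez]])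
  have wG: "(\<lambda>k. nG (\<lambda>x. w k x - G x)) \<longlonglongrightarrow> 0"
  proof (rule tendsto_0_dominated[OF L2_norm_nonneg])
    show "(\<lambda>k. nG (\<lambda>x. w k x - b k x) + nG (\<lambda>x. b k x - G x)) \<longlonglongrightarrow> 0"
      using tendsto_add[OF wb bG] by simp
    show "nG (\<lambda>x. w k x - G x) \<le> nG (\<lambda>x. w k x - b k x) + nG (\<lambda>x. b k x - G x)" for k
      by (intro L2_norm_triangle_diff C1_L2_space(4) wC b GL)
  qed
  show ?thesis
    by (rule that[of w], unfold traced_def, intro conjI allI ballI wC uL W12D(2)[OF uW] gL GL w0 w1 wL wG)
       (simp_all add: w_def S0_proj_in)
qed

end

section \<open>The space \<open>L\<^sup>4\<close> and the weak formulation\<close>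

text \<open>Encoded through the squared norm, so that Hoelder's inequality for L^4 becomes
  Cauchy-Schwarz for squares.\<close>

definition L4_space :: "'a measure \<Rightarrow> ('a \<Rightarrow> 'b::euclidean_space) set" where
  "L4_space M = {f \<in> borel_measurable M. (\<lambda>x. (norm (f x))\<^sup>2) \<in> L2_space M}"

text \<open>The square of the L^4 norm. It satisfies the triangle inequality only up to the factor
  2, which is enough for limits.\<close>

definition L4_sq :: "'a measure \<Rightarrow> ('a \<Rightarrow> 'b::euclidean_space) \<Rightarrow> real" where
  "L4_sq M f = L2_norm M (\<lambda>x. (norm (f x))\<^sup>2)"

lemma L4_spaceD:
  assumes "f \<in> L4_space M"
  shows "f \<in> borel_measurable M" "(\<lambda>x. (norm (f x))\<^sup>2) \<in> L2_space M"
  using assms by (auto simp: L4_space_def)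

lemma L4_sq_nonneg: "0 \<le> L4_sq M f"
  by (simp add: L4_sq_def)

lemma L4_add:
  assumes f: "f \<in> L4_space M" and g: "g \<in> L4_space M"
  shows "(\<lambda>x. f x + g x) \<in> L4_space M" "L4_sq M (\<lambda>x. f x + g x) \<le> 2 * (L4_sq M f + L4_sq M g)"
proof -
  note [measurable] = L4_spaceD(1)[OF f] L4_spaceD(1)[OF g]
  let ?h = "\<lambda>x. (norm (f x))\<^sup>2 + (norm (g x))\<^sup>2"
  have h: "?h \<in> L2_space M" by (rule L2_space_add[OF L4_spaceD(2)[OF f] L4_spaceD(2)[OF g]])
  have b: "norm ((norm (f x + g x))\<^sup>2) \<le> 2 * norm (?h x)" for x
  proof -
    have "(norm (f x + g x))\<^sup>2 \<le> (norm (f x) + norm (g x))\<^sup>2"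
      by (intro power_mono norm_triangle_ineq) auto
    also have "\<dots> \<le> 2 * ?h x"
      using sum_squares_bound[of "norm (f x)" "norm (g x)"] by (simp add: power2_sum)
    finally show ?thesis by simp
  qed
  have m: "(\<lambda>x. (norm (f x + g x))\<^sup>2) \<in> borel_measurable M" by simp
  show "(\<lambda>x. f x + g x) \<in> L4_space M"
    using L2_space_bound[OF h m AE_I2[OF b]] by (simp add: L4_space_def)
  have "L4_sq M (\<lambda>x. f x + g x) \<le> 2 * L2_norm M ?h"
    unfolding L4_sq_def by (rule L2_norm_bound[OF h m AE_I2[OF b]]) simp
  also have "\<dots> \<le> 2 * (L4_sq M f + L4_sq M g)"
    unfolding L4_sq_def using L2_norm_triangle[OF L4_spaceD(2)[OF f] L4_spaceD(2)[OF g]] by simp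
  finally show "L4_sq M (\<lambda>x. f x + g x) \<le> 2 * (L4_sq M f + L4_sq M g)" .
qed

lemma L4_uminus:
  assumes f: "f \<in> L4_space M"
  shows "(\<lambda>x. - f x) \<in> L4_space M" "L4_sq M (\<lambda>x. - f x) = L4_sq M f"
  using f by (auto simp: L4_space_def L4_sq_def)

lemma L4_diff:
  assumes f: "f \<in> L4_space M" and g: "g \<in> L4_space M"
  shows "(\<lambda>x. f x - g x) \<in> L4_space M"
  using L4_add(1)[OF f L4_uminus(1)[OF g]] by simp

lemma L4_sq_le:
  assumes f: "f \<in> L4_space M" and g: "g \<in> L4_space M"
  shows "L4_sq M f \<le> 2 * (L4_sq M (\<lambda>x. f x - g x) + L4_sq M g)"
  using L4_add(2)[OF L4_diff[OF f g] g] by simp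

lemma L4_mult:
  assumes f: "f \<in> L4_space M" and g: "g \<in> L4_space M"
  shows "(\<lambda>x. norm (f x) * norm (g x)) \<in> L2_space M"
    "L2_norm M (\<lambda>x. norm (f x) * norm (g x)) \<le> sqrt (L4_sq M f * L4_sq M g)"
proof -
  note [measurable] = L4_spaceD(1)[OF f] L4_spaceD(1)[OF g]
  note f2 = L4_spaceD(2)[OF f] and g2 = L4_spaceD(2)[OF g]
  have e: "(norm (norm (f x) * norm (g x)))\<^sup>2 = norm ((norm (f x))\<^sup>2) * norm ((norm (g x))\<^sup>2)" for x
    by (simp add: power_mult_distrib)
  show "(\<lambda>x. norm (f x) * norm (g x)) \<in> L2_space M"
    unfolding L2_space_def using integrable_norm_mult_L2[OF f2 g2] by (simp add: power_mult_distrib)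
  show "L2_norm M (\<lambda>x. norm (f x) * norm (g x)) \<le> sqrt (L4_sq M f * L4_sq M g)"
    unfolding L2_norm_def[of M "\<lambda>x. norm (f x) * norm (g x)"] e L4_sq_def
    by (rule real_sqrt_le_mono[OF integral_norm_mult_le[OF f2 g2]])
qed

context finite_measure
begin

lemma L4_weight:
  assumes P: "P \<in> L4_space M" and Q: "Q \<in> L4_space M"
  shows "(\<lambda>x. 1 + (norm (P x))\<^sup>2 + (norm (Q x))\<^sup>2) \<in> L2_space M"
    "L2_norm M (\<lambda>x. 1 + (norm (P x))\<^sup>2 + (norm (Q x))\<^sup>2) \<le> L2_norm M (\<lambda>x. 1::real) + L4_sq M P + L4_sq M Q"
proof -
  have 1: "(\<lambda>x. 1::real) \<in> L2_space M" by (simp add: L2_space_def)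
  note p = L4_spaceD(2)[OF P] and q = L4_spaceD(2)[OF Q]
  show "(\<lambda>x. 1 + (norm (P x))\<^sup>2 + (norm (Q x))\<^sup>2) \<in> L2_space M"
    by (intro L2_space_add 1 p q)
  show "L2_norm M (\<lambda>x. 1 + (norm (P x))\<^sup>2 + (norm (Q x))\<^sup>2) \<le> L2_norm M (\<lambda>x. 1::real) + L4_sq M P + L4_sq M Q"
    using L2_norm_triangle[OF L2_space_add[OF 1 p] q] L2_norm_triangle[OF 1 p] by (simp add: L4_sq_def)
qed

text \<open>Hoelder's inequality with exponents 2, 4 and 4.\<close>

lemma integral_weight_le:
  assumes P: "P \<in> L4_space M" and Q: "Q \<in> L4_space M" and X: "X \<in> L4_space M" and Y: "Y \<in> L4_space M"
  shows "integrable M (\<lambda>x. (1 + (norm (P x))\<^sup>2 + (norm (Q x))\<^sup>2) * (norm (X x) * norm (Y x)))"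
    "(\<integral>x. (1 + (norm (P x))\<^sup>2 + (norm (Q x))\<^sup>2) * (norm (X x) * norm (Y x)) \<partial>M)
      \<le> (L2_norm M (\<lambda>x. 1::real) + L4_sq M P + L4_sq M Q) * sqrt (L4_sq M X * L4_sq M Y)"
proof -
  note W = L4_weight[OF P Q] and XY = L4_mult[OF X Y]
  show "integrable M (\<lambda>x. (1 + (norm (P x))\<^sup>2 + (norm (Q x))\<^sup>2) * (norm (X x) * norm (Y x)))"
    using integrable_inner_L2[OF W(1) XY(1)] by simp
  have "(\<integral>x. (1 + (norm (P x))\<^sup>2 + (norm (Q x))\<^sup>2) * (norm (X x) * norm (Y x)) \<partial>M)
     \<le> L2_norm M (\<lambda>x. 1 + (norm (P x))\<^sup>2 + (norm (Q x))\<^sup>2) * L2_norm M (\<lambda>x. norm (X x) * norm (Y x))"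
    using abs_integral_inner_le[OF W(1) XY(1)] by simp
  also have "\<dots> \<le> (L2_norm M (\<lambda>x. 1::real) + L4_sq M P + L4_sq M Q) * sqrt (L4_sq M X * L4_sq M Y)"
    by (intro mult_mono W(2) XY(2) add_nonneg_nonneg L4_sq_nonneg L2_norm_nonneg)
  finally show "(\<integral>x. (1 + (norm (P x))\<^sup>2 + (norm (Q x))\<^sup>2) * (norm (X x) * norm (Y x)) \<partial>M)
      \<le> (L2_norm M (\<lambda>x. 1::real) + L4_sq M P + L4_sq M Q) * sqrt (L4_sq M X * L4_sq M Y)" .
qed

end

lemma continuous_on_bulk: "continuous_on UNIV (bulk A B C)"
proof -
  have m: "continuous_on UNIV (\<lambda>Q::real^3^3. Q ** Q)"
    unfolding matrix_matrix_mult_def by (intro continuous_intros continuous_on_vec_lambda)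
  have "continuous_on UNIV (\<lambda>Q::real^3^3. trace (Q ** Q))"
    unfolding trace_def by (intro continuous_intros m continuous_on_component)
  with m show ?thesis unfolding bulk_def by (intro continuous_intros) simp_all
qed

lemma borel_measurable_bulk [measurable]: "bulk A B C \<in> borel_measurable borel"
  by (intro borel_measurable_continuous_onI continuous_on_bulk)

lemma bulk_0: "bulk A B C 0 = 0"
  by (simp add: bulk_def vec_eq_iff matrix_matrix_mult_def trace_def)

context finite_measure
begin

text \<open>The pointwise Lipschitz bound integrated by Hoelder's inequality; it makes the nonlinear
  term of the equation continuous with respect to L^4 convergence.\<close>

lemma integral_bulk_diff_le:
  assumes P: "P \<in> L4_space M" "AE x in M. P x \<in> S0" and Q: "Q \<in> L4_space M" "AE x in M. Q x \<in> S0"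
    and X: "X \<in> L4_space M" "AE x in M. X x \<in> S0" and BC: "0 < B" "0 < C"
  shows "integrable M (\<lambda>x. bulk A B C (P x) \<bullet> X x - bulk A B C (Q x) \<bullet> X x)"
    "\<bar>\<integral>x. bulk A B C (P x) \<bullet> X x - bulk A B C (Q x) \<bullet> X x \<partial>M\<bar>
      \<le> (\<bar>A\<bar> + B + 2 * C) * ((L2_norm M (\<lambda>x. 1::real) + L4_sq M P + L4_sq M Q) * sqrt (L4_sq M (\<lambda>x. P x - Q x) * L4_sq M X))"
proof -
  note [measurable] = L4_spaceD(1)[OF P(1)] L4_spaceD(1)[OF Q(1)] L4_spaceD(1)[OF X(1)]
  let ?F = "\<lambda>x. bulk A B C (P x) \<bullet> X x - bulk A B C (Q x) \<bullet> X x"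
  let ?W = "\<lambda>x. (1 + (norm (P x))\<^sup>2 + (norm (Q x))\<^sup>2) * (norm (P x - Q x) * norm (X x))"
  note W = integral_weight_le[OF P(1) Q(1) L4_diff[OF P(1) Q(1)] X(1)]
  have b: "AE x in M. \<bar>?F x\<bar> \<le> (\<bar>A\<bar> + B + 2 * C) * ?W x"
    using P(2) Q(2) X(2) by eventually_elim (rule bulk_Lipschitz[OF _ _ _ BC])
  have iW: "integrable M (\<lambda>x. (\<bar>A\<bar> + B + 2 * C) * ?W x)" by (rule integrable_mult_right[OF W(1)])
  show i: "integrable M ?F"
  proof (rule Bochner_Integration.integrable_bound[OF iW])
    show "AE x in M. norm (?F x) \<le> norm ((\<bar>A\<bar> + B + 2 * C) * ?W x)"
      using b by eventually_elim simp
  qed measurable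
  have "\<bar>\<integral>x. ?F x \<partial>M\<bar> \<le> (\<integral>x. \<bar>?F x\<bar> \<partial>M)" using integral_norm_bound[of M ?F] by simp
  also have "\<dots> \<le> (\<integral>x. (\<bar>A\<bar> + B + 2 * C) * ?W x \<partial>M)"
    by (rule integral_mono_AE[OF integrable_abs[OF i] iW b])
  also have "\<dots> = (\<bar>A\<bar> + B + 2 * C) * (\<integral>x. ?W x \<partial>M)" by (rule integral_mult_right_zero)
  also have "\<dots> \<le> (\<bar>A\<bar> + B + 2 * C) * ((L2_norm M (\<lambda>x. 1::real) + L4_sq M P + L4_sq M Q) * sqrt (L4_sq M (\<lambda>x. P x - Q x) * L4_sq M X))"
    using BC by (intro mult_left_mono W(2)) auto
  finally show "\<bar>\<integral>x. ?F x \<partial>M\<bar>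
      \<le> (\<bar>A\<bar> + B + 2 * C) * ((L2_norm M (\<lambda>x. 1::real) + L4_sq M P + L4_sq M Q) * sqrt (L4_sq M (\<lambda>x. P x - Q x) * L4_sq M X))" .
qed

lemma L4_0: "(\<lambda>x. 0) \<in> L4_space M" "L4_sq M (\<lambda>x. 0) = 0"
  by (simp_all add: L4_space_def L4_sq_def)

text \<open>The difference estimate with the zero field as Q.\<close>

lemma integral_bulk_le:
  assumes P: "P \<in> L4_space M" "AE x in M. P x \<in> S0"
    and X: "X \<in> L4_space M" "AE x in M. X x \<in> S0" and BC: "0 < B" "0 < C"
  shows "integrable M (\<lambda>x. bulk A B C (P x) \<bullet> X x)"
    "\<bar>\<integral>x. bulk A B C (P x) \<bullet> X x \<partial>M\<bar>
      \<le> (\<bar>A\<bar> + B + 2 * C) * ((L2_norm M (\<lambda>x. 1::real) + L4_sq M P) * sqrt (L4_sq M P * L4_sq M X))"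
proof -
  have z: "AE x in M. (0 :: real^3^3) \<in> S0" by (simp add: zero_S0)
  show "integrable M (\<lambda>x. bulk A B C (P x) \<bullet> X x)"
    using integral_bulk_diff_le(1)[OF P L4_0(1) z X BC, where A=A] by (simp add: bulk_0)
  show "\<bar>\<integral>x. bulk A B C (P x) \<bullet> X x \<partial>M\<bar>
      \<le> (\<bar>A\<bar> + B + 2 * C) * ((L2_norm M (\<lambda>x. 1::real) + L4_sq M P) * sqrt (L4_sq M P * L4_sq M X))"
    using integral_bulk_diff_le(2)[OF P L4_0(1) z X BC, where A=A] by (simp add: bulk_0 L4_0(2))
qed

lemma integral_bulk_tendsto:
  assumes P: "\<And>k. P k \<in> L4_space M" "\<And>k. AE x in M. P k x \<in> S0" and Q: "Q \<in> L4_space M" "AE x in M. Q x \<in> S0"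
    and X: "\<And>k. X k \<in> L4_space M" "\<And>k. AE x in M. X k x \<in> S0" and Y: "Y \<in> L4_space M" "AE x in M. Y x \<in> S0"
    and BC: "0 < B" "0 < C"
    and PQ: "(\<lambda>k. L4_sq M (\<lambda>x. P k x - Q x)) \<longlonglongrightarrow> 0" and XY: "(\<lambda>k. L4_sq M (\<lambda>x. X k x - Y x)) \<longlonglongrightarrow> 0"
  shows "(\<lambda>k. \<integral>x. bulk A B C (P k x) \<bullet> X k x \<partial>M) \<longlonglongrightarrow> (\<integral>x. bulk A B C (Q x) \<bullet> Y x \<partial>M)"
proof -
  let ?c = "\<bar>A\<bar> + B + 2 * C" and ?K = "L2_norm M (\<lambda>x. 1::real)"
  let ?a = "\<lambda>k. L4_sq M (\<lambda>x. P k x - Q x)" and ?b = "\<lambda>k. L4_sq M (\<lambda>x. X k x - Y x)"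
  let ?q = "L4_sq M Q" and ?y = "L4_sq M Y"
  \<comment> \<open>The norms of \<open>P k\<close> and \<open>X k\<close> are replaced by errors
    plus norms of the limits, so that r visibly tends to zero.\<close>
  define r where "r k = ?c * ((?K + 2 * (?a k + ?q) + ?q) * sqrt (?a k * (2 * (?b k + ?y))))
     + ?c * ((?K + ?q) * sqrt (?q * ?b k))" for k
  have c: "0 \<le> ?c" using BC by simp
  have d: "norm ((\<integral>x. bulk A B C (P k x) \<bullet> X k x \<partial>M) - (\<integral>x. bulk A B C (Q x) \<bullet> Y x \<partial>M)) \<le> r k" for k
  proof -
    have S: "AE x in M. X k x - Y x \<in> S0"
      using X(2)[of k] Y(2) by eventually_elim (rule subspace_diff[OF subspace_S0])
    have i: "integrable M (\<lambda>x. bulk A B C (P k x) \<bullet> X k x)" "integrable M (\<lambda>x. bulk A B C (Q x) \<bullet> X k x)"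
      "integrable M (\<lambda>x. bulk A B C (Q x) \<bullet> Y x)"
      by (intro integral_bulk_le(1) P Q X Y BC)+
    have "(\<integral>x. bulk A B C (P k x) \<bullet> X k x \<partial>M) - (\<integral>x. bulk A B C (Q x) \<bullet> Y x \<partial>M)
       = (\<integral>x. bulk A B C (P k x) \<bullet> X k x - bulk A B C (Q x) \<bullet> X k x \<partial>M) + (\<integral>x. bulk A B C (Q x) \<bullet> (X k x - Y x) \<partial>M)"
      using i by (simp add: inner_diff_right)
    also have "norm \<dots> \<le> \<bar>\<integral>x. bulk A B C (P k x) \<bullet> X k x - bulk A B C (Q x) \<bullet> X k x \<partial>M\<bar> + \<bar>\<integral>x. bulk A B C (Q x) \<bullet> (X k x - Y x) \<partial>M\<bar>"
      using norm_triangle_ineq by fastforce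
    also have "\<dots> \<le> ?c * ((?K + L4_sq M (P k) + ?q) * sqrt (?a k * L4_sq M (X k))) + ?c * ((?K + ?q) * sqrt (?q * ?b k))"
      by (intro add_mono integral_bulk_diff_le(2)[OF P Q X BC] integral_bulk_le(2)[OF Q L4_diff[OF X(1) Y(1)] S BC])
    also have "\<dots> \<le> r k"
      unfolding r_def using L4_sq_le[OF P(1) Q(1), of k] L4_sq_le[OF X(1) Y(1), of k]
      by (intro add_mono order_refl mult_left_mono[OF _ c] mult_mono real_sqrt_le_mono)
         (auto simp: L4_sq_nonneg intro!: mult_left_mono add_nonneg_nonneg)
    finally show ?thesis .
  qed
  have "r \<longlonglongrightarrow> ?c * ((?K + 2 * (0 + ?q) + ?q) * sqrt (0 * (2 * (0 + ?y)))) + ?c * ((?K + ?q) * sqrt (?q * 0))"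
    unfolding r_def by (intro tendsto_intros PQ XY)
  then have r0: "r \<longlonglongrightarrow> 0" by simp
  show ?thesis
    by (rule LIM_zero_cancel, rule Lim_null_comparison[OF always_eventually r0], rule allI, rule d)
qed

end

context square_well
begin

section \<open>Passage to the limit in the weak formulation\<close>

lemma C1_L4: "continuously_differentiable w \<Longrightarrow> w \<in> L4_space (volume_on V)"
  unfolding L4_space_def
  by (auto intro!: continuous_measurable[OF V.bfm] continuous_L2[OF V.bfm] C1_continuous_on continuous_intros)

text \<open>The embedding is proved for C^1 fields only. It is applied to
  \<open>w k - w (r j)\<close>, and Fatou's lemma in j transfers it to
  \<open>w k - u\<close>.\<close>

lemma traced_L4:
  assumes t: "traced w u v g G"
  shows "u \<in> L4_space (volume_on V)" "(\<lambda>k. L4_sq (volume_on V) (\<lambda>x. w k x - u x)) \<longlonglongrightarrow> 0"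
proof -
  note w = tracedD(1)[OF t] and u = tracedD(3)[OF t]
  note [measurable] = L2_spaceD(1)[OF C1_L2_space(1)[OF w]] L2_spaceD(1)[OF u]
  obtain r where r: "strict_mono r" "AE x in volume_on V. (\<lambda>j. w (r j) x) \<longlonglongrightarrow> u x"
    using V.L2_AE_subseq[OF C1_L2_space(1)[OF w] u tracedD(7)[OF t]] by blast
  define N where "N k = (nV (\<lambda>x. w k x - u x))\<^sup>2 + gradsq (\<lambda>e x. partial e (w k) x - v e x)" for k
  define Nj where "Nj k j = (nV (\<lambda>x. w k x - w (r j) x))\<^sup>2 + gradsq (\<lambda>e. partial e (\<lambda>x. w k x - w (r j) x))" for k j
  have N0: "N k \<ge> 0" for k by (simp add: N_def sum_nonneg)
  have diff: "(\<lambda>j. L2_norm M (\<lambda>x. a x - f (r j) x)) \<longlonglongrightarrow> L2_norm M (\<lambda>x. a x - h x)"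
    if f: "\<And>k. f k \<in> L2_space M" and h: "h \<in> L2_space M" and a: "a \<in> L2_space M"
      and l: "(\<lambda>k. L2_norm M (\<lambda>x. f k x - h x)) \<longlonglongrightarrow> 0"
    for M :: "point measure" and f and a h :: "point \<Rightarrow> real^3^3"
  proof (rule tendsto_L2_norm[OF L2_space_diff[OF a f] L2_space_diff[OF a h]])
    have "(\<lambda>j. L2_norm M (\<lambda>x. f (r j) x - h x)) \<longlonglongrightarrow> 0"
      using LIMSEQ_subseq_LIMSEQ[OF l r(1)] by (simp add: o_def)
    then show "(\<lambda>j. L2_norm M (\<lambda>x. a x - f (r j) x - (a x - h x))) \<longlonglongrightarrow> 0"
      by (subst L2_norm_minus_commute) simp
  qed
  have Nlim: "(\<lambda>j. Nj k j) \<longlonglongrightarrow> N k" for k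
  proof -
    have p: "partial e (\<lambda>x. w k x - w (r j) x) = (\<lambda>x. partial e (w k) x - partial e (w (r j)) x)" for e j
      by (intro ext C1_diff(2) w)
    show ?thesis
      unfolding Nj_def N_def p
      by (intro tendsto_add tendsto_power tendsto_sum diff C1_L2_space w u tracedD(4,7,8)[OF t])
  qed
  have main: "(\<integral>\<^sup>+x. ennreal ((norm (w k x - u x)) ^ 4) \<partial>volume_on V) \<le> ennreal (Sob * (N k)\<^sup>2)" for k
  proof -
    have "(\<integral>\<^sup>+x. ennreal ((norm (w k x - u x)) ^ 4) \<partial>volume_on V)
       = (\<integral>\<^sup>+x. liminf (\<lambda>j. ennreal ((norm (w k x - w (r j) x)) ^ 4)) \<partial>volume_on V)"
    proof (rule nn_integral_cong_AE)
      show "AE x in volume_on V. ennreal ((norm (w k x - u x)) ^ 4) = liminf (\<lambda>j. ennreal ((norm (w k x - w (r j) x)) ^ 4))"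
        using r(2)
      proof eventually_elim
        case (elim x)
        have "(\<lambda>j. ennreal ((norm (w k x - w (r j) x)) ^ 4)) \<longlonglongrightarrow> ennreal ((norm (w k x - u x)) ^ 4)"
          by (intro tendsto_intros elim)
        then show ?case by (rule lim_imp_Liminf[OF sequentially_bot, symmetric])
      qed
    qed
    also have "\<dots> \<le> liminf (\<lambda>j. \<integral>\<^sup>+x. ennreal ((norm (w k x - w (r j) x)) ^ 4) \<partial>volume_on V)"
      by (rule nn_integral_liminf) measurable
    also have "\<dots> \<le> liminf (\<lambda>j. ennreal (Sob * (Nj k j)\<^sup>2))"
      unfolding Nj_def by (intro Liminf_mono always_eventually allI Sobolev C1_diff(1) w)
    also have "\<dots> = ennreal (Sob * (N k)\<^sup>2)"
      by (rule lim_imp_Liminf[OF sequentially_bot]) (intro tendsto_intros Nlim)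
    finally show ?thesis .
  qed
  have sq: "(\<lambda>x. (norm (w k x - u x))\<^sup>2) \<in> L2_space (volume_on V) \<and> L4_sq (volume_on V) (\<lambda>x. w k x - u x) \<le> sqrt Sob * N k" for k
  proof -
    have e: "(norm ((norm (w k x - u x))\<^sup>2))\<^sup>2 = (norm (w k x - u x)) ^ 4" for x by simp
    have i: "integrable (volume_on V) (\<lambda>x. (norm (w k x - u x)) ^ 4)"
      using main[of k] by (subst integrable_iff_bounded) (auto intro: le_less_trans)
    have "ennreal (\<integral>x. (norm (w k x - u x)) ^ 4 \<partial>volume_on V) \<le> ennreal (Sob * (N k)\<^sup>2)"
      using main[of k] nn_integral_eq_integral[OF i] by simp
    then have "(\<integral>x. (norm (w k x - u x)) ^ 4 \<partial>volume_on V) \<le> Sob * (N k)\<^sup>2"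
      using Sob_nonneg by (subst (asm) ennreal_le_iff) auto
    then have "sqrt (\<integral>x. (norm (w k x - u x)) ^ 4 \<partial>volume_on V) \<le> sqrt (Sob * (N k)\<^sup>2)"
      by (rule real_sqrt_le_mono)
    also have "\<dots> = sqrt Sob * N k" using N0[of k] by (simp add: real_sqrt_mult)
    finally have "L4_sq (volume_on V) (\<lambda>x. w k x - u x) \<le> sqrt Sob * N k"
      unfolding L4_sq_def L2_norm_def e .
    moreover have "(\<lambda>x. (norm (w k x - u x))\<^sup>2) \<in> L2_space (volume_on V)"
      unfolding L2_space_def using i by (simp add: e)
    ultimately show ?thesis by simp
  qed
  have N_lim: "N \<longlonglongrightarrow> 0"
  proof -
    have "N \<longlonglongrightarrow> 0\<^sup>2 + (\<Sum>e\<in>(Basis::point set). 0\<^sup>2)"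
      unfolding N_def by (intro tendsto_add tendsto_power tendsto_sum tracedD(7,8)[OF t])
    then show ?thesis by simp
  qed
  show "(\<lambda>k. L4_sq (volume_on V) (\<lambda>x. w k x - u x)) \<longlonglongrightarrow> 0"
  proof (rule tendsto_0_dominated[OF L4_sq_nonneg])
    show "(\<lambda>k. sqrt Sob * N k) \<longlonglongrightarrow> 0" using tendsto_mult_left[OF N_lim, of "sqrt Sob"] by simp
  qed (use sq in blast)
  have "(\<lambda>x. w 0 x - u x) \<in> L4_space (volume_on V)" using sq[of 0] by (simp add: L4_space_def)
  from L4_diff[OF C1_L4[OF w, of 0] this] show "u \<in> L4_space (volume_on V)" by simp
qed

text \<open>Gradient and trace are arguments of their own, so the same expression covers limits of
  sequences and also C^1 fields with their classical derivatives and restrictions.\<close>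

definition weak_form :: "real \<Rightarrow> real \<Rightarrow> real \<Rightarrow> real \<Rightarrow> real \<Rightarrow> real \<Rightarrow> real \<Rightarrow> real \<Rightarrow>
    (point \<Rightarrow> real^3^3) \<Rightarrow> (point \<Rightarrow> point \<Rightarrow> real^3^3) \<Rightarrow> (point \<Rightarrow> real^3^3) \<Rightarrow>
    (point \<Rightarrow> real^3^3) \<Rightarrow> (point \<Rightarrow> point \<Rightarrow> real^3^3) \<Rightarrow> (point \<Rightarrow> real^3^3) \<Rightarrow> real" where
  "weak_form A B C L s \<alpha>z \<gamma>z lam u v G u' v' G' =
     (\<Sum>e\<in>Basis. \<integral>x. v e x \<bullet> v' e x \<partial>volume_on V)
     + (lam / L) * (\<integral>x. H s \<alpha>z \<gamma>z (G x) \<bullet> G' x \<partial>Gamma_measure \<eta> \<epsilon>)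
     + (lam\<^sup>2 / L) * (\<integral>x. bulk A B C (u x) \<bullet> u' x \<partial>volume_on V)"

lemma H_L2:
  assumes "G \<in> L2_space (Gamma_measure \<eta> \<epsilon>)"
  shows "(\<lambda>x. H s \<alpha>z \<gamma>z (G x)) \<in> L2_space (Gamma_measure \<eta> \<epsilon>)"
proof -
  \<comment> \<open>\<open>H\<close> is affine: a linear image of G plus a constant field.\<close>
  have "(\<lambda>x. H 0 \<alpha>z \<gamma>z (G x) + H s \<alpha>z \<gamma>z 0) \<in> L2_space (Gamma_measure \<eta> \<epsilon>)"
    by (intro L2_space_add L2_space_linear[OF assms bounded_linear_H] continuous_L2[OF bfm_Gamma]) simp
  moreover have "H 0 \<alpha>z \<gamma>z Q + H s \<alpha>z \<gamma>z 0 = H s \<alpha>z \<gamma>z Q" for Q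
    using H_diff[of s \<alpha>z \<gamma>z Q 0] by (simp add: algebra_simps)
  ultimately show ?thesis by simp
qed

text \<open>Gradients converge in L^2 of the well, restrictions in L^2 of \<Gamma>, and the fields
  themselves in L^4, which the bulk term demands.\<close>

lemma weak_form_tendsto:
  assumes t: "traced w u v g G" and t': "traced w' u' v' g' G'" and BC: "0 < B" "0 < C"
  shows "(\<lambda>k. weak_form A B C L s \<alpha>z \<gamma>z lam (w k) (\<lambda>e. partial e (w k)) (w k) (w' k) (\<lambda>e. partial e (w' k)) (w' k))
     \<longlonglongrightarrow> weak_form A B C L s \<alpha>z \<gamma>z lam u v G u' v' G'"
proof -
  note w = tracedD(1)[OF t] and w' = tracedD(1)[OF t']
  have 1: "(\<lambda>k. \<integral>x. partial e (w k) x \<bullet> partial e (w' k) x \<partial>volume_on V) \<longlonglongrightarrow> (\<integral>x. v e x \<bullet> v' e x \<partial>volume_on V)"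
    if "e \<in> Basis" for e
    by (intro tendsto_integral_inner C1_L2_space w w' tracedD(4,8)[OF t] tracedD(4,8)[OF t'] that)
  have "(\<lambda>k. nG (\<lambda>x. H s \<alpha>z \<gamma>z (w k x) - H s \<alpha>z \<gamma>z (G x))) \<longlonglongrightarrow> 0"
  proof (rule tendsto_0_dominated[OF L2_norm_nonneg])
    show "nG (\<lambda>x. H s \<alpha>z \<gamma>z (w k x) - H s \<alpha>z \<gamma>z (G x)) \<le> onorm (H 0 \<alpha>z \<gamma>z) * nG (\<lambda>x. w k x - G x)" for k
      unfolding H_diff by (rule L2_norm_linear[OF L2_space_diff[OF C1_L2_space(4)[OF w] tracedD(6)[OF t]] bounded_linear_H])
    show "(\<lambda>k. onorm (H 0 \<alpha>z \<gamma>z) * nG (\<lambda>x. w k x - G x)) \<longlonglongrightarrow> 0"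
      using tendsto_mult_left[OF tracedD(10)[OF t], of "onorm (H 0 \<alpha>z \<gamma>z)"] by simp
  qed
  then have 2: "(\<lambda>k. \<integral>x. H s \<alpha>z \<gamma>z (w k x) \<bullet> w' k x \<partial>Gamma_measure \<eta> \<epsilon>) \<longlonglongrightarrow> (\<integral>x. H s \<alpha>z \<gamma>z (G x) \<bullet> G' x \<partial>Gamma_measure \<eta> \<epsilon>)"
    by (intro tendsto_integral_inner H_L2 C1_L2_space w w' tracedD(6)[OF t] tracedD(6,10)[OF t'])
  have 3: "(\<lambda>k. \<integral>x. bulk A B C (w k x) \<bullet> w' k x \<partial>volume_on V) \<longlonglongrightarrow> (\<integral>x. bulk A B C (u x) \<bullet> u' x \<partial>volume_on V)"
    by (rule V.integral_bulk_tendsto)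
       (use tracedD(2)[OF t] tracedD(2)[OF t'] in \<open>auto intro!: C1_L4 w w' traced_L4[OF t] traced_L4[OF t'] traced_AE_S0[OF t] traced_AE_S0[OF t'] BC\<close>)
  show ?thesis
    unfolding weak_form_def by (intro tendsto_add tendsto_sum tendsto_mult_left 1 2 3)
qed

end

section \<open>Uniqueness\<close>

text \<open>The exact deficit is kept because it is what later makes minimising sequences
  Cauchy.\<close>

lemma L2_parallelogram:
  fixes f g :: "'a \<Rightarrow> 'b::euclidean_space"
  assumes f: "f \<in> L2_space M" and g: "g \<in> L2_space M"
  shows "(L2_norm M (\<lambda>x. (1/2) *\<^sub>R (f x + g x)))\<^sup>2
     = (L2_norm M f)\<^sup>2 / 2 + (L2_norm M g)\<^sup>2 / 2 - (L2_norm M (\<lambda>x. f x - g x))\<^sup>2 / 4"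
proof -
  note i = L2_spaceD(2)[OF f] L2_spaceD(2)[OF g] L2_spaceD(2)[OF L2_space_diff[OF f g]]
  have e: "(norm ((1/2) *\<^sub>R (f x + g x)))\<^sup>2 = (norm (f x))\<^sup>2 / 2 + (norm (g x))\<^sup>2 / 2 - (norm (f x - g x))\<^sup>2 / 4" for x
  proof -
    have "(norm ((1/2) *\<^sub>R (f x + g x)))\<^sup>2 = (1/4) * (norm (f x + g x))\<^sup>2"
      by (simp add: power_divide)
    moreover have "(norm (f x + g x))\<^sup>2 = (norm (f x))\<^sup>2 + 2 * (f x \<bullet> g x) + (norm (g x))\<^sup>2"
      "(norm (f x - g x))\<^sup>2 = (norm (f x))\<^sup>2 - 2 * (f x \<bullet> g x) + (norm (g x))\<^sup>2"
      by (simp_all only: power2_norm_eq_inner inner_add_left inner_add_right inner_diff_left inner_diff_right inner_commute[of "g x" "f x"])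
    ultimately show ?thesis by linarith
  qed
  show ?thesis
    unfolding L2_norm_power2 e using i by simp
qed

lemma tendsto_L2_norm_diff_diff:
  assumes a: "\<And>k. a k \<in> L2_space M" "a' \<in> L2_space M" "(\<lambda>k. L2_norm M (\<lambda>x. a k x - a' x)) \<longlonglongrightarrow> 0"
    and b: "\<And>k. b k \<in> L2_space M" "b' \<in> L2_space M" "(\<lambda>k. L2_norm M (\<lambda>x. b k x - b' x)) \<longlonglongrightarrow> 0"
  shows "(\<lambda>k. L2_norm M (\<lambda>x. (a k x - b k x) - (a' x - b' x))) \<longlonglongrightarrow> 0"
proof (rule tendsto_0_dominated[OF L2_norm_nonneg])
  show "L2_norm M (\<lambda>x. (a k x - b k x) - (a' x - b' x)) \<le> L2_norm M (\<lambda>x. a k x - a' x) + L2_norm M (\<lambda>x. b k x - b' x)" for k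
  proof -
    have "L2_norm M (\<lambda>x. (a k x - a' x) + (b' x - b k x)) \<le> L2_norm M (\<lambda>x. a k x - a' x) + L2_norm M (\<lambda>x. b' x - b k x)"
      by (intro L2_norm_triangle L2_space_diff a b)
    moreover have "(\<lambda>x. (a k x - a' x) + (b' x - b k x)) = (\<lambda>x. (a k x - b k x) - (a' x - b' x))" by auto
    ultimately show ?thesis by (simp add: L2_norm_minus_commute[of M b'])
  qed
  show "(\<lambda>k. L2_norm M (\<lambda>x. a k x - a' x) + L2_norm M (\<lambda>x. b k x - b' x)) \<longlonglongrightarrow> 0"
    using tendsto_add[OF a(3) b(3)] by simp
qed

lemma continuous_on_bulk_energy: "continuous_on UNIV (bulk_energy A B C)"
proof -
  have m: "continuous_on UNIV (\<lambda>Q::real^3^3. Q ** Q)"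
    unfolding matrix_matrix_mult_def by (intro continuous_intros continuous_on_vec_lambda)
  then show ?thesis unfolding bulk_energy_def[abs_def] cubic_def by (intro continuous_intros)
qed

lemma continuous_on_anchoring_energy: "continuous_on UNIV (anchoring_energy s \<alpha>z \<gamma>z)"
  unfolding anchoring_energy_def[abs_def] by (intro continuous_intros continuous_on_component)

text \<open>For a small t of the sign opposite to W the linear term would win.\<close>

lemma real_first_variation:
  fixes W R :: real
  assumes "\<And>t. \<bar>t\<bar> \<le> 1 \<Longrightarrow> 0 \<le> t * W + t\<^sup>2 * R"
  shows "W = 0"
proof (rule ccontr)
  assume W: "W \<noteq> 0"
  \<comment> \<open>Small enough that the quadratic term is at most half of the linear one in
    absolute value; the summand 1 avoids division by zero.\<close>
  define r where "r = min 1 (\<bar>W\<bar> / (2 * (\<bar>R\<bar> + 1)))"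
  have c: "0 < 2 * (\<bar>R\<bar> + 1)" by simp
  have "r \<le> \<bar>W\<bar> / (2 * (\<bar>R\<bar> + 1))" by (simp add: r_def)
  then have r: "0 < r" "r \<le> 1" "r * (2 * (\<bar>R\<bar> + 1)) \<le> \<bar>W\<bar>"
    using W c by (simp_all only: pos_le_divide_eq[OF c]) (simp_all add: r_def)
  have "\<bar>- sgn W * r\<bar> \<le> 1" using r by (simp add: abs_mult W)
  from assms[OF this] have "0 \<le> - (r * \<bar>W\<bar>) + r\<^sup>2 * R"
    using W by (cases "W > 0") (auto simp: sgn_if)
  then have "r * \<bar>W\<bar> \<le> r * (r * R)" by (simp add: power2_eq_square mult.assoc)
  then have "\<bar>W\<bar> \<le> r * R" using r(1) by simp
  also have "\<dots> \<le> r * \<bar>R\<bar>" using r(1) by (intro mult_left_mono) auto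
  finally have "\<bar>W\<bar> \<le> r * \<bar>R\<bar>" .
  moreover have "r * (2 * (\<bar>R\<bar> + 1)) = 2 * (r * \<bar>R\<bar>) + 2 * r" by (simp add: algebra_simps)
  moreover have "0 \<le> r * \<bar>R\<bar>" using r by simp
  ultimately show False using r by linarith
qed

context square_well
begin

section \<open>Strict monotonicity and uniqueness\<close>

lemma traced_diff:
  assumes t: "traced w u v g G" and t': "traced w' u' v' g' G'"
  shows "traced (\<lambda>k x. w k x - w' k x) (\<lambda>x. u x - u' x) (\<lambda>e x. v e x - v' e x) (\<lambda>x. g x - g' x) (\<lambda>x. G x - G' x)"
proof -
  note w = tracedD(1)[OF t] and w' = tracedD(1)[OF t']
  show ?thesis
    unfolding traced_def C1_diff(2)[OF w w']
    by (intro conjI allI ballI C1_diff(1) w w' subspace_diff[OF subspace_S0] tracedD(2)[OF t] tracedD(2)[OF t'] L2_space_diff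
        tracedD(3,4,5,6)[OF t] tracedD(3,4,5,6)[OF t'] tendsto_L2_norm_diff_diff C1_L2_space
        tracedD(7,8,9,10)[OF t] tracedD(7,8,9,10)[OF t'])
qed

lemma traced_Poincare:
  assumes t: "traced w u v g G"
  shows "(nV u)\<^sup>2 \<le> 4 * (nL g)\<^sup>2 + 16 * (nV (v ex))\<^sup>2"
proof (rule LIMSEQ_le)
  note w = tracedD(1)[OF t]
  have ex: "ex \<in> Basis" by (simp add: Basis_point)
  show "(\<lambda>k. (nV (w k))\<^sup>2) \<longlonglongrightarrow> (nV u)\<^sup>2"
    by (intro tendsto_power tendsto_L2_norm C1_L2_space w tracedD(3,7)[OF t])
  show "(\<lambda>k. 4 * (nL (w k))\<^sup>2 + 16 * (nV (partial ex (w k)))\<^sup>2) \<longlonglongrightarrow> 4 * (nL g)\<^sup>2 + 16 * (nV (v ex))\<^sup>2"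
    by (intro tendsto_add tendsto_mult_left tendsto_power tendsto_L2_norm C1_L2_space w tracedD(4,5,8,9)[OF t] ex)
  show "\<exists>N. \<forall>k\<ge>N. (nV (w k))\<^sup>2 \<le> 4 * (nL (w k))\<^sup>2 + 16 * (nV (partial ex (w k)))\<^sup>2"
    using Poincare[OF w] by blast
qed

lemma weak_form_weak_partial:
  assumes t: "traced w u v g G" and t': "traced w' u' v' g' G'"
  shows "weak_form A B C L s \<alpha>z \<gamma>z lam u (\<lambda>e. weak_partial V e u) G u' (\<lambda>e. weak_partial V e u') G'
     = weak_form A B C L s \<alpha>z \<gamma>z lam u v G u' v' G'"
proof -
  have "(\<integral>x. weak_partial V e u x \<bullet> weak_partial V e u' x \<partial>volume_on V) = (\<integral>x. v e x \<bullet> v' e x \<partial>volume_on V)"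
    if e: "e \<in> Basis" for e
  proof (rule integral_cong_AE)
    have m: "weak_partial V e u \<in> L2_space (volume_on V)" "weak_partial V e u' \<in> L2_space (volume_on V)"
      by (rule V.weak_partial_AE(2)[OF traced_weak_partial(1)[OF t e] tracedD(4)[OF t e]]
               V.weak_partial_AE(2)[OF traced_weak_partial(1)[OF t' e] tracedD(4)[OF t' e]])+
    note [measurable] = L2_spaceD(1)[OF m(1)] L2_spaceD(1)[OF m(2)]
      L2_spaceD(1)[OF tracedD(4)[OF t e]] L2_spaceD(1)[OF tracedD(4)[OF t' e]]
    show "(\<lambda>x. weak_partial V e u x \<bullet> weak_partial V e u' x) \<in> borel_measurable (volume_on V)" by measurable
    show "(\<lambda>x. v e x \<bullet> v' e x) \<in> borel_measurable (volume_on V)" by measurable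
    show "AE x in volume_on V. weak_partial V e u x \<bullet> weak_partial V e u' x = v e x \<bullet> v' e x"
      using traced_weak_partial(2)[OF t e] traced_weak_partial(2)[OF t' e] by eventually_elim simp
  qed
  then show ?thesis by (simp add: weak_form_def)
qed

lemma weak_solution_iff:
  "weak_solution A B C L \<alpha>z \<gamma>z \<eta> g0 lam \<epsilon> Q \<longleftrightarrow>
     Q \<in> W12_S0 V \<and> has_trace V (lateral_measure \<eta> \<epsilon>) Q (Qb (s_plus A B C) \<eta> g0) \<and>
     (\<exists>G. has_trace V (Gamma_measure \<eta> \<epsilon>) Q G \<and>
       (\<forall>\<Phi> \<Psi>. \<Phi> \<in> W12_S0 V \<longrightarrow> has_trace V (lateral_measure \<eta> \<epsilon>) \<Phi> (\<lambda>_. 0) \<longrightarrow>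
          has_trace V (Gamma_measure \<eta> \<epsilon>) \<Phi> \<Psi> \<longrightarrow>
          weak_form A B C L (s_plus A B C) \<alpha>z \<gamma>z lam Q (\<lambda>e. weak_partial V e Q) G \<Phi> (\<lambda>e. weak_partial V e \<Phi>) \<Psi> = 0))"
  unfolding weak_solution_def weak_form_def Let_def ..

text \<open>The gradient term gives exactly \<open>gradsq v\<close>, the anchoring term is
  nonnegative since the linear part of \<open>H\<close> is positive semidefinite, and the bulk term
  loses at most K times the squared norm.\<close>

lemma weak_form_monotone:
  assumes t1: "traced w1 u1 v1 g1 G1" and t2: "traced w2 u2 v2 g2 G2"
    and pos: "0 < B" "0 < C" "0 \<le> \<alpha>z" "0 \<le> \<gamma>z" "0 \<le> lam" "0 < L"
  defines "u \<equiv> \<lambda>x. u1 x - u2 x" and "v \<equiv> \<lambda>e x. v1 e x - v2 e x" and "G \<equiv> \<lambda>x. G1 x - G2 x"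
  shows "gradsq v - lam\<^sup>2 / L * ((\<bar>A\<bar> + B\<^sup>2 / C) * (nV u)\<^sup>2)
     \<le> weak_form A B C L s \<alpha>z \<gamma>z lam u1 v1 G1 u v G - weak_form A B C L s \<alpha>z \<gamma>z lam u2 v2 G2 u v G"
proof -
  have t: "traced (\<lambda>k x. w1 k x - w2 k x) u v (\<lambda>x. g1 x - g2 x) G"
    unfolding u_def v_def G_def by (rule traced_diff[OF t1 t2])
  have 1: "(\<Sum>e\<in>Basis. \<integral>x. v1 e x \<bullet> v e x \<partial>volume_on V) - (\<Sum>e\<in>Basis. \<integral>x. v2 e x \<bullet> v e x \<partial>volume_on V) = gradsq v"
    unfolding sum_subtractf[symmetric]
  proof (rule sum.cong[OF refl])
    fix e :: point assume e: "e \<in> Basis"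
    have "(\<integral>x. v1 e x \<bullet> v e x \<partial>volume_on V) - (\<integral>x. v2 e x \<bullet> v e x \<partial>volume_on V) = (\<integral>x. v1 e x \<bullet> v e x - v2 e x \<bullet> v e x \<partial>volume_on V)"
      by (rule Bochner_Integration.integral_diff[symmetric]) (intro integrable_inner_L2 tracedD(4)[OF t1] tracedD(4)[OF t2] tracedD(4)[OF t] e)+
    also have "\<dots> = (nV (v e))\<^sup>2"
      unfolding L2_norm_power2 v_def by (simp add: power2_norm_eq_inner inner_diff_left)
    finally show "(\<integral>x. v1 e x \<bullet> v e x \<partial>volume_on V) - (\<integral>x. v2 e x \<bullet> v e x \<partial>volume_on V) = (nV (v e))\<^sup>2" .
  qed
  let ?h = "\<lambda>G x. H s \<alpha>z \<gamma>z (G x)"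
  have 2: "0 \<le> (\<integral>x. ?h G1 x \<bullet> G x \<partial>Gamma_measure \<eta> \<epsilon>) - (\<integral>x. ?h G2 x \<bullet> G x \<partial>Gamma_measure \<eta> \<epsilon>)"
  proof -
    have "0 \<le> (\<integral>x. ?h G1 x \<bullet> G x - ?h G2 x \<bullet> G x \<partial>Gamma_measure \<eta> \<epsilon>)"
    proof (rule integral_nonneg_AE)
      show "AE x in Gamma_measure \<eta> \<epsilon>. 0 \<le> ?h G1 x \<bullet> G x - ?h G2 x \<bullet> G x"
        using traced_AE_S0(3)[OF t]
      proof eventually_elim
        case (elim x)
        have "?h G1 x \<bullet> G x - ?h G2 x \<bullet> G x = H 0 \<alpha>z \<gamma>z (G x) \<bullet> G x"
          by (simp add: G_def H_diff flip: inner_diff_left)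
        also have "\<dots> = 2 * \<alpha>z * (G x $ 3 $ 3)\<^sup>2 + 2 * \<gamma>z * ((G x $ 1 $ 3)\<^sup>2 + (G x $ 2 $ 3)\<^sup>2)"
          unfolding H_inner[OF elim] by (simp add: power2_eq_square)
        finally show ?case using pos by simp
      qed
    qed
    also have "\<dots> = (\<integral>x. ?h G1 x \<bullet> G x \<partial>Gamma_measure \<eta> \<epsilon>) - (\<integral>x. ?h G2 x \<bullet> G x \<partial>Gamma_measure \<eta> \<epsilon>)"
      by (rule Bochner_Integration.integral_diff) (intro integrable_inner_L2 H_L2 tracedD(6)[OF t1] tracedD(6)[OF t2] tracedD(6)[OF t])+
    finally show ?thesis .
  qed
  have 3: "- ((\<bar>A\<bar> + B\<^sup>2 / C) * (nV u)\<^sup>2)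
     \<le> (\<integral>x. bulk A B C (u1 x) \<bullet> u x \<partial>volume_on V) - (\<integral>x. bulk A B C (u2 x) \<bullet> u x \<partial>volume_on V)"
  proof -
    have i: "integrable (volume_on V) (\<lambda>x. bulk A B C (u1 x) \<bullet> u x)" "integrable (volume_on V) (\<lambda>x. bulk A B C (u2 x) \<bullet> u x)"
      by (intro V.integral_bulk_le(1) traced_L4(1)[OF t1] traced_L4(1)[OF t2] traced_L4(1)[OF t] traced_AE_S0(1)[OF t1]
          traced_AE_S0(1)[OF t2] traced_AE_S0(1)[OF t] pos)+
    have "- ((\<bar>A\<bar> + B\<^sup>2 / C) * (nV u)\<^sup>2) = (\<integral>x. - ((\<bar>A\<bar> + B\<^sup>2 / C) * (norm (u x))\<^sup>2) \<partial>volume_on V)"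
      unfolding L2_norm_power2 by simp
    also have "\<dots> \<le> (\<integral>x. bulk A B C (u1 x) \<bullet> u x - bulk A B C (u2 x) \<bullet> u x \<partial>volume_on V)"
    proof (rule integral_mono_AE)
      show "integrable (volume_on V) (\<lambda>x. - ((\<bar>A\<bar> + B\<^sup>2 / C) * (norm (u x))\<^sup>2))"
        using L2_spaceD(2)[OF tracedD(3)[OF t]] by simp
      show "integrable (volume_on V) (\<lambda>x. bulk A B C (u1 x) \<bullet> u x - bulk A B C (u2 x) \<bullet> u x)"
        by (intro Bochner_Integration.integrable_diff i)
      show "AE x in volume_on V. - ((\<bar>A\<bar> + B\<^sup>2 / C) * (norm (u x))\<^sup>2) \<le> bulk A B C (u1 x) \<bullet> u x - bulk A B C (u2 x) \<bullet> u x"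
        using traced_AE_S0(1)[OF t1] traced_AE_S0(1)[OF t2]
      proof eventually_elim
        case (elim x)
        then show ?case
          using bulk_monotone[OF elim pos(2), of A B] by (simp add: u_def power2_norm_eq_inner)
      qed
    qed
    also have "\<dots> = (\<integral>x. bulk A B C (u1 x) \<bullet> u x \<partial>volume_on V) - (\<integral>x. bulk A B C (u2 x) \<bullet> u x \<partial>volume_on V)"
      by (rule Bochner_Integration.integral_diff[OF i])
    finally show ?thesis .
  qed
  have "0 \<le> lam / L * ((\<integral>x. ?h G1 x \<bullet> G x \<partial>Gamma_measure \<eta> \<epsilon>) - (\<integral>x. ?h G2 x \<bullet> G x \<partial>Gamma_measure \<eta> \<epsilon>))"
    using 2 pos by simp
  moreover have "lam\<^sup>2 / L * (- ((\<bar>A\<bar> + B\<^sup>2 / C) * (nV u)\<^sup>2))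
     \<le> lam\<^sup>2 / L * ((\<integral>x. bulk A B C (u1 x) \<bullet> u x \<partial>volume_on V) - (\<integral>x. bulk A B C (u2 x) \<bullet> u x \<partial>volume_on V))"
    using 3 pos by (intro mult_left_mono) auto
  ultimately show ?thesis
    using 1 unfolding weak_form_def by (simp only: right_diff_distrib mult_minus_right)
qed

text \<open>Both equations are tested with the difference of the solutions, which is admissible
  because its lateral trace is zero.\<close>

lemma weak_solution_unique:
  assumes pos: "0 < B" "0 < C" "0 \<le> \<alpha>z" "0 \<le> \<gamma>z" "0 \<le> lam" "0 < L"
    and small: "32 * ((\<bar>A\<bar> + B\<^sup>2 / C) * lam\<^sup>2) \<le> L"
    and S: "AE x in lateral_measure \<eta> \<epsilon>. Qb (s_plus A B C) \<eta> g0 x \<in> S0"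
    and s1: "weak_solution A B C L \<alpha>z \<gamma>z \<eta> g0 lam \<epsilon> Q1" and s2: "weak_solution A B C L \<alpha>z \<gamma>z \<eta> g0 lam \<epsilon> Q2"
  shows "AE x in volume_on V. Q1 x = Q2 x"
proof -
  let ?s = "s_plus A B C" and ?K = "\<bar>A\<bar> + B\<^sup>2 / C"
  let ?test = "\<lambda>Q G. \<forall>\<Phi> \<Psi>. \<Phi> \<in> W12_S0 V \<longrightarrow> has_trace V (lateral_measure \<eta> \<epsilon>) \<Phi> (\<lambda>_. 0) \<longrightarrow>
          has_trace V (Gamma_measure \<eta> \<epsilon>) \<Phi> \<Psi> \<longrightarrow>
          weak_form A B C L ?s \<alpha>z \<gamma>z lam Q (\<lambda>e. weak_partial V e Q) G \<Phi> (\<lambda>e. weak_partial V e \<Phi>) \<Psi> = 0"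
  obtain G1 where G1: "Q1 \<in> W12_S0 V" "has_trace V (lateral_measure \<eta> \<epsilon>) Q1 (Qb ?s \<eta> g0)"
      "has_trace V (Gamma_measure \<eta> \<epsilon>) Q1 G1" "?test Q1 G1"
    using s1 unfolding weak_solution_iff by blast
  obtain G2 where G2: "Q2 \<in> W12_S0 V" "has_trace V (lateral_measure \<eta> \<epsilon>) Q2 (Qb ?s \<eta> g0)"
      "has_trace V (Gamma_measure \<eta> \<epsilon>) Q2 G2" "?test Q2 G2"
    using s2 unfolding weak_solution_iff by blast
  obtain w1 where t1: "traced w1 Q1 (\<lambda>e. weak_partial V e Q1) (Qb ?s \<eta> g0) G1"
    using has_trace_traced[OF G1(1-3) S] by blast
  obtain w2 where t2: "traced w2 Q2 (\<lambda>e. weak_partial V e Q2) (Qb ?s \<eta> g0) G2"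
    using has_trace_traced[OF G2(1-3) S] by blast
  let ?u = "\<lambda>x. Q1 x - Q2 x" and ?v = "\<lambda>e x. weak_partial V e Q1 x - weak_partial V e Q2 x" and ?G = "\<lambda>x. G1 x - G2 x"
  have t: "traced (\<lambda>k x. w1 k x - w2 k x) ?u ?v (\<lambda>x. 0) ?G"
    using traced_diff[OF t1 t2] by (simp only: diff_self)
  have z1: "weak_form A B C L ?s \<alpha>z \<gamma>z lam Q1 (\<lambda>e. weak_partial V e Q1) G1 ?u ?v ?G = 0"
    by (rule trans[OF weak_form_weak_partial[OF t1 t, symmetric]]) (use G1(4) traced_has_trace[OF t] in blast)
  have z2: "weak_form A B C L ?s \<alpha>z \<gamma>z lam Q2 (\<lambda>e. weak_partial V e Q2) G2 ?u ?v ?G = 0"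
    by (rule trans[OF weak_form_weak_partial[OF t2 t, symmetric]]) (use G2(4) traced_has_trace[OF t] in blast)
  have m: "gradsq ?v \<le> lam\<^sup>2 / L * (?K * (nV ?u)\<^sup>2)"
    using weak_form_monotone[OF t1 t2 pos, of A ?s] unfolding z1 z2 by simp
  have P: "(nV ?u)\<^sup>2 \<le> 16 * gradsq ?v"
  proof -
    have "(nV (?v ex))\<^sup>2 \<le> gradsq ?v" by (simp add: sum_Basis_point)
    then show ?thesis using traced_Poincare[OF t] by simp
  qed
  \<comment> \<open>Against the Poincare factor 16 this leaves half of the squared norm of the
    difference on the right, which forces it to vanish.\<close>
  have "?K * lam\<^sup>2 / L \<le> 1 / 32" using small pos by (simp add: field_simps)
  then have "?K * lam\<^sup>2 / L * (nV ?u)\<^sup>2 \<le> 1 / 32 * (nV ?u)\<^sup>2" by (rule mult_right_mono) simp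
  moreover have "lam\<^sup>2 / L * (?K * (nV ?u)\<^sup>2) = ?K * lam\<^sup>2 / L * (nV ?u)\<^sup>2"
    by (simp only: times_divide_eq_left times_divide_eq_right mult_ac)
  ultimately have "gradsq ?v \<le> 1 / 32 * (nV ?u)\<^sup>2" using m by (simp only: order_trans)
  with P have "(nV ?u)\<^sup>2 \<le> 0" by linarith
  then have "nV ?u = 0" by simp
  then have "AE x in volume_on V. ?u x = 0" by (rule L2_norm_eq_0_D[OF tracedD(3)[OF t]])
  then show ?thesis by simp
qed

section \<open>The energy of C^1 fields\<close>

definition energy :: "real \<Rightarrow> real \<Rightarrow> real \<Rightarrow> real \<Rightarrow> real \<Rightarrow> real \<Rightarrow> real \<Rightarrow> real \<Rightarrow> (point \<Rightarrow> real^3^3) \<Rightarrow> real" where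
  "energy A B C L s \<alpha>z \<gamma>z lam w = gradsq (\<lambda>e. partial e w) / 2
     + lam / L * (\<integral>x. anchoring_energy s \<alpha>z \<gamma>z (w x) \<partial>Gamma_measure \<eta> \<epsilon>)
     + lam\<^sup>2 / L * (\<integral>x. bulk_energy A B C (w x) \<partial>volume_on V)"

lemma C1_energy_integrable:
  assumes w: "continuously_differentiable w"
  shows "integrable (Gamma_measure \<eta> \<epsilon>) (\<lambda>x. anchoring_energy s \<alpha>z \<gamma>z (w x))"
    "integrable (volume_on V) (\<lambda>x. bulk_energy A B C (w x))"
proof -
  show "integrable (Gamma_measure \<eta> \<epsilon>) (\<lambda>x. anchoring_energy s \<alpha>z \<gamma>z (w x))"
    by (rule continuous_integrable[OF bfm_Gamma])
       (rule continuous_on_compose2[OF continuous_on_anchoring_energy C1_continuous_on[OF w]], simp)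
  show "integrable (volume_on V) (\<lambda>x. bulk_energy A B C (w x))"
    by (rule continuous_integrable[OF V.bfm])
       (rule continuous_on_compose2[OF continuous_on_bulk_energy C1_continuous_on[OF w]], simp)
qed

text \<open>Uniform convexity: the parallelogram law contributes the gain in the gradient, against
  which only the concave part of the bulk energy has to be weighed.\<close>

lemma energy_midpoint:
  assumes u: "continuously_differentiable u" "\<And>x. u x \<in> S0" and w: "continuously_differentiable w" "\<And>x. w x \<in> S0"
    and pos: "0 < C" "0 \<le> \<alpha>z" "0 \<le> \<gamma>z" "0 \<le> lam" "0 < L"
  defines "d \<equiv> \<lambda>x. u x - w x"
  shows "energy A B C L s \<alpha>z \<gamma>z lam (\<lambda>x. (1/2) *\<^sub>R (u x + w x))
     \<le> (energy A B C L s \<alpha>z \<gamma>z lam u + energy A B C L s \<alpha>z \<gamma>z lam w) / 2 - gradsq (\<lambda>e. partial e d) / 8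
       + lam\<^sup>2 / L * ((\<bar>A\<bar> + B\<^sup>2 / C) / 8 * (nV d)\<^sup>2)"
proof -
  let ?m = "\<lambda>x. (1/2) *\<^sub>R (u x + w x)"
  have m: "continuously_differentiable ?m" by (intro C1_scaleR(1) C1_add(1) u w)
  have mp: "partial e ?m x = (1/2) *\<^sub>R (partial e u x + partial e w x)" for e x
    using C1_scaleR(2)[OF C1_add(1)[OF u(1) w(1)]] C1_add(2)[OF u(1) w(1)] by simp
  have dC: "continuously_differentiable d" unfolding d_def by (intro C1_diff(1) u w)
  have dp: "partial e d x = partial e u x - partial e w x" for e x
    unfolding d_def by (rule C1_diff(2)[OF u(1) w(1)])
  have "gradsq (\<lambda>e. partial e ?m) = (\<Sum>e\<in>Basis. (nV (partial e u))\<^sup>2 / 2 + (nV (partial e w))\<^sup>2 / 2 - (nV (partial e d))\<^sup>2 / 4)"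
    unfolding mp dp by (intro sum.cong refl L2_parallelogram C1_L2_space u w)
  then have 1: "gradsq (\<lambda>e. partial e ?m) / 2 = (gradsq (\<lambda>e. partial e u) / 2 + gradsq (\<lambda>e. partial e w) / 2) / 2 - gradsq (\<lambda>e. partial e d) / 8"
    by (simp add: sum.distrib sum_subtractf sum_divide_distrib[symmetric])
  let ?h = "\<lambda>f. \<integral>x. anchoring_energy s \<alpha>z \<gamma>z (f x) \<partial>Gamma_measure \<eta> \<epsilon>"
  have "?h ?m \<le> (\<integral>x. (anchoring_energy s \<alpha>z \<gamma>z (u x) + anchoring_energy s \<alpha>z \<gamma>z (w x)) / 2 \<partial>Gamma_measure \<eta> \<epsilon>)"
    using C1_energy_integrable(1)[OF m] C1_energy_integrable(1)[OF u(1)] C1_energy_integrable(1)[OF w(1)]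
    by (intro integral_mono anchoring_energy_midpoint pos) auto
  also have "\<dots> = (?h u + ?h w) / 2"
    using C1_energy_integrable(1)[OF u(1)] C1_energy_integrable(1)[OF w(1)] by simp
  finally have 2: "lam / L * ?h ?m \<le> lam / L * ((?h u + ?h w) / 2)"
    using pos by (intro mult_left_mono) auto
  let ?f = "\<lambda>f. \<integral>x. bulk_energy A B C (f x) \<partial>volume_on V"
  have di: "integrable (volume_on V) (\<lambda>x. (\<bar>A\<bar> + B\<^sup>2 / C) / 8 * (norm (d x))\<^sup>2)"
    using L2_spaceD(2)[OF C1_L2_space(1)[OF dC]] by simp
  have "?f ?m \<le> (\<integral>x. (bulk_energy A B C (u x) + bulk_energy A B C (w x)) / 2 + (\<bar>A\<bar> + B\<^sup>2 / C) / 8 * (norm (d x))\<^sup>2 \<partial>volume_on V)"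
  proof (rule integral_mono)
    show "integrable (volume_on V) (\<lambda>x. (bulk_energy A B C (u x) + bulk_energy A B C (w x)) / 2 + (\<bar>A\<bar> + B\<^sup>2 / C) / 8 * (norm (d x))\<^sup>2)"
      using C1_energy_integrable(2)[OF u(1)] C1_energy_integrable(2)[OF w(1)] di by (intro Bochner_Integration.integrable_add) auto
    show "bulk_energy A B C (?m x) \<le> (bulk_energy A B C (u x) + bulk_energy A B C (w x)) / 2 + (\<bar>A\<bar> + B\<^sup>2 / C) / 8 * (norm (d x))\<^sup>2" for x
      using bulk_energy_midpoint[OF u(2) w(2) pos(1)] by (simp add: d_def power2_norm_eq_inner)
  qed (rule C1_energy_integrable(2)[OF m])
  also have "\<dots> = (\<integral>x. (bulk_energy A B C (u x) + bulk_energy A B C (w x)) / 2 \<partial>volume_on V) + (\<integral>x. (\<bar>A\<bar> + B\<^sup>2 / C) / 8 * (norm (d x))\<^sup>2 \<partial>volume_on V)"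
    using C1_energy_integrable(2)[OF u(1)] C1_energy_integrable(2)[OF w(1)] di by (intro Bochner_Integration.integral_add) auto
  also have "(\<integral>x. (\<bar>A\<bar> + B\<^sup>2 / C) / 8 * (norm (d x))\<^sup>2 \<partial>volume_on V) = (\<bar>A\<bar> + B\<^sup>2 / C) / 8 * (nV d)\<^sup>2"
    unfolding L2_norm_power2 by (rule integral_mult_right_zero)
  also have "(\<integral>x. (bulk_energy A B C (u x) + bulk_energy A B C (w x)) / 2 \<partial>volume_on V) = (?f u + ?f w) / 2"
    using C1_energy_integrable(2)[OF u(1)] C1_energy_integrable(2)[OF w(1)] by simp
  finally have 3: "lam\<^sup>2 / L * ?f ?m \<le> lam\<^sup>2 / L * ((?f u + ?f w) / 2 + (\<bar>A\<bar> + B\<^sup>2 / C) / 8 * (nV d)\<^sup>2)"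
    using pos by (intro mult_left_mono) auto
  have 4: "c * ((p + q) / 2) = (c * p + c * q) / 2" for c p q :: real by (simp add: distrib_left)
  have "a + b + c \<le> (a1 + b1 + c1 + (a2 + b2 + c2)) / 2 - d + e"
    if "a = (a1 + a2) / 2 - d" "b \<le> (b1 + b2) / 2" "c \<le> (c1 + c2) / 2 + e" for a b c a1 a2 b1 b2 c1 c2 d e :: real
    using that by argo
  from this[OF 1 2[unfolded 4] 3[unfolded distrib_left[of "lam\<^sup>2 / L"] 4]] show ?thesis
    unfolding energy_def .
qed

text \<open>The first variation of the energy is the weak form. The remainder is expressed by norms
  that stay bounded along approximating sequences, so the expansion survives the passage to the
  limit.\<close>

lemma energy_Taylor:
  assumes w: "continuously_differentiable w" "\<And>x. w x \<in> S0" and f: "continuously_differentiable f" "\<And>x. f x \<in> S0"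
    and pos: "A \<le> 0" "0 < B" "0 < C" "0 \<le> \<alpha>z" "0 \<le> \<gamma>z" "0 \<le> lam" "0 < L" and t: "\<bar>t\<bar> \<le> 1"
  shows "energy A B C L s \<alpha>z \<gamma>z lam (\<lambda>x. w x + t *\<^sub>R f x)
     \<le> energy A B C L s \<alpha>z \<gamma>z lam w
       + t * weak_form A B C L s \<alpha>z \<gamma>z lam w (\<lambda>e. partial e w) w f (\<lambda>e. partial e f) f
       + t\<^sup>2 * (gradsq (\<lambda>e. partial e f) / 2 + lam / L * ((\<alpha>z + 2 * \<gamma>z) * (nG f)\<^sup>2)
          + lam\<^sup>2 / L * ((2 * B + 3 * C) * ((L2_norm (volume_on V) (\<lambda>x. 1::real) + L4_sq (volume_on V) w + L4_sq (volume_on V) f)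
              * L4_sq (volume_on V) f)))"
proof -
  let ?m = "\<lambda>x. w x + t *\<^sub>R f x"
  have tf: "continuously_differentiable (\<lambda>x. t *\<^sub>R f x)" by (rule C1_scaleR(1)[OF f(1)])
  have m: "continuously_differentiable ?m" by (rule C1_add(1)[OF w(1) tf])
  have mp: "partial e ?m x = partial e w x + t *\<^sub>R partial e f x" for e x
    using C1_add(2)[OF w(1) tf] C1_scaleR(2)[OF f(1)] by simp
  note Lw = C1_L2_space[OF w(1)] and Lf = C1_L2_space[OF f(1)]
  have "(nV (partial e ?m))\<^sup>2 = (nV (partial e w))\<^sup>2 + 2 * t * (\<integral>x. partial e w x \<bullet> partial e f x \<partial>volume_on V) + t\<^sup>2 * (nV (partial e f))\<^sup>2" for e
  proof -
    have q: "(norm (a + t *\<^sub>R b))\<^sup>2 = (norm a)\<^sup>2 + 2 * t * (a \<bullet> b) + t\<^sup>2 * (norm b)\<^sup>2" for a b :: "real^3^3"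
    proof -
      have "(norm (a + c))\<^sup>2 = (norm a)\<^sup>2 + 2 * (a \<bullet> c) + (norm c)\<^sup>2" for c
        by (simp only: power2_norm_eq_inner inner_add_left inner_add_right inner_commute[of c a])
      then show ?thesis by (simp add: power_mult_distrib mult.assoc)
    qed
    show ?thesis
      unfolding L2_norm_power2 mp q
      using L2_spaceD(2)[OF Lw(2)[of e]] L2_spaceD(2)[OF Lf(2)[of e]] integrable_inner_L2[OF Lw(2)[of e] Lf(2)[of e]] by simp
  qed
  then have 1: "gradsq (\<lambda>e. partial e ?m) / 2 = gradsq (\<lambda>e. partial e w) / 2
      + t * (\<Sum>e\<in>Basis. \<integral>x. partial e w x \<bullet> partial e f x \<partial>volume_on V) + t\<^sup>2 * (gradsq (\<lambda>e. partial e f) / 2)"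
    by (simp add: sum.distrib sum_distrib_left sum_divide_distrib add_divide_distrib)
  let ?h = "\<lambda>f. \<integral>x. anchoring_energy s \<alpha>z \<gamma>z (f x) \<partial>Gamma_measure \<eta> \<epsilon>"
  have hi: "integrable (Gamma_measure \<eta> \<epsilon>) (\<lambda>x. H s \<alpha>z \<gamma>z (w x) \<bullet> f x)"
    by (rule integrable_inner_L2[OF H_L2[OF Lw(4)] Lf(4)])
  have "?h ?m \<le> (\<integral>x. anchoring_energy s \<alpha>z \<gamma>z (w x) + t * (H s \<alpha>z \<gamma>z (w x) \<bullet> f x) + t\<^sup>2 * ((\<alpha>z + 2 * \<gamma>z) * (norm (f x))\<^sup>2) \<partial>Gamma_measure \<eta> \<epsilon>)"
  proof (rule integral_mono)
    show "integrable (Gamma_measure \<eta> \<epsilon>) (\<lambda>x. anchoring_energy s \<alpha>z \<gamma>z (w x) + t * (H s \<alpha>z \<gamma>z (w x) \<bullet> f x) + t\<^sup>2 * ((\<alpha>z + 2 * \<gamma>z) * (norm (f x))\<^sup>2))"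
      using C1_energy_integrable(1)[OF w(1)] hi L2_spaceD(2)[OF Lf(4)] by (intro Bochner_Integration.integrable_add) auto
    show "anchoring_energy s \<alpha>z \<gamma>z (?m x) \<le> anchoring_energy s \<alpha>z \<gamma>z (w x) + t * (H s \<alpha>z \<gamma>z (w x) \<bullet> f x) + t\<^sup>2 * ((\<alpha>z + 2 * \<gamma>z) * (norm (f x))\<^sup>2)" for x
      unfolding anchoring_energy_add[OF f(2)]
      by (intro add_left_mono mult_left_mono anchoring_energy_le pos) auto
  qed (rule C1_energy_integrable(1)[OF m])
  also have "\<dots> = ?h w + t * (\<integral>x. H s \<alpha>z \<gamma>z (w x) \<bullet> f x \<partial>Gamma_measure \<eta> \<epsilon>) + t\<^sup>2 * ((\<alpha>z + 2 * \<gamma>z) * (nG f)\<^sup>2)"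
    using C1_energy_integrable(1)[OF w(1)] hi L2_spaceD(2)[OF Lf(4)] by (simp add: L2_norm_power2)
  finally have 2: "lam / L * ?h ?m \<le> lam / L * (?h w + t * (\<integral>x. H s \<alpha>z \<gamma>z (w x) \<bullet> f x \<partial>Gamma_measure \<eta> \<epsilon>) + t\<^sup>2 * ((\<alpha>z + 2 * \<gamma>z) * (nG f)\<^sup>2))"
    using pos by (intro mult_left_mono) auto
  let ?f = "\<lambda>f. \<integral>x. bulk_energy A B C (f x) \<partial>volume_on V"
  let ?W = "\<lambda>x. (1 + (norm (w x))\<^sup>2 + (norm (f x))\<^sup>2) * (norm (f x) * norm (f x))"
  note W = V.integral_weight_le[OF C1_L4[OF w(1)] C1_L4[OF f(1)] C1_L4[OF f(1)] C1_L4[OF f(1)]]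
  have bi: "integrable (volume_on V) (\<lambda>x. bulk A B C (w x) \<bullet> f x)"
    by (rule V.integral_bulk_le(1)[OF C1_L4[OF w(1)] _ C1_L4[OF f(1)] _ pos(2,3)]) (simp_all add: w(2) f(2))
  have "?f ?m \<le> (\<integral>x. bulk_energy A B C (w x) + t * (bulk A B C (w x) \<bullet> f x) + t\<^sup>2 * (2 * B + 3 * C) * ?W x \<partial>volume_on V)"
  proof (rule integral_mono)
    show "integrable (volume_on V) (\<lambda>x. bulk_energy A B C (w x) + t * (bulk A B C (w x) \<bullet> f x) + t\<^sup>2 * (2 * B + 3 * C) * ?W x)"
      by (intro Bochner_Integration.integrable_add integrable_mult_right C1_energy_integrable(2)[OF w(1)] bi W(1))
    show "bulk_energy A B C (?m x) \<le> bulk_energy A B C (w x) + t * (bulk A B C (w x) \<bullet> f x) + t\<^sup>2 * (2 * B + 3 * C) * ?W x" for x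
      using bulk_energy_Taylor[OF w(2) f(2) pos(1-3) t] by (simp add: power2_eq_square[of "norm (f x)", symmetric])
  qed (rule C1_energy_integrable(2)[OF m])
  also have "\<dots> = ?f w + t * (\<integral>x. bulk A B C (w x) \<bullet> f x \<partial>volume_on V) + t\<^sup>2 * (2 * B + 3 * C) * (\<integral>x. ?W x \<partial>volume_on V)"
    by (subst Bochner_Integration.integral_add[OF Bochner_Integration.integrable_add integrable_mult_right])
       (simp_all only: Bochner_Integration.integral_add integral_mult_right_zero integrable_mult_right C1_energy_integrable(2)[OF w(1)] bi W(1))
  also have "\<dots> \<le> ?f w + t * (\<integral>x. bulk A B C (w x) \<bullet> f x \<partial>volume_on V) + t\<^sup>2 * (2 * B + 3 * C)
      * ((L2_norm (volume_on V) (\<lambda>x. 1::real) + L4_sq (volume_on V) w + L4_sq (volume_on V) f) * L4_sq (volume_on V) f)"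
    using W(2) pos by (intro add_left_mono mult_left_mono) (auto simp: L4_sq_nonneg)
  finally have 3: "lam\<^sup>2 / L * ?f ?m \<le> lam\<^sup>2 / L * (?f w + t * (\<integral>x. bulk A B C (w x) \<bullet> f x \<partial>volume_on V) + t\<^sup>2 * (2 * B + 3 * C)
      * ((L2_norm (volume_on V) (\<lambda>x. 1::real) + L4_sq (volume_on V) w + L4_sq (volume_on V) f) * L4_sq (volume_on V) f))"
    using pos by (intro mult_left_mono) auto
  \<comment> \<open>Collects the powers of t, for plain reals in order to keep the arithmetic apart
    from the integrals.\<close>
  have "a + b + c \<le> a1 + l * b1 + l2 * c1 + t * (a2 + l * b2 + l2 * c2) + t\<^sup>2 * (a3 + l * b3 + l2 * c3)"
    if "a = a1 + t * a2 + t\<^sup>2 * a3" "b \<le> l * (b1 + t * b2 + t\<^sup>2 * b3)" "c \<le> l2 * (c1 + t * c2 + t\<^sup>2 * c3)"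
    for a b c a1 a2 a3 b1 b2 b3 c1 c2 c3 l l2 :: real
  proof -
    have "a1 + l * b1 + l2 * c1 + t * (a2 + l * b2 + l2 * c2) + t\<^sup>2 * (a3 + l * b3 + l2 * c3)
       = (a1 + t * a2 + t\<^sup>2 * a3) + l * (b1 + t * b2 + t\<^sup>2 * b3) + l2 * (c1 + t * c2 + t\<^sup>2 * c3)"
      by (simp add: algebra_simps)
    then show ?thesis using that by argo
  qed
  from this[OF 1 2 3[unfolded mult.assoc]] show ?thesis
    unfolding energy_def weak_form_def by (simp only: mult.assoc)
qed

lemma energy_bounded_below:
  assumes "0 < B" "0 < C" "0 \<le> \<alpha>z" "0 \<le> \<gamma>z" "0 \<le> lam" "0 < L"
  obtains E0 where "\<And>w. continuously_differentiable w \<Longrightarrow> E0 \<le> energy A B C L s \<alpha>z \<gamma>z lam w"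
proof -
  obtain c where c: "\<And>Q. - c \<le> bulk_energy A B C Q" using bulk_energy_bounded_below[OF assms(1,2)] by metis
  have "lam\<^sup>2 / L * (\<integral>x. - c \<partial>volume_on V) \<le> energy A B C L s \<alpha>z \<gamma>z lam w" if w: "continuously_differentiable w" for w
  proof -
    have "0 \<le> gradsq (\<lambda>e. partial e w) / 2" by (simp add: sum_nonneg)
    moreover have "0 \<le> lam / L * (\<integral>x. anchoring_energy s \<alpha>z \<gamma>z (w x) \<partial>Gamma_measure \<eta> \<epsilon>)"
      using assms by (intro mult_nonneg_nonneg integral_nonneg_AE) (auto simp: anchoring_energy_nonneg)
    moreover have "lam\<^sup>2 / L * (\<integral>x. - c \<partial>volume_on V) \<le> lam\<^sup>2 / L * (\<integral>x. bulk_energy A B C (w x) \<partial>volume_on V)"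
      using assms c by (intro mult_left_mono integral_mono C1_energy_integrable(2)[OF w]) auto
    ultimately show ?thesis unfolding energy_def by linarith
  qed
  then show ?thesis using that by blast
qed

end

section \<open>Minimisation of the energy\<close>

text \<open>The Cauchy property in the shape in which the minimisation delivers it: squared
  distances bounded by a null sequence.\<close>

lemma L2_complete_bound:
  fixes f :: "nat \<Rightarrow> 'a \<Rightarrow> 'b::euclidean_space"
  assumes M: "finite_measure M" and f: "\<And>k. f k \<in> L2_space M"
    and b: "\<And>N i j. N \<le> i \<Longrightarrow> N \<le> j \<Longrightarrow> (L2_norm M (\<lambda>x. f i x - f j x))\<^sup>2 \<le> \<tau> N" and \<tau>: "\<tau> \<longlonglongrightarrow> 0"
  obtains g where "g \<in> L2_space M" "(\<lambda>k. L2_norm M (\<lambda>x. f k x - g x)) \<longlonglongrightarrow> 0"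
proof -
  have "\<exists>N. \<forall>i\<ge>N. \<forall>j\<ge>N. L2_norm M (\<lambda>x. f i x - f j x) < e" if "e > 0" for e
  proof -
    have "eventually (\<lambda>N. \<tau> N < e\<^sup>2) sequentially" using that by (intro order_tendstoD(2)[OF \<tau>]) simp
    then obtain N where "\<tau> N < e\<^sup>2" by (auto simp: eventually_sequentially)
    then have "L2_norm M (\<lambda>x. f i x - f j x) < e" if "i \<ge> N" "j \<ge> N" for i j
      using b[OF that] \<open>e > 0\<close> by (intro power2_less_imp_less[of _ e]) auto
    then show ?thesis by blast
  qed
  from finite_measure.L2_complete[OF M f this] show ?thesis using that by metis
qed

context square_well
begin

text \<open>The sequence \<open>b\<close> makes every level nonempty and bounds the infima from
  above, so that their limit m, which takes the place of the minimal energy, is finite.\<close>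

lemma minimizer:
  assumes pos: "A \<le> 0" "0 < B" "0 < C" "0 \<le> \<alpha>z" "0 \<le> \<gamma>z" "0 \<le> lam" "0 < L"
    and small: "32 * ((\<bar>A\<bar> + B\<^sup>2 / C) * lam\<^sup>2) \<le> L"
    and g: "g \<in> L2_space (lateral_measure \<eta> \<epsilon>)"
    and b: "\<And>k. continuously_differentiable (b k)" "\<And>k x. b k x \<in> S0" "(\<lambda>k. nL (\<lambda>x. b k x - g x)) \<longlonglongrightarrow> 0"
      "\<And>k. energy A B C L s \<alpha>z \<gamma>z lam (b k) \<le> M"
  obtains w u v G where "traced w u v g G"
    "\<And>\<phi> u' v' G'. traced \<phi> u' v' (\<lambda>x. 0) G' \<Longrightarrow> weak_form A B C L s \<alpha>z \<gamma>z lam u v G u' v' G' = 0"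
proof -
  let ?E = "energy A B C L s \<alpha>z \<gamma>z lam"
  define \<delta> where "\<delta> k = inverse (real (Suc k))" for k
  have \<delta>0: "\<delta> k > 0" for k by (simp add: \<delta>_def)
  have \<delta>mono: "\<delta> j \<le> \<delta> i" if "i \<le> j" for i j using that by (simp add: \<delta>_def)
  have \<delta>lim: "\<delta> \<longlonglongrightarrow> 0" unfolding \<delta>_def by (rule LIMSEQ_inverse_real_of_nat)
  define adm where "adm k = {w. continuously_differentiable w \<and> (\<forall>x. w x \<in> S0) \<and> nL (\<lambda>x. w x - g x) \<le> \<delta> k}" for k
  define I where "I k = Inf (?E ` adm k)" for k
  obtain E0 where E0: "\<And>w. continuously_differentiable w \<Longrightarrow> E0 \<le> ?E w"
    using energy_bounded_below[OF pos(2-7)] by metis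
  have bdd: "bdd_below (?E ` adm k)" for k using E0 by (auto simp: adm_def intro!: bdd_belowI[of _ E0])
  have I_le: "I k \<le> ?E w" if "w \<in> adm k" for k w
    unfolding I_def by (rule cInf_lower[OF _ bdd]) (use that in blast)
  have b_adm: "\<exists>j. b j \<in> adm k" for k
  proof -
    have "eventually (\<lambda>j. nL (\<lambda>x. b j x - g x) < \<delta> k) sequentially" by (rule order_tendstoD(2)[OF b(3) \<delta>0])
    then obtain j where "nL (\<lambda>x. b j x - g x) < \<delta> k" by (auto simp: eventually_sequentially)
    then show ?thesis using b(1,2) by (intro exI[of _ j]) (simp add: adm_def)
  qed
  have ne: "?E ` adm k \<noteq> {}" for k using b_adm[of k] by blast
  have I_M: "I k \<le> M" for k using b_adm[of k] I_le b(4) order_trans by blast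
  have adm_mono: "adm j \<subseteq> adm i" if "i \<le> j" for i j using \<delta>mono[OF that] by (auto simp: adm_def)
  have I_mono: "incseq I"
  proof (rule incseq_SucI)
    fix k
    show "I k \<le> I (Suc k)"
      unfolding I_def[of "Suc k"] using adm_mono[of k "Suc k"] by (intro cInf_greatest[OF ne]) (auto intro!: I_le)
  qed
  obtain m where m: "I \<longlonglongrightarrow> m" "\<And>k. I k \<le> m"
    using incseq_convergent[OF I_mono, of M] I_M by metis
  have "\<exists>w\<in>adm k. ?E w < I k + \<delta> k" for k
    using cInf_lessD[OF ne[of k], of "I k + \<delta> k"] \<delta>0[of k] unfolding I_def[symmetric] by auto
  then obtain w where w: "\<And>k. w k \<in> adm k" "\<And>k. ?E (w k) < I k + \<delta> k" by metis
  have wC: "continuously_differentiable (w k)" and wS: "w k x \<in> S0" and wg: "nL (\<lambda>x. w k x - g x) \<le> \<delta> k" for k x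
    using w(1)[of k] unfolding adm_def by blast+
  have wE: "?E (w i) \<le> m + \<delta> N" if "N \<le> i" for i N
    using w(2)[of i] m(2)[of i] \<delta>mono[OF that] by linarith
  \<comment> \<open>The bound that results when the midpoint inequality is solved for the gradient
    of a difference; it tends to zero because the infima converge to m.\<close>
  define \<rho> where "\<rho> N = 16 * (m + \<delta> N - I N) + (\<delta> N)\<^sup>2" for N
  have \<rho>lim: "\<rho> \<longlonglongrightarrow> 0"
  proof -
    have "\<rho> \<longlonglongrightarrow> 16 * (m + 0 - m) + 0\<^sup>2" unfolding \<rho>_def by (intro tendsto_intros \<delta>lim m(1))
    then show ?thesis by simp
  qed
  have nLd: "nL (\<lambda>x. w i x - w j x) \<le> 2 * \<delta> N" if "N \<le> i" "N \<le> j" for i j N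
  proof -
    have "nL (\<lambda>x. w i x - w j x) \<le> nL (\<lambda>x. w i x - g x) + nL (\<lambda>x. g x - w j x)"
      by (rule L2_norm_triangle_diff[OF C1_L2_space(3)[OF wC] g C1_L2_space(3)[OF wC]])
    then show ?thesis
      using wg[of i] wg[of j] \<delta>mono[OF that(1)] \<delta>mono[OF that(2)] by (simp add: L2_norm_minus_commute[of _ g])
  qed
  have grad: "gradsq (\<lambda>e. partial e (\<lambda>x. w i x - w j x)) \<le> \<rho> N" if "N \<le> i" "N \<le> j" for i j N
  proof -
    let ?d = "\<lambda>x. w i x - w j x" and ?m = "\<lambda>x. (1/2) *\<^sub>R (w i x + w j x)"
    let ?D = "gradsq (\<lambda>e. partial e ?d)"
    have dC: "continuously_differentiable ?d" by (rule C1_diff(1)[OF wC wC])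
    have mS: "?m x \<in> S0" for x by (intro subspace_scale[OF subspace_S0] subspace_add[OF subspace_S0] wS)
    \<comment> \<open>The constraint is convex, so the midpoint competes at level N as well.\<close>
    have "nL (\<lambda>x. ?m x - g x) \<le> \<delta> N"
    proof -
      have "(\<lambda>x. ?m x - g x) = (\<lambda>x. (1/2) *\<^sub>R ((w i x - g x) + (w j x - g x)))"
        by (simp add: algebra_simps flip: scaleR_2)
      then have "nL (\<lambda>x. ?m x - g x) = 1/2 * nL (\<lambda>x. (w i x - g x) + (w j x - g x))"
        using L2_norm_scaleR[of _ "1/2" "\<lambda>x. (w i x - g x) + (w j x - g x)"] by simp
      also have "\<dots> \<le> 1/2 * (nL (\<lambda>x. w i x - g x) + nL (\<lambda>x. w j x - g x))"
        by (intro mult_left_mono L2_norm_triangle L2_space_diff C1_L2_space wC g) simp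
      also have "\<dots> \<le> \<delta> N" using wg[of i] wg[of j] \<delta>mono[OF that(1)] \<delta>mono[OF that(2)] by simp
      finally show ?thesis .
    qed
    then have "?m \<in> adm N" using mS C1_scaleR(1)[OF C1_add(1)[OF wC wC]] by (simp add: adm_def)
    then have Im: "I N \<le> ?E ?m" by (rule I_le)
    \<comment> \<open>1/256 is 1/32 divided by 8. Multiplied by the Poincare factor 16 it becomes
      1/16, which consumes half of the gain \<open>?D / 8\<close>.\<close>
    have Km: "lam\<^sup>2 / L * ((\<bar>A\<bar> + B\<^sup>2 / C) / 8 * (nV ?d)\<^sup>2) \<le> 1 / 256 * (nV ?d)\<^sup>2"
    proof -
      have "lam\<^sup>2 / L * ((\<bar>A\<bar> + B\<^sup>2 / C) / 8) \<le> 1 / 256"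
      proof -
        have "(\<bar>A\<bar> + B\<^sup>2 / C) * lam\<^sup>2 / L \<le> 1 / 32"
          using small unfolding pos_divide_le_eq[OF pos(7)] by linarith
        then have 1: "(\<bar>A\<bar> + B\<^sup>2 / C) * lam\<^sup>2 / L / 8 \<le> 1 / 32 / 8"
          by (rule divide_right_mono) simp
        have 2: "lam\<^sup>2 / L * ((\<bar>A\<bar> + B\<^sup>2 / C) / 8) = (\<bar>A\<bar> + B\<^sup>2 / C) * lam\<^sup>2 / L / 8"
          by (simp only: times_divide_eq_left times_divide_eq_right mult.commute)
        show ?thesis unfolding 2 by (rule order_trans[OF 1]) simp
      qed
      from mult_right_mono[OF this, of "(nV ?d)\<^sup>2"] show ?thesis by (simp only: mult.assoc zero_le_power2)
    qed
    have "(nV (partial ex ?d))\<^sup>2 \<le> ?D" by (simp add: sum_Basis_point)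
    then have Po: "(nV ?d)\<^sup>2 \<le> 4 * (nL ?d)\<^sup>2 + 16 * ?D" using Poincare[OF dC] by linarith
    have "(nL ?d)\<^sup>2 \<le> (2 * \<delta> N)\<^sup>2" by (intro power_mono nLd that) simp
    then have nl: "(nL ?d)\<^sup>2 \<le> 4 * (\<delta> N)\<^sup>2" by (simp add: power_mult_distrib)
    have "?E ?m \<le> (?E (w i) + ?E (w j)) / 2 - ?D / 8 + lam\<^sup>2 / L * ((\<bar>A\<bar> + B\<^sup>2 / C) / 8 * (nV ?d)\<^sup>2)"
      by (rule energy_midpoint[OF wC wS wC wS pos(3-7)])
    then show ?thesis
      using Im Km Po nl wE[OF that(1)] wE[OF that(2)] unfolding \<rho>_def by argo
  qed
  \<comment> \<open>The Poincare inequality turns the bounds on the gradient and on the lateral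
    restriction into one on the field.\<close>
  define \<tau> where "\<tau> N = 4 * (2 * \<delta> N)\<^sup>2 + 16 * \<rho> N" for N
  have \<tau>lim: "\<tau> \<longlonglongrightarrow> 0"
  proof -
    have "\<tau> \<longlonglongrightarrow> 4 * (2 * 0)\<^sup>2 + 16 * 0" unfolding \<tau>_def by (intro tendsto_intros \<delta>lim \<rho>lim)
    then show ?thesis by simp
  qed
  have gradV: "(nV (partial e (\<lambda>x. w i x - w j x)))\<^sup>2 \<le> \<rho> N" if "N \<le> i" "N \<le> j" "e \<in> Basis" for i j N e
    using member_le_sum[OF that(3), of "\<lambda>e. (nV (partial e (\<lambda>x. w i x - w j x)))\<^sup>2"] grad[OF that(1,2)] by simp
  have cV: "(nV (\<lambda>x. w i x - w j x))\<^sup>2 \<le> \<tau> N" if "N \<le> i" "N \<le> j" for i j N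
  proof -
    have "(nL (\<lambda>x. w i x - w j x))\<^sup>2 \<le> (2 * \<delta> N)\<^sup>2" by (intro power_mono nLd that) simp
    then show ?thesis
      using Poincare[OF C1_diff(1)[OF wC wC], of i j] gradV[OF that, of ex] unfolding \<tau>_def by (simp add: Basis_point)
  qed
  have cG: "(nG (\<lambda>x. w i x - w j x))\<^sup>2 \<le> 2 * (1 / \<epsilon> + 1) * (\<tau> N + \<rho> N)" if "N \<le> i" "N \<le> j" for i j N
  proof -
    have "(nV (\<lambda>x. w i x - w j x))\<^sup>2 + (nV (partial ez (\<lambda>x. w i x - w j x)))\<^sup>2 \<le> \<tau> N + \<rho> N"
      using cV[OF that] gradV[OF that, of ez] by (simp add: Basis_point)
    then have "2 * (1 / \<epsilon> + 1) * ((nV (\<lambda>x. w i x - w j x))\<^sup>2 + (nV (partial ez (\<lambda>x. w i x - w j x)))\<^sup>2) \<le> 2 * (1 / \<epsilon> + 1) * (\<tau> N + \<rho> N)"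
      using eps by (intro mult_left_mono) auto
    then show ?thesis using trace_Gamma_le[OF C1_diff(1)[OF wC wC], of i j] by linarith
  qed
  have cD: "(nV (\<lambda>x. partial e (w i) x - partial e (w j) x))\<^sup>2 \<le> \<rho> N" if "e \<in> Basis" "N \<le> i" "N \<le> j" for i j N e
  proof -
    have "partial e (\<lambda>x. w i x - w j x) = (\<lambda>x. partial e (w i) x - partial e (w j) x)"
      by (intro ext C1_diff(2) wC)
    then show ?thesis using gradV[OF that(2,3,1)] by simp
  qed
  obtain u where u: "u \<in> L2_space (volume_on V)" "(\<lambda>k. nV (\<lambda>x. w k x - u x)) \<longlonglongrightarrow> 0"
    by (rule L2_complete_bound[where f=w, OF V.finite_measure_axioms C1_L2_space(1)[OF wC] cV \<tau>lim])
  have "\<exists>v. v \<in> L2_space (volume_on V) \<and> (\<lambda>k. nV (\<lambda>x. partial e (w k) x - v x)) \<longlonglongrightarrow> 0" if e: "e \<in> Basis" for e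
  proof -
    obtain h where h: "h \<in> L2_space (volume_on V)" "(\<lambda>k. nV (\<lambda>x. partial e (w k) x - h x)) \<longlonglongrightarrow> 0"
      by (rule L2_complete_bound[where f="\<lambda>k. partial e (w k)", OF V.finite_measure_axioms C1_L2_space(2)[OF wC] cD[OF e] \<rho>lim])
    show ?thesis by (rule exI[of _ h]) (rule conjI[OF h])
  qed
  then have "\<forall>e\<in>Basis. \<exists>v. v \<in> L2_space (volume_on V) \<and> (\<lambda>k. nV (\<lambda>x. partial e (w k) x - v x)) \<longlonglongrightarrow> 0" ..
  from bchoice[OF this] obtain v where v': "\<forall>e\<in>Basis. v e \<in> L2_space (volume_on V) \<and> (\<lambda>k. nV (\<lambda>x. partial e (w k) x - v e x)) \<longlonglongrightarrow> 0"
    by (rule exE)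
  have v: "v e \<in> L2_space (volume_on V)" "(\<lambda>k. nV (\<lambda>x. partial e (w k) x - v e x)) \<longlonglongrightarrow> 0" if "e \<in> Basis" for e
    using bspec[OF v' that] by (rule conjunct1, rule conjunct2)
  have "(\<lambda>N. 2 * (1 / \<epsilon> + 1) * (\<tau> N + \<rho> N)) \<longlonglongrightarrow> 2 * (1 / \<epsilon> + 1) * (0 + 0)"
    by (intro tendsto_intros \<tau>lim \<rho>lim)
  then have Glim: "(\<lambda>N. 2 * (1 / \<epsilon> + 1) * (\<tau> N + \<rho> N)) \<longlonglongrightarrow> 0" by simp
  have fG: "finite_measure (Gamma_measure \<eta> \<epsilon>)" using bfm_Gamma by (simp add: bounded_finite_measure_def)
  obtain G where G: "G \<in> L2_space (Gamma_measure \<eta> \<epsilon>)" "(\<lambda>k. nG (\<lambda>x. w k x - G x)) \<longlonglongrightarrow> 0"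
    by (rule L2_complete_bound[where f=w, OF fG C1_L2_space(4)[OF wC] cG Glim])
  have wL: "(\<lambda>k. nL (\<lambda>x. w k x - g x)) \<longlonglongrightarrow> 0"
    by (rule tendsto_0_dominated[OF L2_norm_nonneg wg \<delta>lim])
  have t: "traced w u v g G"
    unfolding traced_def by (intro conjI allI ballI wC wS u v g G wL)
  show ?thesis
  proof (rule that[OF t])
    fix \<phi> u' v' G' assume t': "traced \<phi> u' v' (\<lambda>x. 0) G'"
    note \<phi> = tracedD(1,2)[OF t']
    let ?W = "weak_form A B C L s \<alpha>z \<gamma>z lam u v G u' v' G'"
    define Wk where "Wk k = weak_form A B C L s \<alpha>z \<gamma>z lam (w k) (\<lambda>e. partial e (w k)) (w k) (\<phi> k) (\<lambda>e. partial e (\<phi> k)) (\<phi> k)" for k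
    have Wlim: "Wk \<longlonglongrightarrow> ?W" unfolding Wk_def by (rule weak_form_tendsto[OF t t' pos(2,3)])
    let ?one = "L2_norm (volume_on V) (\<lambda>x. 1::real)"
    let ?q = "\<lambda>k. 2 * (L4_sq (volume_on V) (\<lambda>x. w k x - u x) + L4_sq (volume_on V) u)"
    let ?y = "\<lambda>k. 2 * (L4_sq (volume_on V) (\<lambda>x. \<phi> k x - u' x) + L4_sq (volume_on V) u')"
    \<comment> \<open>Bounds the remainder with the L^4 quantities replaced by errors plus those of
      the limits, so that its convergence is immediate.\<close>
    define Rk where "Rk k = gradsq (\<lambda>e. partial e (\<phi> k)) / 2 + lam / L * ((\<alpha>z + 2 * \<gamma>z) * (nG (\<phi> k))\<^sup>2)
          + lam\<^sup>2 / L * ((2 * B + 3 * C) * ((?one + ?q k + ?y k) * ?y k))" for k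
    define R where "R = gradsq v' / 2 + lam / L * ((\<alpha>z + 2 * \<gamma>z) * (nG G')\<^sup>2)
          + lam\<^sup>2 / L * ((2 * B + 3 * C) * ((?one + 2 * (0 + L4_sq (volume_on V) u) + 2 * (0 + L4_sq (volume_on V) u'))
             * (2 * (0 + L4_sq (volume_on V) u'))))"
    have Rlim: "Rk \<longlonglongrightarrow> R"
      unfolding Rk_def R_def
      by (intro tendsto_add tendsto_mult tendsto_const tendsto_divide tendsto_sum tendsto_power tendsto_L2_norm
          traced_L4(2)[OF t] traced_L4(2)[OF t'] C1_L2_space \<phi>(1) tracedD(4,6,8,10)[OF t']) simp_all
    have nL\<phi>: "(\<lambda>k. nL (\<phi> k)) \<longlonglongrightarrow> 0" using tracedD(9)[OF t'] by simp
    have main: "0 \<le> \<theta> * ?W + \<theta>\<^sup>2 * R" if \<theta>: "\<bar>\<theta>\<bar> \<le> 1" for \<theta>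
    proof -
      have ub: "?E (\<lambda>x. w k x + \<theta> *\<^sub>R \<phi> k x) \<le> m + \<delta> k + \<theta> * Wk k + \<theta>\<^sup>2 * Rk k" for k
      proof -
        have q: "L4_sq (volume_on V) (w k) \<le> ?q k" "L4_sq (volume_on V) (\<phi> k) \<le> ?y k"
          by (intro L4_sq_le C1_L4 wC \<phi>(1) traced_L4(1)[OF t] traced_L4(1)[OF t'])+
        have "(?one + L4_sq (volume_on V) (w k) + L4_sq (volume_on V) (\<phi> k)) * L4_sq (volume_on V) (\<phi> k)
           \<le> (?one + ?q k + ?y k) * ?y k"
          by (intro mult_mono add_mono q order_refl add_nonneg_nonneg mult_nonneg_nonneg L4_sq_nonneg L2_norm_nonneg) simp_all
        then have X: "lam\<^sup>2 / L * ((2 * B + 3 * C) * ((?one + L4_sq (volume_on V) (w k) + L4_sq (volume_on V) (\<phi> k)) * L4_sq (volume_on V) (\<phi> k)))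
           \<le> lam\<^sup>2 / L * ((2 * B + 3 * C) * ((?one + ?q k + ?y k) * ?y k))"
          using pos by (intro mult_left_mono) auto
        have "\<theta>\<^sup>2 * (gradsq (\<lambda>e. partial e (\<phi> k)) / 2 + lam / L * ((\<alpha>z + 2 * \<gamma>z) * (nG (\<phi> k))\<^sup>2)
            + lam\<^sup>2 / L * ((2 * B + 3 * C) * ((?one + L4_sq (volume_on V) (w k) + L4_sq (volume_on V) (\<phi> k)) * L4_sq (volume_on V) (\<phi> k))))
           \<le> \<theta>\<^sup>2 * Rk k"
          unfolding Rk_def by (rule mult_left_mono[OF add_left_mono[OF X]]) simp
        then show ?thesis
          using energy_Taylor[OF wC wS \<phi> pos \<theta>, of s k k] wE[of k k] unfolding Wk_def by linarith
      qed
      \<comment> \<open>For large k the perturbed field competes at level j, as the lateral norm of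
        \<open>\<phi> k\<close> tends to zero. The limit in j may be taken only after the one in
        k.\<close>
      have lb: "I j \<le> m + 0 + \<theta> * ?W + \<theta>\<^sup>2 * R" for j
      proof (rule LIMSEQ_le_const)
        show "(\<lambda>k. m + \<delta> k + \<theta> * Wk k + \<theta>\<^sup>2 * Rk k) \<longlonglongrightarrow> m + 0 + \<theta> * ?W + \<theta>\<^sup>2 * R"
          by (intro tendsto_intros \<delta>lim Wlim Rlim)
        have "(\<lambda>k. \<delta> k + nL (\<phi> k)) \<longlonglongrightarrow> 0" using tendsto_add[OF \<delta>lim nL\<phi>] by simp
        then have "eventually (\<lambda>k. \<delta> k + nL (\<phi> k) < \<delta> j) sequentially" by (rule order_tendstoD(2)[OF _ \<delta>0])
        then obtain N where N: "\<And>k. k \<ge> N \<Longrightarrow> \<delta> k + nL (\<phi> k) < \<delta> j" by (auto simp: eventually_sequentially)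
        have "I j \<le> m + \<delta> k + \<theta> * Wk k + \<theta>\<^sup>2 * Rk k" if "k \<ge> N" for k
        proof -
          have "nL (\<lambda>x. (w k x - g x) + \<theta> *\<^sub>R \<phi> k x) \<le> nL (\<lambda>x. w k x - g x) + nL (\<lambda>x. \<theta> *\<^sub>R \<phi> k x)"
            by (intro L2_norm_triangle L2_space_diff L2_space_scaleR C1_L2_space wC g \<phi>(1))
          moreover have "nL (\<lambda>x. \<theta> *\<^sub>R \<phi> k x) \<le> nL (\<phi> k)"
            unfolding L2_norm_scaleR using \<theta> by (intro mult_left_le_one_le) auto
          moreover have "(\<lambda>x. (w k x - g x) + \<theta> *\<^sub>R \<phi> k x) = (\<lambda>x. (w k x + \<theta> *\<^sub>R \<phi> k x) - g x)" by auto
          ultimately have "nL (\<lambda>x. (w k x + \<theta> *\<^sub>R \<phi> k x) - g x) \<le> \<delta> j" using wg[of k] N[OF that] by simp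
          moreover have "w k x + \<theta> *\<^sub>R \<phi> k x \<in> S0" for x
            by (intro subspace_add[OF subspace_S0] subspace_scale[OF subspace_S0] wS \<phi>(2))
          ultimately have "(\<lambda>x. w k x + \<theta> *\<^sub>R \<phi> k x) \<in> adm j"
            using C1_add(1)[OF wC C1_scaleR(1)[OF \<phi>(1)]] by (simp add: adm_def)
          then show ?thesis using I_le ub[of k] order_trans by blast
        qed
        then show "\<exists>N. \<forall>k\<ge>N. I j \<le> m + \<delta> k + \<theta> * Wk k + \<theta>\<^sup>2 * Rk k" by blast
      qed
      \<comment> \<open>As j grows, the infima reach m, which cancels and leaves only the terms in
        \<theta>.\<close>
      have "m \<le> m + 0 + \<theta> * ?W + \<theta>\<^sup>2 * R"
        by (rule LIMSEQ_le_const2[OF m(1)]) (use lb in blast)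
      then show ?thesis by simp
    qed
    show "?W = 0" by (rule real_first_variation[OF main])
  qed
qed

end

section \<open>Extension of the boundary datum\<close>

text \<open>On each closed piece the derivative is bounded by compactness; the estimates are chained
  at the break points.\<close>

lemma piecewise_C1_Lipschitz:
  assumes "piecewise_C1 a b g"
  obtains K where "0 \<le> K" "\<And>x y. x \<in> {a..b} \<Longrightarrow> y \<in> {a..b} \<Longrightarrow> \<bar>g x - g y\<bar> \<le> K * \<bar>x - y\<bar>"
proof -
  obtain n :: nat and t where t: "t 0 = a" "t n = b" "\<And>i. i < n \<Longrightarrow> t i < t (Suc i)"
    and d: "\<And>i. i < n \<Longrightarrow> \<exists>g'. continuous_on {t i..t (Suc i)} g' \<and>
           (\<forall>s\<in>{t i..t (Suc i)}. (g has_real_derivative g' s) (at s within {t i..t (Suc i)}))"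
    using assms unfolding piecewise_C1_def by blast
  have "\<exists>k. 0 \<le> k \<and> (\<forall>x\<in>{t i..t (Suc i)}. \<forall>y\<in>{t i..t (Suc i)}. \<bar>g x - g y\<bar> \<le> k * \<bar>x - y\<bar>)" if i: "i < n" for i
  proof -
    obtain g' where g': "continuous_on {t i..t (Suc i)} g'"
      "\<And>s. s \<in> {t i..t (Suc i)} \<Longrightarrow> (g has_real_derivative g' s) (at s within {t i..t (Suc i)})"
      using d[OF i] by blast
    have "compact (g' ` {t i..t (Suc i)})" by (rule compact_continuous_image[OF g'(1)]) simp
    then obtain k where k: "\<And>s. s \<in> {t i..t (Suc i)} \<Longrightarrow> \<bar>g' s\<bar> \<le> k"
      by (metis bounded_real compact_imp_bounded image_eqI)
    have "\<bar>g x - g y\<bar> \<le> max 0 k * \<bar>x - y\<bar>" if "x \<in> {t i..t (Suc i)}" "y \<in> {t i..t (Suc i)}" for x y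
    proof -
      have "norm (g x - g y) \<le> max 0 k * norm (x - y)"
      proof (rule field_differentiable_bound[OF convex_real_interval(5) g'(2)])
        show "norm (g' z) \<le> max 0 k" if "z \<in> {t i..t (Suc i)}" for z using k[OF that] by simp
      qed (use that in auto)
      then show ?thesis by simp
    qed
    then show ?thesis by (intro exI[of _ "max 0 k"]) auto
  qed
  then obtain k where k: "\<And>i. i < n \<Longrightarrow> 0 \<le> k i"
    "\<And>i x y. i < n \<Longrightarrow> x \<in> {t i..t (Suc i)} \<Longrightarrow> y \<in> {t i..t (Suc i)} \<Longrightarrow> \<bar>g x - g y\<bar> \<le> k i * \<bar>x - y\<bar>"
    by metis
  \<comment> \<open>The sum dominates the constant of every piece and, unlike a maximum, makes sense
    for n = 0.\<close>
  define K where "K = (\<Sum>i<n. k i)"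
  have K0: "0 \<le> K" unfolding K_def by (intro sum_nonneg k(1)) simp
  have kK: "k i \<le> K" if "i < n" for i
    unfolding K_def using that by (intro member_le_sum) (auto intro: k(1))
  \<comment> \<open>Induction on the number of pieces; the step splits the interval at
    \<open>t m\<close>.\<close>
  have "\<bar>g x - g y\<bar> \<le> K * (y - x)" if "m \<le> n" "t 0 \<le> x" "x \<le> y" "y \<le> t m" for m x y
    using that
  proof (induction m arbitrary: x y)
    case 0
    then have "x = y" by simp
    then show ?case by simp
  next
    case (Suc m)
    then have m: "m < n" by simp
    have step: "\<bar>g u - g v\<bar> \<le> K * (v - u)" if "t m \<le> u" "u \<le> v" "v \<le> t (Suc m)" for u v
    proof -
      have "\<bar>g u - g v\<bar> \<le> k m * \<bar>u - v\<bar>" using that by (intro k(2)[OF m]) auto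
      also have "\<dots> \<le> K * (v - u)" using that kK[OF m] by (simp add: mult_right_mono)
      finally show ?thesis .
    qed
    consider "y \<le> t m" | "t m \<le> x" | "x \<le> t m" "t m \<le> y" by linarith
    then show ?case
    proof cases
      case 1
      then show ?thesis using Suc by simp
    next
      case 2
      then show ?thesis using step Suc by simp
    next
      case 3
      have "\<bar>g x - g (t m)\<bar> \<le> K * (t m - x)" using Suc 3 by simp
      moreover have "\<bar>g (t m) - g y\<bar> \<le> K * (y - t m)" using step[of "t m" y] Suc 3 by simp
      ultimately show ?thesis by (simp add: algebra_simps)
    qed
  qed
  from this[of n] have le: "\<bar>g x - g y\<bar> \<le> K * (y - x)" if "a \<le> x" "x \<le> y" "y \<le> b" for x y
    using that t by simp
  show ?thesis
  proof (rule that[OF K0])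
    fix x y assume "x \<in> {a..b}" "y \<in> {a..b}"
    then show "\<bar>g x - g y\<bar> \<le> K * \<bar>x - y\<bar>"
      using le[of x y] le[of y x] by (cases "x \<le> y") (auto simp: abs_minus_commute)
  qed
qed

text \<open>Smoothing by averaging over \<open>[t, t + h]\<close>.\<close>

lemma Lipschitz_smoothing:
  fixes f :: "real \<Rightarrow> real"
  assumes K: "0 \<le> K" "\<And>x y. \<bar>f x - f y\<bar> \<le> K * \<bar>x - y\<bar>" and b: "\<And>x. \<bar>f x\<bar> \<le> b" and h: "0 < h"
  obtains g g' where "\<And>t. (g has_real_derivative g' t) (at t)" "continuous_on UNIV g'"
    "\<And>t. \<bar>g' t\<bar> \<le> K" "\<And>t. \<bar>g t - f t\<bar> \<le> K * h" "\<And>t. \<bar>g t\<bar> \<le> b"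
proof -
  have f: "continuous_on UNIV f"
  proof (rule lipschitz_on_continuous_on)
    show "K-lipschitz_on UNIV f" using K by (intro lipschitz_onI) (auto simp: dist_real_def)
  qed
  have "\<exists>F. \<forall>x :: real. -\<infinity> < ereal x \<longrightarrow> ereal x < \<infinity> \<longrightarrow> (F has_vector_derivative f x) (at x)"
  proof (rule einterval_antiderivative)
    show "isCont f x" for x using f by (simp add: continuous_on_eq_continuous_at)
  qed simp
  then obtain F where F: "\<And>x. (F has_real_derivative f x) (at x)"
    by (auto simp: has_real_derivative_iff_has_vector_derivative)
  define g where "g t = (F (t + h) - F t) / h" for t
  define g' where "g' t = (f (t + h) - f t) / h" for t
  \<comment> \<open>An average of f over a short interval is a value of f in it, so the bound on f
    carries over and the distance to f is controlled.\<close>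
  have mvt: "\<exists>z. t < z \<and> z < t + h \<and> g t = f z" for t
  proof -
    obtain z where "t < z" "z < t + h" "F (t + h) - F t = (t + h - t) * f z"
      using MVT2[of t "t + h" F f] F h by auto
    then show ?thesis using h by (auto simp: g_def intro!: exI[of _ z])
  qed
  show ?thesis
  proof (rule that)
    show "(g has_real_derivative g' t) (at t)" for t
    proof -
      have "((\<lambda>t. F (t + h)) has_real_derivative f (t + h) * 1) (at t)"
        by (rule DERIV_chain2[OF F]) (auto intro!: derivative_eq_intros)
      from DERIV_cdivide[OF DERIV_diff[OF this F[of t]], of h] show ?thesis
        by (simp add: g_def[abs_def] g'_def)
    qed
    show "continuous_on UNIV g'"
      unfolding g'_def using h by (intro continuous_intros continuous_on_compose2[OF f]) auto
    show "\<bar>g' t\<bar> \<le> K" for t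
      using K(2)[of "t + h" t] h by (simp add: g'_def pos_divide_le_eq)
    show "\<bar>g t - f t\<bar> \<le> K * h" for t
    proof -
      obtain z where z: "t < z" "z < t + h" "g t = f z" using mvt by blast
      have "\<bar>f z - f t\<bar> \<le> K * \<bar>z - t\<bar>" by (rule K(2))
      also have "\<dots> \<le> K * h" using z K(1) by (intro mult_left_mono) auto
      finally show ?thesis using z by simp
    qed
    show "\<bar>g t\<bar> \<le> b" for t using mvt[of t] b by metis
  qed
qed

text \<open>Extends a profile to the whole line by its end values, which preserves a Lipschitz
  constant.\<close>

definition clamped :: "real \<Rightarrow> (real \<Rightarrow> real) \<Rightarrow> real \<Rightarrow> real" where
  "clamped \<eta> g t = g (max (- \<eta>) (min \<eta> t))"

lemma clamped_Lipschitz: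
  assumes "0 < \<eta>" "0 \<le> K" "\<And>x y. x \<in> {-\<eta>..\<eta>} \<Longrightarrow> y \<in> {-\<eta>..\<eta>} \<Longrightarrow> \<bar>g x - g y\<bar> \<le> K * \<bar>x - y\<bar>"
  shows "\<bar>clamped \<eta> g x - clamped \<eta> g y\<bar> \<le> K * \<bar>x - y\<bar>"
proof -
  have "\<bar>clamped \<eta> g x - clamped \<eta> g y\<bar> \<le> K * \<bar>max (- \<eta>) (min \<eta> x) - max (- \<eta>) (min \<eta> y)\<bar>"
    unfolding clamped_def using assms(1) by (intro assms(3)) auto
  also have "\<dots> \<le> K * \<bar>x - y\<bar>" using assms(2) by (intro mult_left_mono) auto
  finally show ?thesis .
qed

text \<open>The constant matrix that multiplies the scalar profile; together with \<open>bY\<close>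
  it presents the datum as an affine function of \<open>q1b\<close>.\<close>

definition bX :: "real^3^3" where "bX = n1 \<otimes>\<^sub>v n1 - n2 \<otimes>\<^sub>v n2"
definition bY :: "real \<Rightarrow> real^3^3" where
  "bY s = - ((s / 6) *\<^sub>R (2 *\<^sub>R (zhat \<otimes>\<^sub>v zhat) - n1 \<otimes>\<^sub>v n1 - n2 \<otimes>\<^sub>v n2))"

lemma Qb_eq: "Qb s \<eta> g0 (p, z) = q1b s \<eta> g0 p *\<^sub>R bX + bY s"
  by (simp add: Qb_def bX_def bY_def)

lemma bX_S0: "bX \<in> S0"
  by (simp add: bX_def S0_iff tensor_def n1_def n2_def)

lemma bY_S0: "bY s \<in> S0"
  by (simp add: bY_def S0_iff tensor_def n1_def n2_def zhat_def)

lemma Qb_S0: "Qb s \<eta> g0 x \<in> S0"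
  by (cases x) (auto simp: Qb_eq intro!: subspace_add[OF subspace_S0] subspace_scale[OF subspace_S0] bX_S0 bY_S0)

section \<open>The datum on the edges\<close>

context truncated_square
begin

abbreviation bdry :: "(real \<times> real) set" where
  "bdry \<equiv> C1 \<eta> \<union> C2 \<eta> \<union> C3 \<eta> \<union> C4 \<eta> \<union> S1 \<eta> \<union> S2 \<eta> \<union> S3 \<eta> \<union> S4 \<eta>"

text \<open>Connects the parametrised edges that carry the lateral measure with the sets by which
  \<open>q1b\<close> is defined.\<close>

lemma edges_bdry:
  assumes "(a, b) \<in> edges \<eta>" "t \<in> {0..1}"
  shows "(1 - t) *\<^sub>R a + t *\<^sub>R b \<in> bdry"
proof -
  have f: "0 \<le> t" "t \<le> 1" "0 \<le> t * \<eta>" "t * \<eta> \<le> \<eta>" "0 \<le> t - 2 * (t * \<eta>)" "t - 2 * (t * \<eta>) \<le> 1 - 2 * \<eta>"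
  proof -
    have "0 \<le> t * (1 - 2 * \<eta>)" "0 \<le> (1 - t) * (1 - 2 * \<eta>)" using assms(2) eta by auto
    then show "0 \<le> t - 2 * (t * \<eta>)" "t - 2 * (t * \<eta>) \<le> 1 - 2 * \<eta>" by (simp_all add: algebra_simps)
  qed (use assms(2) eta in \<open>auto simp: mult_left_le_one_le\<close>)
  have "(a, b) \<in> {((1 - \<eta>, - \<eta>), (1 - \<eta>, \<eta>)),
      ((1 - \<eta>, \<eta>), (\<eta>, 1 - \<eta>)),
      ((\<eta>, 1 - \<eta>), (- \<eta>, 1 - \<eta>)),
      ((- \<eta>, 1 - \<eta>), (- 1 + \<eta>, \<eta>)),
      ((- 1 + \<eta>, \<eta>), (- 1 + \<eta>, - \<eta>)),
      ((- 1 + \<eta>, - \<eta>), (- \<eta>, - 1 + \<eta>)),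
      ((- \<eta>, - 1 + \<eta>), (\<eta>, - 1 + \<eta>)),
      ((\<eta>, - 1 + \<eta>), (1 - \<eta>, - \<eta>))}"
    using assms(1) by (simp only: edges_def)
  then show ?thesis
  proof (elim insertE emptyE)
    assume "(a, b) = ((1 - \<eta>, - \<eta>), (1 - \<eta>, \<eta>))"
    then have "(1 - t) *\<^sub>R a + t *\<^sub>R b \<in> S1 \<eta>" using f eta by (auto simp: S1_def algebra_simps abs_le_iff)
    then show ?thesis by simp
  next
    assume "(a, b) = ((1 - \<eta>, \<eta>), (\<eta>, 1 - \<eta>))"
    then have "(1 - t) *\<^sub>R a + t *\<^sub>R b \<in> C1 \<eta>" using f eta by (auto simp: C1_def algebra_simps)
    then show ?thesis by simp
  next
    assume "(a, b) = ((\<eta>, 1 - \<eta>), (- \<eta>, 1 - \<eta>))"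
    then have "(1 - t) *\<^sub>R a + t *\<^sub>R b \<in> S2 \<eta>" using f eta by (auto simp: S2_def algebra_simps abs_le_iff)
    then show ?thesis by simp
  next
    assume "(a, b) = ((- \<eta>, 1 - \<eta>), (- 1 + \<eta>, \<eta>))"
    then have "(1 - t) *\<^sub>R a + t *\<^sub>R b \<in> C2 \<eta>" using f eta by (auto simp: C2_def algebra_simps)
    then show ?thesis by simp
  next
    assume "(a, b) = ((- 1 + \<eta>, \<eta>), (- 1 + \<eta>, - \<eta>))"
    then have "(1 - t) *\<^sub>R a + t *\<^sub>R b \<in> S3 \<eta>" using f eta by (auto simp: S3_def algebra_simps abs_le_iff)
    then show ?thesis by simp
  next
    assume "(a, b) = ((- 1 + \<eta>, - \<eta>), (- \<eta>, - 1 + \<eta>))"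
    then have "(1 - t) *\<^sub>R a + t *\<^sub>R b \<in> C3 \<eta>" using f eta by (auto simp: C3_def algebra_simps)
    then show ?thesis by simp
  next
    assume "(a, b) = ((- \<eta>, - 1 + \<eta>), (\<eta>, - 1 + \<eta>))"
    then have "(1 - t) *\<^sub>R a + t *\<^sub>R b \<in> S4 \<eta>" using f eta by (auto simp: S4_def algebra_simps abs_le_iff)
    then show ?thesis by simp
  next
    assume "(a, b) = ((\<eta>, - 1 + \<eta>), (1 - \<eta>, - \<eta>))"
    then have "(1 - t) *\<^sub>R a + t *\<^sub>R b \<in> C4 \<eta>" using f eta by (auto simp: C4_def algebra_simps)
    then show ?thesis by simp
  qed
qed

lemma clamped_vals:
  assumes "g \<eta> = s / 2" "g (- \<eta>) = - s / 2"
  shows "\<eta> \<le> t \<Longrightarrow> clamped \<eta> g t = s / 2" "t \<le> - \<eta> \<Longrightarrow> clamped \<eta> g t = - s / 2"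
    "\<bar>t\<bar> \<le> \<eta> \<Longrightarrow> clamped \<eta> g t = g t"
  using assms eta by (auto simp: clamped_def max_def min_def)

text \<open>On the boundary the datum is a product of functions of one variable: on each edge at least one
  of the two factors is \<open>\<plusminus>s/2\<close>.\<close>

lemma q1b_product:
  assumes g: "g \<eta> = s / 2" "g (- \<eta>) = - s / 2" and s: "0 < s" and p: "(x, y) \<in> bdry"
  shows "q1b s \<eta> g (x, y) = 2 / s * (clamped \<eta> g x * clamped \<eta> g y)"
proof -
  note v = clamped_vals[where g=g and s=s, OF g]
  \<comment> \<open>Adjacent edges share their end points, so the cases follow the order of the
    conditionals in \<open>q1b\<close>.\<close>
  consider "(x, y) \<in> C1 \<eta>" | "(x, y) \<in> C3 \<eta>" | "(x, y) \<in> C2 \<eta> \<union> C4 \<eta>" "(x, y) \<notin> C1 \<eta> \<union> C3 \<eta>"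
    | "(x, y) \<in> S1 \<eta>" "(x, y) \<notin> C1 \<eta> \<union> C3 \<eta>" "(x, y) \<notin> C2 \<eta> \<union> C4 \<eta>"
    | "(x, y) \<in> S3 \<eta>" "(x, y) \<notin> C1 \<eta> \<union> C3 \<eta>" "(x, y) \<notin> C2 \<eta> \<union> C4 \<eta>" "(x, y) \<notin> S1 \<eta>"
    | "(x, y) \<in> S2 \<eta>" "(x, y) \<notin> C1 \<eta> \<union> C3 \<eta>" "(x, y) \<notin> C2 \<eta> \<union> C4 \<eta>" "(x, y) \<notin> S1 \<eta>" "(x, y) \<notin> S3 \<eta>"
    | "(x, y) \<in> S4 \<eta>" "(x, y) \<notin> C1 \<eta> \<union> C3 \<eta>" "(x, y) \<notin> C2 \<eta> \<union> C4 \<eta>" "(x, y) \<notin> S1 \<eta>" "(x, y) \<notin> S3 \<eta>" "(x, y) \<notin> S2 \<eta>"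
    using p by blast
  then show ?thesis
  proof cases
    case 1
    then have "\<eta> \<le> x" "\<eta> \<le> y" by (auto simp: C1_def)
    then show ?thesis using 1 s by (simp add: q1b_def v)
  next
    case 2
    then have "x \<le> - \<eta>" "y \<le> - \<eta>" by (auto simp: C3_def)
    then show ?thesis using 2 s by (simp add: q1b_def v)
  next
    case 3
    then have "x \<le> - \<eta> \<and> \<eta> \<le> y \<or> \<eta> \<le> x \<and> y \<le> - \<eta>" by (auto simp: C2_def C4_def)
    then show ?thesis using 3 s by (auto simp: q1b_def v)
  next
    case 4
    then have "\<eta> \<le> x" "\<bar>y\<bar> \<le> \<eta>" using eta by (auto simp: S1_def)
    then show ?thesis using 4 s by (simp add: q1b_def v)
  next
    case 5
    then have "x \<le> - \<eta>" "\<bar>y\<bar> \<le> \<eta>" using eta by (auto simp: S3_def)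
    then show ?thesis using 5 s by (simp add: q1b_def v)
  next
    case 6
    then have "\<eta> \<le> y" "\<bar>x\<bar> \<le> \<eta>" using eta by (auto simp: S2_def)
    then show ?thesis using 6 s by (simp add: q1b_def v)
  next
    case 7
    then have "y \<le> - \<eta>" "\<bar>x\<bar> \<le> \<eta>" using eta by (auto simp: S4_def)
    then show ?thesis using 7 s by (simp add: q1b_def v)
  qed
qed

text \<open>The profile is arbitrary outside its interval, so it is first replaced by the clamped
  one, which agrees with it wherever \<open>q1b\<close> evaluates it.\<close>

lemma q1b_measurable:
  assumes c: "continuous_on UNIV (clamped \<eta> g)"
  shows "q1b s \<eta> g \<in> borel_measurable borel"
proof -
  let ?g = "clamped \<eta> g"
  have e: "q1b s \<eta> g = (\<lambda>p. if p \<in> C1 \<eta> \<union> C3 \<eta> then s / 2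
      else if p \<in> C2 \<eta> \<union> C4 \<eta> then - s / 2
      else if p \<in> S1 \<eta> then ?g (snd p)
      else if p \<in> S3 \<eta> then - ?g (snd p)
      else if p \<in> S2 \<eta> then ?g (fst p)
      else if p \<in> S4 \<eta> then - ?g (fst p)
      else 0)"
    using eta by (intro ext) (auto simp: q1b_def S1_def S2_def S3_def S4_def clamped_def max_def min_def)
  have [measurable]: "?g \<in> borel_measurable borel" using c by (rule borel_measurable_continuous_onI)
  have [measurable]: "fst \<in> borel_measurable (borel :: (real \<times> real) measure)" "snd \<in> borel_measurable (borel :: (real \<times> real) measure)"
    by (auto intro!: borel_measurable_continuous_onI continuous_intros)
  have cl: "{p. fst p + snd p = (c::real) \<and> a \<le> fst p \<and> fst p \<le> b} \<in> sets borel"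
    "{p. snd p - fst p = (c::real) \<and> a \<le> - fst p \<and> - fst p \<le> b} \<in> sets borel"
    "{p. fst p + snd p = (c::real) \<and> a \<le> - fst p \<and> - fst p \<le> b} \<in> sets borel"
    "{p. fst p - snd p = (c::real) \<and> a \<le> fst p \<and> fst p \<le> b} \<in> sets borel"
    "{p. fst p = c \<and> \<bar>snd p\<bar> \<le> a} \<in> sets borel" "{p. snd p = c \<and> \<bar>fst p\<bar> \<le> a} \<in> sets borel" for a b c
    by measurable
  have [measurable]: "C1 \<eta> \<in> sets borel" "C2 \<eta> \<in> sets borel" "C3 \<eta> \<in> sets borel" "C4 \<eta> \<in> sets borel"
    "S1 \<eta> \<in> sets borel" "S2 \<eta> \<in> sets borel" "S3 \<eta> \<in> sets borel" "S4 \<eta> \<in> sets borel"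
    unfolding C1_def C2_def C3_def C4_def S1_def S2_def S3_def S4_def case_prod_beta by (rule cl)+
  show ?thesis unfolding e by measurable
qed

end

context square_well
begin

text \<open>The product formula for the datum makes sense off the boundary too. With smoothed
  factors, constant in z, it defines C^1 fields; smoothing preserves the bound s/2 and the Lipschitz
  constant K, so the energies stay bounded while the fields approach the datum.\<close>

lemma boundary_extension:
  assumes bp: "boundary_profile s \<eta> g0" and s: "0 < s" and pos: "0 \<le> \<alpha>z" "0 \<le> \<gamma>z" "0 \<le> lam" "0 < L"
  obtains w M where "Qb s \<eta> g0 \<in> L2_space (lateral_measure \<eta> \<epsilon>)"
    "\<And>k. continuously_differentiable (w k)" "\<And>k x. w k x \<in> S0"
    "(\<lambda>k. nL (\<lambda>x. w k x - Qb s \<eta> g0 x)) \<longlonglongrightarrow> 0" "\<And>k. energy A B C L s \<alpha>z \<gamma>z lam (w k) \<le> M"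
proof -
  let ?g = "clamped \<eta> g0"
  have g0: "g0 \<eta> = s / 2" "g0 (- \<eta>) = - s / 2" "piecewise_C1 (- \<eta>) \<eta> g0" "g0 ` {- \<eta>..\<eta>} \<subseteq> {- s / 2..s / 2}"
    using bp by (auto simp: boundary_profile_def)
  obtain K where K: "0 \<le> K" "\<And>x y. x \<in> {-\<eta>..\<eta>} \<Longrightarrow> y \<in> {-\<eta>..\<eta>} \<Longrightarrow> \<bar>g0 x - g0 y\<bar> \<le> K * \<bar>x - y\<bar>"
    by (rule piecewise_C1_Lipschitz[OF g0(3)]) blast
  have gK: "\<bar>?g x - ?g y\<bar> \<le> K * \<bar>x - y\<bar>" for x y by (rule clamped_Lipschitz[OF eta(1) K])
  have gb: "\<bar>?g x\<bar> \<le> s / 2" for x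
  proof -
    have "max (- \<eta>) (min \<eta> x) \<in> {- \<eta>..\<eta>}" using eta by auto
    then have "?g x \<in> {- s / 2..s / 2}" unfolding clamped_def using g0(4) by blast
    then show ?thesis by auto
  qed
  have gc: "continuous_on UNIV ?g"
  proof (rule lipschitz_on_continuous_on)
    show "K-lipschitz_on UNIV ?g" using K gK by (intro lipschitz_onI) (auto simp: dist_real_def)
  qed
  define h where "h k = inverse (real (Suc k))" for k
  have h0: "h k > 0" for k by (simp add: h_def)
  have hlim: "h \<longlonglongrightarrow> 0" unfolding h_def by (rule LIMSEQ_inverse_real_of_nat)
  let ?P = "\<lambda>k (g, g'). (\<forall>t. (g has_real_derivative g' t) (at t)) \<and> continuous_on UNIV g' \<and>
      (\<forall>t. \<bar>g' t\<bar> \<le> K) \<and> (\<forall>t. \<bar>g t - ?g t\<bar> \<le> K * h k) \<and> (\<forall>t. \<bar>g t\<bar> \<le> s / 2)"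
  have "\<exists>p. ?P k p" for k
  proof (rule Lipschitz_smoothing[OF K(1) gK gb h0[of k]])
    fix g g' assume a: "\<And>t. (g has_real_derivative g' t) (at t)" "continuous_on UNIV g'"
      "\<And>t. \<bar>g' t\<bar> \<le> K" "\<And>t. \<bar>g t - ?g t\<bar> \<le> K * h k" "\<And>t. \<bar>g t\<bar> \<le> s / 2"
    show "\<exists>p. ?P k p" by (rule exI[of _ "(g, g')"], unfold prod.case, intro conjI allI a)
  qed
  then have "\<forall>k. \<exists>p. ?P k p" ..
  from choice[OF this] obtain P where P: "\<forall>k. ?P k (P k)" by (rule exE)
  define g g' where "g k = fst (P k)" and "g' k = snd (P k)" for k
  have g: "(g k has_real_derivative g' k t) (at t)" "continuous_on UNIV (g' k)"
      "\<bar>g' k t\<bar> \<le> K" "\<bar>g k t - ?g t\<bar> \<le> K * h k" "\<bar>g k t\<bar> \<le> s / 2" for k t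
    using spec[OF P, of k] unfolding g_def g'_def case_prod_beta by blast+
  have gkc: "continuous_on UNIV (g k)" for k
    by (rule continuous_at_imp_continuous_on) (use DERIV_isCont[OF g(1)] in blast)
  define w :: "nat \<Rightarrow> point \<Rightarrow> real^3^3" where
    "w k x = (2 / s * (g k (fst (fst x)) * g k (snd (fst x)))) *\<^sub>R bX + bY s" for k x
  define w' where "w' k x e = (2 / s * (g k (fst (fst x)) * (g' k (snd (fst x)) * snd (fst e))
      + g' k (fst (fst x)) * fst (fst e) * g k (snd (fst x)))) *\<^sub>R bX" for k and x e :: point
  have wd: "(w k has_derivative w' k x) (at x)" for k x
  proof -
    have 1: "((\<lambda>x::point. g k (fst (fst x))) has_derivative (\<lambda>e. g' k (fst (fst x)) * fst (fst e))) (at x)"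
      by (rule has_derivative_compose[OF _ g(1)[unfolded has_field_derivative_def]]) (auto intro!: derivative_eq_intros)
    have 2: "((\<lambda>x::point. g k (snd (fst x))) has_derivative (\<lambda>e. g' k (snd (fst x)) * snd (fst e))) (at x)"
      by (rule has_derivative_compose[OF _ g(1)[unfolded has_field_derivative_def]]) (auto intro!: derivative_eq_intros)
    show ?thesis
      unfolding w_def[abs_def] w'_def
      by (intro has_derivative_add_const has_derivative_scaleR_left has_derivative_mult_right has_derivative_mult 1 2)
  qed
  have cg: "continuous_on UNIV (\<lambda>x::point. f (fst (fst x)))" "continuous_on UNIV (\<lambda>x::point. f (snd (fst x)))"
    if "continuous_on UNIV f" for f :: "real \<Rightarrow> real"
    by (rule continuous_on_compose2[OF that]; auto intro!: continuous_intros)+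
  have wC: "continuously_differentiable (w k)" for k
    by (rule C1_I[OF wd]) (unfold w'_def, intro continuous_intros cg g(2) gkc)
  have wS: "w k x \<in> S0" for k x
    unfolding w_def by (intro subspace_add[OF subspace_S0] subspace_scale[OF subspace_S0] bX_S0 bY_S0)
  \<comment> \<open>One factor of the product is at most s/2, which cancels the normalising
    \<open>2 / s\<close>.\<close>
  have gg: "\<bar>2 / s * (a * b)\<bar> \<le> c" if "\<bar>a\<bar> \<le> s / 2" "\<bar>b\<bar> \<le> c" for a b c :: real
  proof -
    have "\<bar>a\<bar> * \<bar>b\<bar> \<le> s / 2 * c" using that by (intro mult_mono) auto
    then have "2 / s * (\<bar>a\<bar> * \<bar>b\<bar>) \<le> 2 / s * (s / 2 * c)" using s by (intro mult_left_mono) auto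
    then show ?thesis using s by (simp add: abs_mult)
  qed
  have wb: "norm (w k x) \<le> s / 2 * norm bX + norm (bY s)" for k x
    unfolding w_def
    by (rule order_trans[OF norm_triangle_ineq], intro add_right_mono)
       (use gg[OF g(5) g(5), of k "fst (fst x)" k "snd (fst x)"] in \<open>simp add: mult_right_mono del: times_divide_eq_left\<close>)
  have pb: "norm (partial e (w k) x) \<le> K * norm bX" if e: "e \<in> Basis" for e k x
  proof -
    have "\<bar>2 / s * (g k a * (g' k b * p) + g' k a * q * g k b)\<bar> \<le> K" if "\<bar>p\<bar> + \<bar>q\<bar> \<le> 1" for a b p q
    proof -
      have 1: "\<bar>2 / s * (g k a * (g' k b * p))\<bar> \<le> K * \<bar>p\<bar>"
        by (rule gg[OF g(5)]) (simp add: abs_mult mult_right_mono g(3))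
      have 2: "\<bar>2 / s * (g k b * (g' k a * q))\<bar> \<le> K * \<bar>q\<bar>"
        by (rule gg[OF g(5)]) (simp add: abs_mult mult_right_mono g(3))
      have e: "2 / s * (g k a * (g' k b * p) + g' k a * q * g k b) = 2 / s * (g k a * (g' k b * p)) + 2 / s * (g k b * (g' k a * q))"
        by (simp add: algebra_simps)
      have 3: "K * \<bar>p\<bar> + K * \<bar>q\<bar> \<le> K"
        using mult_left_mono[OF that K(1)] by (simp only: distrib_left mult_1_right)
      show ?thesis
        unfolding e by (rule order_trans[OF abs_triangle_ineq], rule order_trans[OF add_mono[OF 1 2] 3])
    qed
    \<comment> \<open>A basis vector moves at most one of the two planar coordinates.\<close>
    moreover have "\<bar>snd (fst e)\<bar> + \<bar>fst (fst e)\<bar> \<le> 1" using e by (auto simp: Basis_point)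
    ultimately have "norm (w' k x e) \<le> K * norm bX"
      unfolding w'_def by (simp add: mult_right_mono del: times_divide_eq_left)
    then show ?thesis using partial_eqI[OF wd] by simp
  qed
  have Qm: "Qb s \<eta> g0 \<in> borel_measurable borel"
  proof -
    have [measurable]: "q1b s \<eta> g0 \<in> borel_measurable borel" by (rule q1b_measurable[OF gc])
    have [measurable]: "fst \<in> measurable (borel :: point measure) borel" by (intro borel_measurable_continuous_onI continuous_intros)
    have "Qb s \<eta> g0 = (\<lambda>x. q1b s \<eta> g0 (fst x) *\<^sub>R bX + bY s)" by (rule ext) (metis Qb_eq prod.collapse)
    then show ?thesis by simp
  qed
  have QmL: "Qb s \<eta> g0 \<in> borel_measurable (lateral_measure \<eta> \<epsilon>)"
    by (rule measurable_compose[OF lateral_id Qm])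
  have diff: "AE x in lateral_measure \<eta> \<epsilon>. norm (w k x - Qb s \<eta> g0 x) \<le> 2 * K * h k * norm bX" for k
  proof (rule AE_lateral)
    note [measurable] = Qm C1_borel(5)[OF wC[of k]]
    show "{x. norm (w k x - Qb s \<eta> g0 x) \<le> 2 * K * h k * norm bX} \<in> sets borel" by measurable
    fix a b t z assume *: "(a, b) \<in> edges \<eta>" "t \<in> {0..1::real}" "z \<in> {0<..<\<epsilon>}"
    obtain x y where xy: "(1 - t) *\<^sub>R a + t *\<^sub>R b = (x, y)" by (meson surj_pair)
    then have "(x, y) \<in> bdry" using edges_bdry[OF *(1,2)] by simp
    then have q: "q1b s \<eta> g0 (x, y) = 2 / s * (?g x * ?g y)" by (rule q1b_product[OF g0(1,2) s])
    \<comment> \<open>A difference of two products, one factor changed at a time.\<close>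
    have D: "w k ((x, y), z) - Qb s \<eta> g0 ((x, y), z) = (2 / s * (g k x * (g k y - ?g y)) + 2 / s * (?g y * (g k x - ?g x))) *\<^sub>R bX"
      unfolding w_def Qb_eq q by (simp add: algebra_simps flip: scaleR_diff_left scaleR_add_left)
    have "\<bar>2 / s * (g k x * (g k y - ?g y)) + 2 / s * (?g y * (g k x - ?g x))\<bar> \<le> K * h k + K * h k"
      by (rule order_trans[OF abs_triangle_ineq], intro add_mono gg g(4,5) gb)
    also have "\<dots> = 2 * K * h k" by simp
    finally have R: "\<bar>2 / s * (g k x * (g k y - ?g y)) + 2 / s * (?g y * (g k x - ?g x))\<bar> \<le> 2 * K * h k" .
    show "norm (w k ((1 - t) *\<^sub>R a + t *\<^sub>R b, z) - Qb s \<eta> g0 ((1 - t) *\<^sub>R a + t *\<^sub>R b, z)) \<le> 2 * K * h k * norm bX"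
      unfolding xy D norm_scaleR by (rule mult_right_mono[OF R]) simp
  qed
  interpret LM: finite_measure "lateral_measure \<eta> \<epsilon>" using bfm_lateral by (simp add: bounded_finite_measure_def)
  have one: "(\<lambda>x. 1::real) \<in> L2_space (lateral_measure \<eta> \<epsilon>)" by (simp add: L2_space_def)
  have dm: "(\<lambda>x. w k x - Qb s \<eta> g0 x) \<in> borel_measurable (lateral_measure \<eta> \<epsilon>)" for k
    using L2_spaceD(1)[OF C1_L2_space(3)[OF wC]] QmL by simp
  have d1: "AE x in lateral_measure \<eta> \<epsilon>. norm (w k x - Qb s \<eta> g0 x) \<le> (2 * K * h k * norm bX) * norm (1::real)" for k
    using diff[of k] by simp
  have "(\<lambda>x. w 0 x - Qb s \<eta> g0 x) \<in> L2_space (lateral_measure \<eta> \<epsilon>)"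
    by (rule L2_space_bound[OF one dm d1])
  from L2_space_diff[OF C1_L2_space(3)[OF wC, of 0] this]
  have QL2: "Qb s \<eta> g0 \<in> L2_space (lateral_measure \<eta> \<epsilon>)" by simp
  have lim: "(\<lambda>k. nL (\<lambda>x. w k x - Qb s \<eta> g0 x)) \<longlonglongrightarrow> 0"
  proof (rule tendsto_0_dominated[OF L2_norm_nonneg])
    show "nL (\<lambda>x. w k x - Qb s \<eta> g0 x) \<le> (2 * K * h k * norm bX) * nL (\<lambda>x. 1::real)" for k
      by (rule L2_norm_bound[OF one dm d1]) (use K(1) h0[of k] in simp)
    have "(\<lambda>k. (2 * K * h k * norm bX) * nL (\<lambda>x. 1::real)) \<longlonglongrightarrow> (2 * K * 0 * norm bX) * nL (\<lambda>x. 1::real)"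
      by (intro tendsto_intros hlim)
    then show "(\<lambda>k. (2 * K * h k * norm bX) * nL (\<lambda>x. 1::real)) \<longlonglongrightarrow> 0" by simp
  qed
  define c where "c = s / 2 * norm bX + norm (bY s)"
  have wball: "w k x \<in> cball 0 c" for k x using wb by (simp add: c_def)
  \<comment> \<open>All the fields take values in one ball, on which the continuous energy densities
    are bounded.\<close>
  have bounded_on: "\<exists>b. \<forall>Q\<in>cball 0 c. f Q \<le> b" if "continuous_on UNIV f" for f :: "real^3^3 \<Rightarrow> real"
  proof -
    have "compact (f ` cball 0 c)"
      by (rule compact_continuous_image[OF continuous_on_subset[OF that]]) auto
    then show ?thesis by (meson bdd_above_def bounded_imp_bdd_above compact_imp_bounded image_eqI)
  qed
  obtain M1 where M1: "\<And>Q. Q \<in> cball 0 c \<Longrightarrow> anchoring_energy s \<alpha>z \<gamma>z Q \<le> M1"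
    using bounded_on[OF continuous_on_anchoring_energy] by blast
  obtain M2 where M2: "\<And>Q. Q \<in> cball 0 c \<Longrightarrow> bulk_energy A B C Q \<le> M2"
    using bounded_on[OF continuous_on_bulk_energy] by blast
  interpret GM: finite_measure "Gamma_measure \<eta> \<epsilon>" using bfm_Gamma by (simp add: bounded_finite_measure_def)
  have E: "energy A B C L s \<alpha>z \<gamma>z lam (w k) \<le> (\<Sum>e\<in>(Basis::point set). (K * norm bX * nV (\<lambda>x. 1::real))\<^sup>2) / 2
     + lam / L * (\<integral>x. M1 \<partial>Gamma_measure \<eta> \<epsilon>) + lam\<^sup>2 / L * (\<integral>x. M2 \<partial>volume_on V)" for k
    unfolding energy_def
  proof (intro add_mono)
    have "nV (partial e (w k)) \<le> K * norm bX * nV (\<lambda>x. 1::real)" if e: "e \<in> Basis" for e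
    proof (rule L2_norm_bound)
      show "(\<lambda>x. 1::real) \<in> L2_space (volume_on V)" by (simp add: L2_space_def)
      show "partial e (w k) \<in> borel_measurable (volume_on V)" by (rule L2_spaceD(1)[OF C1_L2_space(2)[OF wC]])
      show "AE x in volume_on V. norm (partial e (w k) x) \<le> K * norm bX * norm (1::real)" using pb[OF e] by simp
      show "0 \<le> K * norm bX" using K(1) by simp
    qed
    then show "gradsq (\<lambda>e. partial e (w k)) / 2 \<le> (\<Sum>e\<in>(Basis::point set). (K * norm bX * nV (\<lambda>x. 1::real))\<^sup>2) / 2"
      by (intro divide_right_mono sum_mono power_mono) auto
    show "lam / L * (\<integral>x. anchoring_energy s \<alpha>z \<gamma>z (w k x) \<partial>Gamma_measure \<eta> \<epsilon>) \<le> lam / L * (\<integral>x. M1 \<partial>Gamma_measure \<eta> \<epsilon>)"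
      using pos M1 wball by (intro mult_left_mono integral_mono C1_energy_integrable(1)[OF wC]) auto
    show "lam\<^sup>2 / L * (\<integral>x. bulk_energy A B C (w k x) \<partial>volume_on V) \<le> lam\<^sup>2 / L * (\<integral>x. M2 \<partial>volume_on V)"
      using pos M2 wball by (intro mult_left_mono integral_mono C1_energy_integrable(2)[OF wC]) auto
  qed
  show ?thesis by (rule that[OF QL2 wC wS lim E])
qed

end

context square_well
begin

text \<open>The equation for the minimiser is known against test fields that come with an
  approximating sequence; every test field in the sense of traces is of this kind.\<close>

lemma weak_solution_exists:
  assumes pos: "A \<le> 0" "0 < B" "0 < C" "0 \<le> \<alpha>z" "0 \<le> \<gamma>z" "0 \<le> lam" "0 < L"
    and small: "32 * ((\<bar>A\<bar> + B\<^sup>2 / C) * lam\<^sup>2) \<le> L"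
    and bp: "boundary_profile (s_plus A B C) \<eta> g0" and s: "0 < s_plus A B C"
  shows "\<exists>Q. weak_solution A B C L \<alpha>z \<gamma>z \<eta> g0 lam \<epsilon> Q"
proof -
  let ?s = "s_plus A B C"
  obtain b M where g: "Qb ?s \<eta> g0 \<in> L2_space (lateral_measure \<eta> \<epsilon>)"
    and b: "\<And>k. continuously_differentiable (b k)" "\<And>k x. b k x \<in> S0"
      "(\<lambda>k. nL (\<lambda>x. b k x - Qb ?s \<eta> g0 x)) \<longlonglongrightarrow> 0" "\<And>k. energy A B C L ?s \<alpha>z \<gamma>z lam (b k) \<le> M"
    by (rule boundary_extension[OF bp s pos(4-7), of A B C]) blast
  obtain w u v G where t: "traced w u v (Qb ?s \<eta> g0) G"
    and el: "\<And>\<phi> u' v' G'. traced \<phi> u' v' (\<lambda>x. 0) G' \<Longrightarrow> weak_form A B C L ?s \<alpha>z \<gamma>z lam u v G u' v' G' = 0"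
    by (rule minimizer[OF pos small g b]) blast
  have "weak_form A B C L ?s \<alpha>z \<gamma>z lam u (\<lambda>e. weak_partial V e u) G \<Phi> (\<lambda>e. weak_partial V e \<Phi>) \<Psi> = 0"
    if \<Phi>: "\<Phi> \<in> W12_S0 V" "has_trace V (lateral_measure \<eta> \<epsilon>) \<Phi> (\<lambda>_. 0)" "has_trace V (Gamma_measure \<eta> \<epsilon>) \<Phi> \<Psi>" for \<Phi> \<Psi>
  proof -
    have z: "AE x in lateral_measure \<eta> \<epsilon>. (0 :: real^3^3) \<in> S0" by (simp add: zero_S0)
    obtain \<phi> where t': "traced \<phi> \<Phi> (\<lambda>e. weak_partial V e \<Phi>) (\<lambda>_. 0) \<Psi>"
      by (rule has_trace_traced[OF \<Phi> z])
    show ?thesis by (rule trans[OF weak_form_weak_partial[OF t t'] el[OF t']])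
  qed
  then have "weak_solution A B C L \<alpha>z \<gamma>z \<eta> g0 lam \<epsilon> u"
    unfolding weak_solution_iff using traced_has_trace[OF t] by blast
  then show ?thesis by blast
qed

end

theorem proposition3p13:
  fixes A B C L \<eta> :: real
  assumes "0 < L" and "0 < B" and "0 < C" and "A < 0" and "0 < \<eta>" and "\<eta> < 1 / 2"
  shows "\<exists>lam0>0. \<forall>lam \<epsilon> \<alpha>z \<gamma>z :: real. \<forall>g0 :: real \<Rightarrow> real.
           0 < lam \<longrightarrow> lam < lam0 \<longrightarrow> 0 < \<epsilon> \<longrightarrow> 0 < \<alpha>z \<longrightarrow> 0 < \<gamma>z \<longrightarrow>
           boundary_profile (s_plus A B C) \<eta> g0 \<longrightarrow>
             (\<exists>Q. weak_solution A B C L \<alpha>z \<gamma>z \<eta> g0 lam \<epsilon> Q \<and>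
                  (\<forall>Q'. weak_solution A B C L \<alpha>z \<gamma>z \<eta> g0 lam \<epsilon> Q' \<longrightarrow>
                        (AE x in volume_on (well \<eta> \<epsilon>). Q' x = Q x)))"
proof -
  define K where "K = \<bar>A\<bar> + B\<^sup>2 / C"
  have K: "0 < K" unfolding K_def by (rule add_pos_nonneg) (use assms in auto)
  have s: "0 < s_plus A B C"
    unfolding s_plus_def using assms
    by (intro divide_pos_pos add_pos_nonneg real_sqrt_ge_zero add_nonneg_nonneg zero_le_power2 mult_nonneg_nonneg) simp_all
  \<comment> \<open>The threshold is the smallness condition solved for \<open>lam\<close>; it is an
    expression in A, B, C and L alone.\<close>
  show ?thesis
  proof (intro exI[of _ "sqrt (L / (32 * K))"] conjI allI impI)
    show "0 < sqrt (L / (32 * K))" using assms K by simp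
    fix lam \<epsilon> \<alpha>z \<gamma>z :: real and g0 :: "real \<Rightarrow> real"
    assume lam: "0 < lam" "lam < sqrt (L / (32 * K))" and eps: "0 < \<epsilon>" and pos: "0 < \<alpha>z" "0 < \<gamma>z"
      and bp: "boundary_profile (s_plus A B C) \<eta> g0"
    interpret square_well \<eta> \<epsilon> using assms eps by unfold_locales
    have "lam\<^sup>2 \<le> L / (32 * K)"
      using power_mono[of lam "sqrt (L / (32 * K))" 2] lam assms K by simp
    then have small: "32 * ((\<bar>A\<bar> + B\<^sup>2 / C) * lam\<^sup>2) \<le> L"
      using K by (simp add: K_def[symmetric] pos_le_divide_eq mult_ac)
    have n: "A \<le> 0" "0 \<le> \<alpha>z" "0 \<le> \<gamma>z" "0 \<le> lam" using assms pos lam by auto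
    obtain Q where Q: "weak_solution A B C L \<alpha>z \<gamma>z \<eta> g0 lam \<epsilon> Q"
      using weak_solution_exists[OF n(1) assms(2,3) n(2-4) assms(1) small bp s] by blast
    have "AE x in volume_on (well \<eta> \<epsilon>). Q' x = Q x" if "weak_solution A B C L \<alpha>z \<gamma>z \<eta> g0 lam \<epsilon> Q'" for Q'
      by (rule weak_solution_unique[OF assms(2,3) n(2-4) assms(1) small _ that Q]) (simp add: Qb_S0)
    with Q show "\<exists>Q. weak_solution A B C L \<alpha>z \<gamma>z \<eta> g0 lam \<epsilon> Q \<and>
        (\<forall>Q'. weak_solution A B C L \<alpha>z \<gamma>z \<eta> g0 lam \<epsilon> Q' \<longrightarrow> (AE x in volume_on (well \<eta> \<epsilon>). Q' x = Q x))"
      by blast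
  qed
qed

end
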